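(* Let $w_1,\dots,w_n>0$ be item weights and $u=\lceil\log U\rceil$ with $U=\max_i w_i/\min_i w_i$. Preprocessing for weighted sampling with replacement can be done in the work and span needed for integer sorting $n$ elements with $u$ different keys, plus $O(n)$ work and $O(\log n)$ span on a CREW PRAM for building the actual data structure. Using this data structure, sampling a multiset $S$ with $k$ items and $s$ different items (output as the $s$ pairs $(i,k_i)$ of distinct items and their multiplicities) can be done with span $O(\log n)$ and expected work $O(s+\log n)$ on a CREW PRAM.
   Context: Weighted sampling with replacement: draw $k$ independent samples, each equal to item $i$ with probability $w_i/W$ where $W=\sum_j w_j$; the output lists each distinct sampled item $i$ together with the number $k_i$ of times it was sampled. CREW PRAM: concurrent read, exclusive write parallel random access machine; work = total number of operations, span = running time with unboundedly many processors. *)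

theory Defs
  imports "HOL-Probability.Probability"
begin

section \<open>A randomised CREW PRAM with work and span\<close>

text \<open>
  Registers and memory cells hold exact real numbers; natural numbers (indices, counts) are
  represented by their images in the reals. The shared memory is divided into
  arrays: a cell is addressed by an array name, which is static in the program, and an index.
\<close>

type_synonym address = "nat \<times> nat"
type_synonym memory = "address \<Rightarrow> real"
type_synonym registers = "nat \<Rightarrow> real"

datatype arith = Plus | Minus | Times | Divide

fun arith_op :: "arith \<Rightarrow> real \<Rightarrow> real \<Rightarrow> real" where
  "arith_op Plus x y = x + y"
| "arith_op Minus x y = x - y"
| "arith_op Times x y = x * y"
| "arith_op Divide x y = x / y"

text \<open>
  There is no rounding of reals. \<open>FloorLog\<close> is what makes weights accessible to
  integer sorting (it extracts the binary exponent), and \<open>Uniform\<close> and \<open>Binomial\<close>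
  are the sources of randomness: both kinds of deviates are drawn in unit time.
  \<open>Par\<close> forks the processor into two and continues when both have finished.
\<close>

datatype instr =
    Const nat int
  | Arith arith nat nat nat
  | FloorLog nat nat
  | Load nat nat nat            \<comment> \<open>target register, array, index register\<close>
  | Store nat nat nat           \<comment> \<open>array, index register, source register\<close>
  | Uniform nat nat
  | Binomial nat nat nat        \<comment> \<open>target register, number of trials, success probability\<close>
  | IfLess nat nat "instr list" "instr list"
  | Call nat
  | Par "instr list" "instr list"

text \<open>A program is a table of (possibly recursive) procedures; procedure 0 is the entry point.\<close>

type_synonym program = "instr list list"

text \<open>
  \<open>Run b \<rho>\<close> is a processor with remaining code \<open>b\<close> and private registers \<open>\<rho>\<close>.
  In \<open>Join p q b \<rho>\<close> such a processor is suspended until \<open>p\<close> and \<open>q\<close> have finished.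
\<close>

datatype proc =
    Run "instr list" registers
  | Join proc proc "instr list" registers

fun finished :: "proc \<Rightarrow> bool" where
  "finished (Run b \<rho>) \<longleftrightarrow> b = []"
| "finished (Join p q b \<rho>) \<longleftrightarrow> False"

definition guarded :: "bool \<Rightarrow> 'a spmf \<Rightarrow> 'a spmf" where
  "guarded c p = (if c then p else return_pmf None)"

text \<open>
  One instruction of one processor, executed on the memory at the beginning of the step. The
  result is the new processor state with the requested writes; \<open>None\<close> is a machine
  fault, such as an index that is not a natural number.
\<close>

fun exec_instr :: "program \<Rightarrow> memory \<Rightarrow> instr \<Rightarrow> instr list \<Rightarrow> registers
    \<Rightarrow> (proc \<times> (address \<times> real) list) spmf" where
  "exec_instr P m (Const r z) b \<rho> = return_spmf (Run b (\<rho>(r := of_int z)), [])"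
| "exec_instr P m (Arith f r r1 r2) b \<rho> =
     return_spmf (Run b (\<rho>(r := arith_op f (\<rho> r1) (\<rho> r2))), [])"
| "exec_instr P m (FloorLog r r1) b \<rho> =
     guarded (\<rho> r1 > 0) (return_spmf (Run b (\<rho>(r := of_int \<lfloor>log 2 (\<rho> r1)\<rfloor>)), []))"
| "exec_instr P m (Load r a ri) b \<rho> =
     guarded (\<rho> ri \<in> \<nat>) (return_spmf (Run b (\<rho>(r := m (a, nat \<lfloor>\<rho> ri\<rfloor>))), []))"
| "exec_instr P m (Store a ri r) b \<rho> =
     guarded (\<rho> ri \<in> \<nat>) (return_spmf (Run b \<rho>, [((a, nat \<lfloor>\<rho> ri\<rfloor>), \<rho> r)]))"
| "exec_instr P m (Uniform r rn) b \<rho> =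
     guarded (\<rho> rn \<in> \<nat> \<and> \<rho> rn > 0)
       (spmf_of_pmf (map_pmf (\<lambda>x. (Run b (\<rho>(r := real x)), []))
          (pmf_of_set {..<nat \<lfloor>\<rho> rn\<rfloor>})))"
| "exec_instr P m (Binomial r rn rp) b \<rho> =
     guarded (\<rho> rn \<in> \<nat> \<and> 0 \<le> \<rho> rp \<and> \<rho> rp \<le> 1)
       (spmf_of_pmf (map_pmf (\<lambda>x. (Run b (\<rho>(r := real x)), []))
          (binomial_pmf (nat \<lfloor>\<rho> rn\<rfloor>) (\<rho> rp))))"
| "exec_instr P m (IfLess r1 r2 b1 b2) b \<rho> =
     return_spmf (Run ((if \<rho> r1 < \<rho> r2 then b1 else b2) @ b) \<rho>, [])"
| "exec_instr P m (Call i) b \<rho> = guarded (i < length P) (return_spmf (Run (P ! i @ b) \<rho>, []))"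
| "exec_instr P m (Par b1 b2) b \<rho> = return_spmf (Join (Run b1 \<rho>) (Run b2 \<rho>) b \<rho>, [])"

text \<open>One synchronous step of all active processors.\<close>

fun par_step :: "program \<Rightarrow> memory \<Rightarrow> proc \<Rightarrow> (proc \<times> (address \<times> real) list) spmf" where
  "par_step P m (Run [] \<rho>) = return_spmf (Run [] \<rho>, [])"
| "par_step P m (Run (c # b) \<rho>) = exec_instr P m c b \<rho>"
| "par_step P m (Join p q b \<rho>) =
     (if finished p \<and> finished q then return_spmf (Run b \<rho>, [])
      else bind_spmf (par_step P m p) (\<lambda>(p', ws).
           bind_spmf (par_step P m q) (\<lambda>(q', ws').
           return_spmf (Join p' q' b \<rho>, ws @ ws'))))"

text \<open>The number of operations in the next step; resuming a suspended processor counts as one.\<close>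

fun num_ops :: "proc \<Rightarrow> nat" where
  "num_ops (Run b \<rho>) = (if b = [] then 0 else 1)"
| "num_ops (Join p q b \<rho>) =
     (if finished p \<and> finished q then 1 else num_ops p + num_ops q)"

datatype config = Config (shared: memory) (procs: proc) (work: nat)

abbreviation halted :: "config \<Rightarrow> bool" where
  "halted \<sigma> \<equiv> finished (procs \<sigma>)"

text \<open>
  All reads of a step precede its writes, so concurrent reads are unrestricted; the distinctness
  test enforces exclusive writes.
\<close>

definition pram_step :: "program \<Rightarrow> config \<Rightarrow> config spmf" where
  "pram_step P \<sigma> =
     bind_spmf (par_step P (shared \<sigma>) (procs \<sigma>)) (\<lambda>(p, ws).
       guarded (distinct (map fst ws))
         (return_spmf (Config (fold (\<lambda>(a, x) m. m(a := x)) ws (shared \<sigma>)) p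
                              (work \<sigma> + num_ops (procs \<sigma>)))))"

primrec run :: "program \<Rightarrow> nat \<Rightarrow> config \<Rightarrow> config spmf" where
  "run P 0 \<sigma> = return_spmf \<sigma>"
| "run P (Suc t) \<sigma> = bind_spmf (pram_step P \<sigma>) (run P t)"

text \<open>
  The machine started on memory \<open>m\<close> and observed at time \<open>T\<close>. A halted machine
  neither changes nor accumulates work, so the span is at most \<open>T\<close> iff the machine
  has halted in every outcome.
\<close>

definition execute :: "program \<Rightarrow> memory \<Rightarrow> real \<Rightarrow> config spmf" where
  "execute P m T = run P (nat \<lfloor>T\<rfloor>) (Config m (Run [Call 0] (\<lambda>_. 0)) 0)"

text \<open>
  Started on \<open>m\<close>, whatever the random choices, \<open>P\<close> halts without fault with
  span at most \<open>T\<close>, work at most \<open>W\<close> and a final memory satisfying \<open>Q\<close>.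
\<close>

definition achieves :: "program \<Rightarrow> memory \<Rightarrow> real \<Rightarrow> real \<Rightarrow> (memory \<Rightarrow> bool) \<Rightarrow> bool" where
  "achieves P m T W Q \<longleftrightarrow>
     (\<forall>x \<in> set_pmf (execute P m T).
        \<exists>\<sigma>. x = Some \<sigma> \<and> halted \<sigma> \<and> real (work \<sigma>) \<le> W \<and> Q (shared \<sigma>))"

lemma finite_exec_instr: "finite (set_pmf (exec_instr P m c b \<rho>))"
proof (cases c)
  case (Uniform r rn)
  have "\<rho> rn \<in> \<nat> \<Longrightarrow> \<rho> rn > 0 \<Longrightarrow> {..<nat \<lfloor>\<rho> rn\<rfloor>} \<noteq> {}"
    by (auto elim!: Nats_cases)
  with Uniform show ?thesis by (auto simp: guarded_def spmf_of_pmf_def)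
qed (auto simp: guarded_def spmf_of_pmf_def intro!: finite_imageI finite_set_pmf_binomial_pmf)

lemma finite_bind_spmf:
  assumes "finite (set_pmf p)" and "\<And>x. finite (set_pmf (f x))"
  shows "finite (set_pmf (bind_spmf p f))"
  using assms by (auto simp: bind_spmf_def split: option.split)

lemma finite_par_step: "finite (set_pmf (par_step P m p))"
  by (induction P m p rule: par_step.induct)
     (auto simp: finite_exec_instr split: prod.split intro!: finite_bind_spmf)

text \<open>Hence every expectation over the outcomes of a run is a finite sum.\<close>

lemma finite_run: "finite (set_pmf (run P t \<sigma>))"
  by (induction t arbitrary: \<sigma>)
     (auto simp: pram_step_def guarded_def split: prod.split
       intro!: finite_bind_spmf finite_par_step)

lemma finite_execute: "finite (set_pmf (execute P m T))"
  by (simp add: execute_def finite_run)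


section \<open>Integer sorting\<close>

text \<open>Array 0 holds scalar parameters and array 1 the input sequence; all else is 0.\<close>

definition sort_input :: "nat \<Rightarrow> nat \<Rightarrow> (nat \<Rightarrow> nat) \<Rightarrow> memory" where
  "sort_input n u key = (\<lambda>(a, i).
     if a = 0 \<and> i = 0 then real n
     else if a = 0 \<and> i = 1 then real u
     else if a = 1 \<and> i < n then real (key i)
     else 0)"

text \<open>The sorted order is returned as a permutation of the elements.\<close>

definition sort_output :: "nat \<Rightarrow> (nat \<Rightarrow> nat) \<Rightarrow> memory \<Rightarrow> bool" where
  "sort_output n key m \<longleftrightarrow>
     (\<exists>\<pi>. bij_betw \<pi> {..<n} {..<n} \<and>
          (\<forall>j<n. m (2, j) = real (\<pi> j)) \<and>
          (\<forall>i j. i \<le> j \<and> j < n \<longrightarrow> key (\<pi> i) \<le> key (\<pi> j)))"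

text \<open>\<open>P\<close> sorts \<open>n\<close> elements with \<open>u\<close> different keys in work \<open>W n u\<close> and span \<open>T n u\<close>.\<close>

definition integer_sorter :: "program \<Rightarrow> (nat \<Rightarrow> nat \<Rightarrow> nat) \<Rightarrow> (nat \<Rightarrow> nat \<Rightarrow> nat) \<Rightarrow> bool" where
  "integer_sorter P W T \<longleftrightarrow>
     (\<forall>n u key. n \<ge> 1 \<and> (\<forall>i<n. key i < u) \<longrightarrow>
        achieves P (sort_input n u key) (T n u) (W n u) (sort_output n key))"


section \<open>Weighted sampling with replacement\<close>

text \<open>Items are numbered \<open>0, \<dots>, n - 1\<close>.\<close>

definition weights_input :: "nat \<Rightarrow> (nat \<Rightarrow> real) \<Rightarrow> memory" where
  "weights_input n w = (\<lambda>(a, i).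
     if a = 0 \<and> i = 0 then real n
     else if a = 1 \<and> i < n then w i
     else 0)"

definition item_pmf :: "nat \<Rightarrow> (nat \<Rightarrow> real) \<Rightarrow> nat pmf" where
  "item_pmf n w = embed_pmf (\<lambda>i. if i < n then w i / (\<Sum>j<n. w j) else 0)"

lemma pmf_item_pmf:
  assumes "n \<ge> 1" and "\<And>i. i < n \<Longrightarrow> w i > 0"
  shows "pmf (item_pmf n w) i = (if i < n then w i / (\<Sum>j<n. w j) else 0)"
proof -
  let ?W = "\<Sum>j<n. w j"
  have W: "?W > 0"
    using assms by (intro sum_pos) (auto simp: lessThan_empty_iff)
  have nonneg: "0 \<le> (if i < n then w i / ?W else 0)" for i
    using assms(2)[of i] W by (auto intro!: divide_nonneg_pos less_imp_le)
  have "(\<integral>\<^sup>+ i. ennreal (if i < n then w i / ?W else 0) \<partial>count_space UNIV) =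
        (\<integral>\<^sup>+ i. ennreal (if i < n then w i / ?W else 0) \<partial>count_space {..<n})"
    by (auto simp: nn_integral_count_space_indicator indicator_def intro!: nn_integral_cong)
  also have "\<dots> = (\<Sum>i<n. ennreal (w i / ?W))"
    by (simp add: nn_integral_count_space_finite)
  also have "\<dots> = ennreal (\<Sum>i<n. w i / ?W)"
    using nonneg by (intro sum_ennreal) (metis lessThan_iff)
  also have "(\<Sum>i<n. w i / ?W) = 1"
    using W by (simp flip: sum_divide_distrib)
  finally show ?thesis
    unfolding item_pmf_def using nonneg by (subst pmf_embed_pmf) auto
qed

definition sample_pmf :: "nat \<Rightarrow> nat \<Rightarrow> (nat \<Rightarrow> real) \<Rightarrow> nat multiset pmf" where
  "sample_pmf k n w = map_pmf mset (replicate_pmf k (item_pmf n w))"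

text \<open>
  The memory lists the pairs \<open>(i, k\<^sub>i)\<close> of the multiset \<open>S\<close> contiguously in arrays 3 and 4,
  and cell (2, 0) holds the number of pairs.
\<close>

definition outputs :: "memory \<Rightarrow> nat multiset \<Rightarrow> bool" where
  "outputs m S \<longleftrightarrow>
     (\<exists>xs. distinct xs \<and> set xs = set_mset S \<and> m (2, 0) = real (length xs) \<and>
        (\<forall>j<length xs. m (3, j) = real (xs ! j) \<and> m (4, j) = real (count S (xs ! j))))"

text \<open>
  \<open>P\<close> samples \<open>k\<close> items from every memory \<open>m\<close> that contains the data structure, as
  described by the representation invariant \<open>D\<close>; the number \<open>k\<close> is passed in cell (0, 1).
  The invariant is preserved, so the data structure can be used repeatedly. The span bound \<open>T\<close>
  and faultlessness hold for every outcome, \<open>B\<close> bounds the expected work.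
\<close>

definition samples_from ::
  "program \<Rightarrow> (memory \<Rightarrow> bool) \<Rightarrow> nat \<Rightarrow> nat multiset pmf \<Rightarrow> real \<Rightarrow> real \<Rightarrow> bool" where
  "samples_from P D k law T B \<longleftrightarrow>
     (\<forall>m. D m \<longrightarrow>
        (let X = execute P (m((0, 1) := real k)) T in
           (\<forall>x \<in> set_pmf X. \<exists>\<sigma>. x = Some \<sigma> \<and> halted \<sigma> \<and> D (shared \<sigma>)) \<and>
           (\<forall>S. measure_pmf.prob X {x. outputs (shared (the x)) S} = pmf law S) \<and>
           measure_pmf.expectation X (\<lambda>x. real (work (the x))) \<le> B))"

end

theory Submission
  imports Defs
begin

text \<open>
  The data structure is a binary tree over the items, sorted by weight class: the items with
  weight in \<open>[c 2\<^sup>j, c 2\<^sup>j\<^sup>+\<^sup>1]\<close>, where \<open>c\<close> is the least weight, form a group. Every group is a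
  balanced tree, and a balanced top tree joins the groups by increasing weight. A query splits the
  number of requested samples binomially at every node, in parallel on both children, until at
  most one sample is left. That sample is drawn by rejection from the uniform distribution on the
  leaves below, where every rejection descends one level; inside a group at least half of the
  proposals are accepted.

  The expected work is governed by the nodes that receive samples, compared with
  \<open>\<Sum>\<^sub>j min 1 (k w\<^sub>j / W)\<close>, which is at most twice the expected number of distinct items. Group nodes
  count only if they receive two samples, which for a node of mass \<open>\<mu>\<close> has probability at most
  \<open>min 1 (k\<^sup>2 \<mu>\<^sup>2 / W\<^sup>2)\<close>. In a group of weight about \<open>w\<close>, a node with \<open>2\<^sup>i\<close> leaves has mass about
  \<open>2\<^sup>i w\<close>, so with \<open>\<eta> = k w / W\<close> the cost per leaf is \<open>\<Sum>\<^sub>i 2\<^sup>-\<^sup>i min 1 (2\<^sup>i \<eta>)\<^sup>2 = O(min 1 \<eta>)\<close>. In the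
  top tree, weights increase geometrically from group to group: all but \<open>O(log n)\<close> of the groups
  that are not negligible contribute a distinct item with constant probability, and the negligible
  groups form a prefix.
\<close>

section \<open>Runs of the machine coupled with an abstract outcome\<close>

text \<open>Span and absence of faults must hold for every random outcome, whereas the work is
  bounded in expectation and the output in law only. Therefore one relation couples machine runs
  with outcomes of a recursively defined sampler: time and memory are statements about all coupled
  pairs, while law and expected work are computed on the sampler alone. The expectation can be found
  by induction over the tree because binomial splitting keeps two ratios in the mean. If k samples
  at a node of mass M send x samples to a child of mass M', then E[x] / M' = k / M and E[x (x - 1)]
  / M'^2 = k (k - 1) / M^2. The costs are sums of terms \<open>min 1\<close> of multiples of these
  ratios, hence concave in them, and Jensen's inequality closes the induction. The first ratio
  controls nodes that receive a sample, the second one nodes that receive two. The two kinds of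
  trees need different ratios: inside a group a lone sample costs O(1) in the mean, but in the top
  tree the weights below a node differ without bound, a lone sample may be rejected on every level,
  and each node it passes has to be paid for.\<close>

definition upd :: "(address \<times> real) list \<Rightarrow> memory \<Rightarrow> memory" where
  "upd ws m = fold (\<lambda>(a, x) m. m(a := x)) ws m"

lemma upd_Nil [simp]: "upd [] m = m"
  and upd_Cons: "upd (y # ws) m = upd ws (m(fst y := snd y))"
  and upd_append: "upd (ws @ ws') m = upd ws' (upd ws m)"
  by (auto simp: upd_def split: prod.split)

lemma upd_other: "x \<notin> fst ` set ws \<Longrightarrow> upd ws m x = m x"
  by (induction ws arbitrary: m) (auto simp: upd_Cons)

lemma upd_cong: "m x = m' x \<Longrightarrow> upd ws m x = upd ws m' x"
proof (induction ws arbitrary: m m')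
  case (Cons y ws)
  show ?case unfolding upd_Cons by (rule Cons.IH) (use Cons.prems in simp)
qed simp

text \<open>
  Every run of \<open>p\<close> halts within \<open>T\<close> steps, and its final memory and work are coupled by \<open>Q\<close> with
  an outcome drawn from \<open>\<mu>\<close>. The footprints \<open>A\<close> (writes) and \<open>B\<close> (reads) let processes running
  in parallel be specified separately: a step may not depend on cells outside \<open>B\<close>.
\<close>

inductive tr :: "program \<Rightarrow> address set \<Rightarrow> address set \<Rightarrow> nat \<Rightarrow> memory \<Rightarrow> proc \<Rightarrow> 'a pmf \<Rightarrow>
    ('a \<Rightarrow> memory \<Rightarrow> nat \<Rightarrow> bool) \<Rightarrow> bool" for P A B where
  fin: "finished p \<Longrightarrow> (\<And>a. a \<in> set_pmf \<mu> \<Longrightarrow> Q a m 0) \<Longrightarrow> tr P A B T m p \<mu> Q"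
| step: "\<not> finished p \<Longrightarrow>
    (\<And>m'. (\<forall>x\<in>B. m' x = m x) \<Longrightarrow> par_step P m' p = spmf_of_pmf D) \<Longrightarrow>
    (\<And>p' ws. (p', ws) \<in> set_pmf D \<Longrightarrow> distinct (map fst ws) \<and> fst ` set ws \<subseteq> A \<and>
       tr P A B T (upd ws m) p' (f (p', ws)) (\<lambda>a m w. Q a m (num_ops p + w))) \<Longrightarrow>
    \<mu> = bind_pmf D f \<Longrightarrow> tr P A B (Suc T) m p \<mu> Q"

lemma finishedE: "finished p \<Longrightarrow> (\<And>\<rho>. p = Run [] \<rho> \<Longrightarrow> thesis) \<Longrightarrow> thesis"
  by (cases p) auto

lemma tr_finished: "tr P A B T m p \<mu> Q \<Longrightarrow> finished p \<Longrightarrow> a \<in> set_pmf \<mu> \<Longrightarrow> Q a m 0"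
  by (erule tr.cases) auto

lemma tr_zero: "tr P A B 0 m p \<mu> Q \<Longrightarrow> finished p"
  by (erule tr.cases) auto

text \<open>A finished process steps to itself without writing, so a positive time budget unfolds
  into a step in either case. This lets one branch of a fork idle until the other one has
  finished.\<close>

lemma tr_unfold:
  assumes "tr P A B (Suc T) m p \<mu> Q"
  obtains D f where
    "\<And>m'. (\<forall>x\<in>B. m' x = m x) \<Longrightarrow> par_step P m' p = spmf_of_pmf D"
    "\<And>p' ws. (p', ws) \<in> set_pmf D \<Longrightarrow> distinct (map fst ws) \<and> fst ` set ws \<subseteq> A \<and>
       tr P A B T (upd ws m) p' (f (p', ws)) (\<lambda>a m w. Q a m (num_ops p + w))"
    "\<mu> = bind_pmf D f"
proof (cases "finished p")
  case True
  then obtain \<rho> where p: "p = Run [] \<rho>" by (rule finishedE)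
  show ?thesis
    by (rule that[of "return_pmf (p, [])" "\<lambda>_. \<mu>"])
      (use assms True in \<open>auto simp: p bind_return_pmf intro!: tr.fin dest: tr_finished\<close>)
next
  case False
  show ?thesis
    using assms
  proof (cases rule: tr.cases)
    case fin
    then show ?thesis using False by simp
  next
    case (step D f)
    show ?thesis by (rule that[of D f]) (fact step)+
  qed
qed

text \<open>Besides weakening all parameters, the last premise may use that cells outside
  \<open>A\<close> keep their contents; the frame rule \<open>tr_frame\<close> is an
  instance.\<close>

lemma tr_mono:
  assumes "tr P A B T m p \<mu> Q" "A \<subseteq> A'" "B \<subseteq> B'" "T \<le> T'"
    and "\<And>a m' w. a \<in> set_pmf \<mu> \<Longrightarrow> (\<And>x. x \<notin> A \<Longrightarrow> m' x = m x) \<Longrightarrow> Q a m' w \<Longrightarrow> Q' a m' w"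
  shows "tr P A' B' T' m p \<mu> Q'"
  using assms
proof (induction arbitrary: T' Q' rule: tr.induct)
  case (fin p \<mu> Q m T)
  then show ?case by (auto intro: tr.fin)
next
  case (step p m D T f Q \<mu>)
  obtain T'' where T': "T' = Suc T''" "T \<le> T''" using step.prems(3) by (cases T') auto
  show ?case unfolding T'
  proof (rule tr.step[where D = D and f = f])
    fix p' ws assume D: "(p', ws) \<in> set_pmf D"
    note h = step.IH[OF D]
    have "tr P A' B' T'' (upd ws m) p' (f (p', ws)) (\<lambda>a m w. Q' a m (num_ops p + w))"
    proof (rule conjunct2[OF h[THEN conjunct2, THEN conjunct2], rule_format])
      fix a m' w
      assume a: "a \<in> set_pmf (f (p', ws))" "\<And>x. x \<notin> A \<Longrightarrow> m' x = upd ws m x" "Q a m' (num_ops p + w)"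
      show "Q' a m' (num_ops p + w)"
      proof (rule step.prems(4))
        show "a \<in> set_pmf \<mu>" using a(1) D step.hyps by auto
        fix x assume "x \<notin> A"
        then show "m' x = m x" using a(2)[of x] h upd_other[of x ws m] by auto
      qed fact
    qed (use step.prems T' in auto)
    then show "distinct (map fst ws) \<and> fst ` set ws \<subseteq> A' \<and>
       tr P A' B' T'' (upd ws m) p' (f (p', ws)) (\<lambda>a m w. Q' a m (num_ops p + w))"
      using h step.prems(1) by auto
  next
    show "par_step P m0 p = spmf_of_pmf D" if "\<forall>x\<in>B'. m0 x = m x" for m0
      by (rule step.hyps(2)) (use that step.prems(2) in blast)
  qed (use step.hyps in auto)
qed

text \<open>The distribution \<open>D\<close> of the next step is determined by the process, because
  \<open>Some\<close> is injective. Hence only the continuations differ between the couplings with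
  the outcomes \<open>f a\<close>, and they can be averaged over \<open>a\<close> behind the step.
  Such mixtures arise at a join, where the final states of the branches need not determine their
  outcomes.\<close>

lemma tr_mix:
  assumes "\<And>a. a \<in> set_pmf \<nu> \<Longrightarrow> tr P A B T m p (f a) Q"
  shows "tr P A B T m p (bind_pmf \<nu> f) Q"
  using assms
proof (induction T arbitrary: m p f Q)
  case 0
  obtain a where "a \<in> set_pmf \<nu>" by (metis set_pmf_not_empty ex_in_conv)
  then have fp: "finished p" using 0 tr_zero by blast
  then show ?case using tr_finished[OF 0 fp] by (auto intro!: tr.fin)
next
  case (Suc T)
  show ?case
  proof (cases "finished p")
    case True
    then show ?thesis using tr_finished[OF Suc.prems True] by (auto intro!: tr.fin)
  next
    case False
    define ok where "ok D g a \<longleftrightarrow>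
      (\<forall>m'. (\<forall>x\<in>B. m' x = m x) \<longrightarrow> par_step P m' p = spmf_of_pmf D) \<and>
      (\<forall>p' ws. (p', ws) \<in> set_pmf D \<longrightarrow> distinct (map fst ws) \<and> fst ` set ws \<subseteq> A \<and>
       tr P A B T (upd ws m) p' (g (p', ws)) (\<lambda>a m w. Q a m (num_ops p + w))) \<and>
      f a = bind_pmf D g" for D g a
    have ex: "\<exists>D g. ok D g a" if "a \<in> set_pmf \<nu>" for a
      using Suc.prems[OF that] unfolding ok_def by (elim tr_unfold) blast
    obtain a0 where a0: "a0 \<in> set_pmf \<nu>" by (metis set_pmf_not_empty ex_in_conv)
    then obtain D where D: "\<exists>g. ok D g a0" using ex by blast
    have "\<exists>g. ok D g a" if a: "a \<in> set_pmf \<nu>" for a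
    proof -
      obtain D' g where g: "ok D' g a" using ex[OF a] by blast
      have "par_step P m p = spmf_of_pmf D'" using g by (auto simp: ok_def)
      moreover have "par_step P m p = spmf_of_pmf D" using D by (auto simp: ok_def)
      ultimately have "map_pmf Some D' = map_pmf Some D" by (simp add: spmf_of_pmf_def)
      then have "D' = D" using injD[OF pmf.inj_map[OF inj_Some]] by blast
      then show ?thesis using g by blast
    qed
    then obtain g where g: "\<And>a. a \<in> set_pmf \<nu> \<Longrightarrow> ok D (g a) a" by metis
    show ?thesis
    proof (rule tr.step[where D = D and f = "\<lambda>x. bind_pmf \<nu> (\<lambda>a. g a x)"])
      have "bind_pmf \<nu> f = bind_pmf \<nu> (\<lambda>a. bind_pmf D (g a))"
        by (rule bind_pmf_cong) (use g in \<open>auto simp: ok_def\<close>)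
      then show "bind_pmf \<nu> f = bind_pmf D (\<lambda>x. bind_pmf \<nu> (\<lambda>a. g a x))"
        by (rule trans) (rule bind_commute_pmf)
      fix p' ws assume "(p', ws) \<in> set_pmf D"
      then have *: "distinct (map fst ws) \<and> fst ` set ws \<subseteq> A \<and>
        tr P A B T (upd ws m) p' (g a (p', ws)) (\<lambda>a m w. Q a m (num_ops p + w))"
        if "a \<in> set_pmf \<nu>" for a
        using g[OF that] unfolding ok_def by blast
      then show "distinct (map fst ws) \<and> fst ` set ws \<subseteq> A \<and>
        tr P A B T (upd ws m) p' (bind_pmf \<nu> (\<lambda>a. g a (p', ws))) (\<lambda>a m w. Q a m (num_ops p + w))"
        using *[OF a0] by (intro conjI Suc.IH) (use * in blast)+
    qed (use False g[OF a0] in \<open>unfold ok_def, blast+\<close>)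
  qed
qed

text \<open>Each branch is specified on a memory of its own, \<open>m1\<close> or \<open>m2\<close>,
  which may differ from the common one only where the other branch writes. Since neither branch
  reads there, a joint step is the product of two separate steps, and commuting
  \<open>bind_pmf\<close> regroups the outcomes by branch.\<close>

lemma tr_Join:
  assumes "tr P A1 B1 T m1 p1 \<mu>1 Q1" "tr P A2 B2 T m2 p2 \<mu>2 Q2"
    and sets: "A1 \<subseteq> A" "A2 \<subseteq> A" "B1 \<subseteq> B" "B2 \<subseteq> B" "A1 \<inter> A2 = {}" "B1 \<inter> A2 = {}" "B2 \<inter> A1 = {}"
    and "\<And>x. x \<notin> A2 \<Longrightarrow> m x = m1 x" "\<And>x. x \<notin> A1 \<Longrightarrow> m x = m2 x"
    and "\<And>a1 a2 m1' m2' m' w1 w2. a1 \<in> set_pmf \<mu>1 \<Longrightarrow> a2 \<in> set_pmf \<mu>2 \<Longrightarrow>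
      Q1 a1 m1' w1 \<Longrightarrow> Q2 a2 m2' w2 \<Longrightarrow>
      (\<And>x. x \<notin> A2 \<Longrightarrow> m' x = m1' x) \<Longrightarrow> (\<And>x. x \<notin> A1 \<Longrightarrow> m' x = m2' x) \<Longrightarrow>
      (\<And>x. x \<notin> A1 \<Longrightarrow> x \<notin> A2 \<Longrightarrow> m' x = m x) \<Longrightarrow>
      tr P A B T3 m' (Run b \<rho>) (\<mu>3 a1 a2) (\<lambda>a m w. Q a m (w1 + w2 + 1 + w))"
  shows "tr P A B (Suc (T + T3)) m (Join p1 p2 b \<rho>) (bind_pmf \<mu>1 (\<lambda>a1. bind_pmf \<mu>2 (\<mu>3 a1))) Q"
  using assms(1,2,10-)
proof (induction T arbitrary: m m1 m2 p1 p2 \<mu>1 \<mu>2 Q1 Q2 Q)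
  case 0
  then have fp: "finished p1" "finished p2" using tr_zero by blast+
  show ?case
  proof (rule tr.step[where D = "return_pmf (Run b \<rho>, [])"
        and f = "\<lambda>_. bind_pmf \<mu>1 (\<lambda>a1. bind_pmf \<mu>2 (\<mu>3 a1))"])
    show "distinct (map fst ws) \<and> fst ` set ws \<subseteq> A \<and> tr P A B (0 + T3) (upd ws m) p'
       (bind_pmf \<mu>1 (\<lambda>a1. bind_pmf \<mu>2 (\<mu>3 a1))) (\<lambda>a m w. Q a m (num_ops (Join p1 p2 b \<rho>) + w))"
      if "(p', ws) \<in> set_pmf (return_pmf (Run b \<rho>, []))" for p' ws
    proof -
      have "tr P A B T3 m (Run b \<rho>) (\<mu>3 a1 a2) (\<lambda>a m w. Q a m (Suc w))"
        if "a1 \<in> set_pmf \<mu>1" "a2 \<in> set_pmf \<mu>2" for a1 a2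
        using 0(5)[OF that tr_finished[OF 0(1) fp(1) that(1)] tr_finished[OF 0(2) fp(2) that(2)], of m] 0(3,4)
        by simp
      then show ?thesis using that fp by (auto intro!: tr_mix)
    qed
  qed (use fp in \<open>auto simp: bind_return_pmf\<close>)
next
  case (Suc T)
  show ?case
  proof (cases "finished p1 \<and> finished p2")
    case True
    have "tr P A B (Suc (0 + T3)) m (Join p1 p2 b \<rho>) (bind_pmf \<mu>1 (\<lambda>a1. bind_pmf \<mu>2 (\<mu>3 a1))) Q"
    proof (rule tr.step[where D = "return_pmf (Run b \<rho>, [])"
          and f = "\<lambda>_. bind_pmf \<mu>1 (\<lambda>a1. bind_pmf \<mu>2 (\<mu>3 a1))"])
      show "distinct (map fst ws) \<and> fst ` set ws \<subseteq> A \<and> tr P A B (0 + T3) (upd ws m) p'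
       (bind_pmf \<mu>1 (\<lambda>a1. bind_pmf \<mu>2 (\<mu>3 a1))) (\<lambda>a m w. Q a m (num_ops (Join p1 p2 b \<rho>) + w))"
        if "(p', ws) \<in> set_pmf (return_pmf (Run b \<rho>, []))" for p' ws
      proof -
        have "tr P A B T3 m (Run b \<rho>) (\<mu>3 a1 a2) (\<lambda>a m w. Q a m (Suc w))"
          if "a1 \<in> set_pmf \<mu>1" "a2 \<in> set_pmf \<mu>2" for a1 a2
          using Suc.prems(5)[OF that tr_finished[OF Suc.prems(1) True[THEN conjunct1] that(1)]
              tr_finished[OF Suc.prems(2) True[THEN conjunct2] that(2)], of m] Suc.prems(3,4)
          by simp
        then show ?thesis using that True by (auto intro!: tr_mix)
      qed
    qed (use True in \<open>auto simp: bind_return_pmf\<close>)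
    then show ?thesis by (rule tr_mono) auto
  next
    case False
    obtain D1 f1 where 1: "\<And>m'. (\<forall>x\<in>B1. m' x = m1 x) \<Longrightarrow> par_step P m' p1 = spmf_of_pmf D1"
      "\<And>p' ws. (p', ws) \<in> set_pmf D1 \<Longrightarrow> distinct (map fst ws) \<and> fst ` set ws \<subseteq> A1 \<and>
        tr P A1 B1 T (upd ws m1) p' (f1 (p', ws)) (\<lambda>a m w. Q1 a m (num_ops p1 + w))"
      "\<mu>1 = bind_pmf D1 f1"
      using Suc.prems(1) by (rule tr_unfold) (rule that)
    obtain D2 f2 where 2: "\<And>m'. (\<forall>x\<in>B2. m' x = m2 x) \<Longrightarrow> par_step P m' p2 = spmf_of_pmf D2"
      "\<And>p' ws. (p', ws) \<in> set_pmf D2 \<Longrightarrow> distinct (map fst ws) \<and> fst ` set ws \<subseteq> A2 \<and>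
        tr P A2 B2 T (upd ws m2) p' (f2 (p', ws)) (\<lambda>a m w. Q2 a m (num_ops p2 + w))"
      "\<mu>2 = bind_pmf D2 f2"
      using Suc.prems(2) by (rule tr_unfold) (rule that)
    \<comment> \<open>The continuation must be a function of the joint state, but it depends on
      which branch made which writes. As the write footprints are disjoint, filtering by address
      splits the joint list again.\<close>
    define sel where "sel = (\<lambda>C. filter (\<lambda>y :: address \<times> real. fst y \<in> C))"
    define D where "D = bind_pmf D1 (\<lambda>(p1', ws1). map_pmf (\<lambda>(p2', ws2). (Join p1' p2' b \<rho>, ws1 @ ws2)) D2)"
    define f where "f = (\<lambda>(p, ws). case p of Join p1' p2' _ _ \<Rightarrow>
      bind_pmf (f1 (p1', sel A1 ws)) (\<lambda>a1. bind_pmf (f2 (p2', sel A2 ws)) (\<mu>3 a1)) | _ \<Rightarrow> undefined)"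
    have sel: "sel A1 (ws1 @ ws2) = ws1" "sel A2 (ws1 @ ws2) = ws2"
      if "(p1', ws1) \<in> set_pmf D1" "(p2', ws2) \<in> set_pmf D2" for p1' ws1 p2' ws2
    proof -
      have "fst ` set ws1 \<subseteq> A1" "fst ` set ws2 \<subseteq> A2" using 1(2)[OF that(1)] 2(2)[OF that(2)] by auto
      then have "\<forall>y\<in>set ws1. fst y \<in> A1 \<and> fst y \<notin> A2" "\<forall>y\<in>set ws2. fst y \<in> A2 \<and> fst y \<notin> A1"
        using sets(5) by auto
      then show "sel A1 (ws1 @ ws2) = ws1" "sel A2 (ws1 @ ws2) = ws2"
        by (auto simp: sel_def)
    qed
    show ?thesis
    proof (rule tr.step[where D = D and f = f])
      show "\<not> finished (Join p1 p2 b \<rho>)" by simp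
    next
      fix m' assume m': "\<forall>x\<in>B. m' x = m x"
      have "par_step P m' p1 = spmf_of_pmf D1"
        by (rule 1(1)) (use m' sets Suc.prems(3) in \<open>metis disjoint_iff subsetD\<close>)
      moreover have "par_step P m' p2 = spmf_of_pmf D2"
        by (rule 2(1)) (use m' sets Suc.prems(4) in \<open>metis disjoint_iff subsetD\<close>)
      ultimately show "par_step P m' (Join p1 p2 b \<rho>) = spmf_of_pmf D"
        using False
        by (auto simp: D_def spmf_of_pmf_bind map_pmf_def bind_assoc_pmf case_prod_unfold)
    next
      have "bind_pmf D f = bind_pmf D1 (\<lambda>(p1', ws1). bind_pmf D2 (\<lambda>(p2', ws2).
          bind_pmf (f1 (p1', ws1)) (\<lambda>a1. bind_pmf (f2 (p2', ws2)) (\<mu>3 a1))))"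
        unfolding D_def bind_assoc_pmf
        by (intro bind_pmf_cong refl)
          (auto simp: bind_map_pmf f_def intro!: bind_pmf_cong[OF refl] simp: sel)
      also have "\<dots> = bind_pmf D1 (\<lambda>x1. bind_pmf (f1 x1) (\<lambda>a1. bind_pmf D2 (\<lambda>x2. bind_pmf (f2 x2) (\<mu>3 a1))))"
        by (subst (2) bind_commute_pmf) (simp add: case_prod_unfold)
      finally show "bind_pmf \<mu>1 (\<lambda>a1. bind_pmf \<mu>2 (\<mu>3 a1)) = bind_pmf D f"
        by (simp add: 1(3) 2(3) bind_assoc_pmf)
    next
      fix p' ws assume "(p', ws) \<in> set_pmf D"
      then obtain p1' ws1 p2' ws2 where x: "(p1', ws1) \<in> set_pmf D1" "(p2', ws2) \<in> set_pmf D2"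
        "p' = Join p1' p2' b \<rho>" "ws = ws1 @ ws2"
        by (auto simp: D_def)
      note h1 = 1(2)[OF x(1)] and h2 = 2(2)[OF x(2)]
      have ws: "fst ` set ws1 \<subseteq> A1" "fst ` set ws2 \<subseteq> A2" using h1 h2 by auto
      have f: "f (p', ws) = bind_pmf (f1 (p1', ws1)) (\<lambda>a1. bind_pmf (f2 (p2', ws2)) (\<mu>3 a1))"
        using x sel[OF x(1,2)] by (simp add: f_def)
      have no: "num_ops (Join p1 p2 b \<rho>) = num_ops p1 + num_ops p2" using False by auto
      have "tr P A B (Suc (T + T3)) (upd ws m) (Join p1' p2' b \<rho>) (f (p', ws)) (\<lambda>a m w. Q a m (num_ops p1 + num_ops p2 + w))"
        unfolding f
      proof (rule Suc.IH)
        show "tr P A1 B1 T (upd ws1 m1) p1' (f1 (p1', ws1)) (\<lambda>a m w. Q1 a m (num_ops p1 + w))" using h1 by blast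
        show "tr P A2 B2 T (upd ws2 m2) p2' (f2 (p2', ws2)) (\<lambda>a m w. Q2 a m (num_ops p2 + w))" using h2 by blast
        show "upd ws m y = upd ws1 m1 y" if "y \<notin> A2" for y
          using that ws Suc.prems(3) by (simp add: x upd_append) (metis subsetD upd_cong upd_other)
        show "upd ws m y = upd ws2 m2 y" if "y \<notin> A1" for y
          using that ws Suc.prems(4) unfolding x(4) upd_append
          by (intro upd_cong) (metis subsetD upd_other)
      next
        fix a1 a2 m1' m2' m' w1 w2
        assume a: "a1 \<in> set_pmf (f1 (p1', ws1))" "a2 \<in> set_pmf (f2 (p2', ws2))"
          "Q1 a1 m1' (num_ops p1 + w1)" "Q2 a2 m2' (num_ops p2 + w2)"
          "\<And>x. x \<notin> A2 \<Longrightarrow> m' x = m1' x" "\<And>x. x \<notin> A1 \<Longrightarrow> m' x = m2' x"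
          "\<And>x. x \<notin> A1 \<Longrightarrow> x \<notin> A2 \<Longrightarrow> m' x = upd ws m x"
        have "tr P A B T3 m' (Run b \<rho>) (\<mu>3 a1 a2) (\<lambda>a m w. Q a m ((num_ops p1 + w1) + (num_ops p2 + w2) + 1 + w))"
        proof (rule Suc.prems(5)[OF _ _ a(3,4,5,6)])
          show "a1 \<in> set_pmf \<mu>1" "a2 \<in> set_pmf \<mu>2" using a x 1(3) 2(3) by auto
          fix y assume "y \<notin> A1" "y \<notin> A2"
          then show "m' y = m y" using a(7)[of y] ws upd_other[of y ws m] by (auto simp: x)
        qed
        then show "tr P A B T3 m' (Run b \<rho>) (\<mu>3 a1 a2) (\<lambda>a m w. Q a m (num_ops p1 + num_ops p2 + (w1 + w2 + 1 + w)))"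
          by (simp add: algebra_simps)
      qed
      moreover have "fst ` set ws1 \<inter> fst ` set ws2 = {}" using ws sets(5) by blast
      then have "distinct (map fst ws)" using h1 h2 by (simp add: x)
      moreover have "fst ` set ws \<subseteq> A" using ws sets by (auto simp: x)
      ultimately show "distinct (map fst ws) \<and> fst ` set ws \<subseteq> A \<and>
        tr P A B (Suc T + T3) (upd ws m) p' (f (p', ws)) (\<lambda>a m w. Q a m (num_ops (Join p1 p2 b \<rho>) + w))"
        unfolding no using x(3) by simp
    qed
  qed
qed

text \<open>Leads from \<open>tr\<close> back to actual runs. A coupling, rather than a bound for
  every outcome, is what allows probabilities and expectations to be transferred. Surplus time does
  no harm, as a halted machine stays put.\<close>

theorem tr_adequate:
  assumes "tr P A B T m p \<mu> Q" "T \<le> T'"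
  shows "rel_pmf (\<lambda>x a. \<exists>\<sigma>. x = Some \<sigma> \<and> halted \<sigma> \<and> (\<exists>w. work \<sigma> = w0 + w \<and> Q a (shared \<sigma>) w))
    (run P T' (Config m p w0)) \<mu>"
  using assms
proof (induction arbitrary: T' w0 rule: tr.induct)
  case (fin p \<mu> Q m T)
  then obtain \<rho> where p: "p = Run [] \<rho>" by (elim finishedE)
  have "run P T' (Config m p w0) = return_spmf (Config m p w0)"
    by (induction T') (simp_all add: p pram_step_def guarded_def)
  then show ?case using fin by (auto simp: rel_pmf_return_pmf1)
next
  case (step p m D T f Q \<mu>)
  obtain T'' where T': "T' = Suc T''" "T \<le> T''" using step.prems by (cases T') auto
  have "pram_step P (Config m p w0) =
      bind_pmf D (\<lambda>(p', ws). return_spmf (Config (upd ws m) p' (w0 + num_ops p)))"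
    using step.hyps(2)[of m] step.IH
    by (auto simp: pram_step_def bind_spmf_of_pmf guarded_def upd_def case_prod_unfold intro!: bind_pmf_cong)
  then have "run P T' (Config m p w0) = bind_pmf D (\<lambda>(p', ws). run P T'' (Config (upd ws m) p' (w0 + num_ops p)))"
    by (simp add: T' bind_spmf_def bind_assoc_pmf bind_return_pmf case_prod_unfold)
  moreover have "rel_pmf (\<lambda>x a. \<exists>\<sigma>. x = Some \<sigma> \<and> halted \<sigma> \<and> (\<exists>w. work \<sigma> = w0 + w \<and> Q a (shared \<sigma>) w))
     (bind_pmf D (\<lambda>(p', ws). run P T'' (Config (upd ws m) p' (w0 + num_ops p)))) (bind_pmf D f)"
  proof (rule rel_pmf_bindI[where R = "\<lambda>x y. x = y \<and> x \<in> set_pmf D"])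
    show "rel_pmf (\<lambda>x y. x = y \<and> x \<in> set_pmf D) D D" by (rule rel_pmf_reflI) simp
    fix x y assume "x = y \<and> x \<in> set_pmf D"
    then obtain p' ws where x: "x = (p', ws)" "y = (p', ws)" "(p', ws) \<in> set_pmf D" by (cases x) auto
    have "rel_pmf (\<lambda>x a. \<exists>\<sigma>. x = Some \<sigma> \<and> halted \<sigma> \<and> (\<exists>w. work \<sigma> = (w0 + num_ops p) + w \<and> Q a (shared \<sigma>) (num_ops p + w)))
      (run P T'' (Config (upd ws m) p' (w0 + num_ops p))) (f (p', ws))"
      using step.IH[OF x(3)] T'(2) by blast
    then show "rel_pmf (\<lambda>x a. \<exists>\<sigma>. x = Some \<sigma> \<and> halted \<sigma> \<and> (\<exists>w. work \<sigma> = w0 + w \<and> Q a (shared \<sigma>) w))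
      (case x of (p', ws) \<Rightarrow> run P T'' (Config (upd ws m) p' (w0 + num_ops p))) (f y)"
      unfolding x by (auto elim!: pmf.rel_mono_strong simp: add.assoc) 
  qed
  ultimately show ?case by (simp add: step.hyps)
qed

section \<open>Symbolic execution and proof rules for the instructions\<close>

definition idx :: "real \<Rightarrow> nat" where "idx x = nat \<lfloor>x\<rfloor>"

lemma idx_simps [simp]:
  "idx (real a) = a" "idx (real a + real b) = a + b" "idx (real a + 1) = a + 1" "idx (1 + real a) = a + 1"
  "idx 0 = 0" "idx 1 = 1" "idx (numeral k) = numeral k"
  "b \<le> a \<Longrightarrow> idx (real a - real b) = a - b" "1 \<le> a \<Longrightarrow> idx (real a - 1) = a - 1"
  "idx (real a + real b + real c) = a + b + c"
proof -
  show "idx (real a + real b) = a + b" unfolding idx_def by (metis floor_of_nat nat_int of_nat_add)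
  show "idx (real a + real b + real c) = a + b + c" unfolding idx_def by (metis floor_of_nat nat_int of_nat_add)
  show "idx (real a + 1) = a + 1" unfolding idx_def by (metis floor_of_nat nat_int of_nat_add of_nat_1)
  then show "idx (1 + real a) = a + 1" by (simp add: add.commute)
  show "idx (real a - real b) = a - b" if "b \<le> a" unfolding idx_def using that by (metis floor_of_nat nat_int of_nat_diff)
  show "idx (real a - 1) = a - 1" if "1 \<le> a" unfolding idx_def using that by (metis floor_of_nat nat_int of_nat_diff of_nat_1)
qed (simp_all add: idx_def)

lemma Nats_diff_1 [simp]: "1 \<le> a \<Longrightarrow> real a - 1 \<in> \<nat>"
  by (metis of_nat_diff of_nat_in_Nats of_nat_1)

lemma tr_step1:
  assumes "par_step P m (Run (c # b) \<rho>) = return_spmf (Run b' \<rho>', ws)"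
    and "\<And>m'. (\<forall>x\<in>B. m' x = m x) \<Longrightarrow> par_step P m' (Run (c # b) \<rho>) = par_step P m (Run (c # b) \<rho>)"
    and "distinct (map fst ws)" "fst ` set ws \<subseteq> A"
    and "tr P A B T (upd ws m) (Run b' \<rho>') \<mu> (\<lambda>a m w. Q a m (1 + w))"
  shows "tr P A B (Suc T) m (Run (c # b) \<rho>) \<mu> Q"
  by (rule tr.step[where D = "return_pmf (Run b' \<rho>', ws)" and f = "\<lambda>_. \<mu>"])
    (use assms in \<open>auto simp: bind_return_pmf\<close>)

text \<open>
  Symbolic execution of the straight-line prefix of a program. It stops at the first instruction
  that is random, forks or calls, where the continuation \<open>\<Psi>\<close> has to hold.
\<close>

function (sequential) sx :: "address set \<Rightarrow> address set \<Rightarrow> (nat \<Rightarrow> instr list \<Rightarrow> registers \<Rightarrow> memory \<Rightarrow> bool) \<Rightarrow>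
    nat \<Rightarrow> instr list \<Rightarrow> registers \<Rightarrow> memory \<Rightarrow> bool" where
  "sx A B \<Psi> n (Const r z # b) \<rho> m = sx A B \<Psi> (n + 1) b (\<rho>(r := of_int z)) m"
| "sx A B \<Psi> n (Arith f r r1 r2 # b) \<rho> m = sx A B \<Psi> (n + 1) b (\<rho>(r := arith_op f (\<rho> r1) (\<rho> r2))) m"
| "sx A B \<Psi> n (FloorLog r r1 # b) \<rho> m \<longleftrightarrow> \<rho> r1 > 0 \<and> sx A B \<Psi> (n + 1) b (\<rho>(r := of_int \<lfloor>log 2 (\<rho> r1)\<rfloor>)) m"
| "sx A B \<Psi> n (Load r a ri # b) \<rho> m \<longleftrightarrow> \<rho> ri \<in> \<nat> \<and> (a, idx (\<rho> ri)) \<in> B \<and>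
     sx A B \<Psi> (n + 1) b (\<rho>(r := m (a, idx (\<rho> ri)))) m"
| "sx A B \<Psi> n (Store a ri r # b) \<rho> m \<longleftrightarrow> \<rho> ri \<in> \<nat> \<and> (a, idx (\<rho> ri)) \<in> A \<and>
     sx A B \<Psi> (n + 1) b \<rho> (m((a, idx (\<rho> ri)) := \<rho> r))"
| "sx A B \<Psi> n (IfLess r1 r2 b1 b2 # b) \<rho> m \<longleftrightarrow>
     (\<rho> r1 < \<rho> r2 \<longrightarrow> sx A B \<Psi> (n + 1) (b1 @ b) \<rho> m) \<and> (\<not> \<rho> r1 < \<rho> r2 \<longrightarrow> sx A B \<Psi> (n + 1) (b2 @ b) \<rho> m)"
| "sx A B \<Psi> n b \<rho> m = \<Psi> n b \<rho> m"
  by pat_completeness auto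
termination
  by (relation "Wellfounded.measure (\<lambda>(_, _, _, _, b, _, _). size_list size b)") auto

text \<open>The counter of \<open>sx\<close> measures elapsed time and work alike, because a lone
  processor performs one operation per step.\<close>

lemma sx_tr:
  assumes "sx A B (\<lambda>n b \<rho> m. n \<le> T \<and> tr P A B (T - n) m (Run b \<rho>) \<mu> (\<lambda>a m w. Q a m (n + w))) 0 b \<rho> m"
  shows "tr P A B T m (Run b \<rho>) \<mu> Q"
proof -
  define \<Psi> where "\<Psi> = (\<lambda>n b \<rho> m. n \<le> T \<and> tr P A B (T - n) m (Run b \<rho>) \<mu> (\<lambda>a m w. Q a m (n + w)))"
  have I: "\<Psi> n (c # b) \<rho> m" if "\<Psi> (n + 1) b' \<rho>' (upd ws m)"
    "par_step P m (Run (c # b) \<rho>) = return_spmf (Run b' \<rho>', ws)"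
    "\<And>m'. (\<forall>x\<in>B. m' x = m x) \<Longrightarrow> par_step P m' (Run (c # b) \<rho>) = par_step P m (Run (c # b) \<rho>)"
    "distinct (map fst ws)" "fst ` set ws \<subseteq> A" for n c b \<rho> m b' \<rho>' ws
  proof -
    have "tr P A B (Suc (T - (n + 1))) m (Run (c # b) \<rho>) \<mu> (\<lambda>a m w. Q a m (n + w))"
      by (rule tr_step1[OF that(2,3,4,5)]) (use that(1) in \<open>auto simp: \<Psi>_def\<close>)
    moreover have "Suc (T - (n + 1)) = T - n" "n \<le> T" using that(1) by (auto simp: \<Psi>_def)
    ultimately show ?thesis by (simp add: \<Psi>_def)
  qed
  have "sx A' B' \<Psi>' n b \<rho> m \<Longrightarrow> A' = A \<Longrightarrow> B' = B \<Longrightarrow> \<Psi>' = \<Psi> \<Longrightarrow> \<Psi> n b \<rho> m" for A' B' \<Psi>' n b \<rho> m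
  proof (induction A' B' \<Psi>' n b \<rho> m rule: sx.induct)
    case (6 A' B' \<Psi>' n r1 r2 b1 b2 b \<rho> m)
    then show ?case
      by (intro I[where ws = "[]" and b' = "(if \<rho> r1 < \<rho> r2 then b1 else b2) @ b" and \<rho>' = \<rho>]) auto
  qed (auto simp: guarded_def idx_def upd_def intro!: I)
  from this[OF assms[folded \<Psi>_def] refl refl refl] show ?thesis by (simp add: \<Psi>_def)
qed

lemma tr_Call:
  assumes "i < length P" "tr P A B T m (Run (P ! i @ b) \<rho>) \<mu> (\<lambda>a m w. Q a m (1 + w))"
  shows "tr P A B (Suc T) m (Run (Call i # b) \<rho>) \<mu> Q"
  by (rule tr_step1[where ws = "[]"]) (use assms in \<open>auto simp: guarded_def\<close>)

lemma tr_Uniform: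
  assumes "\<rho> rn = real n" "n > 0"
    and "\<And>x. x < n \<Longrightarrow> tr P A B T m (Run b (\<rho>(r := real x))) (f x) (\<lambda>a m w. Q a m (1 + w))"
  shows "tr P A B (Suc T) m (Run (Uniform r rn # b) \<rho>) (bind_pmf (pmf_of_set {..<n}) f) Q"
proof (rule tr.step)
  let ?D = "map_pmf (\<lambda>x. (Run b (\<rho>(r := real x)), [])) (pmf_of_set {..<n})"
  show "par_step P m' (Run (Uniform r rn # b) \<rho>) = spmf_of_pmf ?D" for m'
    using assms(1,2) by (simp add: guarded_def)
  \<comment> \<open>The continuation has to be a function of the successor state, so the number
    drawn is read back from register \<open>r\<close>.\<close>
  show "bind_pmf (pmf_of_set {..<n}) f =
      bind_pmf ?D (\<lambda>(p, _). f (case p of Run _ \<rho>' \<Rightarrow> idx (\<rho>' r)))"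
    by (simp add: bind_map_pmf)
  have "{..<n} \<noteq> {}" using assms(2) by auto
  then show "distinct (map fst ws) \<and> fst ` set ws \<subseteq> A \<and>
       tr P A B T (upd ws m) p' ((\<lambda>(p, _). f (case p of Run _ \<rho>' \<Rightarrow> idx (\<rho>' r))) (p', ws))
         (\<lambda>a m w. Q a m (num_ops (Run (Uniform r rn # b) \<rho>) + w))"
    if "(p', ws) \<in> set_pmf ?D" for p' ws
    using that assms(3) by auto
qed simp

lemma tr_Binomial:
  assumes "\<rho> rn = real n" "0 \<le> \<rho> rp" "\<rho> rp \<le> 1"
    and "\<And>x. x \<le> n \<Longrightarrow> tr P A B T m (Run b (\<rho>(r := real x))) (f x) (\<lambda>a m w. Q a m (1 + w))"
  shows "tr P A B (Suc T) m (Run (Binomial r rn rp # b) \<rho>) (bind_pmf (binomial_pmf n (\<rho> rp)) f) Q"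
proof (rule tr.step)
  let ?D = "map_pmf (\<lambda>x. (Run b (\<rho>(r := real x)), [])) (binomial_pmf n (\<rho> rp))"
  show "par_step P m' (Run (Binomial r rn rp # b) \<rho>) = spmf_of_pmf ?D" for m'
    using assms(1-3) by (simp add: guarded_def)
  show "bind_pmf (binomial_pmf n (\<rho> rp)) f =
      bind_pmf ?D (\<lambda>(p, _). f (case p of Run _ \<rho>' \<Rightarrow> idx (\<rho>' r)))"
    by (simp add: bind_map_pmf)
  show "distinct (map fst ws) \<and> fst ` set ws \<subseteq> A \<and>
       tr P A B T (upd ws m) p' ((\<lambda>(p, _). f (case p of Run _ \<rho>' \<Rightarrow> idx (\<rho>' r))) (p', ws))
         (\<lambda>a m w. Q a m (num_ops (Run (Binomial r rn rp # b) \<rho>) + w))"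
    if mem: "(p', ws) \<in> set_pmf ?D" for p' ws
  proof -
    obtain x where x: "x \<in> set_pmf (binomial_pmf n (\<rho> rp))" "p' = Run b (\<rho>(r := real x))" "ws = []"
      using mem unfolding set_map_pmf by blast
    then have "x \<le> n" using set_pmf_binomial_eq[of "\<rho> rp" n] assms(2,3) by (auto split: if_splits)
    then show ?thesis using assms(4)[of x] x by simp
  qed
qed simp

lemma tr_Par:
  assumes "tr P A1 B1 T m (Run b1 \<rho>) \<mu>1 Q1" "tr P A2 B2 T m (Run b2 \<rho>) \<mu>2 Q2"
    and sets: "A1 \<subseteq> A" "A2 \<subseteq> A" "B1 \<subseteq> B" "B2 \<subseteq> B" "A1 \<inter> A2 = {}" "B1 \<inter> A2 = {}" "B2 \<inter> A1 = {}"
    and "\<And>a1 a2 m1 m2 m' w1 w2. a1 \<in> set_pmf \<mu>1 \<Longrightarrow> a2 \<in> set_pmf \<mu>2 \<Longrightarrow> Q1 a1 m1 w1 \<Longrightarrow> Q2 a2 m2 w2 \<Longrightarrow>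
      (\<And>x. x \<notin> A2 \<Longrightarrow> m' x = m1 x) \<Longrightarrow> (\<And>x. x \<notin> A1 \<Longrightarrow> m' x = m2 x) \<Longrightarrow>
      (\<And>x. x \<notin> A1 \<Longrightarrow> x \<notin> A2 \<Longrightarrow> m' x = m x) \<Longrightarrow>
      tr P A B T3 m' (Run b \<rho>) (\<mu>3 a1 a2) (\<lambda>a m w. Q a m (w1 + w2 + 2 + w))"
  shows "tr P A B (T + T3 + 2) m (Run (Par b1 b2 # b) \<rho>) (bind_pmf \<mu>1 (\<lambda>a1. bind_pmf \<mu>2 (\<mu>3 a1))) Q"
proof -
  have "tr P A B (Suc (T + T3)) m (Join (Run b1 \<rho>) (Run b2 \<rho>) b \<rho>) (bind_pmf \<mu>1 (\<lambda>a1. bind_pmf \<mu>2 (\<mu>3 a1)))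
      (\<lambda>a m w. Q a m (1 + w))"
    using assms(10) by (intro tr_Join[OF assms(1,2) sets]) (auto simp: eval_nat_numeral)
  then have "tr P A B (Suc (Suc (T + T3))) m (Run (Par b1 b2 # b) \<rho>) (bind_pmf \<mu>1 (\<lambda>a1. bind_pmf \<mu>2 (\<mu>3 a1))) Q"
    by (intro tr.step[where D = "return_pmf (Join (Run b1 \<rho>) (Run b2 \<rho>) b \<rho>, [])" and
          f = "\<lambda>_. bind_pmf \<mu>1 (\<lambda>a1. bind_pmf \<mu>2 (\<mu>3 a1))"]) (auto simp: bind_return_pmf)
  then show ?thesis by simp
qed

lemma tr_Nil: "(\<And>a. a \<in> set_pmf \<mu> \<Longrightarrow> Q a m 0) \<Longrightarrow> tr P A B T m (Run [] \<rho>) \<mu> Q"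
  by (rule tr.fin) auto

text \<open>A fork with an empty second branch acts as a procedure call that preserves the
  registers: the suspended parent resumes with its own \<rho>. The 2 pays for forking and
  resuming.\<close>

lemma tr_sub:
  assumes "tr P A1 B1 T m (Run b1 \<rho>) \<mu>1 Q1" "A1 \<subseteq> A" "B1 \<subseteq> B"
    and "\<And>a1 m' w1. a1 \<in> set_pmf \<mu>1 \<Longrightarrow> Q1 a1 m' w1 \<Longrightarrow> (\<And>x. x \<notin> A1 \<Longrightarrow> m' x = m x) \<Longrightarrow>
      tr P A B T3 m' (Run b \<rho>) (\<mu>3 a1) (\<lambda>a m w. Q a m (w1 + 2 + w))"
  shows "tr P A B (T + T3 + 2) m (Run (Par b1 [] # b) \<rho>) (bind_pmf \<mu>1 \<mu>3) Q"
proof -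
  have "tr P A B (T + T3 + 2) m (Run (Par b1 [] # b) \<rho>)
      (bind_pmf \<mu>1 (\<lambda>a1. bind_pmf (return_pmf ()) (\<lambda>_. \<mu>3 a1))) Q"
  proof (rule tr_Par[OF assms(1) tr_Nil[where A = "{}" and B = "{}" and Q = "\<lambda>_ m' w. w = 0"]])
    fix a1 a2 m1 m2 m' w1 and w2 :: nat
    assume a: "a1 \<in> set_pmf \<mu>1" "Q1 a1 m1 w1" "\<And>x. x \<notin> {} \<Longrightarrow> m' x = m1 x" "w2 = 0"
      "\<And>x. x \<notin> A1 \<Longrightarrow> x \<notin> {} \<Longrightarrow> m' x = m x"
    have "m' = m1" using a(3) by auto
    then show "tr P A B T3 m' (Run b \<rho>) (\<mu>3 a1) (\<lambda>a m w. Q a m (w1 + w2 + 2 + w))"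
      using assms(4)[OF a(1), of m' w1] a(2,4,5) by simp
  qed (use assms in auto)
  then show ?thesis by (simp add: bind_return_pmf)
qed

lemma tr_frame:
  assumes "tr P A B T m p \<mu> Q"
  shows "tr P A B T m p \<mu> (\<lambda>a m' w. Q a m' w \<and> (\<forall>x. x \<notin> A \<longrightarrow> m' x = m x))"
  using assms by (rule tr_mono) auto

abbreviation dt :: "program \<Rightarrow> address set \<Rightarrow> address set \<Rightarrow> nat \<Rightarrow> memory \<Rightarrow> instr list \<Rightarrow> registers \<Rightarrow>
    (memory \<Rightarrow> nat \<Rightarrow> bool) \<Rightarrow> bool" where
  "dt P A B T m b \<rho> Q \<equiv> tr P A B T m (Run b \<rho>) (return_pmf ()) (\<lambda>_. Q)"

lemma dt_Par:
  assumes "dt P A1 B1 T m b1 \<rho> Q1" "dt P A2 B2 T m b2 \<rho> Q2"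
    and "A1 \<subseteq> A" "A2 \<subseteq> A" "B1 \<subseteq> B" "B2 \<subseteq> B" "A1 \<inter> A2 = {}" "B1 \<inter> A2 = {}" "B2 \<inter> A1 = {}"
    and "\<And>m1 m2 m' w1 w2. Q1 m1 w1 \<Longrightarrow> Q2 m2 w2 \<Longrightarrow>
      (\<And>x. x \<notin> A2 \<Longrightarrow> m' x = m1 x) \<Longrightarrow> (\<And>x. x \<notin> A1 \<Longrightarrow> m' x = m2 x) \<Longrightarrow>
      (\<And>x. x \<notin> A1 \<Longrightarrow> x \<notin> A2 \<Longrightarrow> m' x = m x) \<Longrightarrow> dt P A B T3 m' b \<rho> (\<lambda>m w. Q m (w1 + w2 + 2 + w))"
  shows "dt P A B (T + T3 + 2) m (Par b1 b2 # b) \<rho> Q"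
  using tr_Par[OF assms(1-9), of T3 b "\<lambda>_ _. return_pmf ()"] assms(10) by (simp add: bind_return_pmf)

lemma dt_sub:
  assumes "dt P A1 B1 T m b1 \<rho> Q1" "A1 \<subseteq> A" "B1 \<subseteq> B"
    and "\<And>m' w1. Q1 m' w1 \<Longrightarrow> (\<And>x. x \<notin> A1 \<Longrightarrow> m' x = m x) \<Longrightarrow>
      tr P A B T3 m' (Run b \<rho>) \<mu> (\<lambda>a m w. Q a m (w1 + 2 + w))"
  shows "tr P A B (T + T3 + 2) m (Run (Par b1 [] # b) \<rho>) \<mu> Q"
  using tr_sub[OF assms(1-3), of T3 b "\<lambda>_. \<mu>"] assms(4) by (simp add: bind_return_pmf)

section \<open>Relocation of a program\<close>

text \<open>
  The given sorter runs as a subroutine of the preprocessing: its procedures are renumbered from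
  \<open>c\<close> on and its arrays from \<open>d\<close> on, so that it cannot disturb the other data.
\<close>

fun shift_instr :: "nat \<Rightarrow> nat \<Rightarrow> instr \<Rightarrow> instr" where
  "shift_instr d c (Load r a ri) = Load r (a + d) ri"
| "shift_instr d c (Store a ri r) = Store (a + d) ri r"
| "shift_instr d c (IfLess r1 r2 b1 b2) = IfLess r1 r2 (map (shift_instr d c) b1) (map (shift_instr d c) b2)"
| "shift_instr d c (Call i) = Call (i + c)"
| "shift_instr d c (Par b1 b2) = Par (map (shift_instr d c) b1) (map (shift_instr d c) b2)"
| "shift_instr d c i = i"

fun shift_proc :: "nat \<Rightarrow> nat \<Rightarrow> proc \<Rightarrow> proc" where
  "shift_proc d c (Run b \<rho>) = Run (map (shift_instr d c) b) \<rho>"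
| "shift_proc d c (Join p q b \<rho>) = Join (shift_proc d c p) (shift_proc d c q) (map (shift_instr d c) b) \<rho>"

definition shift_writes :: "nat \<Rightarrow> (address \<times> real) list \<Rightarrow> (address \<times> real) list" where
  "shift_writes d = map (\<lambda>((a, i), x). ((a + d, i), x))"

definition view :: "nat \<Rightarrow> memory \<Rightarrow> memory" where
  "view d m = (\<lambda>(a, i). m (a + d, i))"

lemma finished_shift [simp]: "finished (shift_proc d c p) = finished p"
  by (cases p) auto

lemma num_ops_shift [simp]: "num_ops (shift_proc d c p) = num_ops p"
  by (induction p) auto

text \<open>Registers and control flow are untouched by the renumbering, so a step of the relocated
  program on \<open>m\<close> is a step of the original one on the part of the memory that
  \<open>view\<close> shows.\<close>

lemma par_step_shift:
  assumes "length P0 = c"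
  shows "par_step (P0 @ map (map (shift_instr d c)) P) m (shift_proc d c p) =
    map_spmf (\<lambda>(p', ws). (shift_proc d c p', shift_writes d ws)) (par_step P (view d m) p)"
proof (induction P "view d m" p rule: par_step.induct)
  case (2 P ins b \<rho>)
  then show ?case
    by (cases ins)
      (auto simp: guarded_def view_def shift_writes_def assms nth_append map_bind_pmf pmf.map_comp o_def
        spmf_of_pmf_def map_pmf_def[symmetric])
next
  case (3 P p q b \<rho>)
  show ?case
  proof (cases "finished p \<and> finished q")
    case True
    then show ?thesis by (auto simp: shift_writes_def)
  next
    case False
    then show ?thesis using 3
      by (auto simp: map_spmf_bind_spmf bind_map_spmf o_def case_prod_unfold shift_writes_def)
  qed
qed (simp_all add: shift_writes_def)

lemma view_upd: "view d (upd (shift_writes d ws) m) = upd ws (view d m)"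
proof (induction ws arbitrary: m)
  case (Cons y ws)
  obtain a i x where y: "y = ((a, i), x)" by (metis prod.exhaust)
  have "view d (m((a + d, i) := x)) = (view d m)((a, i) := x)" by (auto simp: view_def)
  moreover have "shift_writes d (y # ws) = ((a + d, i), x) # shift_writes d ws" by (simp add: y shift_writes_def)
  ultimately show ?case using Cons[of "m((a + d, i) := x)"] by (simp only: y upd_Cons fst_conv snd_conv)
qed (simp add: shift_writes_def)

lemma map_spmf_spmf_of_pmf: "map_spmf g (spmf_of_pmf D) = spmf_of_pmf (map_pmf g D)"
  by (simp add: spmf_of_pmf_def pmf.map_comp o_def)

lemma set_pmf_bind_spmf_Some: "Some y \<in> set_pmf p \<Longrightarrow> set_pmf (f y) \<subseteq> set_pmf (bind_spmf p f)"
  unfolding bind_spmf_def by (auto intro!: bexI[of _ "Some y"])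

lemma set_pmf_bind_spmf_None: "None \<in> set_pmf p \<Longrightarrow> None \<in> set_pmf (bind_spmf p f)"
  unfolding bind_spmf_def by (auto intro!: bexI[of _ None])

text \<open>A converse of adequacy, for a program that is known only through its runs. A fault or a
  write conflict at any step would make \<open>None\<close> a possible result, which the premise
  excludes; hence every step has a proper distribution and exclusive writes. Only a guarantee for
  all outcomes is passed on, so the abstract outcome is trivial.\<close>

lemma tr_shift:
  assumes len: "length P0 = c"
    and "\<forall>x\<in>set_pmf (run P T (Config (view d m) p w0)).
      \<exists>\<sigma>. x = Some \<sigma> \<and> halted \<sigma> \<and> R (work \<sigma>) (shared \<sigma>)"
  shows "tr (P0 @ map (map (shift_instr d c)) P) {(a, i). a \<ge> d} {(a, i). a \<ge> d} T m (shift_proc d c p)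
    (return_pmf ()) (\<lambda>_ m' w. R (w0 + w) (view d m'))"
  using assms(2)
proof (induction T arbitrary: m p w0)
  case 0
  then show ?case by (auto intro: tr.fin)
next
  case (Suc T)
  let ?P = "P0 @ map (map (shift_instr d c)) P"
  show ?case
  proof (cases "finished p")
    case True
    then obtain \<rho> where p: "p = Run [] \<rho>" by (rule finishedE)
    have r: "run P T (Config (view d m) p w0) = return_spmf (Config (view d m) p w0)" for T
      by (induction T) (simp_all add: p pram_step_def guarded_def)
    show ?thesis using Suc.prems True unfolding r by (auto intro!: tr.fin)
  next
    case False
    have some: "x \<noteq> None" if x: "x \<in> set_pmf (par_step P (view d m) p)" for x
    proof
      assume "x = None"
      then have "None \<in> set_pmf (pram_step P (Config (view d m) p w0))"
        using x by (auto simp: pram_step_def intro: set_pmf_bind_spmf_None)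
      then have "None \<in> set_pmf (run P (Suc T) (Config (view d m) p w0))"
        by (auto intro: set_pmf_bind_spmf_None)
      then show False using Suc.prems by blast
    qed
    define D where "D = map_pmf the (par_step P (view d m) p)"
    have D: "par_step P (view d m) p = spmf_of_pmf D"
    proof -
      have "map_pmf (Some \<circ> the) (par_step P (view d m) p) = par_step P (view d m) p"
        using some by (intro map_pmf_idI) auto
      then show ?thesis by (simp add: D_def spmf_of_pmf_def pmf.map_comp)
    qed
    show ?thesis
    proof (rule tr.step[where D = "map_pmf (\<lambda>(p', ws). (shift_proc d c p', shift_writes d ws)) D"
          and f = "\<lambda>_. return_pmf ()"])
      fix m' assume "\<forall>x\<in>{(a, i). a \<ge> d}. m' x = m x"
      then have "view d m' = view d m" by (auto simp: view_def)
      then show "par_step ?P m' (shift_proc d c p) =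
          spmf_of_pmf (map_pmf (\<lambda>(p', ws). (shift_proc d c p', shift_writes d ws)) D)"
        using par_step_shift[OF len, of d P m' p] D map_spmf_spmf_of_pmf by metis
    next
      fix p' ws assume "(p', ws) \<in> set_pmf (map_pmf (\<lambda>(p', ws). (shift_proc d c p', shift_writes d ws)) D)"
      then obtain q vs where q: "(q, vs) \<in> set_pmf D" "p' = shift_proc d c q" "ws = shift_writes d vs" by auto
      have step: "pram_step P (Config (view d m) p w0) =
        bind_pmf D (\<lambda>(p, ws). guarded (distinct (map fst ws))
          (return_spmf (Config (upd ws (view d m)) p (w0 + num_ops p'')))) " if "p'' = p" for p''
        using D that by (simp add: pram_step_def upd_def case_prod_unfold)
      have dist: "distinct (map fst vs)"
      proof (rule ccontr)
        assume "\<not> distinct (map fst vs)"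
        then have "None \<in> set_pmf (pram_step P (Config (view d m) p w0))"
          using q(1) unfolding step[OF refl] by (auto simp: guarded_def intro!: bexI[of _ "(q, vs)"])
        then have "None \<in> set_pmf (run P (Suc T) (Config (view d m) p w0))"
          by (auto intro: set_pmf_bind_spmf_None)
        then show False using Suc.prems by blast
      qed
      then have "Some (Config (upd vs (view d m)) q (w0 + num_ops p)) \<in> set_pmf (pram_step P (Config (view d m) p w0))"
        using q(1) unfolding step[OF refl] by (auto simp: guarded_def intro!: bexI[of _ "(q, vs)"])
      then have "set_pmf (run P T (Config (upd vs (view d m)) q (w0 + num_ops p))) \<subseteq>
          set_pmf (run P (Suc T) (Config (view d m) p w0))"
        unfolding run.simps(2) by (rule set_pmf_bind_spmf_Some)
      then have "tr ?P {(a, i). a \<ge> d} {(a, i). a \<ge> d} T (upd ws m) p' (return_pmf ())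
          (\<lambda>_ m' w. R ((w0 + num_ops p) + w) (view d m'))"
        unfolding q(2,3) by (intro Suc.IH) (use Suc.prems in \<open>unfold view_upd, blast\<close>)
      moreover have "distinct (map fst ws)"
      proof -
        have "map fst (shift_writes d vs) = map (\<lambda>(a, i). (a + d, i)) (map fst vs)"
          by (simp add: shift_writes_def case_prod_unfold)
        moreover have "inj (\<lambda>(a, i). (a + d, i :: nat))" by (auto simp: inj_def)
        ultimately show ?thesis
          using dist unfolding q(3) by (metis distinct_map inj_on_subset subset_UNIV)
      qed
      moreover have "fst ` set ws \<subseteq> {(a, i). a \<ge> d}" by (auto simp: q shift_writes_def)
      ultimately show "distinct (map fst ws) \<and> fst ` set ws \<subseteq> {(a, i). d \<le> a} \<and>
        tr ?P {(a, i). d \<le> a} {(a, i). d \<le> a} T (upd ws m) p' (return_pmf ())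
          (\<lambda>a m w. R (w0 + (num_ops (shift_proc d c p) + w)) (view d m))"
        by (simp add: add.assoc)
    qed (use False in auto)
  qed
qed

section \<open>Sampling from a weighted tree\<close>

datatype tree = Lf nat | Nd nat tree tree

primrec lvs :: "tree \<Rightarrow> nat list" where
  "lvs (Lf j) = [j]"
| "lvs (Nd i l r) = lvs l @ lvs r"

primrec root :: "tree \<Rightarrow> nat" where
  "root (Lf j) = j"
| "root (Nd i l r) = i"

primrec ids :: "tree \<Rightarrow> nat set" where
  "ids (Lf j) = {j}"
| "ids (Nd i l r) = insert i (ids l \<union> ids r)"

primrec depth :: "tree \<Rightarrow> nat" where
  "depth (Lf j) = 0"
| "depth (Nd i l r) = Suc (max (depth l) (depth r))"

definition mass :: "(nat \<Rightarrow> real) \<Rightarrow> tree \<Rightarrow> real" where "mass v t = sum_list (map v (lvs t))"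
definition cnt :: "tree \<Rightarrow> nat" where "cnt t = length (lvs t)"
definition lo :: "tree \<Rightarrow> nat" where "lo t = hd (lvs t)"

primrec mx :: "(nat \<Rightarrow> real) \<Rightarrow> tree \<Rightarrow> real" where
  "mx v (Lf j) = v j"
| "mx v (Nd i l r) = max (mx v l) (mx v r)"

lemma lessThan_ne: "0 < (n::nat) \<Longrightarrow> {..<n} \<noteq> {}" by auto

lemma lvs_ne [simp]: "lvs t \<noteq> []" by (induction t) auto
lemma mass_simps [simp]: "mass v (Lf j) = v j" "mass v (Nd i l r) = mass v l + mass v r" by (simp_all add: mass_def)
lemma cnt_simps [simp]: "cnt (Lf j) = 1" "cnt (Nd i l r) = cnt l + cnt r" by (simp_all add: cnt_def)
lemma lo_simps [simp]: "lo (Lf j) = j" "lo (Nd i l r) = lo l" by (simp_all add: lo_def)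
lemma cnt_pos [simp]: "cnt t > 0" by (simp add: cnt_def)
lemma root_in_ids [simp]: "root t \<in> ids t" by (cases t) auto

lemma mx_ge: "j \<in> set (lvs t) \<Longrightarrow> v j \<le> mx v t" by (induction t) auto
lemma mx_in: "\<exists>j\<in>set (lvs t). mx v t = v j" by (induction t) (auto simp: max_def)

lemma mass_pos: "(\<And>j. j \<in> set (lvs t) \<Longrightarrow> v j > 0) \<Longrightarrow> mass v t > 0"
  by (induction t) (auto intro: add_pos_pos)

text \<open>
  The second component counts the proposals. After a rejection the attempt continues in a random
  child rather than at the same node; this bounds the number of proposals by the depth.
\<close>

primrec single :: "(nat \<Rightarrow> real) \<Rightarrow> tree \<Rightarrow> (nat \<times> nat) pmf" where
  "single v (Lf j) = return_pmf (j, 0)"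
| "single v (Nd i l r) = bind_pmf (pmf_of_set {..<cnt (Nd i l r)}) (\<lambda>x.
     bind_pmf (binomial_pmf 1 (v (lo l + x) / mx v (Nd i l r))) (\<lambda>b.
       if 0 < b then return_pmf (lo l + x, 1)
       else bind_pmf (binomial_pmf 1 (mass v l / mass v (Nd i l r))) (\<lambda>c.
         map_pmf (\<lambda>(p, s). (p, Suc s)) (if 0 < c then single v l else single v r))))"

text \<open>
  \<open>Ot p k s\<close>: all \<open>k\<close> samples fall on leaf \<open>p\<close>, which was found after \<open>s\<close> proposals.
\<close>

datatype outcome = Zr | Ot nat nat nat | Sp outcome outcome

primrec sampler :: "(nat \<Rightarrow> real) \<Rightarrow> tree \<Rightarrow> nat \<Rightarrow> outcome pmf" where
  "sampler v (Lf j) k = return_pmf (if k = 0 then Zr else Ot j k 0)"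
| "sampler v (Nd i l r) k =
     (if k = 0 then return_pmf Zr
      else if k = 1 then map_pmf (\<lambda>(p, s). Ot p 1 s) (single v (Nd i l r))
      else bind_pmf (binomial_pmf k (mass v l / mass v (Nd i l r))) (\<lambda>x.
        bind_pmf (sampler v l x) (\<lambda>a. bind_pmf (sampler v r (k - x)) (\<lambda>b. return_pmf (Sp a b)))))"

primrec outl :: "outcome \<Rightarrow> (nat \<times> nat) list" where
  "outl Zr = []"
| "outl (Ot p k s) = [(p, k)]"
| "outl (Sp a b) = outl a @ outl b"

primrec oms :: "outcome \<Rightarrow> nat multiset" where
  "oms Zr = {#}"
| "oms (Ot p k s) = replicate_mset k p"
| "oms (Sp a b) = oms a + oms b"

text \<open>The law of a random descent to a leaf, with the recursion that \<open>single\<close>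
  follows after a rejection. Both can thus be compared node by node.\<close>

primrec lp :: "(nat \<Rightarrow> real) \<Rightarrow> tree \<Rightarrow> nat pmf" where
  "lp v (Lf j) = return_pmf j"
| "lp v (Nd i l r) = bind_pmf (binomial_pmf 1 (mass v l / mass v (Nd i l r)))
     (\<lambda>c. if 0 < c then lp v l else lp v r)"

lemma binomial_0: "0 \<le> p \<Longrightarrow> p \<le> 1 \<Longrightarrow> binomial_pmf 0 p = return_pmf 0"
  using binomial_pmf_0[of p] by simp

lemma binomial_Suc: "0 \<le> p \<Longrightarrow> p \<le> 1 \<Longrightarrow> binomial_pmf (Suc n) p =
    bind_pmf (bernoulli_pmf p) (\<lambda>b. bind_pmf (binomial_pmf n p) (\<lambda>k. return_pmf ((if b then 1 else 0) + k)))"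
  by (rule binomial_pmf_Suc) auto

lemma binomial_1: "0 \<le> p \<Longrightarrow> p \<le> 1 \<Longrightarrow> binomial_pmf 1 p = map_pmf (\<lambda>b. if b then 1 else 0) (bernoulli_pmf p)"
  using binomial_Suc[of p 0]
  by (simp add: bind_return_pmf map_pmf_def binomial_0)

lemma bind_binomial_1:
  assumes "0 \<le> p" "p \<le> 1"
  shows "bind_pmf (binomial_pmf 1 p) f = bind_pmf (bernoulli_pmf p) (\<lambda>b. if b then f 1 else f 0)"
  unfolding binomial_1[OF assms] bind_map_pmf by (intro bind_pmf_cong) auto

lemma pmf_bind_bernoulli:
  assumes "0 \<le> p" "p \<le> 1"
  shows "pmf (bind_pmf (bernoulli_pmf p) f) j = p * pmf (f True) j + (1 - p) * pmf (f False) j"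
  using assms by (simp add: pmf_bind integral_bernoulli_pmf)

lemma pmf_bind_binomial_1:
  assumes "0 \<le> p" "p \<le> 1"
  shows "pmf (bind_pmf (binomial_pmf 1 p) f) j = p * pmf (f 1) j + (1 - p) * pmf (f 0) j"
  unfolding bind_binomial_1[OF assms] by (simp add: pmf_bind_bernoulli[OF assms])

definition pos_on :: "(nat \<Rightarrow> real) \<Rightarrow> tree \<Rightarrow> bool" where
  "pos_on v t \<longleftrightarrow> (\<forall>j\<in>set (lvs t). v j > 0)"

lemma pos_on_Nd [simp]: "pos_on v (Nd i l r) \<longleftrightarrow> pos_on v l \<and> pos_on v r"
  by (auto simp: pos_on_def)

lemma pos_mass: "pos_on v t \<Longrightarrow> mass v t > 0" by (simp add: pos_on_def mass_pos)

lemma pos_mx: "pos_on v t \<Longrightarrow> mx v t > 0"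
  using mx_in[of t v] by (auto simp: pos_on_def)

lemma split_prob:
  assumes "pos_on v (Nd i l r)"
  shows "0 \<le> mass v l / mass v (Nd i l r)" "mass v l / mass v (Nd i l r) \<le> 1"
    "1 - mass v l / mass v (Nd i l r) = mass v r / mass v (Nd i l r)"
proof -
  have "mass v l > 0" "mass v r > 0" using assms pos_mass by auto
  then show "0 \<le> mass v l / mass v (Nd i l r)" "mass v l / mass v (Nd i l r) \<le> 1"
    "1 - mass v l / mass v (Nd i l r) = mass v r / mass v (Nd i l r)"
    by (auto simp: field_simps)
qed

lemma pmf_lp:
  assumes "pos_on v t" "distinct (lvs t)"
  shows "pmf (lp v t) j = (if j \<in> set (lvs t) then v j / mass v t else 0)"
  using assms
proof (induction t)
  case (Lf j')
  then show ?case by (auto simp: pos_on_def indicator_def)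
next
  case (Nd i l r)
  have m: "mass v l > 0" "mass v r > 0" using Nd.prems pos_mass by auto
  have IH: "pmf (lp v l) j = (if j \<in> set (lvs l) then v j / mass v l else 0)"
    "pmf (lp v r) j = (if j \<in> set (lvs r) then v j / mass v r else 0)"
    using Nd by auto
  have "pmf (lp v (Nd i l r)) j = mass v l / mass v (Nd i l r) * pmf (lp v l) j
      + mass v r / mass v (Nd i l r) * pmf (lp v r) j"
    unfolding lp.simps pmf_bind_binomial_1[OF split_prob(1,2)[OF Nd.prems(1)]]
      split_prob(3)[OF Nd.prems(1)] by simp
  then show ?case using Nd.prems m unfolding IH by auto
qed

definition contig :: "tree \<Rightarrow> bool" where "contig t \<longleftrightarrow> lvs t = [lo t..<lo t + cnt t]"

lemma contig_Nd:
  assumes "contig (Nd i l r)"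
  shows "contig l" "contig r" "lo r = lo l + cnt l"
proof -
  have e: "lvs l @ lvs r = [lo l..<lo l + (cnt l + cnt r)]" using assms by (simp add: contig_def)
  also have "\<dots> = [lo l..<lo l + cnt l] @ [lo l + cnt l..<lo l + cnt l + cnt r]"
    using upt_add_eq_append[of "lo l" "lo l + cnt l" "cnt r"] by (simp add: add.assoc)
  finally have "lvs l = [lo l..<lo l + cnt l] \<and> lvs r = [lo l + cnt l..<lo l + cnt l + cnt r]"
    by (subst (asm) append_eq_append_conv) (auto simp: cnt_def)
  moreover from this have "lo r = lo l + cnt l" using cnt_pos[of r] by (simp add: lo_def upt_rec)
  ultimately show "contig l" "contig r" "lo r = lo l + cnt l" by (auto simp: contig_def)
qed

lemma contig_distinct: "contig t \<Longrightarrow> distinct (lvs t)" by (metis contig_def distinct_upt)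

lemma contig_iff: "contig t \<Longrightarrow> j \<in> set (lvs t) \<longleftrightarrow> lo t \<le> j \<and> j < lo t + cnt t"
  by (metis contig_def set_upt atLeastLessThan_iff)

lemma contig_mem: "contig t \<Longrightarrow> x < cnt t \<Longrightarrow> lo t + x \<in> set (lvs t)" by (simp add: contig_def)

lemma contig_mass: "contig t \<Longrightarrow> mass v t = (\<Sum>x<cnt t. v (lo t + x))"
proof -
  have "sum_list (map v [a..<a + n]) = (\<Sum>x<n. v (a + x))" for a n
    by (induction n) auto
  then show "contig t \<Longrightarrow> mass v t = (\<Sum>x<cnt t. v (lo t + x))"
    unfolding mass_def contig_def by metis
qed

text \<open>Leaf j is proposed and accepted with probability \<open>v j\<close> divided by the
  number of leaves times the maximal weight; so given acceptance, the law is proportional to the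
  weights, which is \<open>lp\<close>. A rejection forgets the proposal, and the descent that
  follows has law \<open>lp\<close> by induction. The result is a mixture of \<open>lp\<close> with
  itself.\<close>

lemma map_fst_single:
  assumes "pos_on v t" "contig t"
  shows "map_pmf fst (single v t) = lp v t"
  using assms
proof (induction t)
  case (Lf j)
  show ?case by (simp add: map_return_pmf)
next
  case (Nd i l r)
  let ?t = "Nd i l r"
  let ?q = "\<lambda>x. v (lo l + x) / mx v ?t"
  note c = contig_Nd[OF Nd.prems(2)]
  have IH: "map_pmf fst (single v l) = lp v l" "map_pmf fst (single v r) = lp v r"
    using Nd c by auto
  have q: "0 \<le> ?q x" "?q x \<le> 1" if "x < cnt ?t" for x
  proof -
    have "lo l + x \<in> set (lvs ?t)" using contig_mem[OF Nd.prems(2) that] by simp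
    then have "v (lo l + x) > 0" "v (lo l + x) \<le> mx v ?t"
      using Nd.prems(1) mx_ge[of "lo l + x" ?t v] unfolding pos_on_def by blast+
    then show "0 \<le> ?q x" "?q x \<le> 1" by auto
  qed
  have h1: "map_pmf fst (single v ?t) = bind_pmf (pmf_of_set {..<cnt ?t}) (\<lambda>x. bind_pmf (binomial_pmf 1 (?q x))
      (\<lambda>b. if 0 < b then return_pmf (lo l + x) else lp v ?t))"
    unfolding single.simps lp.simps map_bind_pmf
    by (intro bind_pmf_cong refl)
      (auto simp: map_bind_pmf pmf.map_comp o_def case_prod_unfold IH[symmetric] intro!: bind_pmf_cong)
  have h2: "pmf (bind_pmf (pmf_of_set {..<cnt ?t}) (\<lambda>x. bind_pmf (binomial_pmf 1 (?q x))
      (\<lambda>b. if 0 < b then return_pmf (lo l + x) else lp v ?t))) j = pmf (lp v ?t) j" for j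
  proof -
    have M: "mass v ?t > 0" "mx v ?t > 0" using pos_mass pos_mx Nd.prems by blast+
    have ne: "{..<cnt ?t} \<noteq> {}" "finite {..<cnt ?t}" by (rule lessThan_ne[OF cnt_pos]) simp
    have "pmf (bind_pmf (pmf_of_set {..<cnt ?t}) (\<lambda>x. bind_pmf (binomial_pmf 1 (?q x))
      (\<lambda>b. if 0 < b then return_pmf (lo l + x) else lp v ?t))) j =
      (\<Sum>x<cnt ?t. ?q x * indicator {lo l + x} j + (1 - ?q x) * pmf (lp v ?t) j) / cnt ?t"
    proof -
      have "pmf (bind_pmf (binomial_pmf 1 (?q x)) (\<lambda>b. if 0 < b then return_pmf (lo l + x) else lp v ?t)) j =
          ?q x * indicator {lo l + x} j + (1 - ?q x) * pmf (lp v ?t) j" if "x < cnt ?t" for x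
        unfolding pmf_bind_binomial_1[OF q[OF that]] by (simp add: indicator_def)
      then show ?thesis unfolding pmf_bind_pmf_of_set[OF ne] by (simp del: cnt_simps mx.simps lp.simps)
    qed
    also have "(\<Sum>x<cnt ?t. ?q x * indicator {lo l + x} j + (1 - ?q x) * pmf (lp v ?t) j) =
      (\<Sum>x<cnt ?t. ?q x * indicator {lo l + x} j) + (cnt ?t - mass v ?t / mx v ?t) * pmf (lp v ?t) j"
      using contig_mass[OF Nd.prems(2), of v]
      by (simp add: sum.distrib sum_subtractf flip: sum_distrib_right sum_divide_distrib)
    also have "(\<Sum>x<cnt ?t. ?q x * indicator {lo l + x} j) = mass v ?t / mx v ?t * pmf (lp v ?t) j"
    proof (cases "j \<in> set (lvs ?t)")
      case True
      then have j: "lo l \<le> j" "j < lo l + cnt ?t"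
        using contig_iff[OF Nd.prems(2), of j] by auto
      have "(\<Sum>x<cnt ?t. ?q x * indicator {lo l + x} j) = (\<Sum>x\<in>{j - lo l}. v j / mx v ?t)"
        by (rule sum.mono_neutral_cong_right) (use j in \<open>auto simp: indicator_def\<close>)
      then show ?thesis using True M
        unfolding pmf_lp[OF Nd.prems(1) contig_distinct[OF Nd.prems(2)]] by simp
    next
      case False
      then have "?q x * indicator {lo l + x} j = 0" if "x < cnt ?t" for x
        using contig_mem[OF Nd.prems(2) that] by (auto simp: indicator_def)
      then have "(\<Sum>x<cnt ?t. ?q x * indicator {lo l + x} j) = 0"
        by (intro sum.neutral ballI) (simp only: lessThan_iff)
      then show ?thesis using False
        unfolding pmf_lp[OF Nd.prems(1) contig_distinct[OF Nd.prems(2)]] by (simp del: cnt_simps mx.simps)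
    qed
    also have "(mass v ?t / mx v ?t * pmf (lp v ?t) j + (cnt ?t - mass v ?t / mx v ?t) * pmf (lp v ?t) j) / cnt ?t
      = pmf (lp v ?t) j"
    proof -
      have alg: "(a * P + (c - a) * P) / c = P" if "c \<noteq> 0" for a c P :: real
        using that by (simp add: algebra_simps)
      have "real (cnt ?t) \<noteq> 0" using cnt_pos[of ?t] by (simp del: cnt_simps)
      then show ?thesis by (rule alg)
    qed
    finally show ?thesis .
  qed
  show ?case unfolding h1 by (rule pmf_eqI) (rule h2)
qed

section \<open>Multisets of independent samples and the law of the sampler\<close>

definition iid :: "nat \<Rightarrow> 'a pmf \<Rightarrow> 'a multiset pmf" where
  "iid k p = map_pmf mset (replicate_pmf k p)"

lemma iid_0 [simp]: "iid 0 p = return_pmf {#}" by (simp add: iid_def)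

lemma iid_Suc: "iid (Suc k) p = bind_pmf p (\<lambda>x. map_pmf (add_mset x) (iid k p))"
  by (simp add: iid_def map_bind_pmf pmf.map_comp o_def map_pmf_def bind_assoc_pmf bind_return_pmf)

text \<open>If every sample independently chooses \<open>L\<close> with probability
  \<open>p\<close>, the number of those that do is binomial, and given this number the two sides are
  independent. A further sample raises the count by one exactly if it chooses \<open>L\<close>,
  which is the recursion of \<open>binomial_pmf\<close>.\<close>

lemma iid_mixture:
  assumes p: "0 \<le> p" "p \<le> 1"
  shows "iid k (bind_pmf (binomial_pmf 1 p) (\<lambda>c. if 0 < c then L else R)) =
    bind_pmf (binomial_pmf k p) (\<lambda>x. bind_pmf (iid x L) (\<lambda>a. map_pmf (\<lambda>b. a + b) (iid (k - x) R)))"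
proof (induction k)
  case 0
  then show ?case using p by (simp add: binomial_0 bind_return_pmf)
next
  case (Suc k)
  let ?M = "bind_pmf (binomial_pmf 1 p) (\<lambda>c. if 0 < c then L else R)"
  let ?J = "\<lambda>x y. bind_pmf (iid x L) (\<lambda>a. map_pmf (\<lambda>b. a + b) (iid y R))"
  have M: "?M = bind_pmf (bernoulli_pmf p) (\<lambda>c. if c then L else R)"
    unfolding bind_binomial_1[OF p] by simp
  have L: "bind_pmf L (\<lambda>y. map_pmf (add_mset y) (?J x z)) = ?J (Suc x) z" for x z
  proof -
    have e: "(+) (add_mset y a) = (\<lambda>b. add_mset y (a + b))" for y and a :: "'a multiset" by auto
    show ?thesis by (simp add: iid_Suc map_bind_pmf bind_assoc_pmf bind_map_pmf pmf.map_comp o_def e)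
  qed
  have R: "bind_pmf R (\<lambda>y. map_pmf (add_mset y) (?J x z)) = ?J x (Suc z)" for x z
    unfolding iid_Suc map_bind_pmf
    by (subst bind_commute_pmf) (simp add: pmf.map_comp o_def)
  have le: "x \<le> k" if "x \<in> set_pmf (binomial_pmf k p)" for x
    using that set_pmf_binomial_eq[of p k] p by (auto split: if_splits)
  have "iid (Suc k) ?M = bind_pmf (bernoulli_pmf p) (\<lambda>c. bind_pmf (if c then L else R)
      (\<lambda>y. map_pmf (add_mset y) (bind_pmf (binomial_pmf k p) (\<lambda>x. ?J x (k - x)))))"
    unfolding iid_Suc Suc.IH unfolding M by (simp add: bind_assoc_pmf)
  also have "\<dots> = bind_pmf (bernoulli_pmf p) (\<lambda>c. bind_pmf (binomial_pmf k p) (\<lambda>x.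
      bind_pmf (if c then L else R) (\<lambda>y. map_pmf (add_mset y) (?J x (k - x)))))"
    unfolding map_bind_pmf[of _ "binomial_pmf k p"] by (subst bind_commute_pmf) simp
  also have "\<dots> = bind_pmf (bernoulli_pmf p) (\<lambda>c. bind_pmf (binomial_pmf k p) (\<lambda>x.
      ?J ((if c then 1 else 0) + x) (Suc k - ((if c then 1 else 0) + x))))"
    by (intro bind_pmf_cong refl) (auto simp: L R Suc_diff_le dest: le)
  also have "\<dots> = bind_pmf (binomial_pmf (Suc k) p) (\<lambda>x. ?J x (Suc k - x))"
    unfolding binomial_Suc[OF p] by (simp add: bind_assoc_pmf bind_return_pmf)
  finally show ?case .
qed

lemma iid_1: "iid 1 p = map_pmf (\<lambda>x. {#x#}) p"
  using iid_Suc[of 0 p] by (simp add: map_pmf_def bind_return_pmf)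

lemma iid_return: "iid k (return_pmf x) = return_pmf (replicate_mset k x)"
  by (induction k) (simp_all add: iid_Suc bind_return_pmf)

theorem sampler_law:
  assumes "pos_on v t" "contig t"
  shows "map_pmf oms (sampler v t k) = iid k (lp v t)"
  using assms
proof (induction t arbitrary: k)
  case (Lf j)
  then show ?case by (simp add: iid_return)
next
  case (Nd i l r)
  note c = contig_Nd[OF Nd.prems(2)]
  consider "k = 0" | "k = 1" | "k \<ge> 2" by linarith
  then show ?case
  proof cases
    case 1
    then show ?thesis by simp
  next
    case 2
    have "map_pmf oms (sampler v (Nd i l r) k) = map_pmf (\<lambda>x. {#x#}) (map_pmf fst (single v (Nd i l r)))"
      using 2 by (simp add: pmf.map_comp o_def case_prod_unfold del: single.simps)
    then show ?thesis unfolding map_fst_single[OF Nd.prems] 2 iid_1 .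
  next
    case 3
    have "map_pmf oms (sampler v (Nd i l r) k) = bind_pmf (binomial_pmf k (mass v l / mass v (Nd i l r))) (\<lambda>x.
        bind_pmf (map_pmf oms (sampler v l x)) (\<lambda>a. map_pmf (\<lambda>b. a + b) (map_pmf oms (sampler v r (k - x)))))"
      using 3 by (simp add: map_bind_pmf bind_map_pmf pmf.map_comp o_def map_pmf_def[symmetric])
    also have "\<dots> = iid k (lp v (Nd i l r))"
      using Nd c unfolding lp.simps iid_mixture[OF split_prob(1,2)[OF Nd.prems(1)]] by simp
    finally show ?thesis .
  qed
qed

section \<open>Expected work of a query\<close>

abbreviation E :: "'a pmf \<Rightarrow> ('a \<Rightarrow> real) \<Rightarrow> real" where
  "E p f \<equiv> measure_pmf.expectation p f"

lemma E_bind: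
  fixes f :: "'b \<Rightarrow> real"
  assumes "finite (set_pmf p)" "\<And>x. x \<in> set_pmf p \<Longrightarrow> finite (set_pmf (g x))"
  shows "E (bind_pmf p g) f = E p (\<lambda>x. E (g x) f)"
  by (subst pmf_expectation_bind[OF assms(1) assms(2) order_refl])
    (auto simp: integral_measure_pmf[OF assms(1)])

lemma E_mono:
  fixes f g :: "'a \<Rightarrow> real"
  assumes "finite (set_pmf p)" "\<And>x. x \<in> set_pmf p \<Longrightarrow> f x \<le> g x"
  shows "E p f \<le> E p g"
  using assms by (intro integral_mono_AE integrable_measure_pmf_finite) (auto simp: AE_measure_pmf_iff)

lemma E_cong:
  fixes f g :: "'a \<Rightarrow> real"
  assumes "\<And>x. x \<in> set_pmf p \<Longrightarrow> f x = g x"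
  shows "E p f = E p g"
  using assms by (intro integral_cong_AE) (auto simp: AE_measure_pmf_iff)

lemma E_add:
  fixes f g :: "'a \<Rightarrow> real"
  assumes "finite (set_pmf p)"
  shows "E p (\<lambda>x. f x + g x) = E p f + E p g"
  using assms by (intro Bochner_Integration.integral_add integrable_measure_pmf_finite)

lemma E_diff:
  fixes f g :: "'a \<Rightarrow> real"
  assumes "finite (set_pmf p)"
  shows "E p (\<lambda>x. f x - g x) = E p f - E p g"
  using assms by (intro Bochner_Integration.integral_diff integrable_measure_pmf_finite)

lemma finite_binomial: "0 \<le> p \<Longrightarrow> p \<le> 1 \<Longrightarrow> finite (set_pmf (binomial_pmf k p))"
  by (rule finite_set_pmf_binomial_pmf) auto

lemma binomial_le: "0 \<le> p \<Longrightarrow> p \<le> 1 \<Longrightarrow> x \<in> set_pmf (binomial_pmf k p) \<Longrightarrow> x \<le> k"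
  using set_pmf_binomial_eq[of p k] by (auto split: if_splits)

lemma E_binomial_Suc:
  assumes "0 \<le> p" "p \<le> 1"
  shows "E (binomial_pmf (Suc k) p) f = p * E (binomial_pmf k p) (\<lambda>x. f (Suc x)) + (1 - p) * E (binomial_pmf k p) f"
proof -
  have "E (binomial_pmf (Suc k) p) f = E (bernoulli_pmf p) (\<lambda>b. E (binomial_pmf k p) (\<lambda>x. f ((if b then 1 else 0) + x)))"
    unfolding binomial_Suc[OF assms]
    by (subst E_bind) (auto simp: finite_binomial[OF assms] map_pmf_def[symmetric])
  then show ?thesis using assms by (simp add: integral_bernoulli_pmf)
qed

lemma E_binomial_1: "0 \<le> p \<Longrightarrow> p \<le> 1 \<Longrightarrow> E (binomial_pmf 1 p) f = p * f 1 + (1 - p) * f 0"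
  using E_binomial_Suc[of p 0 f] by (simp add: binomial_0)

lemma binomial_mean:
  assumes "0 \<le> p" "p \<le> 1"
  shows "E (binomial_pmf k p) (\<lambda>x. real x) = k * p"
proof (induction k)
  case (Suc k)
  show ?case unfolding E_binomial_Suc[OF assms]
    using finite_binomial[OF assms, of k] Suc by (simp add: E_add algebra_simps)
qed (use assms in \<open>simp add: binomial_0\<close>)

text \<open>The second factorial moment scales exactly with the square of \<open>p\<close>, unlike
  the second moment, and it vanishes for a lone sample. This is why the work inside groups is
  expressed through \<open>k * (k - 1)\<close>.\<close>

lemma binomial_mean2:
  assumes "0 \<le> p" "p \<le> 1"
  shows "E (binomial_pmf k p) (\<lambda>x. real x * (real x - 1)) = real k * (real k - 1) * p\<^sup>2"
proof (induction k)
  case (Suc k)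
  have e: "real (Suc x) * (real (Suc x) - 1) = real x * (real x - 1) + 2 * real x" for x by (simp add: algebra_simps)
  show ?case unfolding E_binomial_Suc[OF assms] e
    using finite_binomial[OF assms, of k] Suc binomial_mean[OF assms, of k]
    by (simp add: E_add) (simp add: algebra_simps power2_eq_square)
qed (use assms in \<open>simp add: binomial_0\<close>)

lemma binomial_mean_rev:
  assumes "0 \<le> p" "p \<le> 1"
  shows "E (binomial_pmf k p) (\<lambda>x. real (k - x)) = k * (1 - p)"
    and "E (binomial_pmf k p) (\<lambda>x. real (k - x) * (real (k - x) - 1)) = real k * (real k - 1) * (1 - p)\<^sup>2"
proof -
  note fin = finite_binomial[OF assms, of k]
  have "E (binomial_pmf k p) (\<lambda>x. real (k - x)) = E (binomial_pmf k p) (\<lambda>x. real k - real x)"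
    using binomial_le[OF assms] by (intro E_cong) auto
  then show "E (binomial_pmf k p) (\<lambda>x. real (k - x)) = k * (1 - p)"
    using binomial_mean[OF assms, of k] by (simp add: E_diff fin algebra_simps)
  have "E (binomial_pmf k p) (\<lambda>x. real (k - x) * (real (k - x) - 1)) =
    E (binomial_pmf k p) (\<lambda>x. (real k * (real k - 1) + real x * (real x - 1)) - (2 * (real k - 1)) * real x)"
    using binomial_le[OF assms] by (intro E_cong) (auto simp: of_nat_diff algebra_simps)
  also have "\<dots> = real k * (real k - 1) + real k * (real k - 1) * p\<^sup>2 - 2 * (real k - 1) * (k * p)"
    using binomial_mean[OF assms, of k] binomial_mean2[OF assms, of k] fin by (simp add: E_diff E_add)
  finally show "E (binomial_pmf k p) (\<lambda>x. real (k - x) * (real (k - x) - 1)) = real k * (real k - 1) * (1 - p)\<^sup>2"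
    by (simp add: algebra_simps power2_eq_square)
qed

primrec cost :: "outcome \<Rightarrow> nat" where
  "cost Zr = 1"
| "cost (Ot p k s) = 1 + s"
| "cost (Sp a b) = 1 + cost a + cost b"

lemma accept_prob:
  assumes "pos_on v t" "contig t" "x < cnt t"
  shows "0 \<le> v (lo t + x) / mx v t" "v (lo t + x) / mx v t \<le> 1"
proof -
  have "lo t + x \<in> set (lvs t)" using contig_mem assms by blast
  then have "v (lo t + x) > 0" "v (lo t + x) \<le> mx v t"
    using assms mx_ge by (auto simp: pos_on_def)
  then show "0 \<le> v (lo t + x) / mx v t" "v (lo t + x) / mx v t \<le> 1" by auto
qed

lemma set_uniform [simp]: "set_pmf (pmf_of_set {..<cnt t}) = {..<cnt t}"
  by (intro set_pmf_of_set lessThan_ne cnt_pos) simp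

lemma finite_single: "pos_on v t \<Longrightarrow> contig t \<Longrightarrow> finite (set_pmf (single v t))"
proof (induction t)
  case (Nd i l r)
  note c = contig_Nd[OF Nd.prems(2)]
  show ?case unfolding single.simps set_bind_pmf set_uniform
  proof (intro finite_UN_I finite_lessThan)
    fix x assume x: "x \<in> {..<cnt (Nd i l r)}"
    show "finite (set_pmf (binomial_pmf 1 (v (lo l + x) / mx v (Nd i l r))))"
      using accept_prob[OF Nd.prems, of x] x by (intro finite_binomial) auto
  qed (use Nd c split_prob[OF Nd.prems(1)] in \<open>auto intro!: finite_UN_I finite_binomial split: if_splits\<close>)
qed simp

lemma finite_sampler: "pos_on v t \<Longrightarrow> contig t \<Longrightarrow> finite (set_pmf (sampler v t k))"
proof (induction t arbitrary: k)
  case (Nd i l r)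
  show ?case using Nd contig_Nd[OF Nd.prems(2)] split_prob[OF Nd.prems(1)] finite_single[OF Nd.prems]
    by (auto intro!: finite_UN_I finite_binomial simp del: single.simps)
qed simp

section \<open>Expected number of proposals for a single sample\<close>

definition steps :: "(nat \<Rightarrow> real) \<Rightarrow> tree \<Rightarrow> real" where "steps v t = E (single v t) (\<lambda>x. real (snd x))"

lemma steps_Lf [simp]: "steps v (Lf j) = 0" by (simp add: steps_def)

lemma steps_nonneg: "steps v t \<ge> 0" unfolding steps_def by (rule Bochner_Integration.integral_nonneg) simp

text \<open>Averaged over the uniform proposal, the acceptance probability is the mean weight
  divided by the maximal weight. With the complementary probability the search goes on in a child
  chosen by mass.\<close>

lemma steps_Nd:
  assumes "pos_on v (Nd i l r)" "contig (Nd i l r)"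
  shows "steps v (Nd i l r) = 1 + (1 - mass v (Nd i l r) / (cnt (Nd i l r) * mx v (Nd i l r))) *
    (mass v l / mass v (Nd i l r) * steps v l + mass v r / mass v (Nd i l r) * steps v r)"
proof -
  let ?t = "Nd i l r"
  let ?q = "\<lambda>x. v (lo l + x) / mx v ?t"
  note c = contig_Nd[OF assms(2)]
  note sp = split_prob[OF assms(1)]
  have fin: "finite (set_pmf (single v l))" "finite (set_pmf (single v r))"
    using finite_single c assms by auto
  \<comment> \<open>The rejected proposal is included: after a rejection the mean total is
    \<open>s'\<close>, after an acceptance it is 1.\<close>
  define s' where "s' = mass v l / mass v ?t * (1 + steps v l) + mass v r / mass v ?t * (1 + steps v r)"
  define D where "D = bind_pmf (binomial_pmf 1 (mass v l / mass v ?t)) (\<lambda>c.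
         map_pmf (\<lambda>(p, s). (p, Suc s)) (if 0 < c then single v l else single v r))"
  have one: "E (map_pmf (\<lambda>(p, s). (p, Suc s)) (single v t)) (\<lambda>x. real (snd x)) = 1 + steps v t"
    if "finite (set_pmf (single v t))" for t
    using that by (simp add: steps_def case_prod_unfold E_add)
  have finD: "finite (set_pmf D)"
    using fin sp by (auto simp: D_def intro!: finite_UN_I finite_binomial)
  have ED: "E D (\<lambda>x. real (snd x)) = s'"
    unfolding D_def using fin sp
    by (subst E_bind, use sp in \<open>simp add: finite_binomial del: mass_simps\<close>, force)
      (simp only: E_binomial_1[OF sp(1,2)] s'_def sp(3) one[OF fin(1)] one[OF fin(2)] if_True if_False
        less_numeral_extra zero_less_one refl simp_thms)
  have "steps v ?t = E (pmf_of_set {..<cnt ?t}) (\<lambda>x. ?q x + (1 - ?q x) * s')"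
    unfolding steps_def single.simps D_def[symmetric]
  proof (subst E_bind, goal_cases)
    case 3
    show ?case
    proof (rule E_cong)
      fix x assume "x \<in> set_pmf (pmf_of_set {..<cnt ?t})"
      then have q: "0 \<le> ?q x" "?q x \<le> 1" using accept_prob[OF assms, of x] unfolding set_uniform by auto
      show "E (bind_pmf (binomial_pmf 1 (?q x)) (\<lambda>b. if 0 < b then return_pmf (lo l + x, 1) else D))
          (\<lambda>x. real (snd x)) = ?q x + (1 - ?q x) * s'"
      proof -
        have "E (bind_pmf (binomial_pmf 1 (?q x)) (\<lambda>b. if 0 < b then return_pmf (lo l + x, 1) else D)) (\<lambda>x. real (snd x))
          = E (binomial_pmf 1 (?q x)) (\<lambda>b. E (if 0 < b then return_pmf (lo l + x, 1) else D) (\<lambda>x. real (snd x)))"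
          by (rule E_bind) (use finD q finite_binomial in \<open>auto simp del: mx.simps\<close>)
        then show ?thesis unfolding E_binomial_1[OF q] using ED by (simp del: mx.simps)
      qed
    qed
  next
    case (2 x)
    then show ?case using accept_prob[OF assms, of x] finD unfolding set_uniform
      by (auto intro!: finite_UN_I finite_binomial)
  qed (simp del: cnt_simps)
  also have "\<dots> = (\<Sum>x<cnt ?t. s' + ?q x * (1 - s')) / cnt ?t"
  proof -
    have "q + (1 - q) * s' = s' + q * (1 - s')" for q :: real by (simp add: algebra_simps)
    then show ?thesis unfolding integral_pmf_of_set[OF lessThan_ne[OF cnt_pos] finite_lessThan] by simp
  qed
  also have "(\<Sum>x<cnt ?t. s' + ?q x * (1 - s')) = cnt ?t * s' + mass v ?t / mx v ?t * (1 - s')"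
    using contig_mass[OF assms(2), of v]
    by (simp add: sum.distrib flip: sum_distrib_right sum_divide_distrib del: cnt_simps)
  finally have st: "steps v ?t = (cnt ?t * s' + mass v ?t / mx v ?t * (1 - s')) / cnt ?t" .
  then have "steps v ?t = s' + mass v ?t / (cnt ?t * mx v ?t) * (1 - s')"
  proof -
    have "(c * s' + M / x * (1 - s')) / c = s' + M / (c * x) * (1 - s')" if "c \<noteq> 0" for c M x :: real
      using that by (simp add: add_divide_distrib)
    moreover have "real (cnt ?t) \<noteq> 0" using cnt_pos[of ?t] by (simp del: cnt_simps)
    ultimately show ?thesis using st by metis
  qed
  moreover have "s' = 1 + (mass v l / mass v ?t * steps v l + mass v r / mass v ?t * steps v r)"
    using sp(3) unfolding s'_def by (simp only: distrib_left mult_1_right, (linarith)?)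
  ultimately show ?thesis by (simp add: algebra_simps del: cnt_simps mass_simps mx.simps)
qed

lemma mass_le_cnt_mx: "mass v t \<le> cnt t * mx v t"
proof -
  have "mass v t \<le> sum_list (map (\<lambda>_. mx v t) (lvs t))"
    unfolding mass_def by (rule sum_list_mono) (auto intro: mx_ge)
  then show ?thesis by (simp add: sum_list_triv cnt_def)
qed

lemma accept_avg:
  assumes "pos_on v t"
  shows "0 \<le> mass v t / (cnt t * mx v t)" "mass v t / (cnt t * mx v t) \<le> 1"
  using mass_le_cnt_mx[of v t] pos_mass[OF assms] pos_mx[OF assms] cnt_pos[of t] by (auto simp: field_simps)

text \<open>Outside the groups there is no useful lower bound on the acceptance probability, so
  every level is charged a proposal.\<close>

lemma steps_le:
  assumes "pos_on v (Nd i l r)" "contig (Nd i l r)"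
  shows "steps v (Nd i l r) \<le> 1 + (mass v l / mass v (Nd i l r) * steps v l + mass v r / mass v (Nd i l r) * steps v r)"
proof -
  have "0 \<le> mass v l / mass v (Nd i l r) * steps v l + mass v r / mass v (Nd i l r) * steps v r"
    using split_prob[OF assms(1)] by (intro add_nonneg_nonneg mult_nonneg_nonneg steps_nonneg) linarith+
  then show ?thesis unfolding steps_Nd[OF assms]
    using accept_avg[OF assms(1)] by (intro add_left_mono mult_left_le_one_le) auto
qed

definition near :: "(nat \<Rightarrow> real) \<Rightarrow> real \<Rightarrow> tree \<Rightarrow> bool" where
  "near v \<beta> t \<longleftrightarrow> \<beta> > 0 \<and> (\<forall>j\<in>set (lvs t). \<beta> / 2 \<le> v j \<and> v j \<le> \<beta>)"

lemma near_Nd [simp]: "near v \<beta> (Nd i l r) \<longleftrightarrow> near v \<beta> l \<and> near v \<beta> r" by (auto simp: near_def)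

lemma near_pos: "near v \<beta> t \<Longrightarrow> pos_on v t" by (force simp: near_def pos_on_def)

lemma near_mass:
  assumes "near v \<beta> t"
  shows "\<beta> / 2 * cnt t \<le> mass v t" "mass v t \<le> \<beta> * cnt t"
proof -
  have "sum_list (map (\<lambda>_. \<beta> / 2) (lvs t)) \<le> mass v t"
    unfolding mass_def using assms by (intro sum_list_mono) (auto simp: near_def)
  then show "\<beta> / 2 * cnt t \<le> mass v t" by (simp add: sum_list_triv cnt_def mult.commute)
  have "mass v t \<le> sum_list (map (\<lambda>_. \<beta>) (lvs t))"
    unfolding mass_def using assms by (intro sum_list_mono) (auto simp: near_def)
  then show "mass v t \<le> \<beta> * cnt t" by (simp add: sum_list_triv cnt_def mult.commute)
qed

text \<open>The bound 2 is the fixed point of x = 1 + x / 2, as the search goes on with probability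
  at most 1 / 2.\<close>

lemma near_steps:
  assumes "near v \<beta> t" "contig t"
  shows "steps v t \<le> 2"
  using assms
proof (induction t)
  case (Nd i l r)
  let ?t = "Nd i l r" and ?p = "mass v l / mass v (Nd i l r)" and ?q = "mass v r / mass v (Nd i l r)"
  have pos: "pos_on v ?t" using near_pos Nd.prems by blast
  note sp = split_prob[OF pos]
  have IH: "steps v l \<le> 2" "steps v r \<le> 2" using Nd contig_Nd[OF Nd.prems(2)] by auto
  obtain j where "j \<in> set (lvs ?t)" "mx v ?t = v j" using mx_in by blast
  then have "mx v ?t \<le> \<beta>" using Nd.prems(1) unfolding near_def by metis
  then have "cnt ?t * mx v ?t \<le> cnt ?t * \<beta>" by (intro mult_left_mono) auto
  then have "cnt ?t * mx v ?t \<le> 2 * mass v ?t"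
  proof -
    have "cnt ?t * \<beta> = 2 * (\<beta> / 2 * cnt ?t)" by simp
    then show ?thesis using near_mass(1)[OF Nd.prems(1)] \<open>cnt ?t * mx v ?t \<le> cnt ?t * \<beta>\<close> by linarith
  qed
  then have a: "1 / 2 \<le> mass v ?t / (cnt ?t * mx v ?t)"
    using pos_mx[OF pos] cnt_pos[of ?t] by (simp add: field_simps del: cnt_simps mass_simps mx.simps)
  have q: "?q \<ge> 0" "?p + ?q = 1" using sp by linarith+
  then have "?p * steps v l + ?q * steps v r \<le> ?p * 2 + ?q * 2"
    using IH sp by (intro add_mono mult_left_mono) auto
  also have "\<dots> = 2" unfolding distrib_right[symmetric] q(2) by simp
  finally have "(1 - mass v ?t / (cnt ?t * mx v ?t)) * (?p * steps v l + ?q * steps v r) \<le> 1 / 2 * 2"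
    using a accept_avg[OF pos] sp q
    by (intro mult_mono add_nonneg_nonneg mult_nonneg_nonneg steps_nonneg) auto
  then show ?case unfolding steps_Nd[OF pos Nd.prems(2)] by simp
qed simp

text \<open>
  With \<open>\<kappa> = k (k - 1) / M\<^sup>2\<close> for a tree of mass \<open>M\<close>, this bounds the expected number of inner
  nodes that receive two samples; below, \<open>tpot\<close> with \<open>\<kappa> = k / M\<close> does so for nodes with one.
\<close>

primrec gp :: "(nat \<Rightarrow> real) \<Rightarrow> tree \<Rightarrow> real \<Rightarrow> real" where
  "gp v (Lf j) \<kappa> = 0"
| "gp v (Nd i l r) \<kappa> = min 1 (\<kappa> * (mass v (Nd i l r))\<^sup>2) + gp v l \<kappa> + gp v r \<kappa>"

lemma gp_0 [simp]: "gp v t 0 = 0" by (induction t) auto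

lemma gp_mono: "\<kappa> \<le> \<kappa>' \<Longrightarrow> gp v t \<kappa> \<le> gp v t \<kappa>'"
proof (induction t)
  case (Nd i l r)
  then have "\<kappa> * (mass v (Nd i l r))\<^sup>2 \<le> \<kappa>' * (mass v (Nd i l r))\<^sup>2" by (intro mult_right_mono) auto
  then show ?case using Nd by (auto intro!: add_mono min.mono simp del: mass_simps)
qed simp

text \<open>Jensen's inequality for the concave function \<open>min 1\<close>; the potentials are
  sums of such terms.\<close>

lemma E_min:
  assumes "finite (set_pmf p)"
  shows "E p (\<lambda>x. min 1 (f x * c)) \<le> min 1 (E p f * c)"
proof -
  have "E p (\<lambda>x. min 1 (f x * c)) \<le> E p (\<lambda>x. 1)" by (rule E_mono[OF assms]) auto
  moreover have "E p (\<lambda>x. min 1 (f x * c)) \<le> E p (\<lambda>x. f x * c)" by (rule E_mono[OF assms]) auto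
  ultimately show ?thesis by simp
qed

lemma gp_jensen: "finite (set_pmf p) \<Longrightarrow> E p (\<lambda>x. gp v t (f x)) \<le> gp v t (E p f)"
proof (induction t)
  case (Nd i l r)
  have "E p (\<lambda>x. gp v (Nd i l r) (f x)) = E p (\<lambda>x. min 1 (f x * (mass v (Nd i l r))\<^sup>2))
      + E p (\<lambda>x. gp v l (f x)) + E p (\<lambda>x. gp v r (f x))"
    unfolding gp.simps using Nd.prems by (simp add: E_add del: mass_simps)
  then show ?case unfolding gp.simps
    using E_min[OF Nd.prems, of f "(mass v (Nd i l r))\<^sup>2"] Nd.IH(1)[OF Nd.prems] Nd.IH(2)[OF Nd.prems] by linarith
qed simp

abbreviation ecost :: "(nat \<Rightarrow> real) \<Rightarrow> tree \<Rightarrow> nat \<Rightarrow> real" where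
  "ecost v t k \<equiv> E (sampler v t k) (\<lambda>a. real (cost a))"

lemma ecost_0 [simp]: "ecost v t 0 = 1" by (cases t) auto

lemma ecost_1:
  assumes "pos_on v t" "contig t"
  shows "ecost v t 1 = 1 + steps v t"
  using finite_single[OF assms] by (cases t) (auto simp: steps_def case_prod_unfold E_add simp del: single.simps(2))

lemma ecost_Nd:
  assumes "pos_on v (Nd i l r)" "contig (Nd i l r)" "k \<ge> 2"
  shows "ecost v (Nd i l r) k = 1 + (E (binomial_pmf k (mass v l / mass v (Nd i l r))) (\<lambda>x. ecost v l x)
     + E (binomial_pmf k (mass v l / mass v (Nd i l r))) (\<lambda>x. ecost v r (k - x)))"
proof -
  note sp = split_prob[OF assms(1)] and c = contig_Nd[OF assms(2)]
  have fin: "finite (set_pmf (sampler v l k))" "finite (set_pmf (sampler v r k))" for k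
    using finite_sampler assms c by auto
  have fb: "finite (set_pmf (binomial_pmf k (mass v l / mass v (Nd i l r))))"
    using sp by (intro finite_binomial) auto
  have "ecost v (Nd i l r) k = E (binomial_pmf k (mass v l / mass v (Nd i l r)))
      (\<lambda>x. 1 + (ecost v l x + ecost v r (k - x)))"
    using assms(3) fb fin
    by (subst sampler.simps, simp del: mass_simps, subst E_bind)
      (auto simp: E_bind E_add algebra_simps simp del: mass_simps intro!: E_cong finite_UN_I)
  then show ?thesis using fb by (simp add: E_add del: mass_simps)
qed

text \<open>A node with at most one sample costs at most 1 + 2 by \<open>near_steps\<close>. A node
  that splits pays 1 and the constant 3 of both children; its own term in \<open>gp\<close> then
  equals 1, and the 3 granted to the node together with 6 times this term cover the total of 7. The
  parameter of \<open>gp\<close> at a child has as its mean the parameter at the node.\<close>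

lemma ecost_near:
  assumes "near v \<beta> t" "contig t"
  shows "ecost v t k \<le> 1 + 2 * min 1 (real k) + 6 * gp v t (real k * (real k - 1) / (mass v t)\<^sup>2)"
  using assms
proof (induction t arbitrary: k)
  case (Lf j)
  then show ?case by simp
next
  case (Nd i l r)
  let ?t = "Nd i l r" and ?p = "mass v l / mass v (Nd i l r)"
  let ?B = "binomial_pmf k ?p"
  have pos: "pos_on v ?t" using near_pos Nd.prems by blast
  note sp = split_prob[OF pos] and c = contig_Nd[OF Nd.prems(2)]
  have M: "mass v l > 0" "mass v r > 0" "mass v ?t > 0" using pos_mass[OF pos] pos pos_mass[of v l] pos_mass[of v r] by (simp_all del: mass_simps)
  consider "k = 0" | "k = 1" | "k \<ge> 2" by linarith
  then show ?case
  proof cases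
    case 1
    then show ?thesis by simp
  next
    case 2
    then show ?thesis using ecost_1[OF pos Nd.prems(2)] near_steps[OF Nd.prems] by simp
  next
    case 3
    have fb: "finite (set_pmf ?B)" using sp by (intro finite_binomial) auto
    have "E ?B (\<lambda>x. ecost v l x) \<le> E ?B (\<lambda>x. 3 + 6 * gp v l (real x * (real x - 1) / (mass v l)\<^sup>2))"
    proof (rule E_mono[OF fb])
      fix x
      have "ecost v l x \<le> 1 + 2 * min 1 (real x) + 6 * gp v l (real x * (real x - 1) / (mass v l)\<^sup>2)"
        using Nd c by auto
      then show "ecost v l x \<le> 3 + 6 * gp v l (real x * (real x - 1) / (mass v l)\<^sup>2)" by (simp add: min_def split: if_splits)
    qed
    also have "\<dots> \<le> 3 + 6 * gp v l (E ?B (\<lambda>x. real x * (real x - 1) / (mass v l)\<^sup>2))"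
      using gp_jensen[OF fb, of v l "\<lambda>x. real x * (real x - 1) / (mass v l)\<^sup>2"] fb by (simp add: E_add)
    also have "E ?B (\<lambda>x. real x * (real x - 1) / (mass v l)\<^sup>2) = real k * (real k - 1) / (mass v ?t)\<^sup>2"
      using binomial_mean2[OF sp(1,2), of k] M by (simp add: power_divide del: mass_simps)
    finally have 1: "E ?B (\<lambda>x. ecost v l x) \<le> 3 + 6 * gp v l (real k * (real k - 1) / (mass v ?t)\<^sup>2)" .
    have "E ?B (\<lambda>x. ecost v r (k - x)) \<le>
      E ?B (\<lambda>x. 3 + 6 * gp v r (real (k - x) * (real (k - x) - 1) / (mass v r)\<^sup>2))"
    proof (rule E_mono[OF fb])
      fix x
      have "ecost v r (k - x) \<le> 1 + 2 * min 1 (real (k - x)) + 6 * gp v r (real (k - x) * (real (k - x) - 1) / (mass v r)\<^sup>2)"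
        using Nd c by auto
      then show "ecost v r (k - x) \<le> 3 + 6 * gp v r (real (k - x) * (real (k - x) - 1) / (mass v r)\<^sup>2)"
        by (simp add: min_def split: if_splits)
    qed
    also have "\<dots> \<le> 3 + 6 * gp v r (E ?B (\<lambda>x. real (k - x) * (real (k - x) - 1) / (mass v r)\<^sup>2))"
      using gp_jensen[OF fb, of v r "\<lambda>x. real (k - x) * (real (k - x) - 1) / (mass v r)\<^sup>2"] fb by (simp add: E_add)
    also have "E ?B (\<lambda>x. real (k - x) * (real (k - x) - 1) / (mass v r)\<^sup>2) = real k * (real k - 1) / (mass v ?t)\<^sup>2"
      using binomial_mean_rev(2)[OF sp(1,2), of k] M unfolding sp(3) by (simp add: power_divide del: mass_simps)
    finally have 2: "E ?B (\<lambda>x. ecost v r (k - x)) \<le> 3 + 6 * gp v r (real k * (real k - 1) / (mass v ?t)\<^sup>2)" .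
    have "2 * (2 - 1) \<le> real k * (real k - 1)" using 3 by (intro mult_mono) auto
    then have "min 1 (real k * (real k - 1) / (mass v ?t)\<^sup>2 * (mass v ?t)\<^sup>2) = 1"
      using M by (simp add: min_def del: mass_simps)
    then have "gp v ?t (real k * (real k - 1) / (mass v ?t)\<^sup>2) = 1 + gp v l (real k * (real k - 1) / (mass v ?t)\<^sup>2)
      + gp v r (real k * (real k - 1) / (mass v ?t)\<^sup>2)"
      by (simp only: gp.simps)
    then show ?thesis using 1 2 3 unfolding ecost_Nd[OF pos Nd.prems(2) 3] by (simp add: min_def)
  qed
qed

text \<open>
  The leaves of a top tree are the trees of the groups; \<open>flat\<close> forgets this structure.
\<close>

datatype ttree = G tree | N nat ttree ttree

primrec flat :: "ttree \<Rightarrow> tree" where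
  "flat (G g) = g"
| "flat (N i l r) = Nd i (flat l) (flat r)"

primrec groups :: "ttree \<Rightarrow> tree list" where
  "groups (G g) = [g]"
| "groups (N i l r) = groups l @ groups r"

primrec tdepth :: "ttree \<Rightarrow> nat" where
  "tdepth (G g) = 0"
| "tdepth (N i l r) = Suc (max (tdepth l) (tdepth r))"

primrec tpot :: "(nat \<Rightarrow> real) \<Rightarrow> ttree \<Rightarrow> real \<Rightarrow> real" where
  "tpot v (G g) \<kappa> = min 1 (\<kappa> * mass v g)"
| "tpot v (N i l r) \<kappa> = min 1 (\<kappa> * mass v (flat (N i l r))) + tpot v l \<kappa> + tpot v r \<kappa>"

primrec gsum :: "(nat \<Rightarrow> real) \<Rightarrow> ttree \<Rightarrow> real \<Rightarrow> real" where
  "gsum v (G g) \<kappa> = gp v g \<kappa>"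
| "gsum v (N i l r) \<kappa> = gsum v l \<kappa> + gsum v r \<kappa>"

lemma tpot_jensen: "finite (set_pmf p) \<Longrightarrow> E p (\<lambda>x. tpot v t (f x)) \<le> tpot v t (E p f)"
proof (induction t)
  case (G g)
  then show ?case using E_min[of p f "mass v g"] by (simp only: tpot.simps)
next
  case (N i l r)
  have "E p (\<lambda>x. tpot v (N i l r) (f x)) = E p (\<lambda>x. min 1 (f x * mass v (flat (N i l r))))
      + E p (\<lambda>x. tpot v l (f x)) + E p (\<lambda>x. tpot v r (f x))"
    unfolding tpot.simps using N.prems by (simp add: E_add del: mass_simps flat.simps)
  then show ?case unfolding tpot.simps
    using E_min[OF N.prems, of f "mass v (flat (N i l r))"] N.IH(1)[OF N.prems] N.IH(2)[OF N.prems] by linarith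
qed

lemma gsum_jensen: "finite (set_pmf p) \<Longrightarrow> E p (\<lambda>x. gsum v t (f x)) \<le> gsum v t (E p f)"
proof (induction t)
  case (G g)
  then show ?case using gp_jensen by simp
next
  case (N i l r)
  then show ?case using N by (simp add: E_add add_mono)
qed

lemma gsum_0 [simp]: "gsum v t 0 = 0" by (induction t) auto
lemma gsum_mono: "\<kappa> \<le> \<kappa>' \<Longrightarrow> gsum v t \<kappa> \<le> gsum v t \<kappa>'" by (induction t) (auto simp: gp_mono add_mono)

lemma scale_min:
  fixes p x :: real
  assumes "0 \<le> p" "p \<le> 1"
  shows "p * min 1 x \<le> min 1 (p * x)"
proof -
  have "p * min 1 x \<le> p * 1" "p * min 1 x \<le> p * x" by (rule mult_left_mono; use assms in simp)+
  then show ?thesis using assms by simp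
qed

text \<open>A concave function f with f(0) = 0 satisfies p f(x) \<le> f(p x). This serves for the
  lone sample, which reaches a given child with probability \<open>p\<close>.\<close>

lemma tpot_scale:
  assumes "0 \<le> p" "p \<le> 1"
  shows "p * tpot v t \<kappa> \<le> tpot v t (p * \<kappa>)"
proof (induction t)
  case (G g)
  then show ?case using scale_min[OF assms, of "\<kappa> * mass v g"] by (simp only: tpot.simps mult.assoc)
next
  case (N i l r)
  then show ?case using scale_min[OF assms, of "\<kappa> * mass v (flat (N i l r))"]
    unfolding tpot.simps distrib_left mult.assoc by linarith
qed

lemma tpot_nonneg: "\<kappa> \<ge> 0 \<Longrightarrow> pos_on v (flat t) \<Longrightarrow> tpot v t \<kappa> \<ge> 0"
proof (induction t)
  case (G g)
  then show ?case using pos_mass[of v g] by simp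
next
  case (N i l r)
  then show ?case using pos_mass[of v "flat (N i l r)"] by (simp del: mass_simps)
qed

text \<open>Nodes of the top tree are paid by \<open>tpot\<close>, whose parameter
  \<open>k / mass\<close> is kept in the mean by binomial splitting, and nodes inside the groups by
  \<open>gsum\<close>, as in \<open>ecost_near\<close>.\<close>

lemma ecost_flat:
  assumes "pos_on v (flat t)" "contig (flat t)" "\<And>g. g \<in> set (groups t) \<Longrightarrow> \<exists>\<beta>. near v \<beta> g"
  shows "ecost v (flat t) k \<le> 1 + 2 * tpot v t (k / mass v (flat t))
    + 6 * gsum v t (real k * (real k - 1) / (mass v (flat t))\<^sup>2)"
  using assms
proof (induction t arbitrary: k)
  case (G g)
  then obtain \<beta> where "near v \<beta> g" by auto
  then show ?case using ecost_near[of v \<beta> g k] G pos_mass[of v g] by simp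
next
  case (N i l r)
  let ?t = "Nd i (flat l) (flat r)"
  let ?p = "mass v (flat l) / mass v ?t" and ?q = "mass v (flat r) / mass v ?t"
  have pos: "pos_on v ?t" and con: "contig ?t" using N.prems by auto
  note sp = split_prob[OF pos] and c = contig_Nd[OF con]
  have M: "mass v (flat l) > 0" "mass v (flat r) > 0" "mass v ?t > 0"
    using pos_mass[OF pos] pos pos_mass[of v "flat l"] pos_mass[of v "flat r"] by (simp_all del: mass_simps)
  have IHl: "ecost v (flat l) x \<le> 1 + 2 * tpot v l (x / mass v (flat l))
      + 6 * gsum v l (real x * (real x - 1) / (mass v (flat l))\<^sup>2)" for x
    using N c by auto
  have IHr: "ecost v (flat r) x \<le> 1 + 2 * tpot v r (x / mass v (flat r))
      + 6 * gsum v r (real x * (real x - 1) / (mass v (flat r))\<^sup>2)" for x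
    using N c by auto
  have tp: "tpot v (N i l r) (k / mass v ?t) = 1 + tpot v l (k / mass v ?t) + tpot v r (k / mass v ?t)" if "k \<ge> 1" for k :: nat
    using M(3) that by (simp add: min_def del: mass_simps)
  consider "k = 0" | "k = 1" | "k \<ge> 2" by linarith
  then show ?case
  proof cases
    case 1
    then show ?thesis using tpot_nonneg[of 0 v "N i l r"] pos by (simp del: tpot.simps)
  next
    case 2
    have pl: "pos_on v (flat l)" "pos_on v (flat r)" using pos by auto
    \<comment> \<open>For one sample \<open>k * (k - 1)\<close> is 0 and \<open>gsum\<close>
      vanishes, so the induction hypothesis bounds \<open>steps\<close> by \<open>tpot\<close>
      alone.\<close>
    have s: "steps v (flat l) \<le> 2 * tpot v l (1 / mass v (flat l))" "steps v (flat r) \<le> 2 * tpot v r (1 / mass v (flat r))"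
      using IHl[of 1] IHr[of 1] ecost_1[OF pl(1) c(1)] ecost_1[OF pl(2) c(2)] by simp_all
    have q: "0 \<le> ?q" "?q \<le> 1" using sp by linarith+
    have "?p * steps v (flat l) \<le> ?p * (2 * tpot v l (1 / mass v (flat l)))"
      using s sp by (intro mult_left_mono) auto
    also have "\<dots> \<le> 2 * tpot v l (?p * (1 / mass v (flat l)))"
      using tpot_scale[OF sp(1,2), of v l "1 / mass v (flat l)"] by (simp only: mult.left_commute[of _ 2], (linarith)?)
    also have "?p * (1 / mass v (flat l)) = 1 / mass v ?t" using M(1) by (simp del: mass_simps)
    finally have 1: "?p * steps v (flat l) \<le> 2 * tpot v l (1 / mass v ?t)" .
    have "?q * steps v (flat r) \<le> ?q * (2 * tpot v r (1 / mass v (flat r)))"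
      using s q by (intro mult_left_mono) auto
    also have "\<dots> \<le> 2 * tpot v r (?q * (1 / mass v (flat r)))"
      using tpot_scale[OF q, of v r "1 / mass v (flat r)"] by (simp only: mult.left_commute[of _ 2], (linarith)?)
    also have "?q * (1 / mass v (flat r)) = 1 / mass v ?t" using M(2) by (simp del: mass_simps)
    finally have 2: "?q * steps v (flat r) \<le> 2 * tpot v r (1 / mass v ?t)" .
    have "ecost v ?t k = 1 + steps v ?t" unfolding \<open>k = 1\<close> by (rule ecost_1[OF pos con])
    also have "\<dots> \<le> 1 + (1 + (?p * steps v (flat l) + ?q * steps v (flat r)))"
      by (intro add_left_mono steps_le pos con)
    also have "\<dots> \<le> 1 + (1 + (2 * tpot v l (1 / mass v ?t) + 2 * tpot v r (1 / mass v ?t)))"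
      by (intro add_left_mono add_mono 1 2)
    finally have "ecost v ?t k \<le> 2 + (2 * tpot v l (1 / mass v ?t) + 2 * tpot v r (1 / mass v ?t))" by linarith
    then show ?thesis using tp[of 1] \<open>k = 1\<close> by (simp del: tpot.simps mass_simps sampler.simps)
  next
    case 3
    let ?B = "binomial_pmf k ?p"
    let ?kk = "real k * (real k - 1) / (mass v ?t)\<^sup>2"
    have fb: "finite (set_pmf ?B)" using sp by (intro finite_binomial) auto
    have "E ?B (\<lambda>x. ecost v (flat l) x) \<le> E ?B (\<lambda>x. 1 + 2 * tpot v l (x / mass v (flat l))
      + 6 * gsum v l (real x * (real x - 1) / (mass v (flat l))\<^sup>2))"
      by (intro E_mono fb IHl)
    also have "\<dots> \<le> 1 + 2 * tpot v l (E ?B (\<lambda>x. real x / mass v (flat l)))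
      + 6 * gsum v l (E ?B (\<lambda>x. real x * (real x - 1) / (mass v (flat l))\<^sup>2))"
      using gsum_jensen[OF fb, of v l "\<lambda>x. real x * (real x - 1) / (mass v (flat l))\<^sup>2"]
        tpot_jensen[OF fb, of v l "\<lambda>x. real x / mass v (flat l)"] fb by (simp add: E_add)
    also have "E ?B (\<lambda>x. real x * (real x - 1) / (mass v (flat l))\<^sup>2) = ?kk"
      using binomial_mean2[OF sp(1,2), of k] M by (simp add: power_divide del: mass_simps)
    also have "E ?B (\<lambda>x. real x / mass v (flat l)) = k / mass v ?t"
      using binomial_mean[OF sp(1,2), of k] M by (simp del: mass_simps)
    finally have 1: "E ?B (\<lambda>x. ecost v (flat l) x) \<le> 1 + 2 * tpot v l (k / mass v ?t) + 6 * gsum v l ?kk" .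
    have "E ?B (\<lambda>x. ecost v (flat r) (k - x)) \<le> E ?B (\<lambda>x. 1 + 2 * tpot v r (real (k - x) / mass v (flat r))
      + 6 * gsum v r (real (k - x) * (real (k - x) - 1) / (mass v (flat r))\<^sup>2))"
      by (intro E_mono fb IHr)
    also have "\<dots> \<le> 1 + 2 * tpot v r (E ?B (\<lambda>x. real (k - x) / mass v (flat r)))
      + 6 * gsum v r (E ?B (\<lambda>x. real (k - x) * (real (k - x) - 1) / (mass v (flat r))\<^sup>2))"
      using gsum_jensen[OF fb, of v r "\<lambda>x. real (k - x) * (real (k - x) - 1) / (mass v (flat r))\<^sup>2"]
        tpot_jensen[OF fb, of v r "\<lambda>x. real (k - x) / mass v (flat r)"] fb by (simp add: E_add)
    also have "E ?B (\<lambda>x. real (k - x) * (real (k - x) - 1) / (mass v (flat r))\<^sup>2) = ?kk"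
      using binomial_mean_rev(2)[OF sp(1,2), of k] M unfolding sp(3) by (simp add: power_divide del: mass_simps)
    also have "E ?B (\<lambda>x. real (k - x) / mass v (flat r)) = k / mass v ?t"
      using binomial_mean_rev(1)[OF sp(1,2), of k] M unfolding sp(3) by (simp del: mass_simps)
    finally have 2: "E ?B (\<lambda>x. ecost v (flat r) (k - x)) \<le> 1 + 2 * tpot v r (k / mass v ?t) + 6 * gsum v r ?kk" .
    have "ecost v ?t k \<le> 3 + 2 * (tpot v l (k / mass v ?t) + tpot v r (k / mass v ?t)) + 6 * (gsum v l ?kk + gsum v r ?kk)"
    proof -
      have "1 + (a + b) \<le> 3 + 2 * (x + x') + 6 * (y + y')"
        if "a \<le> 1 + 2 * x + 6 * y" "b \<le> 1 + 2 * x' + 6 * y'" for a b x x' y y' :: real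
        using that unfolding distrib_left by linarith
      from this[OF 1 2] show ?thesis unfolding ecost_Nd[OF pos con 3] .
    qed
    then show ?thesis using tp[of k] 3 by (simp del: tpot.simps mass_simps sampler.simps)
  qed
qed

text \<open>An inner node that enters at level \<open>Suc h\<close> has more than
  \<open>2 ^ h\<close> leaves; together with \<open>lev_cnt\<close> this fixes its size up to a
  factor of 2, as is needed for charging it to its leaves. The last rule lets a tree skip levels,
  since the construction makes no node for an empty right half.\<close>

inductive lev :: "nat \<Rightarrow> tree \<Rightarrow> bool" where
  "lev h (Lf j)"
| "lev h l \<Longrightarrow> lev h r \<Longrightarrow> 2 ^ h < cnt l + cnt r \<Longrightarrow> lev (Suc h) (Nd i l r)"
| "lev h t \<Longrightarrow> lev (Suc h) t"

lemma lev_cnt: "lev h t \<Longrightarrow> cnt t \<le> 2 ^ h" by (induction rule: lev.induct) auto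
lemma lev_depth: "lev h t \<Longrightarrow> depth t \<le> h" by (induction rule: lev.induct) auto

text \<open>The charge per leaf for \<eta> = \<kappa> * \<beta>: an inner node on level i + 1 has
  more than \<open>2 ^ i\<close> leaves, which share its term, and its mass is at most
  \<open>2 ^ (i + 1)\<close> times \<beta>.\<close>

definition Gs :: "nat \<Rightarrow> real \<Rightarrow> real" where "Gs h \<eta> = (\<Sum>i<h. min 1 ((2 ^ (i + 1) * \<eta>)\<^sup>2) / 2 ^ i)"

lemma Gs_shift: "Gs (Suc h) \<eta> = min 1 ((2 * \<eta>)\<^sup>2) + Gs h (2 * \<eta>) / 2"
  unfolding Gs_def sum.lessThan_Suc_shift sum_divide_distrib by (simp add: mult.assoc mult.commute)

text \<open>
  The right-hand side is chosen so that the recursion in \<open>Gs_shift\<close> preserves it.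
\<close>

lemma Gs_le: "\<eta> \<ge> 0 \<Longrightarrow> Gs h \<eta> \<le> (if \<eta> \<le> 1 / 2 then 6 * \<eta> - 4 * \<eta>\<^sup>2 else 2)"
proof (induction h arbitrary: \<eta>)
  case 0
  have "4 * \<eta>\<^sup>2 \<le> 6 * \<eta>" if "\<eta> \<le> 1 / 2"
    using that 0 mult_mono[of \<eta> "1 / 2" \<eta> \<eta>] by (simp add: power2_eq_square)
  then show ?case by (simp add: Gs_def)
next
  case (Suc h)
  have IH: "Gs h (2 * \<eta>) \<le> (if 2 * \<eta> \<le> 1 / 2 then 6 * (2 * \<eta>) - 4 * (2 * \<eta>)\<^sup>2 else 2)"
    using Suc.prems by (intro Suc.IH) auto
  consider "\<eta> \<le> 1 / 4" | "1 / 4 < \<eta>" "\<eta> \<le> 1 / 2" | "1 / 2 < \<eta>" by linarith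
  then show ?case
  proof cases
    case 1
    have "min 1 ((2 * \<eta>)\<^sup>2) \<le> 4 * \<eta>\<^sup>2" by (simp add: power2_eq_square)
    then show ?thesis unfolding Gs_shift using IH 1 by (simp add: power_mult_distrib)
  next
    case 2
    \<comment> \<open>Doubling \<eta> leads to the constant branch here, and the claim becomes
      \<open>8 * \<eta>\<^sup>2 + 1 \<le> 6 * \<eta>\<close>. The ends 1 / 4 and 1 / 2 of the
      interval are the roots of this quadratic.\<close>
    have "(\<eta> - 1 / 4) * (\<eta> - 1 / 2) \<le> 0" using 2 by (intro mult_nonneg_nonpos) auto
    then have "8 * \<eta>\<^sup>2 + 1 \<le> 6 * \<eta>" by (simp add: power2_eq_square algebra_simps)
    moreover have "min 1 ((2 * \<eta>)\<^sup>2) \<le> 4 * \<eta>\<^sup>2" by (simp add: power2_eq_square)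
    ultimately show ?thesis unfolding Gs_shift using IH 2 by simp
  next
    case 3
    then show ?thesis unfolding Gs_shift using IH by simp
  qed
qed

lemma Gs_le': "\<eta> \<ge> 0 \<Longrightarrow> Gs h \<eta> \<le> 6 * min 1 \<eta>"
proof -
  assume h: "\<eta> \<ge> 0"
  have sq: "0 \<le> \<eta>\<^sup>2" by simp
  show ?thesis
  proof (cases "\<eta> \<le> 1 / 2")
    case True
    then have "Gs h \<eta> \<le> 6 * \<eta> - 4 * \<eta>\<^sup>2" using Gs_le[OF h, of h] by (simp only: if_True)
    then have "Gs h \<eta> \<le> 6 * \<eta>" using sq by linarith
    then show ?thesis using True by simp
  next
    case False
    then have "Gs h \<eta> \<le> 2" using Gs_le[OF h, of h] by (simp only: if_False)
    moreover have "1 / 2 \<le> min 1 \<eta>" using False by simp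
    ultimately show ?thesis by linarith
  qed
qed

lemma gp_lev:
  assumes "lev h t" "near v \<beta> t" "\<kappa> \<ge> 0"
  shows "gp v t (\<kappa>\<^sup>2) \<le> cnt t * Gs h (\<kappa> * \<beta>)"
  using assms
proof (induction rule: lev.induct)
  case (1 h j)
  then show ?case by (simp add: Gs_def sum_nonneg)
next
  case (2 h l r i)
  let ?t = "Nd i l r"
  have near: "near v \<beta> ?t" using 2 by simp
  have "\<beta> > 0" using near by (simp add: near_def)
  have c: "cnt ?t \<le> 2 ^ Suc h" using lev_cnt[OF 2(1)] lev_cnt[OF 2(2)] by simp
  have "\<kappa> * mass v ?t \<le> \<kappa> * (\<beta> * cnt ?t)" using near_mass(2)[OF near] 2 by (intro mult_left_mono) auto
  also have "\<dots> \<le> \<kappa> * (\<beta> * 2 ^ Suc h)" using c \<open>\<beta> > 0\<close> 2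
    by (intro mult_left_mono) (auto simp del: cnt_simps simp flip: of_nat_power_le_of_nat_cancel_iff dest: of_nat_mono[where 'a = real])
  finally have "(\<kappa> * mass v ?t)\<^sup>2 \<le> (\<kappa> * (\<beta> * 2 ^ Suc h))\<^sup>2"
    using 2 pos_mass[OF near_pos[OF near]] by (intro power_mono mult_nonneg_nonneg) (auto simp del: mass_simps)
  then have "min 1 (\<kappa>\<^sup>2 * (mass v ?t)\<^sup>2) \<le> min 1 ((2 ^ (h + 1) * (\<kappa> * \<beta>))\<^sup>2)" (is "_ \<le> ?m")
    by (simp add: power_mult_distrib mult_ac del: mass_simps)
  also have "?m \<le> (cnt ?t / 2 ^ h) * ?m"
  proof -
    have "real (2 ^ h) \<le> real (cnt ?t)" using 2(3) by (subst of_nat_le_iff) simp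
    then have "1 \<le> cnt ?t / 2 ^ h" by (simp del: cnt_simps)
    moreover have "0 \<le> ?m" by simp
    ultimately show ?thesis using mult_right_mono[of 1 "cnt ?t / 2 ^ h" ?m] by simp
  qed
  finally have "min 1 (\<kappa>\<^sup>2 * (mass v ?t)\<^sup>2) \<le> (cnt ?t / 2 ^ h) * ?m" .
  then have "gp v ?t (\<kappa>\<^sup>2) \<le> cnt ?t * (?m / 2 ^ h) + cnt l * Gs h (\<kappa> * \<beta>) + cnt r * Gs h (\<kappa> * \<beta>)"
    using 2 unfolding gp.simps by (simp del: mass_simps cnt_simps)
  also have "\<dots> = cnt ?t * Gs (Suc h) (\<kappa> * \<beta>)"
    by (simp add: Gs_def algebra_simps)
  finally show ?case .
next
  case (3 h t)
  have "Gs h (\<kappa> * \<beta>) \<le> Gs (Suc h) (\<kappa> * \<beta>)" by (simp add: Gs_def)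
  then have "cnt t * Gs h (\<kappa> * \<beta>) \<le> cnt t * Gs (Suc h) (\<kappa> * \<beta>)" by (intro mult_left_mono) auto
  then show ?case using 3(2)[OF 3(3,4)] by linarith
qed

definition hits :: "(nat \<Rightarrow> real) \<Rightarrow> real \<Rightarrow> tree \<Rightarrow> real" where
  "hits v \<kappa> t = sum_list (map (\<lambda>j. min 1 (\<kappa> * v j)) (lvs t))"

lemma min_half:
  fixes x y :: real
  assumes "x \<le> 2 * y" "0 \<le> y"
  shows "min 1 x \<le> 2 * min 1 y"
  using assms by (auto simp: min_def)

lemma near_hits:
  fixes \<kappa> \<beta> :: real
  assumes "near v \<beta> t" "\<kappa> \<ge> 0"
  shows "real (cnt t) * min 1 (\<kappa> * \<beta>) \<le> 2 * hits v \<kappa> t"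
proof -
  have "sum_list (map (\<lambda>j. min 1 (\<kappa> * \<beta>)) (lvs t)) \<le> sum_list (map (\<lambda>j. 2 * min 1 (\<kappa> * v j)) (lvs t))"
  proof (rule sum_list_mono)
    fix j assume j: "j \<in> set (lvs t)"
    then have "\<kappa> * \<beta> \<le> \<kappa> * (2 * v j)" using assms by (intro mult_left_mono) (auto simp: near_def)
    then show "min 1 (\<kappa> * \<beta>) \<le> 2 * min 1 (\<kappa> * v j)"
      using assms near_pos[OF assms(1)] j by (intro min_half) (auto simp: pos_on_def intro: less_imp_le)
  qed
  then show ?thesis by (simp add: hits_def sum_list_triv cnt_def sum_list_const_mult)
qed

lemma hits_nonneg: "\<kappa> \<ge> 0 \<Longrightarrow> pos_on v t \<Longrightarrow> hits v \<kappa> t \<ge> 0"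
  unfolding hits_def pos_on_def by (intro sum_list_nonneg) (auto intro: less_imp_le)

text \<open>The factor 12 is 6 from \<open>Gs_le'\<close> times 2 from \<open>near_hits\<close>,
  where weights are compared with the upper end of their class.\<close>

lemma gp_hits:
  assumes "lev h t" "near v \<beta> t" "\<kappa> \<ge> 0"
  shows "gp v t (\<kappa>\<^sup>2) \<le> 12 * hits v \<kappa> t"
proof -
  have b: "\<kappa> * \<beta> \<ge> 0" using assms by (simp add: near_def)
  have "gp v t (\<kappa>\<^sup>2) \<le> cnt t * (6 * min 1 (\<kappa> * \<beta>))"
    using gp_lev[OF assms] Gs_le'[OF b, of h] by (meson mult_left_mono of_nat_0_le_iff order_trans)
  then show ?thesis using near_hits[OF assms(2,3)] by simp
qed

lemma lvs_flat: "lvs (flat t) = concat (map lvs (groups t))" by (induction t) auto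

lemma hits_flat: "hits v \<kappa> (flat t) = sum_list (map (hits v \<kappa>) (groups t))"
  by (induction t) (auto simp: hits_def)

lemma gsum_hits:
  assumes "\<And>g. g \<in> set (groups t) \<Longrightarrow> \<exists>h \<beta>. lev h g \<and> near v \<beta> g" "\<kappa> \<ge> 0"
  shows "gsum v t (\<kappa>\<^sup>2) \<le> 12 * hits v \<kappa> (flat t)"
  using assms(1)
proof (induction t)
  case (G g)
  then show ?case using gp_hits[OF _ _ assms(2)] by auto
next
  case (N i l r)
  have "gsum v l (\<kappa>\<^sup>2) \<le> 12 * hits v \<kappa> (flat l)" "gsum v r (\<kappa>\<^sup>2) \<le> 12 * hits v \<kappa> (flat r)"
    using N by auto
  then show ?case by (simp add: hits_def)
qed

section \<open>The potential of the top tree\<close>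

lemma tpot_le_groups: "tpot v t \<kappa> + 1 \<le> 2 * length (groups t)"
  by (induction t) auto

text \<open>On each of the \<open>tdepth t + 1\<close> levels the nodes have disjoint sets of
  leaves, so their masses sum to at most the mass of the tree.\<close>

lemma tpot_le_mass:
  assumes "pos_on v (flat t)" "\<kappa> \<ge> 0"
  shows "tpot v t \<kappa> \<le> (tdepth t + 1) * (\<kappa> * mass v (flat t))"
  using assms
proof (induction t)
  case (G g)
  then show ?case by simp
next
  case (N i l r)
  let ?d = "real (max (tdepth l) (tdepth r)) + 1"
  have m: "0 \<le> \<kappa> * mass v (flat l)" "0 \<le> \<kappa> * mass v (flat r)"
    using N.prems pos_mass[of v "flat l"] pos_mass[of v "flat r"] by auto
  have "tpot v l \<kappa> \<le> (tdepth l + 1) * (\<kappa> * mass v (flat l))" using N by auto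
  also have "\<dots> \<le> ?d * (\<kappa> * mass v (flat l))" using m by (intro mult_right_mono) auto
  finally have 1: "tpot v l \<kappa> \<le> ?d * (\<kappa> * mass v (flat l))" .
  have "tpot v r \<kappa> \<le> (tdepth r + 1) * (\<kappa> * mass v (flat r))" using N by auto
  also have "\<dots> \<le> ?d * (\<kappa> * mass v (flat r))" using m by (intro mult_right_mono) auto
  finally have "tpot v r \<kappa> \<le> ?d * (\<kappa> * mass v (flat r))" .
  moreover have "min 1 (\<kappa> * mass v (flat (N i l r))) \<le> \<kappa> * mass v (flat l) + \<kappa> * mass v (flat r)"
    by (simp add: algebra_simps)
  ultimately have "tpot v (N i l r) \<kappa> \<le> (?d + 1) * (\<kappa> * mass v (flat l)) + (?d + 1) * (\<kappa> * mass v (flat r))"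
    using 1 unfolding tpot.simps by (simp only: distrib_right, (linarith)?)
  then show ?case by (simp add: algebra_simps)
qed

lemma mass_flat: "mass v (flat t) = sum_list (map (mass v) (groups t))"
  by (induction t) auto

text \<open>The groups with property \<open>L\<close> form a prefix. At each node either the left
  subtree lies in the prefix, and its mass pays for it level by level, or the right subtree lies
  outside, and it has fewer than twice as many nodes as groups. So only one child is left for the
  induction: the boundary of the prefix is followed along a single path, whose nodes cost at most 1
  each, and the depth enters only once as a factor.\<close>

lemma tpot_mixed:
  assumes "pos_on v (flat t)" "\<kappa> \<ge> 0" "sorted_wrt (\<lambda>g g'. L g' \<longrightarrow> L g) (groups t)"
  shows "tpot v t \<kappa> \<le> 2 * length (filter (\<lambda>g. \<not> L g) (groups t))
    + (tdepth t + 1) * (1 + \<kappa> * sum_list (map (mass v) (filter L (groups t))))"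
  using assms
proof (induction t)
  case (G g)
  then show ?case using pos_mass[of v g] by (auto simp: min_def)
next
  case (N i l r)
  let ?lm = "\<lambda>t. \<kappa> * sum_list (map (mass v) (filter L (groups t)))"
  let ?nl = "\<lambda>t. length (filter (\<lambda>g. \<not> L g) (groups t))"
  let ?d = "real (max (tdepth l) (tdepth r)) + 1"
  have p: "pos_on v (flat l)" "pos_on v (flat r)" using N.prems by auto
  have pg: "pos_on v (flat t) \<Longrightarrow> g \<in> set (groups t) \<Longrightarrow> mass v g > 0" for t g
    using pos_mass[of v g] unfolding pos_on_def lvs_flat by auto
  have lm: "0 \<le> ?lm l" "0 \<le> ?lm r"
  proof -
    have "0 \<le> sum_list (map (mass v) (filter L (groups t)))" if "pos_on v (flat t)" for t
      by (rule sum_list_nonneg) (use pg[OF that] in \<open>auto dest: less_imp_le\<close>)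
    then show "0 \<le> ?lm l" "0 \<le> ?lm r" using N.prems(2) p by simp_all
  qed
  have s: "sorted_wrt (\<lambda>g g'. L g' \<longrightarrow> L g) (groups l)" "sorted_wrt (\<lambda>g g'. L g' \<longrightarrow> L g) (groups r)"
    "\<And>g g'. g \<in> set (groups l) \<Longrightarrow> g' \<in> set (groups r) \<Longrightarrow> L g' \<Longrightarrow> L g"
    using N.prems(3) by (auto simp: sorted_wrt_append)
  have IHl: "tpot v l \<kappa> \<le> 2 * ?nl l + (tdepth l + 1) * (1 + ?lm l)" using N p s by auto
  have IHr: "tpot v r \<kappa> \<le> 2 * ?nl r + (tdepth r + 1) * (1 + ?lm r)" using N p s by auto
  have one: "min 1 (\<kappa> * mass v (flat (N i l r))) \<le> 1" by simp
  have goal: "tpot v (N i l r) \<kappa> \<le> 2 * (?nl l + ?nl r) + (?d + 1) * (1 + (?lm l + ?lm r))"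
  proof (cases "\<forall>g\<in>set (groups l). L g")
    case True
    then have "filter L (groups l) = groups l" by simp
    then have "tpot v l \<kappa> \<le> (tdepth l + 1) * ?lm l" using tpot_le_mass[OF p(1) N.prems(2)] by (simp add: mass_flat)
    also have "\<dots> \<le> (?d + 1) * ?lm l" using lm by (intro mult_right_mono) auto
    finally have 1: "tpot v l \<kappa> \<le> (?d + 1) * ?lm l" .
    have "(tdepth r + 1) * (1 + ?lm r) \<le> ?d * (1 + ?lm r)" using lm by (intro mult_right_mono) auto
    then have "tpot v r \<kappa> \<le> 2 * ?nl r + ?d * (1 + ?lm r)" using IHr by linarith
    then show ?thesis using 1 one lm unfolding tpot.simps by (simp only: distrib_left distrib_right of_nat_add, (linarith)?)
  next
    case False
    then have nr: "\<forall>g\<in>set (groups r). \<not> L g" using s(3) by blast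
    then have "filter (\<lambda>g. \<not> L g) (groups r) = groups r" "filter L (groups r) = []" by simp_all
    then have "tpot v r \<kappa> \<le> 2 * ?nl r" "?lm r = 0" using tpot_le_groups[of v r \<kappa>] by simp_all
    moreover have "(tdepth l + 1) * (1 + ?lm l) \<le> ?d * (1 + ?lm l)" using lm by (intro mult_right_mono) auto
    then have "tpot v l \<kappa> \<le> 2 * ?nl l + ?d * (1 + ?lm l)" using IHl by linarith
    ultimately show ?thesis using one lm unfolding tpot.simps by (simp only: distrib_left distrib_right of_nat_add, (linarith)?)
  qed
  then show ?case by (simp add: algebra_simps del: tpot.simps)
qed

text \<open>Entries of at least 1 are counted by the sum. The others lie between
  \<open>(1 / 2) ^ L\<close> and 1 and at least double from one to the next, so there are at most
  \<open>L\<close> of them.\<close>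

lemma doubling_length:
  fixes xs :: "real list"
  assumes "sorted_wrt (\<lambda>x y. 2 * x \<le> y) xs" "\<And>x. x \<in> set xs \<Longrightarrow> (1 / 2) ^ L \<le> (x :: real)"
  shows "length xs \<le> sum_list (map (min 1) xs) + L"
  using assms
proof (induction xs arbitrary: L)
  case (Cons x xs)
  show ?case
  proof (cases "x \<ge> 1")
    case True
    have "length xs \<le> sum_list (map (min 1) xs) + 0"
    proof (rule order_trans[OF Cons.IH[of 0]])
      fix y assume "y \<in> set xs"
      then have "2 * x \<le> y" using Cons.prems by auto
      then show "(1 / 2) ^ 0 \<le> y" using True by simp
    qed (use Cons.prems in auto)
    then show ?thesis using True by simp
  next
    case False
    then obtain L' where L: "L = Suc L'" using Cons.prems(2)[of x] by (cases L) auto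
    have "length xs \<le> sum_list (map (min 1) xs) + L'"
    proof (rule Cons.IH)
      fix y assume "y \<in> set xs"
      then have "2 * x \<le> y" using Cons.prems by auto
      then show "(1 / 2) ^ L' \<le> y" using Cons.prems(2)[of x] by (simp add: L)
    qed (use Cons.prems in auto)
    moreover have "(1 / 2) ^ L \<le> x" "(0::real) < (1 / 2) ^ L" using Cons.prems(2)[of x] by simp_all
    then have "x > 0" by linarith
    ultimately show ?thesis by (simp add: L)
  qed
qed simp

lemma sum_list_filter_le:
  fixes f :: "'a \<Rightarrow> real"
  assumes "\<And>x. x \<in> set xs \<Longrightarrow> 0 \<le> f x"
  shows "sum_list (map f (filter P xs)) \<le> sum_list (map f xs)"
  using assms by (induction xs) (auto intro: add_increasing)

text \<open>The constant 80 is 2 * 4 from \<open>tpot\<close> plus 6 * 12 from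
  \<open>gsum\<close>.\<close>

theorem ecost_bound:
  assumes "contig (flat t)" "\<And>g. g \<in> set (groups t) \<Longrightarrow> near v (\<beta> g) g \<and> (\<exists>h. lev h g)"
    and "sorted_wrt (\<lambda>g g'. 2 * \<beta> g \<le> \<beta> g') (groups t)" "cnt (flat t) \<le> 2 ^ L"
  shows "ecost v (flat t) k \<le> 1 + 80 * hits v (k / mass v (flat t)) (flat t) + 4 * L + 4 * (tdepth t + 1)"
proof -
  define \<kappa> where "\<kappa> = k / mass v (flat t)"
  have pos: "pos_on v (flat t)"
    using assms(2) near_pos unfolding pos_on_def lvs_flat by fastforce
  have M: "mass v (flat t) > 0" using pos pos_mass by blast
  then have \<kappa>: "\<kappa> \<ge> 0" by (simp add: \<kappa>_def)
  have b: "\<beta> g > 0" if "g \<in> set (groups t)" for g using assms(2)[OF that] by (simp add: near_def)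
  \<comment> \<open>The threshold serves both sides: groups below it have at most
    \<open>2 ^ L\<close> leaves altogether, so \<kappa> times their total mass is at most 1, and for
    the others it is the lower bound that \<open>doubling_length\<close> asks for.\<close>
  define li where "li g \<longleftrightarrow> \<kappa> * \<beta> g < (1 / 2) ^ L" for g
  let ?nl = "filter (\<lambda>g. \<not> li g) (groups t)"
  have "sorted_wrt (\<lambda>g g'. li g' \<longrightarrow> li g) (groups t)"
  proof (rule sorted_wrt_mono_rel[OF _ assms(3)])
    fix g g' assume g: "g \<in> set (groups t)" "g' \<in> set (groups t)" "2 * \<beta> g \<le> \<beta> g'"
    have "\<beta> g \<le> \<beta> g'" using g(3) b[OF g(1)] by linarith
    then have "\<kappa> * \<beta> g \<le> \<kappa> * \<beta> g'" using \<kappa> by (intro mult_left_mono) auto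
    then show "li g' \<longrightarrow> li g" by (auto simp: li_def)
  qed
  note mixed = tpot_mixed[OF pos \<kappa> this]
  have light: "\<kappa> * sum_list (map (mass v) (filter li (groups t))) \<le> 1"
  proof -
    have "sum_list (map (\<lambda>g. \<kappa> * mass v g) (filter li (groups t))) \<le> sum_list (map (\<lambda>g. (1 / 2) ^ L * real (cnt g)) (filter li (groups t)))"
    proof (rule sum_list_mono)
      fix g assume g: "g \<in> set (filter li (groups t))"
      have "\<kappa> * mass v g \<le> \<kappa> * (\<beta> g * cnt g)"
        using assms(2)[of g] g near_mass(2)[of v "\<beta> g" g] \<kappa> by (intro mult_left_mono) auto
      also have "\<dots> = (\<kappa> * \<beta> g) * cnt g" by simp
      also have "\<dots> \<le> (1 / 2) ^ L * cnt g" using g by (intro mult_right_mono) (auto simp: li_def)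
      finally show "\<kappa> * mass v g \<le> (1 / 2) ^ L * cnt g" .
    qed
    also have "\<dots> \<le> sum_list (map (\<lambda>g. (1 / 2) ^ L * real (cnt g)) (groups t))"
      by (rule sum_list_filter_le) simp
    also have "\<dots> = (1 / 2) ^ L * real (cnt (flat t))"
    proof -
      have "real (cnt (flat t)) = sum_list (map (\<lambda>g. real (cnt g)) (groups t))" by (induction t) auto
      then show ?thesis by (simp add: sum_list_const_mult)
    qed
    also have "\<dots> \<le> (1 / 2) ^ L * 2 ^ L" using assms(4) by (intro mult_left_mono) (auto simp flip: of_nat_power dest: of_nat_mono[where 'a = real])
    also have "\<dots> = 1" by (simp flip: power_mult_distrib)
    finally show ?thesis by (simp add: sum_list_const_mult)
  qed
  have "length ?nl \<le> sum_list (map (\<lambda>g. min 1 (\<kappa> * \<beta> g)) ?nl) + L"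
  proof -
    have "sorted_wrt (\<lambda>g g'. 2 * (\<kappa> * \<beta> g) \<le> \<kappa> * \<beta> g') (groups t)"
    proof (rule sorted_wrt_mono_rel[OF _ assms(3)])
      fix g g' assume "2 * \<beta> g \<le> \<beta> g'"
      then have "\<kappa> * (2 * \<beta> g) \<le> \<kappa> * \<beta> g'" using \<kappa> by (intro mult_left_mono) auto
      then show "2 * (\<kappa> * \<beta> g) \<le> \<kappa> * \<beta> g'" by simp
    qed
    then have "sorted_wrt (\<lambda>x y. 2 * x \<le> y) (map (\<lambda>g. \<kappa> * \<beta> g) ?nl)"
      by (simp only: sorted_wrt_map sorted_wrt_filter)
    moreover have "(1 / 2) ^ L \<le> x" if "x \<in> set (map (\<lambda>g. \<kappa> * \<beta> g) ?nl)" for x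
      using that unfolding li_def by (auto simp only: set_map set_filter not_less)
    ultimately show ?thesis
      using doubling_length[of "map (\<lambda>g. \<kappa> * \<beta> g) ?nl" L] by (simp only: length_map map_map o_def)
  qed
  also have "sum_list (map (\<lambda>g. min 1 (\<kappa> * \<beta> g)) ?nl) \<le> sum_list (map (\<lambda>g. 2 * hits v \<kappa> g) ?nl)"
  proof (rule sum_list_mono)
    fix g assume "g \<in> set ?nl"
    then have g: "near v (\<beta> g) g" using assms(2) by auto
    have "1 * min 1 (\<kappa> * \<beta> g) \<le> cnt g * min 1 (\<kappa> * \<beta> g)"
    proof (rule mult_right_mono)
      show "1 \<le> real (cnt g)" using cnt_pos[of g] by linarith
      show "0 \<le> min 1 (\<kappa> * \<beta> g)" using g \<kappa> by (simp add: near_def)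
    qed
    then show "min 1 (\<kappa> * \<beta> g) \<le> 2 * hits v \<kappa> g" using near_hits[OF g \<kappa>] by simp
  qed
  also have "\<dots> \<le> sum_list (map (\<lambda>g. 2 * hits v \<kappa> g) (groups t))"
  proof -
    have "0 \<le> hits v \<kappa> g" if "g \<in> set (groups t)" for g
      using assms(2)[OF that] near_pos \<kappa> hits_nonneg by blast
    then show ?thesis by (intro sum_list_filter_le) simp
  qed
  finally have nl: "length ?nl \<le> 2 * hits v \<kappa> (flat t) + L" by (simp add: hits_flat sum_list_const_mult)
  have "(tdepth t + 1) * (1 + \<kappa> * sum_list (map (mass v) (filter li (groups t)))) \<le> real (tdepth t + 1) * 2"
    using light by (intro mult_left_mono) auto
  then have tp: "tpot v t \<kappa> \<le> 4 * hits v \<kappa> (flat t) + 2 * L + 2 * (tdepth t + 1)" using mixed nl by linarith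
  have "real k * (real k - 1) / (mass v (flat t))\<^sup>2 \<le> \<kappa>\<^sup>2"
    unfolding \<kappa>_def power_divide using M by (intro divide_right_mono) (auto simp: power2_eq_square algebra_simps)
  then have gs: "gsum v t (real k * (real k - 1) / (mass v (flat t))\<^sup>2) \<le> 12 * hits v \<kappa> (flat t)"
    using gsum_mono gsum_hits[of t v \<kappa>] assms(2) \<kappa> by (meson order_trans)
  have "ecost v (flat t) k \<le> 1 + 2 * tpot v t \<kappa> + 6 * gsum v t (real k * (real k - 1) / (mass v (flat t))\<^sup>2)"
    unfolding \<kappa>_def using assms(2) by (intro ecost_flat pos assms(1)) auto
  then show ?thesis using tp gs unfolding \<kappa>_def by linarith
qed

section \<open>The expected number of distinct items\<close>

lemma finite_iid: "finite (set_pmf p) \<Longrightarrow> finite (set_pmf (iid k p))"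
  by (induction k) (auto simp: iid_Suc)

lemma E_pmf_single: "finite (set_pmf p) \<Longrightarrow> E p (\<lambda>x. of_bool (x \<noteq> i)) = 1 - pmf p i"
proof -
  assume fin: "finite (set_pmf p)"
  have "E p (\<lambda>x. of_bool (x \<noteq> i)) = E p (\<lambda>x. 1 - indicator {i} x)"
    by (rule E_cong) (auto simp: indicator_def)
  also have "\<dots> = 1 - pmf p i"
    by (simp add: E_diff[OF fin] measure_pmf_single)
  finally show ?thesis .
qed

lemma iid_avoid:
  assumes "finite (set_pmf p)"
  shows "E (iid k p) (\<lambda>S. of_bool (i \<notin># S)) = (1 - pmf p i) ^ k"
proof (induction k)
  case (Suc k)
  have "E (iid (Suc k) p) (\<lambda>S. of_bool (i \<notin># S)) = E p (\<lambda>x. of_bool (x \<noteq> i) * E (iid k p) (\<lambda>S. of_bool (i \<notin># S)))"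
    unfolding iid_Suc
  proof (subst E_bind)
    have "E (map_pmf (add_mset x) (iid k p)) (\<lambda>S. of_bool (i \<notin># S)) =
        of_bool (x \<noteq> i) * E (iid k p) (\<lambda>S. of_bool (i \<notin># S))" for x
      by (cases "x = i") auto
    then show "E p (\<lambda>x. E (map_pmf (add_mset x) (iid k p)) (\<lambda>S. of_bool (i \<notin># S))) =
        E p (\<lambda>x. of_bool (x \<noteq> i) * E (iid k p) (\<lambda>S. of_bool (i \<notin># S)))" by simp
  qed (use finite_iid[OF assms] assms in auto)
  then show ?case unfolding Suc.IH using E_pmf_single[OF assms, of i] by simp
qed simp

text \<open>Follows from \<open>(1 - p) ^ k \<le> exp (- k * p) \<le> 1 / (1 + k * p)\<close> and
  \<open>x / (1 + x) \<ge> min 1 x / 2\<close>.\<close>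

lemma one_minus_power_ge:
  fixes p :: real
  assumes "0 \<le> p" "p \<le> 1"
  shows "min 1 (k * p) \<le> 2 * (1 - (1 - p) ^ k)"
proof -
  let ?x = "real k * p"
  have x: "0 \<le> ?x" using assms by simp
  have "1 - p \<le> exp (- p)" using exp_ge_add_one_self[of "- p"] by simp
  then have "(1 - p) ^ k \<le> exp (- p) ^ k" using assms by (intro power_mono) auto
  also have "\<dots> = 1 / exp ?x" by (simp add: exp_of_nat_mult[symmetric] exp_minus inverse_eq_divide power_one_over)
  also have "\<dots> \<le> 1 / (1 + ?x)" using exp_ge_add_one_self[of ?x] x by (intro divide_left_mono) (auto intro!: mult_pos_pos)
  finally have "1 - 1 / (1 + ?x) \<le> 1 - (1 - p) ^ k" by simp
  moreover have "min 1 ?x \<le> 2 * (1 - 1 / (1 + ?x))"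
  proof -
    have "1 - 1 / (1 + ?x) = ?x / (1 + ?x)" using x by (simp add: field_simps)
    moreover have "min 1 ?x * (1 + ?x) \<le> 2 * ?x"
    proof -
      have "min 1 y * (1 + y) \<le> 2 * y" if "0 \<le> y" for y :: real
        using that mult_left_mono[of y 1 y] by (cases "y \<le> 1") (auto simp: min_def distrib_left)
      then show ?thesis using x by blast
    qed
    ultimately show ?thesis using x by (simp only: times_divide_eq_right pos_le_divide_eq[of "1 + ?x"] add_pos_nonneg zero_less_one)
  qed
  ultimately show ?thesis unfolding right_diff_distrib by linarith
qed

text \<open>Item i is present with probability \<open>1 - (1 - pmf p i) ^ k\<close>; by linearity
  the dependence between the items does not matter.\<close>

lemma distinct_expectation:
  assumes "finite A" "set_pmf p \<subseteq> A"
  shows "(\<Sum>i\<in>A. min 1 (k * pmf p i)) \<le> 2 * E (iid k p) (\<lambda>S. real (card (set_mset S)))"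
proof -
  have fp: "finite (set_pmf p)" using assms finite_subset by blast
  have sub: "S \<in> set_pmf (iid k p) \<Longrightarrow> set_mset S \<subseteq> A" for S
  proof (induction k arbitrary: S)
    case (Suc k)
    then show ?case using assms(2) Suc.IH unfolding iid_Suc by fastforce
  qed simp
  have "E (iid k p) (\<lambda>S. real (card (set_mset S))) = E (iid k p) (\<lambda>S. \<Sum>i\<in>A. 1 - of_bool (i \<notin># S))"
  proof (rule E_cong)
    fix S assume "S \<in> set_pmf (iid k p)"
    then have "set_mset S \<subseteq> A" by (rule sub)
    then have "real (card (set_mset S)) = (\<Sum>i\<in>A. of_bool (i \<in># S))"
      using assms(1) by (simp add: of_bool_def sum.If_cases Int_absorb1 Int_def[symmetric] Collect_conj_eq)
    also have "\<dots> = (\<Sum>i\<in>A. 1 - of_bool (i \<notin># S))" by (rule sum.cong) auto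
    finally show "real (card (set_mset S)) = (\<Sum>i\<in>A. 1 - of_bool (i \<notin># S))" .
  qed
  also have "\<dots> = (\<Sum>i\<in>A. E (iid k p) (\<lambda>S. 1 - of_bool (i \<notin># S)))"
    by (rule Bochner_Integration.integral_sum) (intro integrable_measure_pmf_finite finite_iid fp)
  also have "\<dots> = (\<Sum>i\<in>A. 1 - (1 - pmf p i) ^ k)"
    by (rule sum.cong) (simp_all add: E_diff finite_iid fp iid_avoid)
  finally have "2 * E (iid k p) (\<lambda>S. real (card (set_mset S))) = (\<Sum>i\<in>A. 2 * (1 - (1 - pmf p i) ^ k))"
    by (simp add: sum_distrib_left)
  moreover have "(\<Sum>i\<in>A. min 1 (k * pmf p i)) \<le> (\<Sum>i\<in>A. 2 * (1 - (1 - pmf p i) ^ k))"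
    by (intro sum_mono one_minus_power_ge) (auto simp: pmf_le_1)
  ultimately show ?thesis by simp
qed

lemma tr_Call':
  assumes "1 \<le> T" "i < length P" "tr P A B (T - 1) m (Run (P ! i @ b) \<rho>) \<mu> (\<lambda>a m w. Q a m (1 + w))"
  shows "tr P A B T m (Run (Call i # b) \<rho>) \<mu> Q"
  using tr_Call[OF assms(2,3)] assms(1) by simp

lemma tr_call:
  assumes "tr P A B T0 m (Run (P ! i) \<rho>) \<mu> Q0" "i < length P" "Suc T0 \<le> T"
    and "\<And>a m w. Q0 a m w \<Longrightarrow> Q a m (1 + w)"
  shows "tr P A B T m (Run [Call i] \<rho>) \<mu> Q"
proof (rule tr_mono[OF tr_Call[where Q = Q]])
  show "tr P A B T0 m (Run (P ! i @ []) \<rho>) \<mu> (\<lambda>a m w. Q a m (1 + w))"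
    using tr_mono[OF assms(1) order_refl order_refl order_refl, of "\<lambda>a m w. Q a m (1 + w)"] assms(4) by simp
qed (use assms in auto)

lemma tr_Uniform':
  assumes "1 \<le> T" "\<rho> rn = real n" "n > 0"
    and "\<And>x. x < n \<Longrightarrow> tr P A B (T - 1) m (Run b (\<rho>(r := real x))) (f x) (\<lambda>a m w. Q a m (1 + w))"
  shows "tr P A B T m (Run (Uniform r rn # b) \<rho>) (bind_pmf (pmf_of_set {..<n}) f) Q"
  using tr_Uniform[OF assms(2,3,4)] assms(1) by simp

lemma tr_Binomial':
  assumes "1 \<le> T" "\<rho> rn = real n" "\<rho> rp = p" "0 \<le> p" "p \<le> 1"
    and "\<And>x. x \<le> n \<Longrightarrow> tr P A B (T - 1) m (Run b (\<rho>(r := real x))) (f x) (\<lambda>a m w. Q a m (1 + w))"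
  shows "tr P A B T m (Run (Binomial r rn rp # b) \<rho>) (bind_pmf (binomial_pmf n p) f) Q"
  using tr_Binomial[of \<rho> rn n rp P A B "T - 1" m b r f Q] assms by simp

lemma tr_map:
  "tr P A B T m p \<mu> R \<Longrightarrow> (\<And>a m w. R a m w \<Longrightarrow> Q (g a) m w) \<Longrightarrow> tr P A B T m p (map_pmf g \<mu>) Q"
proof (induction arbitrary: Q rule: tr.induct)
  case (fin p \<mu> R m T)
  then show ?case by (intro tr.fin) auto
next
  case (step p m D T f R \<mu>)
  show ?case
  proof (rule tr.step[where f = "\<lambda>x. map_pmf g (f x)"])
    fix p' ws assume D: "(p', ws) \<in> set_pmf D"
    have "tr P A B T (upd ws m) p' (map_pmf g (f (p', ws))) (\<lambda>a m w. Q a m (num_ops p + w))"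
      by (rule step.IH[OF D, THEN conjunct2, THEN conjunct2, THEN conjunct2, rule_format]) (rule step.prems)
    then show "distinct (map fst ws) \<and> fst ` set ws \<subseteq> A \<and>
      tr P A B T (upd ws m) p' (map_pmf g (f (p', ws))) (\<lambda>a m w. Q a m (num_ops p + w))"
      using step.IH[OF D] by metis
  next
    show "map_pmf g \<mu> = bind_pmf D (\<lambda>x. map_pmf g (f x))" unfolding step.hyps(3) by (rule map_bind_pmf)
  qed (fact step.hyps(1,2))+
qed

section \<open>The query program\<close>

text \<open>
  A leaf is identified by its position below \<open>n\<close>, inner nodes have identifiers from \<open>n\<close> on. Indexed by
  identifiers, arrays 10 and 11 hold the children, 12 the mass, 13 the maximal weight, 14 the first leaf
  and 15 the number of leaves; array 16 maps leaves to items and cell (5, 0) holds the root.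
  A query uses array 20 for the number of requested samples, 21 for the number of distinct
  items found and 22 for the leaf found by a single sample. Registers 10, 11, 12 and 23 hold the
  constants 1, 0, \<open>n\<close> and 2.
\<close>

definition q_main :: "instr list" where
  "q_main = [Const 10 1, Const 11 0, Const 23 2, Load 12 0 11, Load 13 5 11, Load 14 0 10, Store 20 13 14,
     Par [Call 1] [], Const 22 0, Par [Call 3] [], Load 17 21 13, Store 2 11 17]"

definition q_split :: "instr list" where
  "q_split = [Load 15 10 13, Load 16 11 13, Load 17 12 15, Load 18 12 13, Arith Divide 19 17 18, Binomial 18 14 19,
      Store 20 15 18, Arith Minus 17 14 18, Store 20 16 17,
      Par [Arith Plus 13 15 11, Call 1] [Arith Plus 13 16 11, Call 1],
      Load 17 21 15, Load 18 21 16, Arith Plus 17 17 18, Store 21 13 17]"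

definition q_sample :: "instr list" where
  "q_sample = [Load 14 20 13,
     IfLess 14 10 [Store 21 13 11]
      [IfLess 13 12 [Store 22 13 13, Store 21 13 10]
        [IfLess 10 14 q_split [Arith Plus 20 13 11, Call 2]]]]"

text \<open>Register 13 stays at the node to which the sample was assigned and where the result is
  stored; register 20 is the node that the search has reached.\<close>

definition q_descend :: "instr list" where
  "q_descend = [Load 15 10 20, Load 16 11 20, Load 17 12 15, Load 18 12 20, Arith Divide 19 17 18, Binomial 17 10 19,
      IfLess 11 17 [Arith Plus 20 15 11] [Arith Plus 20 16 11], Call 2]"

definition q_single :: "instr list" where
  "q_single = [IfLess 20 12 [Store 22 13 20, Store 21 13 10]
     [Load 17 15 20, Uniform 18 17, Load 17 14 20, Arith Plus 18 17 18, Load 17 12 18, Load 21 13 20,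
      Arith Divide 19 17 21, Binomial 17 10 19,
      IfLess 11 17 [Store 22 13 18, Store 21 13 10] q_descend]]"

text \<open>Register 22 is the next free output position. Array 21 tells how many pairs the left
  subtree produces, which gives the right subtree its offset, so both can write at once without
  conflict. A node with a lone sample holds the leaf found, and the traversal ends there.\<close>

definition q_emit :: "instr list" where
  "q_emit = [Load 17 21 13,
     IfLess 17 10 []
      [Load 14 20 13,
       IfLess 14 23 [Call 4]
        [IfLess 13 12 [Call 4]
          [Load 15 10 13, Load 16 11 13, Load 17 21 15,
           Par [Arith Plus 13 15 11, Call 3] [Arith Plus 13 16 11, Arith Plus 22 22 17, Call 3]]]]]"

definition q_out :: "instr list" where
  "q_out = [Load 17 22 13, Load 18 16 17, Store 3 22 18, Store 4 22 14]"

definition query :: program where "query = [q_main, q_sample, q_single, q_emit, q_out]"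

lemma query_nth: "length query = 5" "query ! 1 = q_sample" "query ! Suc 0 = q_sample" "query ! 2 = q_single"
  "query ! 3 = q_emit" "query ! 4 = q_out" "query ! 0 = q_main"
  by (simp_all add: query_def)

definition att :: "memory \<Rightarrow> (nat \<Rightarrow> real) \<Rightarrow> tree \<Rightarrow> bool" where
  "att m v t \<longleftrightarrow> m (12, root t) = mass v t \<and> m (13, root t) = mx v t \<and>
     m (14, root t) = real (lo t) \<and> m (15, root t) = real (cnt t)"

primrec rep :: "memory \<Rightarrow> (nat \<Rightarrow> real) \<Rightarrow> nat \<Rightarrow> tree \<Rightarrow> bool" where
  "rep m v n (Lf j) \<longleftrightarrow> j < n \<and> att m v (Lf j)"
| "rep m v n (Nd i l r) \<longleftrightarrow> n \<le> i \<and> m (10, i) = real (root l) \<and> m (11, i) = real (root r) \<and>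
     att m v (Nd i l r) \<and> rep m v n l \<and> rep m v n r"

text \<open>Scratch cells are indexed by node identifiers, so distinct identifiers make the writes
  of parallel subtrees exclusive.\<close>

primrec disj :: "tree \<Rightarrow> bool" where
  "disj (Lf j) \<longleftrightarrow> True"
| "disj (Nd i l r) \<longleftrightarrow> i \<notin> ids l \<and> i \<notin> ids r \<and> ids l \<inter> ids r = {} \<and> disj l \<and> disj r"

lemma att_root: "rep m v n t \<Longrightarrow> att m v t" by (cases t) auto

lemma rep_leaf: "rep m v n t \<Longrightarrow> j \<in> set (lvs t) \<Longrightarrow> j < n \<and> m (12, j) = v j"
  by (induction t) (auto simp: att_def)

lemma rep_cong:
  "rep m v n t \<Longrightarrow> (\<And>a i. 10 \<le> a \<Longrightarrow> a \<le> 15 \<Longrightarrow> i \<in> ids t \<Longrightarrow> m' (a, i) = m (a, i)) \<Longrightarrow> rep m' v n t"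
  by (induction t) (auto simp: att_def)

definition B0 :: "address set" where "B0 = {(a, i). a = 0 \<or> 5 \<le> a \<and> a \<le> 16}"

definition regs :: "nat \<Rightarrow> registers \<Rightarrow> bool" where
  "regs n \<rho> \<longleftrightarrow> \<rho> 10 = 1 \<and> \<rho> 11 = 0 \<and> \<rho> 12 = real n \<and> \<rho> 23 = 2"

definition single_post :: "memory \<Rightarrow> nat \<Rightarrow> tree \<Rightarrow> nat \<Rightarrow> nat \<times> nat \<Rightarrow> memory \<Rightarrow> nat \<Rightarrow> bool" where
  "single_post m d t c = (\<lambda>(p, s) m' w. w \<le> 30 * s + c \<and> p \<in> set (lvs t) \<and> m' = m((22, d) := real p, (21, d) := 1))"

text \<open>The code is verified backwards: each auxiliary fact treats the suffix that begins just
  before or just after a random draw and couples it with the corresponding inner part of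
  \<open>single\<close>. The work is linear in the number of proposals, the time in the
  depth.\<close>

lemma single_tr:
  assumes "rep m v n t" "pos_on v t" "contig t" "regs n \<rho>" "\<rho> 20 = real (root t)" "\<rho> 13 = real d"
    "(21, d) \<in> A" "(22, d) \<in> A" "B0 \<subseteq> B"
  shows "tr query A B (30 * (depth t + 1)) m (Run [Call 2] \<rho>) (single v t) (single_post m d t 20)"
  using assms(1-6)
proof (induction t arbitrary: \<rho>)
  case (Lf j)
  then show ?case
    using assms(7,8)
    by (intro tr_Call') (auto simp: query_nth q_single_def regs_def single_post_def intro!: sx_tr tr_Nil)
next
  case (Nd i l r)
  let ?t = "Nd i l r" and ?p = "mass v l / mass v (Nd i l r)"
  note c = contig_Nd[OF Nd.prems(3)] and sp = split_prob[OF Nd.prems(2)]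
  have B: "a = 0 \<or> 5 \<le> a \<and> a \<le> 16 \<Longrightarrow> (a, x) \<in> B" for a x using assms(9) by (auto simp: B0_def)
  have mem: "m (10, i) = real (root l)" "m (11, i) = real (root r)" "m (12, i) = mass v ?t" "m (13, i) = mx v ?t"
    "m (14, i) = real (lo l)" "m (15, i) = real (cnt ?t)" "m (12, root l) = mass v l" "n \<le> i"
    using Nd.prems(1) att_root[of m v n l] by (auto simp: att_def)
  have desc: "tr query A B (30 * depth ?t + 10) m (Run q_descend \<rho>') (bind_pmf (binomial_pmf 1 ?p) (\<lambda>c.
         map_pmf (\<lambda>(p, s). (p, Suc s)) (if 0 < c then single v l else single v r))) (single_post m d ?t 0)"
    if \<rho>': "regs n \<rho>'" "\<rho>' 20 = real i" "\<rho>' 13 = real d" for \<rho>'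
  proof -
    have rest: "tr query A B (30 * depth ?t + 4) m (Run [IfLess 11 17 [Arith Plus 20 15 11] [Arith Plus 20 16 11], Call 2] \<rho>'')
       (map_pmf (\<lambda>(p, s). (p, Suc s)) (if 0 < x then single v l else single v r)) (\<lambda>a m' w. single_post m d ?t 0 a m' (6 + w))"
      if "regs n \<rho>''" "\<rho>'' 13 = real d" "\<rho>'' 17 = real x" "\<rho>'' 15 = real (root l)" "\<rho>'' 16 = real (root r)" for \<rho>'' x
    proof (cases "0 < x")
      case True
      have IH: "tr query A B (30 * (depth l + 1)) m (Run [Call 2] (\<rho>''(20 := real (root l)))) (single v l) (single_post m d l 20)"
        using that c Nd by (intro Nd.IH(1)) (auto simp: regs_def)
      have "tr query A B (30 * depth ?t + 2) m (Run [Call 2] (\<rho>''(20 := real (root l)))) (map_pmf (\<lambda>(p, s). (p, Suc s)) (single v l))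
         (\<lambda>a m' w. single_post m d ?t 0 a m' (8 + w))"
        by (rule tr_map[OF tr_mono[OF IH, where Q' = "\<lambda>a m' w. single_post m d l 20 a m' w"]]) (auto simp: single_post_def)
      then show ?thesis using that True by (intro sx_tr) (simp add: regs_def)
    next
      case False
      have IH: "tr query A B (30 * (depth r + 1)) m (Run [Call 2] (\<rho>''(20 := real (root r)))) (single v r) (single_post m d r 20)"
        using that c Nd by (intro Nd.IH(2)) (auto simp: regs_def)
      have "tr query A B (30 * depth ?t + 2) m (Run [Call 2] (\<rho>''(20 := real (root r)))) (map_pmf (\<lambda>(p, s). (p, Suc s)) (single v r))
         (\<lambda>a m' w. single_post m d ?t 0 a m' (8 + w))"
        by (rule tr_map[OF tr_mono[OF IH, where Q' = "\<lambda>a m' w. single_post m d r 20 a m' w"]]) (auto simp: single_post_def)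
      then show ?thesis using that False by (intro sx_tr) (simp add: regs_def)
    qed
    have bin: "tr query A B (30 * depth ?t + 5) m (Run [Binomial 17 10 19, IfLess 11 17 [Arith Plus 20 15 11] [Arith Plus 20 16 11], Call 2] \<rho>'')
       (bind_pmf (binomial_pmf 1 ?p) (\<lambda>c.
         map_pmf (\<lambda>(p, s). (p, Suc s)) (if 0 < c then single v l else single v r))) (\<lambda>a m' w. single_post m d ?t 0 a m' (5 + w))"
      if "regs n \<rho>''" "\<rho>'' 13 = real d" "\<rho>'' 19 = ?p" "\<rho>'' 15 = real (root l)" "\<rho>'' 16 = real (root r)" for \<rho>''
    proof (rule tr_Binomial')
      fix x
      show "tr query A B (30 * depth ?t + 5 - 1) m (Run [IfLess 11 17 [Arith Plus 20 15 11] [Arith Plus 20 16 11], Call 2] (\<rho>''(17 := real x)))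
       (map_pmf (\<lambda>(p, s). (p, Suc s)) (if 0 < x then single v l else single v r)) (\<lambda>a m' w. single_post m d ?t 0 a m' (5 + (1 + w)))"
        by (rule tr_mono[OF rest[of _ x]]) (use that in \<open>auto simp: regs_def\<close>)
    qed (use that sp in \<open>auto simp: regs_def\<close>)
    show ?thesis
      unfolding q_descend_def
      by (rule sx_tr) (use \<rho>' in \<open>simp add: regs_def B mem del: One_nat_def mass_simps depth.simps, intro tr_mono[OF bin], auto simp: regs_def\<close>)
  qed
  let ?F = "\<lambda>x. bind_pmf (binomial_pmf 1 (v (lo l + x) / mx v ?t)) (\<lambda>b.
       if 0 < b then return_pmf (lo l + x, 1)
       else bind_pmf (binomial_pmf 1 ?p) (\<lambda>c. map_pmf (\<lambda>(p, s). (p, Suc s)) (if 0 < c then single v l else single v r)))"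
  have bern: "tr query A B (30 * depth ?t + 18) m (Run [Binomial 17 10 19, IfLess 11 17 [Store 22 13 18, Store 21 13 10] q_descend] \<rho>')
      (?F x) (\<lambda>a m' w. single_post m d ?t 20 a m' (9 + w))"
    if \<rho>': "regs n \<rho>'" "\<rho>' 20 = real i" "\<rho>' 13 = real d" "\<rho>' 18 = real (lo l + x)" "\<rho>' 19 = v (lo l + x) / mx v ?t"
      and x: "x < cnt ?t" for \<rho>' x
  proof (rule tr_Binomial')
    fix b :: nat assume "b \<le> 1"
    let ?\<rho> = "\<rho>'(17 := real b)"
    show "tr query A B (30 * depth ?t + 18 - 1) m (Run [IfLess 11 17 [Store 22 13 18, Store 21 13 10] q_descend] ?\<rho>)
      (if 0 < b then return_pmf (lo l + x, 1)
       else bind_pmf (binomial_pmf 1 ?p) (\<lambda>c. map_pmf (\<lambda>(p, s). (p, Suc s)) (if 0 < c then single v l else single v r)))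
      (\<lambda>a m' w. single_post m d ?t 20 a m' (9 + (1 + w)))"
    proof (cases "0 < b")
      case True
      have "lo l + x \<in> set (lvs ?t)" using contig_mem[OF Nd.prems(3) x] by simp
      then show ?thesis using True \<rho>' assms(7,8)
        by (intro sx_tr) (auto simp: regs_def single_post_def intro!: tr_Nil)
    next
      case False
      have "tr query A B (30 * depth ?t + 16) m (Run q_descend ?\<rho>) (bind_pmf (binomial_pmf 1 ?p) (\<lambda>c.
         map_pmf (\<lambda>(p, s). (p, Suc s)) (if 0 < c then single v l else single v r))) (\<lambda>a m' w. single_post m d ?t 20 a m' (11 + w))"
        by (rule tr_mono[OF desc]) (use \<rho>' in \<open>auto simp: regs_def single_post_def\<close>)
      then have "tr query A B (Suc (30 * depth ?t + 16)) m (Run [IfLess 11 17 [Store 22 13 18, Store 21 13 10] q_descend] ?\<rho>)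
         (bind_pmf (binomial_pmf 1 ?p) (\<lambda>c. map_pmf (\<lambda>(p, s). (p, Suc s)) (if 0 < c then single v l else single v r)))
         (\<lambda>a m' w. single_post m d ?t 20 a m' (9 + (1 + w)))"
        using \<rho>' False by (intro tr_step1[where ws = "[]"]) (auto simp: regs_def)
      then show ?thesis using False by (simp del: depth.simps)
    qed
  qed (use that accept_prob[OF Nd.prems(2,3) x] in \<open>auto simp: regs_def\<close>)
  have unif: "tr query A B (30 * depth ?t + 25) m (Run (drop (Suc 0) [Load 17 15 20, Uniform 18 17, Load 17 14 20, Arith Plus 18 17 18, Load 17 12 18, Load 21 13 20,
      Arith Divide 19 17 21, Binomial 17 10 19, IfLess 11 17 [Store 22 13 18, Store 21 13 10] q_descend]) \<rho>') (single v ?t)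
      (\<lambda>a m' w. single_post m d ?t 20 a m' (3 + w))"
    if \<rho>': "regs n \<rho>'" "\<rho>' 20 = real i" "\<rho>' 13 = real d" "\<rho>' 17 = real (cnt ?t)" for \<rho>'
    unfolding single.simps drop_Suc_Cons drop_0
  proof (rule tr_Uniform')
    fix x assume x: "x < cnt ?t"
    have v: "m (12, lo l + x) = v (lo l + x)"
      using rep_leaf[OF Nd.prems(1), of "lo l + x"] contig_mem[OF Nd.prems(3) x] by simp
    show "tr query A B (30 * depth ?t + 25 - 1) m (Run [Load 17 14 20, Arith Plus 18 17 18, Load 17 12 18, Load 21 13 20,
      Arith Divide 19 17 21, Binomial 17 10 19, IfLess 11 17 [Store 22 13 18, Store 21 13 10] q_descend] (\<rho>'(18 := real x)))
      (bind_pmf (binomial_pmf 1 (v (lo l + x) / mx v ?t)) (\<lambda>b.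
       if 0 < b then return_pmf (lo l + x, 1)
       else bind_pmf (binomial_pmf 1 ?p) (\<lambda>c. map_pmf (\<lambda>(p, s). (p, Suc s)) (if 0 < c then single v l else single v r))))
      (\<lambda>a m' w. single_post m d ?t 20 a m' (3 + (1 + w)))"
      by (rule sx_tr) (use \<rho>' in \<open>simp add: regs_def B mem v del: One_nat_def mass_simps depth.simps mx.simps,
          intro tr_mono[OF bern[OF _ _ _ _ _ x]], auto simp: regs_def simp del: One_nat_def mass_simps depth.simps mx.simps\<close>)
  qed (use that cnt_pos[of ?t] in \<open>auto simp del: cnt_simps\<close>)
  have "tr query A B (30 * depth ?t + 29) m (Run q_single \<rho>) (single v ?t) (\<lambda>a m' w. single_post m d ?t 20 a m' (1 + w))"
    unfolding q_single_def
    by (rule sx_tr) (use Nd.prems mem in \<open>simp add: regs_def B del: One_nat_def mass_simps depth.simps mx.simps cnt_simps single.simps,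
        intro tr_mono[OF unif[unfolded drop_Suc_Cons drop_0]],
        auto simp: regs_def single_post_def simp del: mass_simps depth.simps mx.simps cnt_simps single.simps\<close>)
  then have "tr query A B (30 * depth ?t + 29) m (Run (query ! 2) \<rho>) (single v ?t)
      (\<lambda>a m' w. single_post m d ?t 20 a m' (1 + w))" unfolding query_nth .
  then show ?case by (rule tr_call) (simp_all add: query_nth)
qed

definition AS :: "tree \<Rightarrow> address set" where "AS t = {(a, i). (a = 20 \<or> a = 21 \<or> a = 22) \<and> i \<in> ids t}"

lemma AS_iff [simp]: "(a, i) \<in> AS t \<longleftrightarrow> (a = 20 \<or> a = 21 \<or> a = 22) \<and> i \<in> ids t"
  and B0_iff [simp]: "(a, i) \<in> B0 \<longleftrightarrow> a = 0 \<or> 5 \<le> a \<and> a \<le> 16"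
  by (auto simp: AS_def B0_def)

text \<open>Describes the cells of the visited nodes after the sampling phase. Nothing is said about
  other nodes, so leftovers of earlier queries do not have to be cleared.\<close>

primrec hold :: "memory \<Rightarrow> tree \<Rightarrow> nat \<Rightarrow> outcome \<Rightarrow> bool" where
  "hold m t k Zr \<longleftrightarrow> k = 0 \<and> m (21, root t) = 0"
| "hold m t k (Ot p c s) \<longleftrightarrow> c = k \<and> 0 < k \<and> (k = 1 \<or> t = Lf p) \<and> m (20, root t) = real k \<and>
     m (21, root t) = 1 \<and> m (22, root t) = real p \<and> p \<in> set (lvs t)"
| "hold m t k (Sp a b) \<longleftrightarrow> (\<exists>i l r x. t = Nd i l r \<and> 2 \<le> k \<and> x \<le> k \<and> m (20, i) = real k \<and>
     m (21, i) = real (length (outl a) + length (outl b)) \<and> hold m l x a \<and> hold m r (k - x) b)"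

lemma hold_length: "hold m t k a \<Longrightarrow> m (21, root t) = real (length (outl a))"
  by (cases a) auto

lemma hold_cong:
  "hold m t k a \<Longrightarrow> (\<And>x. x \<in> AS t \<Longrightarrow> m' x = m x) \<Longrightarrow> hold m' t k a"
proof (induction a arbitrary: t k)
  case (Sp a b)
  then obtain i l r x where *: "t = Nd i l r" "2 \<le> k" "x \<le> k" "m (20, i) = real k"
    "m (21, i) = real (length (outl a) + length (outl b))" "hold m l x a" "hold m r (k - x) b" by auto
  have "hold m' l x a" "hold m' r (k - x) b"
    using * by (auto intro!: Sp.IH Sp.prems(2) simp: AS_def)
  moreover have "m' (20, i) = m (20, i)" "m' (21, i) = m (21, i)"
    using *(1) Sp.prems(2)[of "(20, i)"] Sp.prems(2)[of "(21, i)"] by simp_all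
  ultimately show ?case using * by auto
qed (auto simp: AS_def)

text \<open>The two parts of a split concern disjoint sets of leaves, so pairs never have to be
  merged: the multiplicity of a leaf is known at a single place.\<close>

lemma hold_oms: "hold m t k a \<Longrightarrow> distinct (lvs t) \<Longrightarrow>
  distinct (map fst (outl a)) \<and> fst ` set (outl a) \<subseteq> set (lvs t) \<and> set_mset (oms a) = fst ` set (outl a) \<and>
  (\<forall>(p, c)\<in>set (outl a). count (oms a) p = c)"
proof (induction a arbitrary: t k)
  case (Sp a b)
  then obtain i l r x where *: "t = Nd i l r" "hold m l x a" "hold m r (k - x) b" by auto
  have d: "distinct (lvs l)" "distinct (lvs r)" "set (lvs l) \<inter> set (lvs r) = {}" using Sp.prems(2) * by auto
  note 1 = Sp.IH(1)[OF *(2) d(1)] and 2 = Sp.IH(2)[OF *(3) d(2)]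
  have dis: "fst ` set (outl a) \<inter> fst ` set (outl b) = {}" using 1 2 d(3) by blast
  have "count (oms (Sp a b)) p = c" if pc: "(p, c) \<in> set (outl (Sp a b))" for p c
  proof (cases "(p, c) \<in> set (outl a)")
    case True
    then have "p \<notin># oms b" using 2 dis by (metis IntI emptyE fst_conv image_eqI)
    then show ?thesis using 1 True by (auto simp: not_in_iff)
  next
    case False
    then have pb: "(p, c) \<in> set (outl b)" using pc by simp
    then have "p \<notin># oms a" using 1 dis by (metis IntI emptyE fst_conv image_eqI)
    then show ?thesis using 2 pb by (auto simp: not_in_iff)
  qed
  then show ?case using 1 2 dis * by (auto simp: image_Un)
qed auto

lemma tr_sub':
  assumes "tr P A1 B1 T1 m (Run b1 \<rho>) \<mu>1 Q1" "A1 \<subseteq> A" "B1 \<subseteq> B" "T1 + T3 + 2 \<le> T"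
    and "\<And>a1 m' w1. a1 \<in> set_pmf \<mu>1 \<Longrightarrow> Q1 a1 m' w1 \<Longrightarrow> (\<And>x. x \<notin> A1 \<Longrightarrow> m' x = m x) \<Longrightarrow>
      tr P A B T3 m' (Run b \<rho>) (\<mu>3 a1) (\<lambda>a m w. Q a m (w1 + 2 + w))"
  shows "tr P A B T m (Run (Par b1 [] # b) \<rho>) (bind_pmf \<mu>1 \<mu>3) Q"
  by (rule tr_mono[OF tr_sub[OF assms(1-3,5)]]) (use assms(4) in auto)

lemma tr_Par':
  assumes "tr P A1 B1 T1 m (Run b1 \<rho>) \<mu>1 Q1" "tr P A2 B2 T1 m (Run b2 \<rho>) \<mu>2 Q2" "T1 + T3 + 2 \<le> T"
    and sets: "A1 \<subseteq> A" "A2 \<subseteq> A" "B1 \<subseteq> B" "B2 \<subseteq> B" "A1 \<inter> A2 = {}" "B1 \<inter> A2 = {}" "B2 \<inter> A1 = {}"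
    and "\<And>a1 a2 m1 m2 m' w1 w2. a1 \<in> set_pmf \<mu>1 \<Longrightarrow> a2 \<in> set_pmf \<mu>2 \<Longrightarrow> Q1 a1 m1 w1 \<Longrightarrow> Q2 a2 m2 w2 \<Longrightarrow>
      (\<And>x. x \<notin> A2 \<Longrightarrow> m' x = m1 x) \<Longrightarrow> (\<And>x. x \<notin> A1 \<Longrightarrow> m' x = m2 x) \<Longrightarrow>
      (\<And>x. x \<notin> A1 \<Longrightarrow> x \<notin> A2 \<Longrightarrow> m' x = m x) \<Longrightarrow>
      tr P A B T3 m' (Run b \<rho>) (\<mu>3 a1 a2) (\<lambda>a m w. Q a m (w1 + w2 + 2 + w))"
  shows "tr P A B T m (Run (Par b1 b2 # b) \<rho>) (bind_pmf \<mu>1 (\<lambda>a1. bind_pmf \<mu>2 (\<mu>3 a1))) Q"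
  by (rule tr_mono[OF tr_Par[OF assms(1,2) sets assms(11)]]) (use assms(3) in auto)

text \<open>A parent writes the requested numbers into the cells of its children before forking.
  From then on each branch touches only the scratch cells of its own subtree and shares the tree
  itself for reading.\<close>

lemma sample_tr:
  assumes "rep m v n t" "pos_on v t" "contig t" "disj t" "regs n \<rho>" "\<rho> 13 = real (root t)" "m (20, root t) = real k"
  shows "tr query (AS t) (B0 \<union> AS t) (100 * (depth t + 1)) m (Run [Call 1] \<rho>) (sampler v t k)
    (\<lambda>a m' w. w \<le> 60 * cost a \<and> hold m' t k a)"
  using assms
proof (induction t arbitrary: \<rho> m k)
  case (Lf j)
  show ?case
  proof (cases "k = 0")
    case True
    then show ?thesis using Lf
      by (intro tr_Call') (auto simp: query_nth q_sample_def regs_def AS_def B0_def intro!: sx_tr tr_Nil)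
  next
    case False
    then show ?thesis using Lf
      by (intro tr_Call') (auto simp: query_nth q_sample_def regs_def AS_def B0_def intro!: sx_tr tr_Nil)
  qed
next
  case (Nd i l r)
  let ?t = "Nd i l r" and ?p = "mass v l / mass v (Nd i l r)"
  note c = contig_Nd[OF Nd.prems(3)] and sp = split_prob[OF Nd.prems(2)]
  have mem: "m (10, i) = real (root l)" "m (11, i) = real (root r)" "m (12, i) = mass v ?t"
    "m (12, root l) = mass v l" "n \<le> i" "m (20, i) = real k"
    using Nd.prems(1,7) att_root[of m v n l] by (auto simp: att_def)
  consider "k = 0" | "k = 1" | "k \<ge> 2" by linarith
  then show ?case
  proof cases
    case 1
    then show ?thesis using Nd.prems
      by (intro tr_Call') (auto simp: query_nth q_sample_def regs_def AS_def B0_def intro!: sx_tr tr_Nil)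
  next
    case 2
    let ?\<rho> = "\<rho>(14 := 1, 20 := real i)"
    have "tr query (AS ?t) (B0 \<union> AS ?t) (30 * (depth ?t + 1)) m (Run [Call 2] ?\<rho>) (single v ?t) (single_post m i ?t 20)"
      by (rule single_tr) (use Nd.prems in \<open>auto simp: regs_def AS_def\<close>)
    then have S: "tr query (AS ?t) (B0 \<union> AS ?t) (30 * (depth ?t + 1)) m (Run [Call 2] ?\<rho>)
        (map_pmf (\<lambda>(p, s). Ot p 1 s) (single v ?t)) (\<lambda>a m' w. w + 20 \<le> 60 * cost a \<and> hold m' ?t k a)"
      by (rule tr_map) (use mem 2 in \<open>auto simp: single_post_def split: prod.splits\<close>)
    have "tr query (AS ?t) (B0 \<union> AS ?t) (50 * (depth ?t + 1)) m (Run q_sample \<rho>) (map_pmf (\<lambda>(p, s). Ot p 1 s) (single v ?t))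
      (\<lambda>a m' w. 1 + w \<le> 60 * cost a \<and> hold m' ?t k a)"
      unfolding q_sample_def
      by (rule sx_tr) (use Nd.prems mem 2 in \<open>simp add: regs_def del: One_nat_def hold.simps single.simps lvs.simps depth.simps,
          intro tr_mono[OF S], auto simp del: One_nat_def hold.simps single.simps depth.simps\<close>)
    then have "tr query (AS ?t) (B0 \<union> AS ?t) (50 * (depth ?t + 1)) m (Run (query ! 1) \<rho>) (sampler v ?t k)
      (\<lambda>a m' w. 1 + w \<le> 60 * cost a \<and> hold m' ?t k a)" using 2 by (simp only: query_nth sampler.simps one_neq_zero if_True if_False refl)
    then show ?thesis by (rule tr_call) (simp_all add: query_nth)
  next
    case 3
    have dis: "i \<notin> ids l" "i \<notin> ids r" "ids l \<inter> ids r = {}" "disj l" "disj r" using Nd.prems by auto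
    then have rr: "root l \<noteq> i" "root r \<noteq> i" "root l \<noteq> root r" using root_in_ids by (metis disjoint_iff)+
    let ?tail = "[Load 17 21 15, Load 18 21 16, Arith Plus 17 17 18, Store 21 13 17]"
    let ?R = "\<lambda>\<rho>'. regs n \<rho>' \<and> \<rho>' 13 = real i \<and> \<rho>' 14 = real k \<and> \<rho>' 15 = real (root l) \<and> \<rho>' 16 = real (root r)"
    have par: "tr query (AS ?t) (B0 \<union> AS ?t) (100 * (depth ?t) + 20) m'
        (Run (Par [Arith Plus 13 15 11, Call 1] [Arith Plus 13 16 11, Call 1] # ?tail) \<rho>')
        (bind_pmf (sampler v l x) (\<lambda>a. bind_pmf (sampler v r (k - x)) (\<lambda>b. return_pmf (Sp a b))))
        (\<lambda>a m' w. w + 30 \<le> 60 * cost a \<and> hold m' ?t k a)"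
      if R: "?R \<rho>'" and x: "x \<le> k" and m': "m' = m((20, root l) := real x, (20, root r) := real (k - x))" for \<rho>' x m'
    proof (rule tr_Par')
      have rp: "rep m' v n l" "rep m' v n r"
        using Nd.prems(1) unfolding m' by (auto elim!: rep_cong)
      have "tr query (AS l) (B0 \<union> AS l) (100 * (depth l + 1)) m' (Run [Call 1] (\<rho>'(13 := real (root l)))) (sampler v l x)
        (\<lambda>a m' w. w \<le> 60 * cost a \<and> hold m' l x a)"
        by (rule Nd.IH(1)[OF rp(1)]) (use Nd.prems c R dis rr in \<open>auto simp: regs_def m'\<close>)
      then have "tr query (AS l) (B0 \<union> AS l) (100 * depth ?t + 1) m' (Run [Call 1] (\<rho>'(13 := real (root l)))) (sampler v l x)
        (\<lambda>a m' w. (1 + w) \<le> 60 * cost a + 1 \<and> hold m' l x a)"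
        by (rule tr_mono) auto
      then show "tr query (AS l) (B0 \<union> AS l) (100 * depth ?t + 2) m' (Run [Arith Plus 13 15 11, Call 1] \<rho>') (sampler v l x)
        (\<lambda>a m' w. w \<le> 60 * cost a + 1 \<and> hold m' l x a)"
        using R by (intro sx_tr) (simp add: regs_def del: depth.simps)
      have "tr query (AS r) (B0 \<union> AS r) (100 * (depth r + 1)) m' (Run [Call 1] (\<rho>'(13 := real (root r)))) (sampler v r (k - x))
        (\<lambda>a m' w. w \<le> 60 * cost a \<and> hold m' r (k - x) a)"
        by (rule Nd.IH(2)[OF rp(2)]) (use Nd.prems c R dis rr in \<open>auto simp: regs_def m'\<close>)
      then have "tr query (AS r) (B0 \<union> AS r) (100 * depth ?t + 1) m' (Run [Call 1] (\<rho>'(13 := real (root r)))) (sampler v r (k - x))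
        (\<lambda>a m' w. (1 + w) \<le> 60 * cost a + 1 \<and> hold m' r (k - x) a)"
        by (rule tr_mono) auto
      then show "tr query (AS r) (B0 \<union> AS r) (100 * depth ?t + 2) m' (Run [Arith Plus 13 16 11, Call 1] \<rho>') (sampler v r (k - x))
        (\<lambda>a m' w. w \<le> 60 * cost a + 1 \<and> hold m' r (k - x) a)"
        using R by (intro sx_tr) (simp add: regs_def del: depth.simps)
      show "AS l \<inter> AS r = {}" "(B0 \<union> AS l) \<inter> AS r = {}" "(B0 \<union> AS r) \<inter> AS l = {}"
        using dis by (auto simp: AS_def B0_def)
      fix a b m1 m2 m'' w1 w2
      assume 1: "w1 \<le> 60 * cost a + 1 \<and> hold m1 l x a" and 2: "w2 \<le> 60 * cost b + 1 \<and> hold m2 r (k - x) b"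
        and e1: "\<And>x. x \<notin> AS r \<Longrightarrow> m'' x = m1 x" and e2: "\<And>x. x \<notin> AS l \<Longrightarrow> m'' x = m2 x"
        and e: "\<And>x. x \<notin> AS l \<Longrightarrow> x \<notin> AS r \<Longrightarrow> m'' x = m' x"
      have h1: "hold m'' l x a" by (rule hold_cong[OF 1[THEN conjunct2]]) (use dis in \<open>auto intro!: e1 simp: AS_def\<close>)
      have h2: "hold m'' r (k - x) b" by (rule hold_cong[OF 2[THEN conjunct2]]) (use dis in \<open>auto intro!: e2 simp: AS_def\<close>)
      have k: "m'' (20, i) = real k" using e[of "(20, i)"] dis rr mem by (auto simp: AS_def m')
      let ?m = "m''((21, i) := real (length (outl a)) + real (length (outl b)))"
      have "hold ?m l x a" by (rule hold_cong[OF h1]) (use dis in \<open>auto simp: AS_def\<close>)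
      moreover have "hold ?m r (k - x) b" by (rule hold_cong[OF h2]) (use dis in \<open>auto simp: AS_def\<close>)
      ultimately have "hold ?m ?t k (Sp a b)" using k x 3 by auto
      then show "tr query (AS ?t) (B0 \<union> AS ?t) 4 m'' (Run ?tail \<rho>') (return_pmf (Sp a b))
         (\<lambda>a m' w. w1 + w2 + 2 + w + 30 \<le> 60 * cost a \<and> hold m' ?t k a)"
        using R 1 2 hold_length[OF h1] hold_length[OF h2]
        by (intro sx_tr) (auto simp: AS_def simp del: hold.simps intro!: tr_Nil)
    qed (auto simp: AS_def)
    have bin: "tr query (AS ?t) (B0 \<union> AS ?t) (100 * (depth ?t) + 40) m
        (Run ([Binomial 18 14 19, Store 20 15 18, Arith Minus 17 14 18, Store 20 16 17,
          Par [Arith Plus 13 15 11, Call 1] [Arith Plus 13 16 11, Call 1], Load 17 21 15, Load 18 21 16, Arith Plus 17 17 18, Store 21 13 17]) \<rho>') (sampler v ?t k) (\<lambda>a m' w. w + 20 \<le> 60 * cost a \<and> hold m' ?t k a)"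
      if R: "?R \<rho>'" "\<rho>' 19 = ?p" for \<rho>'
    proof -
      have s: "sampler v ?t k = bind_pmf (binomial_pmf k ?p) (\<lambda>x. bind_pmf (sampler v l x)
         (\<lambda>a. bind_pmf (sampler v r (k - x)) (\<lambda>b. return_pmf (Sp a b))))" using 3 by simp
      show ?thesis unfolding s
      proof (rule tr_Binomial')
        fix x assume x: "x \<le> k"
        show "tr query (AS ?t) (B0 \<union> AS ?t) (100 * depth ?t + 40 - 1) m
         (Run (Store 20 15 18 # Arith Minus 17 14 18 # Store 20 16 17 # Par [Arith Plus 13 15 11, Call 1] [Arith Plus 13 16 11, Call 1] # ?tail)
          (\<rho>'(18 := real x))) (bind_pmf (sampler v l x) (\<lambda>a. bind_pmf (sampler v r (k - x)) (\<lambda>b. return_pmf (Sp a b))))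
         (\<lambda>a m' w. 1 + w + 20 \<le> 60 * cost a \<and> hold m' ?t k a)"
          by (rule sx_tr) (use R x in \<open>simp add: regs_def del: hold.simps depth.simps,
            intro tr_mono[OF par[OF _ x, unfolded One_nat_def]], auto simp: regs_def of_nat_diff x simp del: hold.simps depth.simps\<close>)
      qed (use R sp in \<open>auto simp: regs_def\<close>)
    qed
    have "tr query (AS ?t) (B0 \<union> AS ?t) (100 * depth ?t + 50) m (Run q_sample \<rho>) (sampler v ?t k)
      (\<lambda>a m' w. 1 + w \<le> 60 * cost a \<and> hold m' ?t k a)"
      unfolding q_sample_def q_split_def
      by (rule sx_tr) (use Nd.prems mem 3 in \<open>simp add: regs_def del: hold.simps sampler.simps lvs.simps depth.simps mass_simps,
          intro tr_mono[OF bin[unfolded One_nat_def]], auto simp del: hold.simps sampler.simps depth.simps mass_simps simp: regs_def\<close>)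
    then have "tr query (AS ?t) (B0 \<union> AS ?t) (100 * depth ?t + 50) m (Run (query ! 1) \<rho>) (sampler v ?t k)
      (\<lambda>a m' w. 1 + w \<le> 60 * cost a \<and> hold m' ?t k a)" by (simp only: query_nth)
    then show ?thesis by (rule tr_call) (simp_all add: query_nth)
  qed
qed

definition AO :: "nat \<Rightarrow> nat \<Rightarrow> address set" where
  "AO off s = {(c, j). (c = 3 \<or> c = 4) \<and> off \<le> j \<and> j < off + s}"

definition B1 :: "address set" where "B1 = {(c, i). 5 \<le> c \<and> c \<le> 22}"

lemma AO_iff [simp]: "(c, j) \<in> AO off s \<longleftrightarrow> (c = 3 \<or> c = 4) \<and> off \<le> j \<and> j < off + s"
  and B1_iff [simp]: "(c, i) \<in> B1 \<longleftrightarrow> 5 \<le> c \<and> c \<le> 22"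
  by (auto simp: AO_def B1_def)

definition emitted :: "(nat \<Rightarrow> nat) \<Rightarrow> memory \<Rightarrow> nat \<Rightarrow> (nat \<times> nat) list \<Rightarrow> bool" where
  "emitted \<pi> m off xs \<longleftrightarrow> (\<forall>j<length xs. m (3, off + j) = real (\<pi> (fst (xs ! j))) \<and> m (4, off + j) = real (snd (xs ! j)))"

lemma emitted_append: "emitted \<pi> m off (xs @ ys) \<longleftrightarrow> emitted \<pi> m off xs \<and> emitted \<pi> m (off + length xs) ys"
proof -
  have "emitted \<pi> m (off + length xs) ys" if *: "emitted \<pi> m off (xs @ ys)"
    unfolding emitted_def
  proof (intro allI impI)
    fix j assume "j < length ys"
    then show "m (3, off + length xs + j) = real (\<pi> (fst (ys ! j))) \<and> m (4, off + length xs + j) = real (snd (ys ! j))"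
      using *[unfolded emitted_def, rule_format, of "length xs + j"] by (simp add: add.assoc)
  qed
  moreover have "emitted \<pi> m off xs" if *: "emitted \<pi> m off (xs @ ys)"
    using that by (auto simp: emitted_def nth_append)
  moreover have "emitted \<pi> m off (xs @ ys)" if 1: "emitted \<pi> m off xs" and 2: "emitted \<pi> m (off + length xs) ys"
    unfolding emitted_def
  proof (intro allI impI)
    fix j assume j: "j < length (xs @ ys)"
    show "m (3, off + j) = real (\<pi> (fst ((xs @ ys) ! j))) \<and> m (4, off + j) = real (snd ((xs @ ys) ! j))"
    proof (cases "j < length xs")
      case True
      then show ?thesis using 1 by (simp add: emitted_def nth_append)
    next
      case False
      then have "j - length xs < length ys" "off + length xs + (j - length xs) = off + j" using j by auto
      then show ?thesis using 2[unfolded emitted_def, rule_format, of "j - length xs"] False by (simp add: nth_append)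
    qed
  qed
  ultimately show ?thesis by blast
qed

lemma emitted_cong:
  "emitted \<pi> m off xs \<Longrightarrow> (\<And>x. x \<in> AO off (length xs) \<Longrightarrow> m' x = m x) \<Longrightarrow> emitted \<pi> m' off xs"
  by (simp add: emitted_def)

text \<open>The induction follows the outcome instead of the tree, because the traversal visits only
  nodes that the sampling phase has visited. So \<open>cost\<close> bounds its work as well.\<close>

lemma emit_tr:
  assumes "rep m v n t" "disj t" "hold m t k a" "\<And>j. j \<in> set (lvs t) \<Longrightarrow> m (16, j) = real (\<pi> j)"
    "regs n \<rho>" "\<rho> 13 = real (root t)" "\<rho> 22 = real off"
  shows "dt query (AO off (length (outl a))) B1 (60 * (depth t + 1)) m [Call 3] \<rho>
    (\<lambda>m' w. w \<le> 60 * cost a \<and> emitted \<pi> m' off (outl a))"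
  using assms
proof (induction a arbitrary: t k \<rho> off)
  case Zr
  have "dt query (AO off (length (outl Zr))) B1 50 m (query ! 3) \<rho> (\<lambda>m' w. 1 + w \<le> 60 * cost Zr \<and> emitted \<pi> m' off (outl Zr))"
    unfolding query_nth q_emit_def
    by (rule sx_tr) (use Zr in \<open>auto simp: regs_def emitted_def intro!: tr_Nil\<close>)
  then show ?case by (rule tr_call) (simp_all add: query_nth)
next
  case (Ot p c s)
  note h = Ot.prems
  have out: "dt query (AO off 1) B1 11 m [Call 4] \<rho>' (\<lambda>m' w. w \<le> 5 \<and> emitted \<pi> m' off [(p, k)])"
    if "regs n \<rho>'" "\<rho>' 13 = real (root t)" "\<rho>' 22 = real off" "\<rho>' 14 = real k" for \<rho>'
  proof -
    have "dt query (AO off 1) B1 10 m (query ! 4) \<rho>' (\<lambda>m' w. w \<le> 4 \<and> emitted \<pi> m' off [(p, k)])"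
      unfolding query_nth q_out_def
      by (rule sx_tr) (use that h in \<open>auto simp: regs_def emitted_def intro!: tr_Nil\<close>)
    then show ?thesis by (rule tr_call) (simp_all add: query_nth)
  qed
  have "dt query (AO off (length (outl (Ot p c s)))) B1 50 m (query ! 3) \<rho>
      (\<lambda>m' w. 1 + w \<le> 60 * cost (Ot p c s) \<and> emitted \<pi> m' off (outl (Ot p c s)))"
    unfolding query_nth q_emit_def
    by (rule sx_tr) (use h in \<open>auto simp: regs_def intro!: tr_mono[OF out]\<close>)
  then show ?case by (rule tr_call) (simp_all add: query_nth)
next
  case (Sp a b)
  obtain i l r x where t: "t = Nd i l r" and *: "2 \<le> k" "x \<le> k" "m (20, i) = real k"
    "m (21, i) = real (length (outl a) + length (outl b))" "hold m l x a" "hold m r (k - x) b" using Sp.prems(3) by auto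
  have mem: "m (10, i) = real (root l)" "m (11, i) = real (root r)" "n \<le> i" "rep m v n l" "rep m v n r" "disj l" "disj r"
    using Sp.prems(1,2) by (auto simp: t)
  show ?case
  proof (cases "outl a @ outl b = []")
    case True
    have "dt query (AO off (length (outl (Sp a b)))) B1 50 m (query ! 3) \<rho>
      (\<lambda>m' w. 1 + w \<le> 60 * cost (Sp a b) \<and> emitted \<pi> m' off (outl (Sp a b)))"
      unfolding query_nth q_emit_def
      by (rule sx_tr) (use True Sp.prems(5-7) * in \<open>auto simp: t regs_def emitted_def intro!: tr_Nil\<close>)
    then show ?thesis by (rule tr_call) (simp_all add: query_nth)
  next
    case False
    then have ne: "1 \<le> length (outl a) + length (outl b)" by (cases "outl a") (auto simp: Suc_le_eq)
    let ?n1 = "length (outl a)" and ?n2 = "length (outl b)"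
    have par: "dt query (AO off (?n1 + ?n2)) B1 (60 * depth t + 10) m
      [Par [Arith Plus 13 15 11, Call 3] [Arith Plus 13 16 11, Arith Plus 22 22 17, Call 3]] \<rho>'
      (\<lambda>m' w. w \<le> 60 * cost a + 60 * cost b + 5 \<and> emitted \<pi> m' off (outl a @ outl b))"
      if R: "regs n \<rho>'" "\<rho>' 22 = real off" "\<rho>' 15 = real (root l)" "\<rho>' 16 = real (root r)" "\<rho>' 17 = real ?n1" for \<rho>'
    proof -
      have 1: "dt query (AO off ?n1) B1 (60 * depth t + 4) m [Arith Plus 13 15 11, Call 3] \<rho>'
        (\<lambda>m' w. w \<le> 60 * cost a + 1 \<and> emitted \<pi> m' off (outl a))"
      proof (rule sx_tr)
        have H: "dt query (AO off ?n1) B1 (60 * (depth l + 1)) m [Call 3] (\<rho>'(13 := real (root l)))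
          (\<lambda>m' w. w \<le> 60 * cost a \<and> emitted \<pi> m' off (outl a))"
          by (rule Sp.IH(1)) (use Sp.prems R * mem in \<open>auto simp: regs_def t\<close>)
        show "sx (AO off ?n1) B1 (\<lambda>n b \<rho> m. n \<le> 60 * depth t + 4 \<and> dt query (AO off ?n1) B1 (60 * depth t + 4 - n) m b \<rho>
           (\<lambda>m w. n + w \<le> 60 * cost a + 1 \<and> emitted \<pi> m off (outl a))) 0 [Arith Plus 13 15 11, Call 3] \<rho>' m"
          using R by (simp add: regs_def t, intro tr_mono[OF H]) auto
      qed
      have 2: "dt query (AO (off + ?n1) ?n2) B1 (60 * depth t + 4) m [Arith Plus 13 16 11, Arith Plus 22 22 17, Call 3] \<rho>'
        (\<lambda>m' w. w \<le> 60 * cost b + 2 \<and> emitted \<pi> m' (off + ?n1) (outl b))"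
      proof (rule sx_tr)
        have H: "dt query (AO (off + ?n1) ?n2) B1 (60 * (depth r + 1)) m [Call 3] (\<rho>'(13 := real (root r), 22 := real off + real ?n1))
          (\<lambda>m' w. w \<le> 60 * cost b \<and> emitted \<pi> m' (off + ?n1) (outl b))"
          by (rule Sp.IH(2)) (use Sp.prems R * mem in \<open>auto simp: regs_def t\<close>)
        show "sx (AO (off + ?n1) ?n2) B1 (\<lambda>n c \<rho> m. n \<le> 60 * depth t + 4 \<and> dt query (AO (off + ?n1) ?n2) B1 (60 * depth t + 4 - n) m c \<rho>
           (\<lambda>m w. n + w \<le> 60 * cost b + 2 \<and> emitted \<pi> m (off + ?n1) (outl b))) 0 [Arith Plus 13 16 11, Arith Plus 22 22 17, Call 3] \<rho>' m"
          using R by (simp add: regs_def t, intro tr_mono[OF H]) auto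
      qed
      have "dt query (AO off (?n1 + ?n2)) B1 ((60 * depth t + 4) + 0 + 2) m
        [Par [Arith Plus 13 15 11, Call 3] [Arith Plus 13 16 11, Arith Plus 22 22 17, Call 3]] \<rho>'
        (\<lambda>m' w. w \<le> 60 * cost a + 60 * cost b + 5 \<and> emitted \<pi> m' off (outl a @ outl b))"
      proof (rule dt_Par[OF 1 2])
        fix m1 m2 m' w1 w2
        assume 1: "w1 \<le> 60 * cost a + 1 \<and> emitted \<pi> m1 off (outl a)"
          and 2: "w2 \<le> 60 * cost b + 2 \<and> emitted \<pi> m2 (off + ?n1) (outl b)"
          and e1: "\<And>x. x \<notin> AO (off + ?n1) ?n2 \<Longrightarrow> m' x = m1 x" and e2: "\<And>x. x \<notin> AO off ?n1 \<Longrightarrow> m' x = m2 x"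
        have "emitted \<pi> m' off (outl a)" by (rule emitted_cong[OF 1[THEN conjunct2]]) (auto intro!: e1)
        moreover have "emitted \<pi> m' (off + ?n1) (outl b)" by (rule emitted_cong[OF 2[THEN conjunct2]]) (auto intro!: e2)
        ultimately show "dt query (AO off (?n1 + ?n2)) B1 0 m' [] \<rho>' (\<lambda>m w. w1 + w2 + 2 + w \<le> 60 * cost a + 60 * cost b + 5 \<and> emitted \<pi> m off (outl a @ outl b))"
          using 1 2 by (intro tr_Nil) (auto simp: emitted_append)
      qed (auto simp: AO_def B1_def)
      then show ?thesis by (rule tr_mono) auto
    qed
    have "dt query (AO off (length (outl (Sp a b)))) B1 (60 * depth t + 30) m (query ! 3) \<rho>
      (\<lambda>m' w. 1 + w \<le> 60 * cost (Sp a b) \<and> emitted \<pi> m' off (outl (Sp a b)))"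
      unfolding query_nth q_emit_def
      by (rule sx_tr) (use ne Sp.prems(5-7) * mem hold_length[OF *(5)] in \<open>simp add: t regs_def,
        intro tr_mono[OF par], auto simp: t regs_def\<close>)
    then show ?thesis by (rule tr_call) (simp_all add: query_nth t)
  qed
qed

definition AQ :: "address set" where "AQ = {(c, i). (c = 2 \<and> i = 0) \<or> c = 3 \<or> c = 4 \<or> c = 20 \<or> c = 21 \<or> c = 22}"

lemma AQ_iff [simp]: "(c, i) \<in> AQ \<longleftrightarrow> (c = 2 \<and> i = 0) \<or> c = 3 \<or> c = 4 \<or> c = 20 \<or> c = 21 \<or> c = 22"
  by (simp add: AQ_def)

definition result :: "(nat \<Rightarrow> nat) \<Rightarrow> tree \<Rightarrow> nat \<Rightarrow> outcome \<Rightarrow> memory \<Rightarrow> bool" where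
  "result \<pi> t k a m \<longleftrightarrow> hold m t k a \<and> m (2, 0) = real (length (outl a)) \<and> emitted \<pi> m 0 (outl a)"

text \<open>The factor 160 leaves room for 60 of sampling, 60 of output and the fixed part of
  \<open>q_main\<close>, as every outcome has cost at least 1.\<close>

theorem query_tr:
  assumes "rep m v n t" "pos_on v t" "contig t" "disj t" "\<And>j. j \<in> set (lvs t) \<Longrightarrow> m (16, j) = real (\<pi> j)"
    "m (0, 0) = real n" "m (5, 0) = real (root t)" "m (0, 1) = real k"
  shows "tr query AQ UNIV (160 * (depth t + 1) + 40) m (Run [Call 0] (\<lambda>_. 0)) (sampler v t k)
    (\<lambda>a m' w. w \<le> 160 * cost a \<and> result \<pi> t k a m')"
proof -
  let ?d = "depth t"
  let ?R = "\<lambda>\<rho>. regs n \<rho> \<and> \<rho> 13 = real (root t)"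
  have fin: "dt query AQ UNIV 5 m' [Load 17 21 13, Store 2 11 17] \<rho> (\<lambda>m' w. w \<le> 2 \<and> result \<pi> t k a m')"
    if "?R \<rho>" "hold m' t k a" "emitted \<pi> m' 0 (outl a)" for m' \<rho> a
  proof -
    have "hold (m'((2, 0) := real (length (outl a)))) t k a" by (rule hold_cong[OF that(2)]) (auto simp: AS_def)
    moreover have "emitted \<pi> (m'((2, 0) := real (length (outl a)))) 0 (outl a)"
      using that(3) by (simp add: emitted_def)
    ultimately show ?thesis using that hold_length[OF that(2)]
      by (intro sx_tr) (auto simp: regs_def result_def intro!: tr_Nil)
  qed
  have emit: "dt query AQ UNIV (60 * (?d + 1) + 12) m' [Const 22 0, Par [Call 3] [], Load 17 21 13, Store 2 11 17] \<rho>
      (\<lambda>m' w. w \<le> 60 * cost a + 5 \<and> result \<pi> t k a m')"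
    if R: "?R \<rho>" and h: "hold m' t k a" and e: "\<And>x. x \<notin> AS t \<Longrightarrow> m' x = m x \<or> x = (20, root t)" for m' \<rho> a
  proof -
    have rp: "rep m' v n t"
      by (rule rep_cong[OF assms(1)]) (use e in \<open>force simp: AS_def\<close>)
    have p: "m' (16, j) = real (\<pi> j)" if "j \<in> set (lvs t)" for j using e[of "(16, j)"] assms(5)[OF that] by auto
    have E: "dt query (AO 0 (length (outl a))) B1 (60 * (?d + 1)) m' [Call 3] (\<rho>(22 := 0))
      (\<lambda>m' w. w \<le> 60 * cost a \<and> emitted \<pi> m' 0 (outl a))"
      by (rule emit_tr[OF rp assms(4) h p]) (use R in \<open>auto simp: regs_def\<close>)
    have "dt query AQ UNIV (60 * (?d + 1) + 5 + 2) m' [Par [Call 3] [], Load 17 21 13, Store 2 11 17] (\<rho>(22 := 0))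
      (\<lambda>m' w. w \<le> 60 * cost a + 4 \<and> result \<pi> t k a m')"
    proof (rule dt_sub[OF E])
      fix m'' w1 assume 1: "w1 \<le> 60 * cost a \<and> emitted \<pi> m'' 0 (outl a)"
        and f: "\<And>x. x \<notin> AO 0 (length (outl a)) \<Longrightarrow> m'' x = m' x"
      have "hold m'' t k a" by (rule hold_cong[OF h]) (rule f, auto simp: AS_def)
      then show "dt query AQ UNIV 5 m'' [Load 17 21 13, Store 2 11 17] (\<rho>(22 := 0))
        (\<lambda>m w. w1 + 2 + w \<le> 60 * cost a + 4 \<and> result \<pi> t k a m)"
        using R 1 by (intro tr_mono[OF fin]) (auto simp: regs_def)
    qed (auto simp: AO_def)
    then show ?thesis by (intro sx_tr) (auto elim!: tr_mono)
  qed
  let ?m = "m((20, root t) := real k)"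
  have rp: "rep ?m v n t" by (rule rep_cong[OF assms(1)]) auto
  have samp: "tr query AQ UNIV (160 * (?d + 1) + 20) ?m (Run [Par [Call 1] [], Const 22 0, Par [Call 3] [], Load 17 21 13, Store 2 11 17] \<rho>)
      (sampler v t k) (\<lambda>a m' w. w + 20 \<le> 160 * cost a \<and> result \<pi> t k a m')" if R: "?R \<rho>" for \<rho>
  proof -
    have S: "tr query (AS t) (B0 \<union> AS t) (100 * (?d + 1)) ?m (Run [Call 1] \<rho>) (sampler v t k)
      (\<lambda>a m' w. w \<le> 60 * cost a \<and> hold m' t k a)"
      by (rule sample_tr[OF rp assms(2-4)]) (use R in auto)
    have "tr query AQ UNIV (160 * (?d + 1) + 20) ?m (Run [Par [Call 1] [], Const 22 0, Par [Call 3] [], Load 17 21 13, Store 2 11 17] \<rho>)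
      (bind_pmf (sampler v t k) return_pmf) (\<lambda>a m' w. w + 20 \<le> 160 * cost a \<and> result \<pi> t k a m')"
    proof (rule tr_sub'[OF S, where ?T3.0 = "60 * (?d + 1) + 12"])
      fix a m' w1 assume 1: "w1 \<le> 60 * cost a \<and> hold m' t k a" and f: "\<And>x. x \<notin> AS t \<Longrightarrow> m' x = ?m x"
      have c: "cost a \<ge> 1" by (cases a) auto
      have "dt query AQ UNIV (60 * (?d + 1) + 12) m' [Const 22 0, Par [Call 3] [], Load 17 21 13, Store 2 11 17] \<rho>
        (\<lambda>m' w. w \<le> 60 * cost a + 5 \<and> result \<pi> t k a m')"
        by (rule emit) (use R 1 f in auto)
      then have "dt query AQ UNIV (60 * (?d + 1) + 12) m' [Const 22 0, Par [Call 3] [], Load 17 21 13, Store 2 11 17] \<rho>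
        (\<lambda>m' w. w1 + 2 + w + 20 \<le> 160 * cost a \<and> result \<pi> t k a m')"
        by (rule tr_mono) (use 1 c in auto)
      then have "tr query AQ UNIV (60 * (?d + 1) + 12) m' (Run [Const 22 0, Par [Call 3] [], Load 17 21 13, Store 2 11 17] \<rho>)
        (map_pmf (\<lambda>_. a) (return_pmf ())) (\<lambda>a m' w. w1 + 2 + w + 20 \<le> 160 * cost a \<and> result \<pi> t k a m')"
        by (rule tr_map)
      then show "tr query AQ UNIV (60 * (?d + 1) + 12) m' (Run [Const 22 0, Par [Call 3] [], Load 17 21 13, Store 2 11 17] \<rho>)
        (return_pmf a) (\<lambda>a m w. w1 + 2 + w + 20 \<le> 160 * cost a \<and> result \<pi> t k a m)"
        by simp
    qed (auto simp: AS_def)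
    then show ?thesis by (simp add: bind_return_pmf')
  qed
  have F: "tr query AQ UNIV (160 * (?d + 1) + 20) ?m (Run [Par [Call 1] [], Const 22 0, Par [Call 3] [], Load 17 21 13, Store 2 11 17]
      ((\<lambda>_. 0) (10 := 1, 11 := 0, 23 := 2, 12 := real n, 13 := real (root t), 14 := real k)))
      (sampler v t k) (\<lambda>a m' w. w + 20 \<le> 160 * cost a \<and> result \<pi> t k a m')"
    by (rule samp) (auto simp: regs_def)
  have "tr query AQ UNIV (160 * (?d + 1) + 30) m (Run (query ! 0) (\<lambda>_. 0)) (sampler v t k)
    (\<lambda>a m' w. 1 + w \<le> 160 * cost a \<and> result \<pi> t k a m')"
    unfolding query_nth q_main_def
    by (rule sx_tr) (simp add: assms(6-8)[unfolded One_nat_def], rule tr_mono[OF F[unfolded One_nat_def]], simp_all)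
  then show ?thesis by (rule tr_call) (simp_all add: query_nth)
qed

text \<open>The memory is mentioned only at cell (0, 0) and in arrays 5 and 10 to 16, none of which
  a query writes. The machine sees the tree \<open>flat T\<close>; its division into groups enters
  only through the existence of \<open>T\<close>.\<close>

definition DS :: "nat \<Rightarrow> (nat \<Rightarrow> real) \<Rightarrow> memory \<Rightarrow> bool" where
  "DS n w m \<longleftrightarrow> (\<exists>T \<pi> \<beta> L. m (0, 0) = real n \<and> bij_betw \<pi> {..<n} {..<n} \<and> (\<forall>j<n. m (16, j) = real (\<pi> j)) \<and>
     rep m (\<lambda>j. w (\<pi> j)) n (flat T) \<and> m (5, 0) = real (root (flat T)) \<and> disj (flat T) \<and> lvs (flat T) = [0..<n] \<and>
     (\<forall>g\<in>set (groups T). near (\<lambda>j. w (\<pi> j)) (\<beta> g) g \<and> (\<exists>h. lev h g)) \<and>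
     sorted_wrt (\<lambda>g g'. 2 * \<beta> g \<le> \<beta> g') (groups T) \<and>
     n \<le> 2 ^ L \<and> real L \<le> log 2 n + 1 \<and> depth (flat T) \<le> 2 * L \<and> tdepth T \<le> L)"

lemma DS_cong:
  assumes "DS n w m" "m' (0, 0) = m (0, 0)" "\<And>a i. 5 \<le> a \<Longrightarrow> a \<le> 16 \<Longrightarrow> m' (a, i) = m (a, i)"
  shows "DS n w m'"
proof -
  have "rep m' v n t" if "rep m v n t" for v t
    by (rule rep_cong[OF that]) (use assms(3) in auto)
  note rp = this
  obtain T \<pi> \<beta> L where D: "m (0, 0) = real n" "bij_betw \<pi> {..<n} {..<n}" "\<forall>j<n. m (16, j) = real (\<pi> j)"
    "rep m (\<lambda>j. w (\<pi> j)) n (flat T)" "m (5, 0) = real (root (flat T))" "disj (flat T)" "lvs (flat T) = [0..<n]"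
    "\<forall>g\<in>set (groups T). near (\<lambda>j. w (\<pi> j)) (\<beta> g) g \<and> (\<exists>h. lev h g)"
    "sorted_wrt (\<lambda>g g'. 2 * \<beta> g \<le> \<beta> g') (groups T)"
    "n \<le> 2 ^ L" "real L \<le> log 2 n + 1" "depth (flat T) \<le> 2 * L" "tdepth T \<le> L"
    using assms(1) unfolding DS_def by blast
  have "m' (0, 0) = real n" "\<forall>j<n. m' (16, j) = real (\<pi> j)" "m' (5, 0) = real (root (flat T))"
    using D(1,3,5) assms(2,3) by simp_all
  then show ?thesis unfolding DS_def using D(2,6-) rp[OF D(4)] by blast
qed

text \<open>The memory fixes the list of items and their counts, so it represents one multiset only.
  This turns the probability of \<open>outputs\<close> into a point mass of the law.\<close>

lemma outputs_unique:
  assumes "outputs m S" "outputs m S'"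
  shows "S = S'"
proof -
  obtain xs where xs: "distinct xs" "set xs = set_mset S" "m (2, 0) = real (length xs)"
    "\<forall>j<length xs. m (3, j) = real (xs ! j) \<and> m (4, j) = real (count S (xs ! j))"
    using assms(1) unfolding outputs_def by blast
  obtain ys where ys: "distinct ys" "set ys = set_mset S'" "m (2, 0) = real (length ys)"
    "\<forall>j<length ys. m (3, j) = real (ys ! j) \<and> m (4, j) = real (count S' (ys ! j))"
    using assms(2) unfolding outputs_def by blast
  have eq: "xs = ys" using xs ys by (intro nth_equalityI) auto
  show ?thesis
  proof (rule multiset_eqI)
    fix x
    show "count S x = count S' x"
    proof (cases "x \<in> set xs")
      case True
      then obtain j where "j < length xs" "xs ! j = x" by (auto simp: in_set_conv_nth)
      then show ?thesis using xs(4) ys(4) eq by auto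
    next
      case False
      then show ?thesis using xs(2) ys(2) eq by (metis count_eq_zero_iff)
    qed
  qed
qed

lemma result_outputs:
  assumes "result \<pi> t k a m" "distinct (lvs t)" "inj_on \<pi> (set (lvs t))"
  shows "outputs m S \<longleftrightarrow> image_mset \<pi> (oms a) = S"
proof -
  have h: "hold m t k a" and len: "m (2, 0) = real (length (outl a))" and em: "emitted \<pi> m 0 (outl a)"
    using assms(1) by (auto simp: result_def)
  note o = hold_oms[OF h assms(2)]
  let ?xs = "map (\<lambda>x. \<pi> (fst x)) (outl a)"
  have cnt: "count (image_mset \<pi> (oms a)) (\<pi> p) = c" if "(p, c) \<in> set (outl a)" for p c
  proof -
    have p: "p \<in> set (lvs t)" "p \<in># oms a" using o that by force+
    have "\<pi> -` {\<pi> p} \<inter> set_mset (oms a) = {p}"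
    proof (intro equalityI subsetI)
      fix q assume "q \<in> \<pi> -` {\<pi> p} \<inter> set_mset (oms a)"
      then have "q \<in> set (lvs t)" "\<pi> q = \<pi> p" using o by auto
      then show "q \<in> {p}" using inj_onD[OF assms(3)] p by blast
    qed (use p in auto)
    then show ?thesis using o that unfolding count_image_mset by auto
  qed
  have "outputs m (image_mset \<pi> (oms a))"
    unfolding outputs_def
  proof (intro exI[of _ ?xs] conjI allI impI)
    have "inj_on \<pi> (fst ` set (outl a))" using assms(3) o inj_on_subset by blast
    then show "distinct ?xs" using o by (simp add: distinct_map inj_on_def comp_inj_on_iff[symmetric])
    show "set ?xs = set_mset (image_mset \<pi> (oms a))" using o by auto
    show "m (2, 0) = real (length ?xs)" using len by simp
    fix j assume j: "j < length ?xs"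
    show "m (3, j) = real (?xs ! j)" using em j by (simp add: emitted_def)
    have "(fst (outl a ! j), snd (outl a ! j)) \<in> set (outl a)" using j by simp
    from cnt[OF this] show "m (4, j) = real (count (image_mset \<pi> (oms a)) (?xs ! j))"
      using em j by (simp add: emitted_def)
  qed
  then show ?thesis using outputs_unique by blast
qed

lemma map_iid: "map_pmf (image_mset f) (iid k p) = iid k (map_pmf f p)"
proof (induction k)
  case (Suc k)
  have "map_pmf (image_mset f) (iid (Suc k) p) = bind_pmf p (\<lambda>x. map_pmf (add_mset (f x)) (map_pmf (image_mset f) (iid k p)))"
    unfolding iid_Suc map_bind_pmf by (simp add: pmf.map_comp o_def)
  then show ?case unfolding Suc.IH unfolding iid_Suc bind_map_pmf .
qed simp

lemma item_pmf_lp: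
  assumes "n \<ge> 1" "\<And>i. i < n \<Longrightarrow> 0 < w i" "bij_betw \<pi> {..<n} {..<n}" "lvs t = [0..<n]"
  defines "v \<equiv> \<lambda>j. w (\<pi> j)"
  shows "map_pmf \<pi> (lp v t) = item_pmf n w" "mass v t = (\<Sum>i<n. w i)"
proof -
  have s: "set (lvs t) = {..<n}" using assms(4) by auto
  have \<pi>: "\<pi> j < n" if "j < n" for j using assms(3) that unfolding bij_betw_def by auto
  have pos: "pos_on v t" using assms(2) \<pi> by (simp add: pos_on_def s v_def)
  have d: "distinct (lvs t)" using assms(4) by simp
  have "mass v t = (\<Sum>j<n. v j)" by (simp add: mass_def assms(4) interv_sum_list_conv_sum_set_nat atLeast0LessThan)
  also have "\<dots> = (\<Sum>i<n. w i)" unfolding v_def by (rule sum.reindex_bij_betw[OF assms(3)])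
  finally show m: "mass v t = (\<Sum>i<n. w i)" .
  have M: "mass v t > 0" using pos pos_mass by blast
  have set: "set_pmf (lp v t) = {..<n}"
  proof -
    have vj: "0 < v j" if "j < n" for j using pos that unfolding pos_on_def s by blast
    have "pmf (lp v t) j \<noteq> 0 \<longleftrightarrow> j < n" for j
      using M vj[of j] unfolding pmf_lp[OF pos d] s by (cases "j < n") auto
    then show ?thesis by (intro set_eqI) (simp only: set_pmf_iff lessThan_iff)
  qed
  show "map_pmf \<pi> (lp v t) = item_pmf n w"
  proof (rule pmf_eqI)
    fix i
    show "pmf (map_pmf \<pi> (lp v t)) i = pmf (item_pmf n w) i"
    proof (cases "i < n")
      case True
      then obtain j where j: "j < n" "i = \<pi> j" using assms(3) unfolding bij_betw_def by auto
      have "pmf (map_pmf \<pi> (lp v t)) (\<pi> j) = pmf (lp v t) j"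
      proof (rule pmf_map_inj)
        show "inj_on \<pi> (set_pmf (lp v t))" unfolding set by (rule bij_betw_imp_inj_on[OF assms(3)])
        show "j \<in> set_pmf (lp v t)" unfolding set using j(1) by (rule lessThan_iff[THEN iffD2])
      qed
      also have "\<dots> = w (\<pi> j) / (\<Sum>i<n. w i)" using j(1) unfolding pmf_lp[OF pos d] s m by (simp add: v_def)
      finally show ?thesis using True j(2) pmf_item_pmf[of n w, OF assms(1,2), of i] by (simp only: if_True)
    next
      case False
      then have "i \<notin> set_pmf (map_pmf \<pi> (lp v t))" using set \<pi> by auto
      then have "pmf (map_pmf \<pi> (lp v t)) i = 0" by (simp only: set_pmf_iff not_not)
      then show ?thesis using False pmf_item_pmf[of n w, OF assms(1,2), of i] by simp
    qed
  qed
qed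

lemma rel_pmf_expectation:
  fixes f :: "'a \<Rightarrow> real" and g :: "'b \<Rightarrow> real"
  assumes "rel_pmf R p q" "finite (set_pmf p)" "finite (set_pmf q)" "\<And>x y. R x y \<Longrightarrow> f x \<le> g y"
  shows "E p f \<le> E q g"
proof -
  obtain pq where pq: "\<And>x y. (x, y) \<in> set_pmf pq \<Longrightarrow> R x y" "map_pmf fst pq = p" "map_pmf snd pq = q"
    using assms(1) by (auto simp: rel_pmf.simps)
  have "set_pmf pq \<subseteq> set_pmf p \<times> set_pmf q"
    unfolding pq(2,3)[symmetric] by force
  then have fin: "finite (set_pmf pq)" using assms(2,3) finite_subset finite_cartesian_product by blast
  have "E pq (\<lambda>x. f (fst x)) \<le> E pq (\<lambda>x. g (snd x))"
    by (rule E_mono[OF fin]) (use pq(1) assms(4) in force)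
  then show ?thesis unfolding pq(2)[symmetric] pq(3)[symmetric] by simp
qed

lemma rel_pmf_prob:
  assumes "rel_pmf R p q" "\<And>x y. R x y \<Longrightarrow> x \<in> A \<longleftrightarrow> y \<in> B"
  shows "measure_pmf.prob p A = measure_pmf.prob q B"
proof -
  obtain pq where pq: "\<And>x y. (x, y) \<in> set_pmf pq \<Longrightarrow> R x y" "map_pmf fst pq = p" "map_pmf snd pq = q"
    using assms(1) by (auto simp: rel_pmf.simps)
  have "measure_pmf.prob pq (fst -` A) = measure_pmf.prob pq (snd -` B)"
    by (rule measure_pmf.finite_measure_eq_AE) (use pq(1) assms(2) in \<open>auto simp: AE_measure_pmf_iff\<close>)
  then show ?thesis unfolding pq(2)[symmetric] pq(3)[symmetric] by simp
qed

lemma iid_sample: "sample_pmf k n w = iid k (item_pmf n w)"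
  by (simp add: sample_pmf_def iid_def)

text \<open>The bound on \<open>C\<close> is dominated by 160 * 80 * 2 = 25600: work per unit of
  \<open>cost\<close>, the factor of \<open>hits\<close> in \<open>ecost_bound\<close>, and the
  comparison of \<open>hits\<close> with the expected number of distinct items.\<close>

theorem query_samples:
  assumes "n \<ge> 1" "\<And>i. i < n \<Longrightarrow> 0 < w i" "C \<ge> 30000"
  shows "samples_from query (DS n w) k (sample_pmf k n w) (C * (1 + log 2 n))
    (C * (E (sample_pmf k n w) (\<lambda>S. real (card (set_mset S))) + log 2 n + 1))"
  unfolding samples_from_def Let_def
proof (intro allI impI)
  fix m0 assume "DS n w m0"
  define m where "m = m0((0, 1) := real k)"
  have ds: "DS n w m" by (rule DS_cong[OF \<open>DS n w m0\<close>]) (auto simp: m_def)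
  then obtain T \<pi> \<beta> L where D: "m (0, 0) = real n" "bij_betw \<pi> {..<n} {..<n}" "\<forall>j<n. m (16, j) = real (\<pi> j)"
    "rep m (\<lambda>j. w (\<pi> j)) n (flat T)" "m (5, 0) = real (root (flat T))" "disj (flat T)" "lvs (flat T) = [0..<n]"
    "\<forall>g\<in>set (groups T). near (\<lambda>j. w (\<pi> j)) (\<beta> g) g \<and> (\<exists>h. lev h g)"
    "sorted_wrt (\<lambda>g g'. 2 * \<beta> g \<le> \<beta> g') (groups T)"
    "n \<le> 2 ^ L" "real L \<le> log 2 n + 1" "depth (flat T) \<le> 2 * L" "tdepth T \<le> L"
    unfolding DS_def by blast
  let ?t = "flat T"
  define v where "v = (\<lambda>j. w (\<pi> j))"
  have \<pi>: "\<pi> j < n" if "j < n" for j using D(2) that unfolding bij_betw_def by auto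
  have s: "set (lvs ?t) = {..<n}" using D(7) by auto
  have pos: "pos_on v ?t" using assms(2) \<pi> by (simp add: pos_on_def s v_def)
  have con: "contig ?t" using assms(1) by (simp add: contig_def D(7) cnt_def lo_def)
  have dist: "distinct (lvs ?t)" using D(7) by simp
  have inj: "inj_on \<pi> (set (lvs ?t))" using D(2) unfolding s bij_betw_def by blast
  have log0: "0 \<le> log 2 n" using assms(1) by simp
  let ?Q = "\<lambda>a m' w. (w \<le> 160 * cost a \<and> result \<pi> ?t k a m') \<and> (\<forall>x. x \<notin> AQ \<longrightarrow> m' x = m x)"
  have tr: "tr query AQ UNIV (160 * (depth ?t + 1) + 40) m (Run [Call 0] (\<lambda>_. 0)) (sampler v ?t k) ?Q"
    by (rule tr_frame[OF query_tr]) (use D pos con in \<open>auto simp: v_def s m_def\<close>)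
  have time: "160 * (depth ?t + 1) + 40 \<le> nat \<lfloor>C * (1 + log 2 n)\<rfloor>"
  proof -
    have "real (depth ?t) \<le> 2 * real L" using D(12) by linarith
    then have "real (160 * (depth ?t + 1) + 40) \<le> 320 * (log 2 n + 1) + 200" using D(11) by simp
    also have "\<dots> \<le> 30000 * (1 + log 2 n)" using log0 by simp
    also have "\<dots> \<le> C * (1 + log 2 n)" using assms(3) log0 by (intro mult_right_mono) auto
    finally show ?thesis by (metis le_nat_floor)
  qed
  let ?X = "execute query m (C * (1 + log 2 n))"
  let ?rel = "\<lambda>x a. \<exists>\<sigma>. x = Some \<sigma> \<and> halted \<sigma> \<and> (\<exists>w. work \<sigma> = 0 + w \<and> ?Q a (shared \<sigma>) w)"
  have rel: "rel_pmf ?rel ?X (sampler v ?t k)"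
    unfolding execute_def by (rule tr_adequate[OF tr time])
  have 1: "\<exists>\<sigma>. x = Some \<sigma> \<and> halted \<sigma> \<and> DS n w (shared \<sigma>)" if x: "x \<in> set_pmf ?X" for x
  proof -
    obtain a where "?rel x a" using rel_setD1[OF rel_pmf_imp_rel_set[OF rel] x] by blast
    then obtain \<sigma> where \<sigma>: "x = Some \<sigma>" "halted \<sigma>" "\<forall>x. x \<notin> AQ \<longrightarrow> shared \<sigma> x = m x" by blast
    have "DS n w (shared \<sigma>)" by (rule DS_cong[OF ds]) (use \<sigma>(3) in auto)
    then show ?thesis using \<sigma> by blast
  qed
  have 2: "measure_pmf.prob ?X {x. outputs (shared (the x)) S} = pmf (sample_pmf k n w) S" for S
  proof -
    have "measure_pmf.prob ?X {x. outputs (shared (the x)) S} =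
        measure_pmf.prob (sampler v ?t k) ((\<lambda>a. image_mset \<pi> (oms a)) -` {S})"
      by (rule rel_pmf_prob[OF rel]) (use result_outputs[OF _ dist inj] in auto)
    also have "\<dots> = pmf (map_pmf (\<lambda>a. image_mset \<pi> (oms a)) (sampler v ?t k)) S"
      by (simp add: pmf_map)
    also have "map_pmf (\<lambda>a. image_mset \<pi> (oms a)) (sampler v ?t k) = map_pmf (image_mset \<pi>) (map_pmf oms (sampler v ?t k))"
      by (simp add: pmf.map_comp o_def)
    also have "\<dots> = sample_pmf k n w"
      unfolding sampler_law[OF pos con] map_iid iid_sample
      using item_pmf_lp(1)[of n w, OF assms(1,2) D(2,7)] by (simp add: v_def)
    finally show ?thesis .
  qed
  have 3: "E ?X (\<lambda>x. real (work (the x))) \<le> C * (E (sample_pmf k n w) (\<lambda>S. real (card (set_mset S))) + log 2 n + 1)"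
  proof -
    let ?S = "E (sample_pmf k n w) (\<lambda>S. real (card (set_mset S)))"
    have S0: "0 \<le> ?S" by (rule Bochner_Integration.integral_nonneg) simp
    have "E ?X (\<lambda>x. real (work (the x))) \<le> E (sampler v ?t k) (\<lambda>a. 160 * real (cost a))"
      by (rule rel_pmf_expectation[OF rel finite_execute finite_sampler[OF pos con]]) auto
    then have e1: "E ?X (\<lambda>x. real (work (the x))) \<le> 160 * ecost v ?t k" by simp
    have e2: "ecost v ?t k \<le> 1 + 80 * hits v (k / mass v ?t) ?t + 4 * real L + 4 * (real (tdepth T) + 1)"
      using ecost_bound[OF con _ D(9), of v L k] D(8,10) by (simp add: v_def D(7) cnt_def)
    have e3: "hits v (k / mass v ?t) ?t \<le> 2 * ?S"
    proof -
      have "hits v (k / mass v ?t) ?t = (\<Sum>j<n. min 1 (k / mass v ?t * v j))"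
        by (simp add: hits_def D(7) interv_sum_list_conv_sum_set_nat atLeast0LessThan)
      also have "\<dots> = (\<Sum>i<n. min 1 (k / mass v ?t * w i))"
        unfolding v_def by (rule sum.reindex_bij_betw[OF D(2), of "\<lambda>i. min 1 (k / mass (\<lambda>j. w (\<pi> j)) ?t * w i)"])
      also have "\<dots> = (\<Sum>i<n. min 1 (k * pmf (item_pmf n w) i))"
        using item_pmf_lp(2)[of n w, OF assms(1,2) D(2,7)] pmf_item_pmf[of n w, OF assms(1,2)] by (simp add: v_def)
      also have "\<dots> \<le> 2 * ?S" unfolding iid_sample
        by (rule distinct_expectation) (simp, metis (no_types, lifting) lessThan_iff pmf_item_pmf[of n w, OF assms(1,2)] set_pmf_iff subsetI)
      finally show ?thesis .
    qed
    have "E ?X (\<lambda>x. real (work (the x))) \<le> 160 * (1 + 80 * (2 * ?S) + 4 * real L + 4 * (real (tdepth T) + 1))"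
      using e1 e2 e3 unfolding distrib_left by linarith
    moreover have "real (tdepth T) \<le> real L" using D(13) by simp
    ultimately have "E ?X (\<lambda>x. real (work (the x))) \<le> 160 * (5 + 160 * ?S + 8 * (log 2 n + 1))"
      using D(11) by (simp add: algebra_simps)
    also have "\<dots> \<le> 30000 * (?S + log 2 n + 1)" using S0 log0 by simp
    also have "\<dots> \<le> C * (?S + log 2 n + 1)" using assms(3) log0 S0 by (intro mult_right_mono) auto
    finally show ?thesis .
  qed
  show "(\<forall>x\<in>set_pmf (execute query (m0((0, 1) := real k)) (C * (1 + log 2 (real n)))).
       \<exists>\<sigma>. x = Some \<sigma> \<and> halted \<sigma> \<and> DS n w (shared \<sigma>)) \<and>
    (\<forall>S. measure_pmf.prob (execute query (m0((0, 1) := real k)) (C * (1 + log 2 (real n))))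
       {x. outputs (shared (the x)) S} = pmf (sample_pmf k n w) S) \<and>
    E (execute query (m0((0, 1) := real k)) (C * (1 + log 2 (real n)))) (\<lambda>x. real (work (the x)))
      \<le> C * (E (sample_pmf k n w) (\<lambda>S. real (card (set_mset S))) + log 2 (real n) + 1)"
    using 1 2 3 unfolding m_def by blast
qed

section \<open>Parallel loops and balanced trees\<close>

text \<open>The rounded-up binary logarithm of a positive \<open>t\<close>. The machine has no
  division with rounding, so ranges are halved through powers of two, and positions beyond the end
  are cut off by comparisons.\<close>

definition hh :: "nat \<Rightarrow> nat" where "hh t = (LEAST h. t \<le> 2 ^ h)"

lemma hh_le: "t \<le> 2 ^ hh t"
  unfolding hh_def by (rule LeastI_ex) (meson less_exp less_imp_le)

lemma hh_gt: "h < hh t \<Longrightarrow> 2 ^ h < t"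
  unfolding hh_def using not_less_Least by (metis not_le)

lemma hh_bound:
  assumes "t \<ge> 1"
  shows "2 ^ hh t \<le> 2 * t" "real (hh t) \<le> log 2 t + 1"
proof -
  show 1: "2 ^ hh t \<le> 2 * t"
  proof (cases "hh t")
    case 0
    then show ?thesis using assms by simp
  next
    case (Suc h)
    then show ?thesis using hh_gt[of h t] by simp
  qed
  have "real (2 ^ hh t) \<le> 2 * real t" using 1 by (metis of_nat_le_iff of_nat_mult of_nat_numeral)
  then have "log 2 (2 ^ hh t) \<le> log 2 (2 * real t)" using assms by (intro log_mono) auto
  then show "real (hh t) \<le> log 2 t + 1" using assms by (simp add: log_mult log_nat_power)
qed

definition p_double :: "instr list" where
  "p_double = [IfLess 21 20 [Arith Plus 21 21 21, Call 1] []]"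

definition p_build :: "instr list" where
  "p_build = [IfLess 14 13 []
     [Arith Divide 14 14 13, Arith Plus 16 15 14,
      IfLess 16 18 [Par [Call 2] [Arith Plus 15 16 11, Call 2], Call 3] [Call 2]]]"

definition p_merge :: "instr list" where
  "p_merge = [Load 20 30 15, Load 21 30 16,
     IfLess 21 11 []
      [IfLess 20 11 [Store 30 15 21]
        [Arith Plus 22 19 16, Store 10 22 20, Store 11 22 21,
         Load 23 12 20, Load 24 12 21, Arith Plus 23 23 24, Store 12 22 23,
         Load 23 13 20, Load 24 13 21, IfLess 23 24 [Store 13 22 24] [Store 13 22 23],
         Load 23 31 20, Load 24 31 21, IfLess 24 23 [Store 31 22 24] [Store 31 22 23],
         Load 23 14 20, Store 14 22 23,
         Load 23 15 20, Load 24 15 21, Arith Plus 23 23 24, Store 15 22 23,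
         Store 30 15 22]]]"

definition p_for :: "nat \<Rightarrow> instr list \<Rightarrow> instr list" where
  "p_for f body = [IfLess 14 13 [IfLess 15 12 body []]
     [Arith Divide 14 14 13, Par [Call f] [Arith Plus 15 15 14, Call f]]]"

definition for_regs :: "nat \<Rightarrow> registers \<Rightarrow> bool" where
  "for_regs n \<rho> \<longleftrightarrow> \<rho> 10 = 1 \<and> \<rho> 11 = 0 \<and> \<rho> 12 = real n \<and> \<rho> 13 = 2"

text \<open>A doubling takes three instructions and the final failing test two. The continuation
  \<open>b\<close> belongs to the statement because the procedure calls itself in front of
  it.\<close>

lemma double_tr:
  assumes "1 < length P" "P ! 1 = p_double" "\<rho> 20 = real t" "\<rho> 21 = 2 ^ h" "t \<le> 2 ^ (h + d)"
    and "\<And>i. i < d \<Longrightarrow> 2 ^ (h + i) < t"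
    and "tr P A B T m (Run b (\<rho>(21 := 2 ^ (h + d)))) \<mu> (\<lambda>a m w. Q a m (3 * d + 2 + w))"
  shows "tr P A B (T + 3 * d + 2) m (Run (Call 1 # b) \<rho>) \<mu> Q"
  using assms(3-)
proof (induction d arbitrary: h \<rho> Q)
  case 0
  have e: "\<rho>(21 := 2 ^ h) = \<rho>" using 0 by auto
  have lt: "\<not> (2::real) ^ h < real t" using 0(3) by (simp add: not_less)
  have "tr P A B T m (Run b \<rho>) \<mu> (\<lambda>a m w. Q a m (2 + w))" using 0(5) e by simp
  then have "tr P A B (Suc T) m (Run (p_double @ b) \<rho>) \<mu> (\<lambda>a m w. Q a m (1 + w))"
    unfolding p_double_def append_Cons append_Nil
    by (intro tr_step1[where ws = "[]"]) (use 0 lt in auto)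
  then have "tr P A B (Suc (Suc T)) m (Run (Call 1 # b) \<rho>) \<mu> Q"
    by (intro tr_Call) (use assms in auto)
  then show ?case by simp
next
  case (Suc d)
  have lt: "(2::real) ^ h < real t" using Suc.prems(4)[of 0] by (metis add_0_right of_nat_less_iff of_nat_numeral of_nat_power zero_less_Suc)
  have "tr P A B (T + 3 * d + 2) m (Run (Call 1 # b) (\<rho>(21 := 2 ^ Suc h))) \<mu> (\<lambda>a m w. Q a m (3 + w))"
  proof (rule Suc.IH)
    show "2 ^ (Suc h + i) < t" if "i < d" for i using Suc.prems(4)[of "Suc i"] that by simp
    show "tr P A B T m (Run b ((\<rho>(21 := 2 ^ Suc h))(21 := 2 ^ (Suc h + d)))) \<mu> (\<lambda>a m w. Q a m (3 + (3 * d + 2 + w)))"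
    proof -
      have e: "(\<rho>(21 := 2 ^ Suc h))(21 := 2 ^ (Suc h + d)) = \<rho>(21 := 2 ^ (h + Suc d))" by simp
      show ?thesis unfolding e by (rule tr_mono[OF Suc.prems(5)]) (auto simp: add.commute add.left_commute)
    qed
  qed (use Suc.prems in auto)
  then have "tr P A B (Suc (T + 3 * d + 2)) m (Run (Arith Plus 21 21 21 # Call 1 # b) \<rho>) \<mu> (\<lambda>a m w. Q a m (2 + w))"
    by (intro tr_step1[where ws = "[]"]) (use Suc.prems in \<open>auto simp: numeral_3_eq_3\<close>)
  then have "tr P A B (Suc (Suc (T + 3 * d + 2))) m (Run (p_double @ b) \<rho>) \<mu> (\<lambda>a m w. Q a m (1 + w))"
    unfolding p_double_def append_Cons append_Nil
    by (intro tr_step1[where ws = "[]"]) (use Suc.prems lt in auto)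
  then have "tr P A B (Suc (Suc (Suc (T + 3 * d + 2)))) m (Run (Call 1 # b) \<rho>) \<mu> Q"
    by (intro tr_Call) (use assms in auto)
  then show ?case by (rule tr_mono) auto
qed

lemma dt_Par':
  assumes "dt P A1 D1 T1 m b1 \<rho> Q1" "dt P A2 D2 T1 m b2 \<rho> Q2" "T1 + T3 + 2 \<le> T"
    and "A1 \<subseteq> A" "A2 \<subseteq> A" "D1 \<subseteq> B" "D2 \<subseteq> B" "A1 \<inter> A2 = {}" "D1 \<inter> A2 = {}" "D2 \<inter> A1 = {}"
    and "\<And>m1 m2 m' w1 w2. Q1 m1 w1 \<Longrightarrow> Q2 m2 w2 \<Longrightarrow>
      (\<And>x. x \<notin> A2 \<Longrightarrow> m' x = m1 x) \<Longrightarrow> (\<And>x. x \<notin> A1 \<Longrightarrow> m' x = m2 x) \<Longrightarrow>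
      (\<And>x. x \<notin> A1 \<Longrightarrow> x \<notin> A2 \<Longrightarrow> m' x = m x) \<Longrightarrow> dt P A B T3 m' b \<rho> (\<lambda>m w. Q m (w1 + w2 + 2 + w))"
  shows "dt P A B T m (Par b1 b2 # b) \<rho> Q"
  by (rule tr_mono[OF dt_Par[OF assms(1,2,4-11)]]) (use assms(3) in auto)

text \<open>Premise \<open>loc\<close> asks that the result of an iteration survives the writes of
  all others. The slack in \<open>w + 10\<close> makes the induction work: two halves bring 20 of
  it, and half of that pays for the node that forks them.\<close>

lemma parfor_dt:
  assumes P: "f < length P" "P ! f = p_for f body"
    and body: "\<And>j \<rho>. j < n \<Longrightarrow> for_regs n \<rho> \<Longrightarrow> \<rho> 15 = real j \<Longrightarrow>
      dt P (A j) (B j) Tb m body \<rho> (\<lambda>m' w. w \<le> W j \<and> Q j m')"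
    and dis: "\<And>i j. i < n \<Longrightarrow> j < n \<Longrightarrow> i \<noteq> j \<Longrightarrow> A i \<inter> A j = {} \<and> A i \<inter> B j = {}"
    and loc: "\<And>j m m'. j < n \<Longrightarrow> Q j m \<Longrightarrow> (\<And>x. x \<notin> (\<Union>i\<in>{..<n} - {j}. A i) \<Longrightarrow> m' x = m x) \<Longrightarrow> Q j m'"
    and \<rho>: "for_regs n \<rho>" "\<rho> 14 = 2 ^ h" "\<rho> 15 = real s"
  shows "dt P (\<Union>j\<in>{s..<min (s + 2 ^ h) n}. A j) (\<Union>j\<in>{s..<min (s + 2 ^ h) n}. B j) (Tb + 10 * (h + 1)) m [Call f] \<rho>
    (\<lambda>m' w. w + 10 \<le> (\<Sum>j\<in>{s..<min (s + 2 ^ h) n}. W j) + 20 * 2 ^ h \<and> (\<forall>j\<in>{s..<min (s + 2 ^ h) n}. Q j m'))"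
  using \<rho>
proof (induction h arbitrary: s \<rho>)
  case 0
  let ?I = "{s..<min (s + 2 ^ 0) n}"
  have "dt P (\<Union>j\<in>?I. A j) (\<Union>j\<in>?I. B j) (Tb + 9) m (P ! f) \<rho>
    (\<lambda>m' w. 1 + w + 10 \<le> (\<Sum>j\<in>?I. W j) + 20 * 2 ^ 0 \<and> (\<forall>j\<in>?I. Q j m'))"
  proof (cases "s < n")
    case True
    then have I: "?I = {s}" by auto
    have b: "dt P (A s) (B s) Tb m body \<rho> (\<lambda>m' w. w \<le> W s \<and> Q s m')" using body True 0 by auto
    have X: "dt P (A s) (B s) (Suc Tb) m [IfLess 15 12 body []] \<rho> (\<lambda>m' w. w \<le> W s + 1 \<and> Q s m')"
      by (rule tr_step1[where ws = "[]" and b' = body and \<rho>' = \<rho>])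
        (use 0 True tr_mono[OF b order_refl order_refl order_refl] in \<open>auto simp: for_regs_def\<close>)
    have "dt P (A s) (B s) (Suc (Suc Tb)) m [IfLess 14 13 [IfLess 15 12 body []]
       [Arith Divide 14 14 13, Par [Call f] [Arith Plus 15 15 14, Call f]]] \<rho> (\<lambda>m' w. w \<le> W s + 2 \<and> Q s m')"
      by (rule tr_step1[where ws = "[]" and b' = "[IfLess 15 12 body []]" and \<rho>' = \<rho>])
        (use 0 tr_mono[OF X order_refl order_refl order_refl] in \<open>auto simp: for_regs_def\<close>)
    then show ?thesis unfolding P p_for_def I by (rule tr_mono) auto
  next
    case False
    then have I: "?I = {}" by auto
    show ?thesis unfolding P p_for_def I
      by (rule sx_tr) (use 0 False in \<open>auto simp: for_regs_def intro!: tr_Nil\<close>)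
  qed
  then show ?case by (rule tr_call) (use P in auto)
next
  case (Suc h)
  let ?I = "{s..<min (s + 2 ^ Suc h) n}" and ?I1 = "{s..<min (s + 2 ^ h) n}"
    and ?I2 = "{s + 2 ^ h..<min (s + 2 ^ h + 2 ^ h) n}"
  have I: "?I = ?I1 \<union> ?I2" "?I1 \<inter> ?I2 = {}" by auto
  have sumI: "(\<Sum>j\<in>?I. W j) = (\<Sum>j\<in>?I1. W j) + (\<Sum>j\<in>?I2. W j)"
    unfolding I(1) by (rule sum.union_disjoint) (use I in auto)
  let ?A = "\<lambda>I. \<Union>j\<in>I. A j" and ?B = "\<lambda>I. \<Union>j\<in>I. B j"
  have ne: "i < n \<and> j < n \<and> i \<noteq> j \<and> j < n" if "i \<in> ?I1" "j \<in> ?I2" for i j using that by auto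
  have par: "dt P (?A ?I) (?B ?I) (Tb + 10 * (h + 1) + 5) m [Par [Call f] [Arith Plus 15 15 14, Call f]] \<rho>'
     (\<lambda>m' w. w + 13 \<le> (\<Sum>j\<in>?I. W j) + 20 * 2 ^ Suc h \<and> (\<forall>j\<in>?I. Q j m'))"
    if R: "for_regs n \<rho>'" "\<rho>' 14 = 2 ^ h" "\<rho>' 15 = real s" for \<rho>'
  proof (rule dt_Par'[where ?T1.0 = "Tb + 10 * (h + 1) + 1" and ?T3.0 = 0 and ?A1.0 = "?A ?I1" and ?A2.0 = "?A ?I2"
        and ?D1.0 = "?B ?I1" and ?D2.0 = "?B ?I2"])
    have "dt P (?A ?I1) (?B ?I1) (Tb + 10 * (h + 1)) m [Call f] \<rho>'
      (\<lambda>m' w. w + 10 \<le> (\<Sum>j\<in>?I1. W j) + 20 * 2 ^ h \<and> (\<forall>j\<in>?I1. Q j m'))"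
      by (rule Suc.IH[OF R])
    then show "dt P (?A ?I1) (?B ?I1) (Tb + 10 * (h + 1) + 1) m [Call f] \<rho>'
      (\<lambda>m' w. w + 10 \<le> (\<Sum>j\<in>?I1. W j) + 20 * 2 ^ h \<and> (\<forall>j\<in>?I1. Q j m'))" by (rule tr_mono) auto
    have H: "dt P (?A ?I2) (?B ?I2) (Tb + 10 * (h + 1)) m [Call f] (\<rho>'(15 := real (s + 2 ^ h)))
      (\<lambda>m' w. w + 10 \<le> (\<Sum>j\<in>?I2. W j) + 20 * 2 ^ h \<and> (\<forall>j\<in>?I2. Q j m'))"
      by (rule Suc.IH) (use R in \<open>auto simp: for_regs_def\<close>)
    show "dt P (?A ?I2) (?B ?I2) (Tb + 10 * (h + 1) + 1) m [Arith Plus 15 15 14, Call f] \<rho>'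
      (\<lambda>m' w. w + 9 \<le> (\<Sum>j\<in>?I2. W j) + 20 * 2 ^ h \<and> (\<forall>j\<in>?I2. Q j m'))"
    proof -
      have "dt P (?A ?I2) (?B ?I2) (Suc (Tb + 10 * (h + 1))) m [Arith Plus 15 15 14, Call f] \<rho>'
        (\<lambda>m' w. w + 9 \<le> (\<Sum>j\<in>?I2. W j) + 20 * 2 ^ h \<and> (\<forall>j\<in>?I2. Q j m'))"
        by (rule tr_step1[where ws = "[]" and \<rho>' = "\<rho>'(15 := real (s + 2 ^ h))"])
          (use R H in \<open>auto elim!: tr_mono\<close>)
      then show ?thesis by simp
    qed
    have D: "A i \<inter> A j = {}" "B i \<inter> A j = {}" "B j \<inter> A i = {}" if "i \<in> ?I1" "j \<in> ?I2" for i j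
      using dis[of i j] dis[of j i] ne[OF that] by blast+
    show "?A ?I1 \<inter> ?A ?I2 = {}" unfolding Int_UN_distrib2 by (intro SUP_bot_conv(1)[THEN iffD2] ballI D(1))
    show "?B ?I1 \<inter> ?A ?I2 = {}" unfolding Int_UN_distrib2 by (intro SUP_bot_conv(1)[THEN iffD2] ballI D(2))
    show "?B ?I2 \<inter> ?A ?I1 = {}" unfolding Int_UN_distrib2 by (intro SUP_bot_conv(1)[THEN iffD2] ballI D(3))
    show "?A ?I1 \<subseteq> ?A ?I" "?A ?I2 \<subseteq> ?A ?I" "?B ?I1 \<subseteq> ?B ?I" "?B ?I2 \<subseteq> ?B ?I"
      unfolding I(1) by blast+
    fix m1 m2 m' w1 w2
    assume 1: "w1 + 10 \<le> (\<Sum>j\<in>?I1. W j) + 20 * 2 ^ h \<and> (\<forall>j\<in>?I1. Q j m1)"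
      and 2: "w2 + 9 \<le> (\<Sum>j\<in>?I2. W j) + 20 * 2 ^ h \<and> (\<forall>j\<in>?I2. Q j m2)"
      and e: "\<And>x. x \<notin> ?A ?I2 \<Longrightarrow> m' x = m1 x" "\<And>x. x \<notin> ?A ?I1 \<Longrightarrow> m' x = m2 x"
    have "Q j m'" if j: "j \<in> ?I1" for j
    proof (rule loc[of j m1])
      fix x assume "x \<notin> (\<Union>i\<in>{..<n} - {j}. A i)"
      moreover have "?I2 \<subseteq> {..<n} - {j}" using j by auto
      ultimately show "m' x = m1 x" using e(1) by blast
    qed (use j 1 in auto)
    moreover have "Q j m'" if j: "j \<in> ?I2" for j
    proof (rule loc[of j m2])
      fix x assume "x \<notin> (\<Union>i\<in>{..<n} - {j}. A i)"
      moreover have "?I1 \<subseteq> {..<n} - {j}" using j by auto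
      ultimately show "m' x = m2 x" using e(2) by blast
    qed (use j 2 in auto)
    ultimately have all: "\<forall>j\<in>?I. Q j m'" unfolding I(1) by blast
    show "dt P (?A ?I) (?B ?I) 0 m' [] \<rho>' (\<lambda>m' w. w1 + w2 + 2 + w + 13 \<le> (\<Sum>j\<in>?I. W j) + 20 * 2 ^ Suc h \<and> (\<forall>j\<in>?I. Q j m'))"
    proof (rule tr_Nil)
      have "w1 + w2 + 2 + 0 + 13 \<le> (\<Sum>j\<in>?I. W j) + 20 * 2 ^ Suc h" using 1 2 unfolding sumI by simp
      then show "w1 + w2 + 2 + 0 + 13 \<le> (\<Sum>j\<in>?I. W j) + 20 * 2 ^ Suc h \<and> (\<forall>j\<in>?I. Q j m')"
        using all by blast
    qed
  qed simp
  have "dt P (?A ?I) (?B ?I) (Tb + 10 * (h + 1) + 8) m (P ! f) \<rho>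
     (\<lambda>m' w. 1 + w + 10 \<le> (\<Sum>j\<in>?I. W j) + 20 * 2 ^ Suc h \<and> (\<forall>j\<in>?I. Q j m'))"
    unfolding P p_for_def
  proof (rule sx_tr)
    let ?\<rho> = "\<rho>(14 := 2 ^ h)"
    have p: "dt P (?A ?I) (?B ?I) (Tb + 10 * (h + 1) + 5) m [Par [Call f] [Arith Plus 15 15 14, Call f]] ?\<rho>
      (\<lambda>m' w. w + 13 \<le> (\<Sum>j\<in>?I. W j) + 20 * 2 ^ Suc h \<and> (\<forall>j\<in>?I. Q j m'))"
      by (rule par) (use Suc.prems in \<open>auto simp: for_regs_def\<close>)
    have c: "\<not> \<rho> 14 < \<rho> 13" using Suc.prems one_le_power[of "2::real" h] by (simp add: for_regs_def not_less)
    have d: "\<rho>(14 := \<rho> 14 / \<rho> 13) = ?\<rho>" using Suc.prems by (simp add: for_regs_def)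
    show "sx (?A ?I) (?B ?I) (\<lambda>n b \<rho> m. n \<le> Tb + 10 * (h + 1) + 8 \<and> dt P (?A ?I) (?B ?I) (Tb + 10 * (h + 1) + 8 - n) m b \<rho>
         (\<lambda>m' w. 1 + (n + w) + 10 \<le> (\<Sum>j\<in>?I. W j) + 20 * 2 ^ Suc h \<and> (\<forall>j\<in>?I. Q j m')))
       0 [IfLess 14 13 [IfLess 15 12 body []] [Arith Divide 14 14 13, Par [Call f] [Arith Plus 15 15 14, Call f]]] \<rho> m"
      using c d by (simp del: power_Suc) (rule tr_mono[OF p], auto)
  qed
  then show ?case by (rule tr_call) (use P in auto)
qed

text \<open>
  \<open>bld nd f b h e s\<close> is the tree that the machine builds from the trees \<open>f s, f (s + 1), \<dots>\<close> below
  \<open>e\<close>, at most \<open>2\<^sup>h\<close> of them. The node whose right subtree starts at position \<open>i\<close> gets the identifier \<open>b + i\<close>, so that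
  identifiers need no allocation.
\<close>

fun mrg :: "(nat \<Rightarrow> 't \<Rightarrow> 't \<Rightarrow> 't) \<Rightarrow> nat \<Rightarrow> 't option \<Rightarrow> 't option \<Rightarrow> 't option" where
  "mrg nd i None y = y"
| "mrg nd i (Some a) None = Some a"
| "mrg nd i (Some a) (Some b) = Some (nd i a b)"

primrec bld :: "(nat \<Rightarrow> 't \<Rightarrow> 't \<Rightarrow> 't) \<Rightarrow> (nat \<Rightarrow> 't option) \<Rightarrow> nat \<Rightarrow> nat \<Rightarrow> nat \<Rightarrow> nat \<Rightarrow> 't option" where
  "bld nd f b 0 e s = f s"
| "bld nd f b (Suc h) e s = (if s + 2 ^ h < e
     then mrg nd (b + s + 2 ^ h) (bld nd f b h e s) (bld nd f b h e (s + 2 ^ h)) else bld nd f b h e s)"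

abbreviation hi :: "nat \<Rightarrow> nat \<Rightarrow> nat \<Rightarrow> nat" where "hi s h e \<equiv> min (s + 2 ^ h) e"

lemma mrg_None: "mrg nd i x None = x" by (cases x) auto

lemma bld_Some: "f s \<noteq> None \<Longrightarrow> bld nd f b h e s \<noteq> None"
proof (induction h)
  case (Suc h)
  then obtain t where t: "bld nd f b h e s = Some t" by auto
  show ?case by (cases "bld nd f b h e (s + 2 ^ h)") (auto simp: t)
qed simp

text \<open>Stated for an arbitrary homomorphism \<open>k\<close> into lists: \<open>lvs\<close> for
  trees of leaves and \<open>groups\<close> for the top tree.\<close>

lemma bld_list:
  assumes "\<And>i l r. k (nd i l r) = k l @ k r" "s < e"
  shows "(case bld nd f b h e s of None \<Rightarrow> [] | Some t \<Rightarrow> k t) =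
    concat (map (\<lambda>j. case f j of None \<Rightarrow> [] | Some t \<Rightarrow> k t) [s..<hi s h e])"
  using assms(2)
proof (induction h arbitrary: s)
  case 0
  then show ?case by (simp add: min_def upt_rec)
next
  case (Suc h)
  let ?k = "\<lambda>x. case x of None \<Rightarrow> [] | Some t \<Rightarrow> k t"
  have m: "?k (mrg nd i x y) = ?k x @ ?k y" for i x y by (cases x; cases y) (auto simp: assms(1))
  show ?case
  proof (cases "s + 2 ^ h < e")
    case True
    have "hi s (Suc h) e = s + 2 ^ h + (hi (s + 2 ^ h) h e - (s + 2 ^ h))" using True by (simp add: min_def)
    then have u: "[s..<hi s (Suc h) e] = [s..<s + 2 ^ h] @ [s + 2 ^ h..<hi (s + 2 ^ h) h e]"
      by (metis le_add1 le_add_diff_inverse less_imp_le_nat min.boundedI True upt_add_eq_append)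
    have "hi s h e = s + 2 ^ h" using True by simp
    then show ?thesis using True Suc.IH[OF Suc.prems] Suc.IH[OF True] unfolding u by (simp add: m)
  next
    case False
    then have "hi s (Suc h) e = hi s h e" by (simp add: min_def)
    then show ?thesis using False Suc.IH[OF Suc.prems] by simp
  qed
qed

text \<open>The boundary between top tree and groups exists in the analysis only. As the
  construction treats nodes uniformly, it makes no difference whether the boundary is forgotten
  before or after it.\<close>

lemma bld_flat: "map_option flat (bld N f b h e s) = bld Nd (\<lambda>j. map_option flat (f j)) b h e s"
proof (induction h arbitrary: s)
  case (Suc h)
  have "map_option flat (mrg N i x y) = mrg Nd i (map_option flat x) (map_option flat y)" for i x y
    by (cases x; cases y) auto
  then show ?case using Suc by simp
qed simp

definition oids :: "tree option \<Rightarrow> nat set" where "oids x = (case x of None \<Rightarrow> {} | Some t \<Rightarrow> ids t)"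

lemma oids_simps [simp]: "oids None = {}" "oids (Some t) = ids t" by (auto simp: oids_def)

lemma oids_mrg: "oids (mrg Nd i x y) \<subseteq> insert i (oids x \<union> oids y)"
  by (cases x; cases y) auto

lemma span_mono:
  fixes F :: "nat \<Rightarrow> nat set" and b :: nat
  assumes "s \<le> s'" "u' \<le> u"
  shows "(\<Union>j\<in>{s'..<u'}. F j) \<union> {b + j |j. s' < j \<and> j < u'} \<subseteq> (\<Union>j\<in>{s..<u}. F j) \<union> {b + j |j. s < j \<and> j < u}"
proof (intro Un_mono)
  show "(\<Union>j\<in>{s'..<u'}. F j) \<subseteq> (\<Union>j\<in>{s..<u}. F j)" using assms by (intro UN_mono) auto
  show "{b + j |j. s' < j \<and> j < u'} \<subseteq> {b + j |j. s < j \<and> j < u}"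
    using assms by (intro Collect_mono ex_mono impI) (auto dest: order_le_less_trans order_less_le_trans)
qed

text \<open>New identifiers lie strictly above \<open>b + s\<close>, because the right subtree of a
  node never starts at the first position.\<close>

lemma bld_ids:
  assumes "s < e"
  shows "oids (bld Nd f b h e s) \<subseteq> (\<Union>j\<in>{s..<hi s h e}. oids (f j)) \<union> {b + j |j. s < j \<and> j < hi s h e}"
  using assms
proof (induction h arbitrary: s)
  case (Suc h)
  show ?case
  proof (cases "s + 2 ^ h < e")
    case True
    have 1: "oids (bld Nd f b h e s) \<subseteq> (\<Union>j\<in>{s..<hi s (Suc h) e}. oids (f j)) \<union> {b + j |j. s < j \<and> j < hi s (Suc h) e}"
      by (rule order_trans[OF Suc.IH[OF Suc.prems] span_mono]) (auto simp: min_def)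
    have 2: "oids (bld Nd f b h e (s + 2 ^ h)) \<subseteq> (\<Union>j\<in>{s..<hi s (Suc h) e}. oids (f j)) \<union> {b + j |j. s < j \<and> j < hi s (Suc h) e}"
      by (rule order_trans[OF Suc.IH[OF True] span_mono]) (auto simp: min_def)
    have 3: "b + s + 2 ^ h \<in> {b + j |j. s < j \<and> j < hi s (Suc h) e}"
      using True by (auto intro!: exI[of _ "s + 2 ^ h"])
    show ?thesis using True order_trans[OF oids_mrg] 1 2 3 by (simp; blast)
  next
    case False
    then have "hi s (Suc h) e = hi s h e" by (simp add: min_def)
    then show ?thesis using False Suc.IH[OF Suc.prems] by simp
  qed
qed auto

text \<open>Old identifiers are at most \<open>b\<close>, new ones above. At a node that splits at
  position i, the new identifiers on the left are below \<open>b + i\<close>, those on the right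
  above, and \<open>b + i\<close> is that of the node.\<close>

lemma bld_disj:
  assumes "s < e" "\<And>i j. i \<noteq> j \<Longrightarrow> oids (f i) \<inter> oids (f j) = {}"
    and "\<And>j t. f j = Some t \<Longrightarrow> disj t" "\<And>j. oids (f j) \<subseteq> {..b}" "bld Nd f b h e s = Some t"
  shows "disj t"
  using assms(1,5)
proof (induction h arbitrary: s t)
  case 0
  then show ?case using assms(3) by auto
next
  case (Suc h)
  show ?case
  proof (cases "s + 2 ^ h < e")
    case True
    let ?x = "bld Nd f b h e s" and ?y = "bld Nd f b h e (s + 2 ^ h)"
    have m: "mrg Nd (b + s + 2 ^ h) ?x ?y = Some t" using Suc.prems(2) True by simp
    have hi: "hi s h e = s + 2 ^ h" using True by simp
    note 1 = bld_ids[OF Suc.prems(1), of f b h, unfolded hi] and 2 = bld_ids[OF True, of f b h]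
    have dj: "oids ?x \<inter> oids ?y = {}"
    proof (rule equals0I)
      fix i assume i: "i \<in> oids ?x \<inter> oids ?y"
      have "(\<exists>j\<in>{s..<s + 2 ^ h}. i \<in> oids (f j)) \<or> (\<exists>j. i = b + j \<and> s < j \<and> j < s + 2 ^ h)" using i 1 by blast
      moreover have "(\<exists>j\<in>{s + 2 ^ h..<hi (s + 2 ^ h) h e}. i \<in> oids (f j)) \<or> (\<exists>j. i = b + j \<and> s + 2 ^ h < j)" using i 2 by blast
      moreover have "i \<le> b" if "i \<in> oids (f j)" for j using assms(4)[of j] that by auto
      moreover have "False" if "j \<in> {s..<s + 2 ^ h}" "j' \<in> {s + 2 ^ h..<hi (s + 2 ^ h) h e}" "i \<in> oids (f j)" "i \<in> oids (f j')" for j j'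
        using assms(2)[of j j'] that by auto
      ultimately show False by fastforce
    qed
    have ni: "b + s + 2 ^ h \<notin> oids ?x" "b + s + 2 ^ h \<notin> oids ?y"
    proof -
      have nb: "b + s + 2 ^ h \<notin> oids (f j)" for j
      proof
        assume "b + s + 2 ^ h \<in> oids (f j)"
        then have "b + s + 2 ^ h \<le> b" using assms(4)[of j] by auto
        moreover have "(0::nat) < 2 ^ h" by simp
        ultimately show False by linarith
      qed
      show "b + s + 2 ^ h \<notin> oids ?x"
      proof
        assume "b + s + 2 ^ h \<in> oids ?x"
        then obtain j where "b + s + 2 ^ h = b + j" "j < s + 2 ^ h" using 1 nb by blast
        then show False by simp
      qed
      show "b + s + 2 ^ h \<notin> oids ?y"
      proof
        assume "b + s + 2 ^ h \<in> oids ?y"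
        then obtain j where "b + s + 2 ^ h = b + j" "s + 2 ^ h < j" using 2 nb by blast
        then show False by simp
      qed
    qed
    show ?thesis
    proof (cases ?x)
      case None
      then show ?thesis using m Suc.IH[OF True, of t] by simp
    next
      case (Some l)
      show ?thesis
      proof (cases ?y)
        case None
        then show ?thesis using m Suc.IH[OF Suc.prems(1), of t] by (simp add: mrg_None)
      next
        case (Some r)
        then show ?thesis using m \<open>?x = Some l\<close> Suc.IH[OF Suc.prems(1), of l] Suc.IH[OF True, of r] dj ni by auto
      qed
    qed
  next
    case False
    then show ?thesis using Suc by simp
  qed
qed

primrec mn :: "(nat \<Rightarrow> real) \<Rightarrow> tree \<Rightarrow> real" where
  "mn v (Lf j) = v j"
| "mn v (Nd i l r) = min (mn v l) (mn v r)"

text \<open>Minima serve only to find the least weight during preprocessing, so they are kept apart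
  from \<open>rep\<close>, on which queries rely.\<close>

primrec rmn :: "memory \<Rightarrow> (nat \<Rightarrow> real) \<Rightarrow> tree \<Rightarrow> bool" where
  "rmn m v (Lf j) \<longleftrightarrow> m (31, j) = v j"
| "rmn m v (Nd i l r) \<longleftrightarrow> m (31, i) = mn v (Nd i l r) \<and> rmn m v l \<and> rmn m v r"

lemma mn_Min: "mn v t = Min (v ` set (lvs t))"
  by (induction t) (auto simp: image_Un Min_Un)

lemma mx_Max: "mx v t = Max (v ` set (lvs t))"
  by (induction t) (auto simp: image_Un Max_Un)

definition attrs :: "nat set" where "attrs = {10, 11, 12, 13, 14, 15, 31}"

lemma rmn_cong: "rmn m v t \<Longrightarrow> (\<And>i. i \<in> ids t \<Longrightarrow> m' (31, i) = m (31, i)) \<Longrightarrow> rmn m' v t"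
  by (induction t) auto

definition good :: "memory \<Rightarrow> (nat \<Rightarrow> real) \<Rightarrow> nat \<Rightarrow> tree option \<Rightarrow> bool" where
  "good m v n x \<longleftrightarrow> (case x of None \<Rightarrow> True | Some t \<Rightarrow> rep m v n t \<and> rmn m v t)"

lemma good_simps [simp]: "good m v n None" "good m v n (Some t) \<longleftrightarrow> rep m v n t \<and> rmn m v t"
  by (auto simp: good_def)

lemma good_cong:
  assumes "good m v n x" "\<And>a i. a \<in> attrs \<Longrightarrow> i \<in> oids x \<Longrightarrow> m' (a, i) = m (a, i)"
  shows "good m' v n x"
proof (cases x)
  case (Some t)
  have "a \<in> attrs" if "10 \<le> a" "a \<le> 15" for a using that by (auto simp: attrs_def)
  then have "rep m' v n t" using assms by (intro rep_cong[of m v n t m']) (auto simp: Some)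
  moreover have "rmn m' v t" using assms by (intro rmn_cong[of m v t m']) (auto simp: Some attrs_def)
  ultimately show ?thesis by (simp add: Some)
qed simp

definition ptr :: "tree option \<Rightarrow> real" where "ptr x = (case x of None \<Rightarrow> -1 | Some t \<Rightarrow> real (root t))"

lemma ptr_simps [simp]: "ptr None = -1" "ptr (Some t) = real (root t)" by (auto simp: ptr_def)

text \<open>What building a tree over the positions from \<open>s\<close> to \<open>e\<close> may
  write. New identifiers exclude both ends, so adjacent ranges are disjoint and leave out the
  identifier of the node that joins them.\<close>

definition AB :: "nat \<Rightarrow> nat \<Rightarrow> nat \<Rightarrow> address set" where
  "AB b s e = {(a, i). (a = 30 \<and> s \<le> i \<and> i < e) \<or> (a \<in> attrs \<and> b + s < i \<and> i < b + e)}"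

definition RB :: "nat \<Rightarrow> address set" where "RB b = {(a, i). a \<in> attrs \<and> i \<le> b}"

lemma AB_iff [simp]: "(a, i) \<in> AB b s e \<longleftrightarrow> (a = 30 \<and> s \<le> i \<and> i < e) \<or> (a \<in> attrs \<and> b + s < i \<and> i < b + e)"
  and RB_iff [simp]: "(a, i) \<in> RB b \<longleftrightarrow> a \<in> attrs \<and> i \<le> b"
  by (auto simp: AB_def RB_def)

lemma attrs_mem [simp]: "10 \<in> attrs" "11 \<in> attrs" "12 \<in> attrs" "13 \<in> attrs" "14 \<in> attrs" "15 \<in> attrs" "31 \<in> attrs"
  "30 \<notin> attrs" by (auto simp: attrs_def)

lemma mrg_rep:
  assumes "good m v n (Some l)" "good m v n (Some r)" "c \<notin> ids l" "c \<notin> ids r" "n \<le> c"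
    and "\<And>a i. a \<in> attrs \<Longrightarrow> i \<noteq> c \<Longrightarrow> m' (a, i) = m (a, i)"
    and "m' (10, c) = real (root l)" "m' (11, c) = real (root r)" "m' (12, c) = mass v l + mass v r"
    "m' (13, c) = max (mx v l) (mx v r)" "m' (31, c) = min (mn v l) (mn v r)" "m' (14, c) = real (lo l)"
    "m' (15, c) = real (cnt l) + real (cnt r)"
  shows "good m' v n (Some (Nd c l r))"
proof -
  have "good m' v n (Some l)"
  proof (rule good_cong[OF assms(1)])
    fix a i assume "a \<in> attrs" "i \<in> oids (Some l)"
    then show "m' (a, i) = m (a, i)" using assms(3) by (intro assms(6)) auto
  qed
  moreover have "good m' v n (Some r)"
  proof (rule good_cong[OF assms(2)])
    fix a i assume "a \<in> attrs" "i \<in> oids (Some r)"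
    then show "m' (a, i) = m (a, i)" using assms(4) by (intro assms(6)) auto
  qed
  ultimately show ?thesis using assms by (simp add: att_def)
qed

lemma merge_dt:
  assumes P: "3 < length P" "P ! 3 = p_merge"
    and \<rho>: "\<rho> 11 = 0" "\<rho> 15 = real s" "\<rho> 16 = real mid" "\<rho> 19 = real b"
    and m: "m (30, s) = ptr x" "m (30, mid) = ptr y" "good m v n x" "good m v n y"
    and ids: "b + mid \<notin> oids x" "b + mid \<notin> oids y" "n \<le> b + mid"
    and A: "(30, s) \<in> A" "\<And>a. a \<in> attrs \<Longrightarrow> (a, b + mid) \<in> A"
    and B: "(30, s) \<in> B" "(30, mid) \<in> B" "\<And>a i. a \<in> attrs \<Longrightarrow> i \<in> oids x \<union> oids y \<Longrightarrow> (a, i) \<in> B"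
  shows "dt P A B 30 m [Call 3] \<rho>
    (\<lambda>m' w. w \<le> 30 \<and> m' (30, s) = ptr (mrg Nd (b + mid) x y) \<and> good m' v n (mrg Nd (b + mid) x y))"
proof -
  have "dt P A B 28 m p_merge \<rho>
    (\<lambda>m' w. w \<le> 28 \<and> m' (30, s) = ptr (mrg Nd (b + mid) x y) \<and> good m' v n (mrg Nd (b + mid) x y))"
  proof (cases y)
    case None
    then show ?thesis unfolding p_merge_def
      by (intro sx_tr) (use \<rho> m B in \<open>auto simp: mrg_None intro!: tr_Nil\<close>)
  next
    case y: (Some r)
    show ?thesis
    proof (cases x)
      case None
      have "good (m((30, s) := real (root r))) v n (Some r)"
        by (rule good_cong[OF m(4)[unfolded y]]) auto
      then show ?thesis unfolding p_merge_def
        by (intro sx_tr) (use \<rho> m B A y None in \<open>auto intro!: tr_Nil\<close>)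
    next
      case x: (Some l)
      have att: "m (12, root l) = mass v l" "m (13, root l) = mx v l" "m (14, root l) = real (lo l)" "m (15, root l) = real (cnt l)"
        "m (12, root r) = mass v r" "m (13, root r) = mx v r" "m (14, root r) = real (lo r)" "m (15, root r) = real (cnt r)"
        using m(3,4) att_root[of m v n l] att_root[of m v n r] by (auto simp: x y att_def)
      have mnr: "m (31, root l) = mn v l" "m (31, root r) = mn v r" using m(3,4) by (cases l; cases r; auto simp: x y)+
      have ne: "root l \<noteq> b + mid" "root r \<noteq> b + mid" using ids x y root_in_ids by (metis oids_simps(2))+
      have Bx: "(a, root l) \<in> B" "(a, root r) \<in> B" if "a \<in> attrs" for a using B(3)[OF that] by (auto simp: x y)
      have main: "good m' v n (Some (Nd (b + mid) l r))"
        if "\<And>a i. a \<in> attrs \<Longrightarrow> i \<noteq> b + mid \<Longrightarrow> m' (a, i) = m (a, i)"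
          "m' (10, b + mid) = real (root l)" "m' (11, b + mid) = real (root r)" "m' (12, b + mid) = mass v l + mass v r"
          "m' (13, b + mid) = max (mx v l) (mx v r)" "m' (31, b + mid) = min (mn v l) (mn v r)" "m' (14, b + mid) = real (lo l)"
          "m' (15, b + mid) = real (cnt l) + real (cnt r)" for m'
        by (rule mrg_rep[of m]) (use m ids that in \<open>auto simp: x y\<close>)
      have fin: "dt P A B 2 m' [] \<rho>' (\<lambda>m w. w \<le> 2 \<and> m (30, s) = ptr (Some (Nd (b + mid) l r)) \<and>
          good m v n (Some (Nd (b + mid) l r)))"
        if "m' (30, s) = real b + real mid" "\<And>a i. a \<in> attrs \<Longrightarrow> i \<noteq> b + mid \<Longrightarrow> m' (a, i) = m (a, i)"
          "m' (10, b + mid) = real (root l)" "m' (11, b + mid) = real (root r)" "m' (12, b + mid) = mass v l + mass v r"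
          "m' (13, b + mid) = max (mx v l) (mx v r)" "m' (31, b + mid) = min (mn v l) (mn v r)" "m' (14, b + mid) = real (lo l)"
          "m' (15, b + mid) = real (cnt l) + real (cnt r)" for m' \<rho>'
        by (rule tr_Nil) (use that main[of m'] in \<open>simp del: good_simps\<close>)
      show ?thesis unfolding p_merge_def
        by (rule sx_tr) (simp add: \<rho> m A B x y Bx att mnr ne del: good_simps ptr_simps(2), simp add: ptr_simps(2)[of l] ptr_simps(2)[of r] \<rho> A B Bx att mnr ne del: good_simps ptr_simps(2),
          intro conjI impI; rule fin; force simp: max_def min_def)
    qed
  qed
  then have "dt P A B 28 m (P ! 3) \<rho>
    (\<lambda>m' w. w \<le> 28 \<and> m' (30, s) = ptr (mrg Nd (b + mid) x y) \<and> good m' v n (mrg Nd (b + mid) x y))" unfolding P .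
  then show ?thesis by (rule tr_call) (use P in auto)
qed

lemma bld_ids':
  assumes "s < e" "\<And>j. oids (f j) \<subseteq> {..b}"
  shows "oids (bld Nd f b h e s) \<subseteq> {i. i \<le> b \<or> (b + s < i \<and> i < b + hi s h e)}"
proof
  fix i assume "i \<in> oids (bld Nd f b h e s)"
  then have "(\<exists>j. i \<in> oids (f j)) \<or> (\<exists>j. i = b + j \<and> s < j \<and> j < hi s h e)"
    using bld_ids[OF assms(1), of f b h] by blast
  then show "i \<in> {i. i \<le> b \<or> (b + s < i \<and> i < b + hi s h e)}" using assms(2) by auto
qed

text \<open>The trees given at the positions have identifiers up to \<open>b\<close> and are only
  read, hence \<open>RB b\<close>. The slack of 50 plays the same role as in
  \<open>parfor_dt\<close>: two halves bring 100, and the difference pays for the merge.\<close>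

lemma build_dt:
  assumes P: "3 < length P" "P ! 2 = p_build" "P ! 3 = p_merge"
    and f: "\<And>j. oids (f j) \<subseteq> {..b}" "n \<le> b"
    and "s < e" "\<rho> 11 = 0" "\<rho> 13 = 2" "\<rho> 14 = 2 ^ h" "\<rho> 15 = real s" "\<rho> 18 = real e" "\<rho> 19 = real b"
    and "\<And>j. s \<le> j \<Longrightarrow> j < hi s h e \<Longrightarrow> m (30, j) = ptr (f j) \<and> good m v n (f j)"
  shows "dt P (AB b s (hi s h e)) (AB b s (hi s h e) \<union> RB b) (50 * (h + 1)) m [Call 2] \<rho>
    (\<lambda>m' w. w + 50 \<le> 100 * 2 ^ h \<and> m' (30, s) = ptr (bld Nd f b h e s) \<and> good m' v n (bld Nd f b h e s))"
  using assms(6-)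
proof (induction h arbitrary: s \<rho>)
  case 0
  have "dt P (AB b s (hi s 0 e)) (AB b s (hi s 0 e) \<union> RB b) 40 m (P ! 2) \<rho>
    (\<lambda>m' w. 1 + w + 50 \<le> 100 * 2 ^ 0 \<and> m' (30, s) = ptr (bld Nd f b 0 e s) \<and> good m' v n (bld Nd f b 0 e s))"
    unfolding P p_build_def by (rule sx_tr) (use 0 in \<open>auto intro!: tr_Nil\<close>)
  then show ?case by (rule tr_call) (use P in auto)
next
  case (Suc h)
  let ?u = "hi s (Suc h) e" and ?mid = "s + 2 ^ h"
  have sz: "\<not> (2::real) * 2 ^ h < 2" using one_le_power[of "2::real" h] by (simp add: not_less)
  have "dt P (AB b s ?u) (AB b s ?u \<union> RB b) (50 * (h + 1) + 48) m (P ! 2) \<rho>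
    (\<lambda>m' w. 1 + w + 50 \<le> 100 * 2 ^ Suc h \<and> m' (30, s) = ptr (bld Nd f b (Suc h) e s) \<and> good m' v n (bld Nd f b (Suc h) e s))"
  proof (cases "?mid < e")
    case False
    then have u: "?u = hi s h e" by (simp add: min_def)
    let ?\<rho> = "\<rho>(14 := 2 ^ h, 16 := real s + 2 ^ h)"
    have H: "dt P (AB b s (hi s h e)) (AB b s (hi s h e) \<union> RB b) (50 * (h + 1)) m [Call 2] ?\<rho>
      (\<lambda>m' w. w + 50 \<le> 100 * 2 ^ h \<and> m' (30, s) = ptr (bld Nd f b h e s) \<and> good m' v n (bld Nd f b h e s))"
      by (rule Suc.IH) (use Suc.prems u in auto)
    have "real e \<le> real (s + 2 ^ h)" using False by (simp only: of_nat_le_iff not_less)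
    then have nlt: "\<not> real s + 2 ^ h < real e" by simp
    have one: "(1::nat) \<le> 2 ^ h" by simp
    show ?thesis unfolding P p_build_def u
      by (rule sx_tr) (use Suc.prems sz False nlt in \<open>simp del: bld.simps, intro tr_mono[OF H], use one in auto\<close>)
  next
    case True
    have u: "?u = hi ?mid h e" "hi s h e = ?mid" "?mid < ?u" using True by (auto simp: min_def)
    let ?x = "bld Nd f b h e s" and ?y = "bld Nd f b h e ?mid"
    have xi: "oids ?x \<subseteq> {i. i \<le> b \<or> (b + s < i \<and> i < b + ?mid)}" using bld_ids'[where f = f and b = b and h = h, OF Suc.prems(1) f(1)] u(2) by simp
    have yi: "oids ?y \<subseteq> {i. i \<le> b \<or> (b + ?mid < i \<and> i < b + ?u)}" using bld_ids'[where f = f and b = b and h = h, OF True f(1)] u(1) by simp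
    have pos: "0 < ?mid" by simp
    let ?R = "\<lambda>\<rho>'. \<rho>' 11 = 0 \<and> \<rho>' 13 = 2 \<and> \<rho>' 14 = 2 ^ h \<and> \<rho>' 15 = real s \<and> \<rho>' 16 = real ?mid \<and> \<rho>' 18 = real e \<and> \<rho>' 19 = real b"
    have par: "dt P (AB b s ?u) (AB b s ?u \<union> RB b) (50 * (h + 1) + 40) m [Par [Call 2] [Arith Plus 15 16 11, Call 2], Call 3] \<rho>'
      (\<lambda>m' w. w + 60 \<le> 100 * 2 ^ Suc h \<and> m' (30, s) = ptr (bld Nd f b (Suc h) e s) \<and> good m' v n (bld Nd f b (Suc h) e s))"
      if R: "?R \<rho>'" for \<rho>'
    proof (rule dt_Par'[where ?A1.0 = "AB b s ?mid" and ?A2.0 = "AB b ?mid ?u" and ?T1.0 = "50 * (h + 1) + 1" and ?T3.0 = 30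
          and ?D1.0 = "AB b s ?mid \<union> RB b" and ?D2.0 = "AB b ?mid ?u \<union> RB b"])
      have H1: "dt P (AB b s ?mid) (AB b s ?mid \<union> RB b) (50 * (h + 1)) m [Call 2] \<rho>'
        (\<lambda>m' w. w + 50 \<le> 100 * 2 ^ h \<and> m' (30, s) = ptr ?x \<and> good m' v n ?x)"
        using Suc.IH[of s \<rho>'] Suc.prems R u by simp
      show "dt P (AB b s ?mid) (AB b s ?mid \<union> RB b) (50 * (h + 1) + 1) m [Call 2] \<rho>'
        (\<lambda>m' w. w + 50 \<le> 100 * 2 ^ h \<and> m' (30, s) = ptr ?x \<and> good m' v n ?x)"
        by (rule tr_mono[OF H1]) auto
      have H2: "dt P (AB b ?mid ?u) (AB b ?mid ?u \<union> RB b) (50 * (h + 1)) m [Call 2] (\<rho>'(15 := real ?mid))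
        (\<lambda>m' w. w + 50 \<le> 100 * 2 ^ h \<and> m' (30, ?mid) = ptr ?y \<and> good m' v n ?y)"
        unfolding u(1) by (rule Suc.IH) (use Suc.prems R u True in auto)
      have "dt P (AB b ?mid ?u) (AB b ?mid ?u \<union> RB b) (Suc (50 * (h + 1))) m [Arith Plus 15 16 11, Call 2] \<rho>'
        (\<lambda>m' w. w + 49 \<le> 100 * 2 ^ h \<and> m' (30, ?mid) = ptr ?y \<and> good m' v n ?y)"
        by (rule tr_step1[where ws = "[]" and b' = "[Call 2]" and \<rho>' = "\<rho>'(15 := real ?mid)"])
          (use R tr_mono[OF H2 order_refl order_refl order_refl, of "\<lambda>_ m' w. 1 + w + 49 \<le> 100 * 2 ^ h \<and> m' (30, ?mid) = ptr ?y \<and> good m' v n ?y"] in auto)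
      then show "dt P (AB b ?mid ?u) (AB b ?mid ?u \<union> RB b) (50 * (h + 1) + 1) m [Arith Plus 15 16 11, Call 2] \<rho>'
        (\<lambda>m' w. w + 49 \<le> 100 * 2 ^ h \<and> m' (30, ?mid) = ptr ?y \<and> good m' v n ?y)" by simp
      show "AB b s ?mid \<inter> AB b ?mid ?u = {}" "(AB b s ?mid \<union> RB b) \<inter> AB b ?mid ?u = {}" "(AB b ?mid ?u \<union> RB b) \<inter> AB b s ?mid = {}"
        by (auto simp: AB_def RB_def)
      show "AB b s ?mid \<subseteq> AB b s ?u" "AB b ?mid ?u \<subseteq> AB b s ?u" "AB b s ?mid \<union> RB b \<subseteq> AB b s ?u \<union> RB b"
        "AB b ?mid ?u \<union> RB b \<subseteq> AB b s ?u \<union> RB b"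
        using u(3) by (auto simp: AB_def RB_def)
      fix m1 m2 m' and w1 w2 :: nat
      assume 1: "w1 + 50 \<le> 100 * 2 ^ h \<and> m1 (30, s) = ptr ?x \<and> good m1 v n ?x"
        and 2: "w2 + 49 \<le> 100 * 2 ^ h \<and> m2 (30, ?mid) = ptr ?y \<and> good m2 v n ?y"
        and e1: "\<And>z. z \<notin> AB b ?mid ?u \<Longrightarrow> m' z = m1 z" and e2: "\<And>z. z \<notin> AB b s ?mid \<Longrightarrow> m' z = m2 z"
      have gx: "good m' v n ?x"
      proof (rule good_cong[OF 1[THEN conjunct2, THEN conjunct2]])
        fix a i assume "a \<in> attrs" "i \<in> oids ?x"
        then have "i \<le> b \<or> (b + s < i \<and> i < b + ?mid)" "a \<noteq> 30" using xi by auto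
        then have "(a, i) \<notin> AB b ?mid ?u" by auto
        then show "m' (a, i) = m1 (a, i)" by (rule e1)
      qed
      have gy: "good m' v n ?y"
      proof (rule good_cong[OF 2[THEN conjunct2, THEN conjunct2]])
        fix a i assume "a \<in> attrs" "i \<in> oids ?y"
        then have "i \<le> b \<or> (b + ?mid < i \<and> i < b + ?u)" "a \<noteq> 30" using yi by auto
        then have "(a, i) \<notin> AB b s ?mid" by auto
        then show "m' (a, i) = m2 (a, i)" by (rule e2)
      qed
      have ps: "m' (30, s) = ptr ?x" "m' (30, ?mid) = ptr ?y"
        using 1 2 e1[of "(30, s)"] e2[of "(30, ?mid)"] by auto
      have nb: "b + ?mid \<notin> {i. i \<le> b \<or> (b + s < i \<and> i < b + ?mid)}" "b + ?mid \<notin> {i. i \<le> b \<or> (b + ?mid < i \<and> i < b + ?u)}"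
        using pos by auto
      have M: "dt P (AB b s ?u) (AB b s ?u \<union> RB b) 30 m' [Call 3] \<rho>'
        (\<lambda>m' w. w \<le> 30 \<and> m' (30, s) = ptr (mrg Nd (b + ?mid) ?x ?y) \<and> good m' v n (mrg Nd (b + ?mid) ?x ?y))"
      proof (rule merge_dt[OF P(1,3) _ _ _ _ ps gx gy])
        show "b + ?mid \<notin> oids ?x" "b + ?mid \<notin> oids ?y" using xi yi nb by blast+
        show "(a, i) \<in> AB b s ?u \<union> RB b" if "a \<in> attrs" "i \<in> oids ?x \<union> oids ?y" for a i
        proof -
          have "i \<le> b \<or> (b + s < i \<and> i < b + ?u)" using that(2) xi yi u(3) by fastforce
          then show ?thesis using that(1) by auto
        qed
      qed (use R f(2) u(3) Suc.prems(1) in auto)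
      have bb: "bld Nd f b (Suc h) e s = mrg Nd (b + ?mid) ?x ?y" using True by (simp add: add.assoc)
      show "dt P (AB b s ?u) (AB b s ?u \<union> RB b) 30 m' [Call 3] \<rho>'
        (\<lambda>m' w. w1 + w2 + 2 + w + 60 \<le> 100 * 2 ^ Suc h \<and> m' (30, s) = ptr (bld Nd f b (Suc h) e s) \<and> good m' v n (bld Nd f b (Suc h) e s))"
        unfolding bb
      proof (rule tr_mono[OF M])
        fix m'' and w :: nat assume "w \<le> 30 \<and> m'' (30, s) = ptr (mrg Nd (b + ?mid) ?x ?y) \<and> good m'' v n (mrg Nd (b + ?mid) ?x ?y)"
        then show "w1 + w2 + 2 + w + 60 \<le> 100 * 2 ^ Suc h \<and> m'' (30, s) = ptr (mrg Nd (b + ?mid) ?x ?y) \<and> good m'' v n (mrg Nd (b + ?mid) ?x ?y)"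
          using 1 2 by auto
      qed auto
    qed simp
    let ?\<rho> = "\<rho>(14 := 2 ^ h, 16 := real s + 2 ^ h)"
    have H: "dt P (AB b s ?u) (AB b s ?u \<union> RB b) (50 * (h + 1) + 40) m [Par [Call 2] [Arith Plus 15 16 11, Call 2], Call 3] ?\<rho>
      (\<lambda>m' w. w + 60 \<le> 100 * 2 ^ Suc h \<and> m' (30, s) = ptr (bld Nd f b (Suc h) e s) \<and> good m' v n (bld Nd f b (Suc h) e s))"
      by (rule par) (use Suc.prems in auto)
    have "real (s + 2 ^ h) < real e" using True by (simp only: of_nat_less_iff)
    then have lt: "real s + 2 ^ h < real e" by simp
    show ?thesis unfolding P p_build_def
      by (rule sx_tr) (use Suc.prems(2-7) sz lt in \<open>simp del: bld.simps, intro tr_mono[OF H], auto simp del: bld.simps\<close>)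
  qed
  then show ?case by (rule tr_call) (use P in auto)
qed

section \<open>Segments of equal keys\<close>

text \<open>For sorted keys this is the position just after the last key that is at most
  \<open>k\<close>, hence the exclusive end of the segment of \<open>k\<close> if that key
  occurs.\<close>

definition en :: "nat \<Rightarrow> (nat \<Rightarrow> nat) \<Rightarrow> nat \<Rightarrow> nat" where "en n \<kappa> k = card {i. i < n \<and> \<kappa> i \<le> k}"

definition start :: "(nat \<Rightarrow> nat) \<Rightarrow> nat \<Rightarrow> bool" where "start \<kappa> j \<longleftrightarrow> j = 0 \<or> \<kappa> (j - 1) < \<kappa> j"

definition sorted_on :: "nat \<Rightarrow> (nat \<Rightarrow> nat) \<Rightarrow> bool" where
  "sorted_on n \<kappa> \<longleftrightarrow> (\<forall>i j. i \<le> j \<and> j < n \<longrightarrow> \<kappa> i \<le> \<kappa> j)"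

lemma down_closed_card:
  fixes S :: "nat set"
  assumes "finite S" "\<And>i j. i \<le> j \<Longrightarrow> j \<in> S \<Longrightarrow> i \<in> S"
  shows "S = {..<card S}"
proof -
  obtain x where "x \<notin> S" using assms(1) ex_new_if_finite infinite_UNIV_nat by blast
  define k where "k = (LEAST x. x \<notin> S)"
  have k: "k \<notin> S" unfolding k_def by (rule LeastI) fact
  have "S = {..<k}"
  proof (intro equalityI subsetI)
    fix i assume "i \<in> S"
    then show "i \<in> {..<k}" using assms(2)[of k i] k by (meson lessThan_iff not_less)
  next
    fix i assume "i \<in> {..<k}"
    then show "i \<in> S" unfolding k_def using not_less_Least by (metis lessThan_iff)
  qed
  then show ?thesis by (metis card_lessThan)
qed

lemma en_iff:
  assumes "sorted_on n \<kappa>"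
  shows "i < en n \<kappa> k \<longleftrightarrow> i < n \<and> \<kappa> i \<le> k"
proof -
  have "{i. i < n \<and> \<kappa> i \<le> k} = {..<card {i. i < n \<and> \<kappa> i \<le> k}}"
  proof (rule down_closed_card)
    fix i j assume "i \<le> j" "j \<in> {i. i < n \<and> \<kappa> i \<le> k}"
    moreover from this have "\<kappa> i \<le> \<kappa> j" using assms by (simp add: sorted_on_def)
    ultimately show "i \<in> {i. i < n \<and> \<kappa> i \<le> k}" by auto
  qed simp
  then show ?thesis unfolding en_def by blast
qed

lemma en_le: "en n \<kappa> k \<le> n"
proof -
  have "en n \<kappa> k \<le> card {..<n}" unfolding en_def by (rule card_mono) auto
  then show ?thesis by simp
qed

lemma start_less:
  assumes "sorted_on n \<kappa>" "start \<kappa> j" "i < j" "j < n"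
  shows "\<kappa> i < \<kappa> j"
proof -
  have "\<kappa> i \<le> \<kappa> (j - 1)"
  proof -
    have "i \<le> j - 1" "j - 1 < n" using assms(3,4) by linarith+
    then show ?thesis using assms(1) unfolding sorted_on_def by blast
  qed
  then show ?thesis using assms by (auto simp: start_def)
qed

lemma seg_key:
  assumes "sorted_on n \<kappa>" "j \<le> i" "i < en n \<kappa> (\<kappa> j)"
  shows "\<kappa> i = \<kappa> j" "i < n"
proof -
  show "i < n" using assms(3) en_iff[OF assms(1)] by blast
  then have "\<kappa> j \<le> \<kappa> i" using assms(1,2) by (simp add: sorted_on_def)
  then show "\<kappa> i = \<kappa> j" using assms(3) en_iff[OF assms(1)] by (simp add: le_antisym)
qed

lemma seg_lt: "sorted_on n \<kappa> \<Longrightarrow> j < n \<Longrightarrow> j < en n \<kappa> (\<kappa> j)"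
  by (simp add: en_iff)

lemma seg_disjoint:
  assumes "sorted_on n \<kappa>" "start \<kappa> i" "start \<kappa> j" "i < n" "j < n" "i < j"
  shows "en n \<kappa> (\<kappa> i) \<le> j"
proof (rule ccontr)
  assume "\<not> en n \<kappa> (\<kappa> i) \<le> j"
  then have "\<kappa> j \<le> \<kappa> i" using en_iff[OF assms(1)] by (meson not_le)
  then show False using start_less[OF assms(1,3,6,5)] by simp
qed

text \<open>Lets a processor recognise the end of a segment by looking only at its right
  neighbour.\<close>

lemma end_iff:
  assumes "sorted_on n \<kappa>" "j < n"
  shows "(j + 1 = n \<or> \<kappa> j < \<kappa> (j + 1)) \<longleftrightarrow> en n \<kappa> (\<kappa> j) = j + 1"
proof
  assume a: "j + 1 = n \<or> \<kappa> j < \<kappa> (j + 1)"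
  have "\<not> j + 1 < en n \<kappa> (\<kappa> j)" using a en_iff[OF assms(1), of "j + 1" "\<kappa> j"] by auto
  then show "en n \<kappa> (\<kappa> j) = j + 1" using seg_lt[OF assms] by simp
next
  assume a: "en n \<kappa> (\<kappa> j) = j + 1"
  then have "\<not> (j + 1 < n \<and> \<kappa> (j + 1) \<le> \<kappa> j)" using en_iff[OF assms(1), of "j + 1" "\<kappa> j"] by simp
  then show "j + 1 = n \<or> \<kappa> j < \<kappa> (j + 1)" using assms(2) by auto
qed

lemma concat_segments:
  assumes "sorted_on n \<kappa>" "i \<le> n"
  shows "concat (map (\<lambda>j. if start \<kappa> j then [j..<en n \<kappa> (\<kappa> j)] else []) [0..<i]) =
    [0..<if i = 0 then 0 else en n \<kappa> (\<kappa> (i - 1))]"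
  using assms(2)
proof (induction i)
  case (Suc i)
  let ?f = "\<lambda>j. if start \<kappa> j then [j..<en n \<kappa> (\<kappa> j)] else []"
  have e: "concat (map ?f [0..<Suc i]) = concat (map ?f [0..<i]) @ ?f i" by simp
  have i: "i < n" using Suc.prems by simp
  show ?case
  proof (cases "start \<kappa> i")
    case False
    then have "i \<noteq> 0" "\<kappa> i \<le> \<kappa> (i - 1)" by (auto simp: start_def)
    moreover have "\<kappa> (i - 1) \<le> \<kappa> i" using assms(1) i by (simp add: sorted_on_def)
    ultimately have "\<kappa> (i - 1) = \<kappa> i" "i \<noteq> 0" by auto
    then show ?thesis unfolding e using Suc.IH Suc.prems False by simp
  next
    case True
    have "(if i = 0 then 0 else en n \<kappa> (\<kappa> (i - 1))) = i"
    proof (cases "i = 0")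
      case False
      then have "\<kappa> (i - 1) < \<kappa> (i - 1 + 1)" using True by (simp add: start_def)
      then have "en n \<kappa> (\<kappa> (i - 1)) = i - 1 + 1" using end_iff[OF assms(1), of "i - 1"] i by simp
      then show ?thesis using False by simp
    qed simp
    then have "concat (map ?f [0..<i]) = [0..<i]" using Suc.IH Suc.prems by simp
    moreover have "i \<le> en n \<kappa> (\<kappa> i)" using seg_lt[OF assms(1) i] by simp
    then have "[0..<i] @ [i..<en n \<kappa> (\<kappa> i)] = [0..<en n \<kappa> (\<kappa> i)]"
      using upt_add_eq_append[of 0 i "en n \<kappa> (\<kappa> i) - i"] by simp
    ultimately show ?thesis unfolding e using True by simp
  qed
qed simp

text \<open>The segments partition the positions; this keeps the total work of building the groups
  linear.\<close>

lemma segments_length: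
  assumes "sorted_on n \<kappa>" "n \<ge> 1"
  shows "(\<Sum>j<n. if start \<kappa> j then en n \<kappa> (\<kappa> j) - j else 0) = n"
proof -
  have "length (concat (map (\<lambda>j. if start \<kappa> j then [j..<en n \<kappa> (\<kappa> j)] else []) [0..<n])) = n"
  proof -
    have "en n \<kappa> (\<kappa> (n - 1)) = n - 1 + 1" using end_iff[OF assms(1), of "n - 1"] assms(2) by simp
    then show ?thesis unfolding concat_segments[OF assms(1) order_refl] using assms(2) by simp
  qed
  moreover have "length (concat (map (\<lambda>j. if start \<kappa> j then [j..<en n \<kappa> (\<kappa> j)] else []) [0..<k])) =
      (\<Sum>j<k. if start \<kappa> j then en n \<kappa> (\<kappa> j) - j else 0)" for k
    by (induction k) auto
  ultimately show ?thesis by metis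
qed

section \<open>Group trees and the top tree over the sorted positions\<close>

definition leafs :: "nat \<Rightarrow> tree option" where "leafs j = Some (Lf j)"

definition gtree :: "nat \<Rightarrow> nat \<Rightarrow> nat \<Rightarrow> tree" where
  "gtree n j e = the (bld Nd leafs n (hh (e - j)) e j)"

lemma hi_hh: "j < e \<Longrightarrow> hi j (hh (e - j)) e = e"
  using hh_le[of "e - j"] by simp

lemma bld_leafs_lvs:
  assumes "s < e" "bld Nd leafs b h e s = Some t"
  shows "lvs t = [s..<hi s h e]"
  using bld_list[of lvs Nd s e leafs b h, OF _ assms(1)] assms(2) by (simp add: leafs_def)

lemma bld_leafs_lev:
  "s < e \<Longrightarrow> bld Nd leafs b h e s = Some t \<Longrightarrow> lev h t"
proof (induction h arbitrary: s t)
  case 0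
  then show ?case by (auto simp: leafs_def intro: lev.intros)
next
  case (Suc h)
  show ?case
  proof (cases "s + 2 ^ h < e")
    case True
    obtain l where l: "bld Nd leafs b h e s = Some l" using bld_Some[of leafs s Nd b h e] by (auto simp: leafs_def)
    obtain r where r: "bld Nd leafs b h e (s + 2 ^ h) = Some r"
      using bld_Some[of leafs "s + 2 ^ h" Nd b h e] by (auto simp: leafs_def)
    have t: "t = Nd (b + s + 2 ^ h) l r" using Suc.prems(2) True l r by simp
    have "cnt l = 2 ^ h" using bld_leafs_lvs[OF Suc.prems(1) l] True by (simp add: cnt_def)
    then show ?thesis unfolding t using Suc.IH[OF Suc.prems(1) l] Suc.IH[OF True r] by (intro lev.intros) auto
  next
    case False
    then show ?thesis using Suc by (auto intro: lev.intros)
  qed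
qed

lemma leafs_oids [simp]: "oids (leafs j) = {j}" by (simp add: leafs_def)

lemma gtree_props:
  assumes "j < e" "e \<le> n"
  shows "bld Nd leafs n (hh (e - j)) e j = Some (gtree n j e)" "lvs (gtree n j e) = [j..<e]"
    "lev (hh (e - j)) (gtree n j e)" "ids (gtree n j e) \<subseteq> {i. (j \<le> i \<and> i < e) \<or> (n + j < i \<and> i < n + e)}"
    "disj (gtree n j e)"
proof -
  show b: "bld Nd leafs n (hh (e - j)) e j = Some (gtree n j e)"
    using bld_Some[of leafs j Nd n "hh (e - j)" e] by (auto simp: gtree_def leafs_def)
  show "lvs (gtree n j e) = [j..<e]" using bld_leafs_lvs[OF assms(1) b] hi_hh[OF assms(1)] by simp
  show "lev (hh (e - j)) (gtree n j e)" by (rule bld_leafs_lev[OF assms(1) b])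
  have i: "ids (gtree n j e) \<subseteq> {j..<e} \<union> {n + i |i. j < i \<and> i < e}"
    using bld_ids[OF assms(1), of leafs n "hh (e - j)"] unfolding b hi_hh[OF assms(1)] by simp
  then show "ids (gtree n j e) \<subseteq> {i. (j \<le> i \<and> i < e) \<or> (n + j < i \<and> i < n + e)}" by auto
  show "disj (gtree n j e)"
  proof -
    \<comment> \<open>\<open>bld_disj\<close> wants identifiers up to \<open>n\<close> at every
      position, while the construction looks only at positions below \<open>e\<close>; hence the
      leaves from \<open>n\<close> on are removed.\<close>
    let ?f = "\<lambda>i. if i < n then leafs i else None"
    have eq: "bld Nd ?f b h e s = bld Nd leafs b h e s" if "s < e" for b h s
      using that
    proof (induction h arbitrary: s)
      case 0
      then show ?case using assms(2) by simp
    qed auto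
    show ?thesis
      by (rule bld_disj[OF assms(1), of ?f n "hh (e - j)"]) (auto simp: eq[OF assms(1)] b leafs_def split: if_splits)
  qed
qed

text \<open>Positions that start no segment carry \<open>None\<close>, so the top tree is built over
  all n positions and the groups need not be compacted. Identifiers below n are leaves, those
  between n and 2 n nodes of groups, and those above 2 n nodes of the top tree.\<close>

definition topf :: "nat \<Rightarrow> (nat \<Rightarrow> nat) \<Rightarrow> nat \<Rightarrow> ttree option" where
  "topf n \<kappa> j = (if j < n \<and> start \<kappa> j then Some (G (gtree n j (en n \<kappa> (\<kappa> j)))) else None)"

definition ttop :: "nat \<Rightarrow> (nat \<Rightarrow> nat) \<Rightarrow> ttree" where
  "ttop n \<kappa> = the (bld N (topf n \<kappa>) (2 * n) (hh n) n 0)"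

lemma bld_tdepth:
  assumes "\<And>j t. f j = Some t \<Longrightarrow> tdepth t = 0"
  shows "bld N f b h e s = Some t \<Longrightarrow> tdepth t \<le> h"
proof (induction h arbitrary: s t)
  case 0
  then show ?case using assms by auto
next
  case (Suc h)
  have "tdepth t \<le> Suc h" if "mrg N i x y = Some t" "\<And>t. x = Some t \<Longrightarrow> tdepth t \<le> h" "\<And>t. y = Some t \<Longrightarrow> tdepth t \<le> h"
    for i x y
    using that by (cases x; cases y) (force simp: le_SucI)+
  then show ?case using Suc by (auto split: if_splits intro: le_SucI)
qed

lemma depth_flat: "(\<And>g. g \<in> set (groups t) \<Longrightarrow> depth g \<le> d) \<Longrightarrow> depth (flat t) \<le> tdepth t + d"
proof (induction t)
  case (N i l r)
  then have "depth (flat l) \<le> tdepth l + d" "depth (flat r) \<le> tdepth r + d" by auto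
  then show ?case by (auto simp: max_def)
qed simp

lemma hh_mono: "a \<le> b \<Longrightarrow> hh a \<le> hh b"
  unfolding hh_def[of a] by (rule Least_le) (meson hh_le order_trans)

text \<open>Keys increase strictly from group to group, so the upper ends \<beta> of the weight
  classes at least double. The depth bound has one \<open>hh n\<close> for the top tree and one for
  the group below it.\<close>

theorem ttop_props:
  assumes \<kappa>: "sorted_on n \<kappa>" and n: "n \<ge> 1"
    and v: "c > 0" "\<And>j. j < n \<Longrightarrow> c * 2 ^ \<kappa> j \<le> v j \<and> v j \<le> c * 2 ^ (\<kappa> j + 1)"
  defines "T \<equiv> ttop n \<kappa>" and "\<beta> \<equiv> \<lambda>g. c * 2 ^ (\<kappa> (lo g) + 1)"
  shows "bld Nd (\<lambda>j. map_option flat (topf n \<kappa> j)) (2 * n) (hh n) n 0 = Some (flat T)"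
    "lvs (flat T) = [0..<n]" "disj (flat T)"
    "\<And>g. g \<in> set (groups T) \<Longrightarrow> near v (\<beta> g) g \<and> (\<exists>h. lev h g)"
    "sorted_wrt (\<lambda>g g'. 2 * \<beta> g \<le> \<beta> g') (groups T)"
    "tdepth T \<le> hh n" "depth (flat T) \<le> 2 * hh n"
    "\<And>j. oids (map_option flat (topf n \<kappa> j)) \<subseteq> {..2 * n}"
proof -
  let ?e = "\<lambda>j. en n \<kappa> (\<kappa> j)"
  have hn: "hi 0 (hh n) n = n" using hh_le[of n] by simp
  have n0: "0 < n" using n by simp
  have b: "bld N (topf n \<kappa>) (2 * n) (hh n) n 0 = Some T"
    using bld_Some[of "topf n \<kappa>" 0 N "2 * n" "hh n" n] n by (auto simp: T_def ttop_def topf_def start_def)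
  show bf: "bld Nd (\<lambda>j. map_option flat (topf n \<kappa> j)) (2 * n) (hh n) n 0 = Some (flat T)"
    unfolding bld_flat[symmetric] b by simp
  have gp: "j < ?e j" "?e j \<le> n" if "j < n" for j using seg_lt[OF \<kappa> that] en_le by auto
  have lv: "lvs (gtree n j (?e j)) = [j..<?e j]" if "j < n" for j using gtree_props(2)[OF gp[OF that]] .
  have gr: "groups T = concat (map (\<lambda>j. if j < n \<and> start \<kappa> j then [gtree n j (?e j)] else []) [0..<n])"
    using bld_list[of groups N 0 n "topf n \<kappa>" "2 * n" "hh n", OF _ n0] unfolding b hn
    by (simp add: topf_def if_distrib[of "\<lambda>x. case x of None \<Rightarrow> [] | Some t \<Rightarrow> groups t"] cong: if_cong)
  have gset: "g \<in> set (groups T) \<Longrightarrow> \<exists>j<n. start \<kappa> j \<and> g = gtree n j (?e j)" for g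
    unfolding gr by (auto split: if_splits)
  show "lvs (flat T) = [0..<n]"
  proof -
    have "lvs (flat T) = concat (map (\<lambda>j. if start \<kappa> j then [j..<?e j] else []) [0..<n])"
    proof -
      have cm: "concat (map lvs (concat (map f xs))) = concat (map (\<lambda>j. concat (map lvs (f j))) xs)"
        for f :: "nat \<Rightarrow> tree list" and xs by (induction xs) auto
      show ?thesis unfolding lvs_flat gr cm
        by (intro arg_cong[where f = concat] map_cong) (auto simp: lv)
    qed
    also have "\<dots> = [0..<n]"
    proof -
      have "en n \<kappa> (\<kappa> (n - 1)) = n - 1 + 1" using end_iff[OF \<kappa>, of "n - 1"] n by simp
      then show ?thesis unfolding concat_segments[OF \<kappa> order_refl] using n by simp
    qed
    finally show ?thesis .
  qed
  have oid: "oids (map_option flat (topf n \<kappa> j)) \<subseteq> {i. (j \<le> i \<and> i < ?e j) \<or> (n + j < i \<and> i < n + ?e j)}" for j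
    using gtree_props(4)[OF gp] by (auto simp: topf_def)
  have ne: "oids (map_option flat (topf n \<kappa> j)) \<noteq> {} \<Longrightarrow> j < n \<and> start \<kappa> j" for j
    by (auto simp: topf_def split: if_splits)
  show oid2: "oids (map_option flat (topf n \<kappa> j)) \<subseteq> {..2 * n}" for j
  proof
    fix i assume i: "i \<in> oids (map_option flat (topf n \<kappa> j))"
    then have "?e j \<le> n" "(j \<le> i \<and> i < ?e j) \<or> (n + j < i \<and> i < n + ?e j)" using oid[of j] en_le by auto
    then show "i \<in> {..2 * n}" by auto
  qed
  have dj: "oids (map_option flat (topf n \<kappa> i)) \<inter> oids (map_option flat (topf n \<kappa> j)) = {}" if "i < j" for i j
  proof (rule equals0I)
    fix x assume x: "x \<in> oids (map_option flat (topf n \<kappa> i)) \<inter> oids (map_option flat (topf n \<kappa> j))"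
    then have ij: "i < n" "start \<kappa> i" "j < n" "start \<kappa> j" using ne[of i] ne[of j] by auto
    have "?e i \<le> j" by (rule seg_disjoint[OF \<kappa> ij(2,4,1,3) that])
    moreover have "?e i \<le> n" "?e j \<le> n" using en_le by auto
    moreover have "(i \<le> x \<and> x < ?e i) \<or> (n + i < x \<and> x < n + ?e i)" "(j \<le> x \<and> x < ?e j) \<or> (n + j < x \<and> x < n + ?e j)"
      using x oid[of i] oid[of j] by auto
    ultimately show False by auto
  qed
  show "disj (flat T)"
  proof (rule bld_disj[OF n0 _ _ oid2 bf])
    show "oids (map_option flat (topf n \<kappa> i)) \<inter> oids (map_option flat (topf n \<kappa> j)) = {}" if "i \<noteq> j" for i j
      using dj[of i j] dj[of j i] that by (cases "i < j") (auto simp: Int_commute)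
    show "disj t" if "map_option flat (topf n \<kappa> j) = Some t" for j t
      using that gtree_props(5)[OF gp] by (auto simp: topf_def split: if_splits)
  qed
  have lo: "lo (gtree n j (?e j)) = j" if "j < n" for j
    using lv[OF that] gp(1)[OF that] by (simp add: lo_def)
  show "near v (\<beta> g) g \<and> (\<exists>h. lev h g)" if gin: "g \<in> set (groups T)" for g
  proof -
    obtain j where j: "j < n" "start \<kappa> j" "g = gtree n j (?e j)" using gset[OF gin] by blast
    have "\<beta> g / 2 \<le> v i \<and> v i \<le> \<beta> g" if "i \<in> set (lvs g)" for i
    proof -
      have "j \<le> i" "i < ?e j" using that lv[OF j(1)] by (auto simp: j(3))
      then have "\<kappa> i = \<kappa> j" "i < n" using seg_key[OF \<kappa>] by auto
      then show ?thesis using v(2)[of i] by (simp add: \<beta>_def j(3) lo[OF j(1)])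
    qed
    moreover have "\<beta> g > 0" using v(1) by (simp add: \<beta>_def)
    ultimately show ?thesis using gtree_props(3)[OF gp[OF j(1)]] by (auto simp: near_def j(3))
  qed
  show "sorted_wrt (\<lambda>g g'. 2 * \<beta> g \<le> \<beta> g') (groups T)"
  proof -
    have g2: "groups T = map (\<lambda>j. gtree n j (?e j)) (filter (start \<kappa>) [0..<n])"
    proof -
      have "concat (map (\<lambda>j. if j < n \<and> start \<kappa> j then [F j] else []) xs) = map F (filter (start \<kappa>) xs)"
        if "\<forall>x\<in>set xs. x < n" for xs and F :: "nat \<Rightarrow> tree" using that by (induction xs) auto
      then show ?thesis unfolding gr by simp
    qed
    have "sorted_wrt (<) (filter (start \<kappa>) [0..<n])" by (intro sorted_wrt_filter sorted_wrt_upt)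
    then have "sorted_wrt (\<lambda>i j. 2 * \<beta> (gtree n i (?e i)) \<le> \<beta> (gtree n j (?e j))) (filter (start \<kappa>) [0..<n])"
    proof (rule sorted_wrt_mono_rel[rotated])
      fix i j assume "i \<in> set (filter (start \<kappa>) [0..<n])" "j \<in> set (filter (start \<kappa>) [0..<n])" "i < j"
      then have ij: "i < n" "j < n" "\<kappa> i < \<kappa> j" using start_less[OF \<kappa>, of j i] by auto
      have "c * (2 * 2 ^ (\<kappa> i + 1)) = c * 2 ^ (Suc (\<kappa> i) + 1)" by simp
      also have "\<dots> \<le> c * 2 ^ (\<kappa> j + 1)" using v(1) ij(3) by (intro mult_left_mono power_increasing) auto
      finally show "2 * \<beta> (gtree n i (?e i)) \<le> \<beta> (gtree n j (?e j))"
        unfolding \<beta>_def lo[OF ij(1)] lo[OF ij(2)] by (simp only: mult.left_commute)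
    qed
    then show ?thesis unfolding g2 sorted_wrt_map .
  qed
  show td: "tdepth T \<le> hh n" by (rule bld_tdepth[OF _ b]) (auto simp: topf_def split: if_splits)
  have "depth g \<le> hh n" if g: "g \<in> set (groups T)" for g
  proof -
    obtain j where j: "j < n" "g = gtree n j (?e j)" using gset[OF g] by blast
    have "depth g \<le> hh (?e j - j)" using lev_depth[OF gtree_props(3)[OF gp[OF j(1)]]] by (simp add: j(2))
    also have "\<dots> \<le> hh n" using gp(2)[OF j(1)] by (intro hh_mono) auto
    finally show ?thesis .
  qed
  then have "depth (flat T) \<le> tdepth T + hh n" by (rule depth_flat)
  then show "depth (flat T) \<le> 2 * hh n" using td by simp
qed

section \<open>Preprocessing\<close>

text \<open>
  Besides the arrays of the data structure, array 30 holds the tree that starts at a position (-1 if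
  there is none), 31 the minimal weight below a node, 32 the sorted keys, 33 marks the segment
  starts, 34 holds the segment ends by key, 35 the keys by item, and 36 the numbers \<open>2\<^sup>H \<ge> n\<close>, \<open>c\<close> and
  \<open>u\<close>. The arrays of the sorter start at 40, its procedures at 11.
\<close>

definition b_init :: "instr list" where
  "b_init = [Load 16 1 15, Store 12 15 16, Store 13 15 16, Store 31 15 16, Store 14 15 15, Store 15 15 10, Store 30 15 15]"
text \<open>The available logarithm rounds down, so rounding up is done on the reciprocal
  \<open>c / x\<close> with a change of sign. Array 41 is the input array 1 of the relocated
  sorter.\<close>

definition b_key :: "instr list" where
  "b_key = [Load 16 1 15, Load 17 36 10, Arith Divide 16 17 16, FloorLog 16 16, Arith Minus 16 11 16, Arith Minus 16 16 10,
     IfLess 16 11 [Const 16 0] [], Store 35 15 16, Store 41 15 16]"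
definition b_ident :: "instr list" where "b_ident = [Store 42 15 15]"
definition b_perm :: "instr list" where
  "b_perm = [Load 16 42 15, Store 16 15 16, Load 17 1 16, Store 12 15 17, Store 13 15 17, Store 31 15 17,
     Store 14 15 15, Store 15 15 10, Store 30 15 15, Load 18 35 16, Store 32 15 18]"
text \<open>Array 34 is indexed by keys and written only by the last position of a segment, so the
  writes are exclusive. The start of a segment later finds the end through its key.\<close>

definition b_flag :: "instr list" where
  "b_flag = [Load 17 32 15,
     IfLess 11 15 [Arith Minus 16 15 10, Load 16 32 16, IfLess 16 17 [Store 33 15 10] [Store 33 15 11]] [Store 33 15 10],
     Arith Plus 16 15 10,
     IfLess 16 12 [Load 18 32 16, IfLess 17 18 [Store 34 17 16] []] [Store 34 17 16]]"
definition b_group :: "instr list" where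
  "b_group = [Load 16 33 15, IfLess 11 16 [Load 17 32 15, Load 18 34 17, Arith Minus 20 18 15, Const 21 1, Call 1,
     Arith Plus 14 21 11, Arith Plus 19 12 11, Call 2] []]"
text \<open>This needs a pass of its own: array 30 holds intermediate trees at the inner positions
  of a segment until the group is complete.\<close>

definition b_null :: "instr list" where
  "b_null = [Load 16 33 15, IfLess 11 16 [] [Arith Minus 16 11 10, Store 30 15 16]]"

text \<open>Every stage runs as a call whose registers are dropped afterwards, so it loads the
  constants anew.\<close>

definition s_consts :: "instr list" where "s_consts = [Const 10 1, Const 11 0, Load 12 0 11, Const 13 2]"
definition s_for :: "nat \<Rightarrow> instr list" where "s_for f = s_consts @ [Load 14 36 11, Const 15 0, Call f]"
definition s_size :: "instr list" where
  "s_size = s_consts @ [Const 21 1, Arith Plus 20 12 11, Call 1, Store 36 11 21]"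
text \<open>Register \<open>r\<close> selects the base of the identifiers: register 11 holds 0 and
  gives n, register 12 holds n and gives 2 n.\<close>

definition s_build :: "nat \<Rightarrow> instr list" where
  "s_build r = s_consts @ [Load 14 36 11, Const 15 0, Arith Plus 18 12 11, Arith Plus 19 12 r, Call 2]"
definition s_scale :: "instr list" where
  "s_scale = s_consts @ [Load 20 30 11, Load 21 31 20, Load 22 13 20, Store 36 10 21, Arith Divide 22 21 22, FloorLog 22 22,
     Arith Minus 22 11 22, Store 36 13 22, Store 40 11 12, Store 40 10 22]"
text \<open>
  If \<open>u = 0\<close> then all weights agree; the sorter needs keys below \<open>u\<close> and is not called.
\<close>

definition s_sort :: "instr list" where
  "s_sort = [Const 10 2, Load 10 36 10, IfLess 11 10 [Const 10 0, Call 11] [Par (s_for 6) []]]"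
definition s_root :: "instr list" where "s_root = s_consts @ [Load 20 30 11, Store 5 11 20]"

definition p_main :: "instr list" where
  "p_main = [Par s_size [], Par (s_for 4) [], Par (s_build 11) [], Par s_scale [], Par (s_for 5) [], Par s_sort [],
     Par (s_for 7) [], Par (s_for 8) [], Par (s_for 9) [], Par (s_for 10) [], Par (s_build 12) [], Par s_root []]"

definition prep_procs :: program where
  "prep_procs = [p_main, p_double, p_build, p_merge, p_for 4 b_init, p_for 5 b_key, p_for 6 b_ident, p_for 7 b_perm,
     p_for 8 b_flag, p_for 9 b_group, p_for 10 b_null]"

lemma length_prep: "length prep_procs = 11" by (simp add: prep_procs_def)

lemma prep_nth: "k < 11 \<Longrightarrow> k < length (prep_procs @ X)" "k < 11 \<Longrightarrow> (prep_procs @ X) ! k = prep_procs ! k"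
  by (simp_all add: length_prep nth_append)

lemma prep_procs_nth: "prep_procs ! 0 = p_main" "prep_procs ! 1 = p_double" "prep_procs ! 2 = p_build" "prep_procs ! 3 = p_merge"
  "prep_procs ! 4 = p_for 4 b_init" "prep_procs ! 5 = p_for 5 b_key" "prep_procs ! 6 = p_for 6 b_ident"
  "prep_procs ! 7 = p_for 7 b_perm" "prep_procs ! 8 = p_for 8 b_flag" "prep_procs ! 9 = p_for 9 b_group"
  "prep_procs ! 10 = p_for 10 b_null"
  by (simp_all add: prep_procs_def)

text \<open>An iteration may read everything except the cells that other iterations write. The
  conclusion \<open>R\<close> is drawn from the local results and the frame together.\<close>

lemma stage_for:
  assumes P: "f < length P" "P ! f = p_for f body"
    and m: "m (0, 0) = real n" "m (36, 0) = 2 ^ H" "n \<le> 2 ^ H"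
    and body: "\<And>j \<rho>. j < n \<Longrightarrow> for_regs n \<rho> \<Longrightarrow> \<rho> 15 = real j \<Longrightarrow>
      dt P (A j) (- (\<Union>i\<in>{..<n} - {j}. A i)) Tb m body \<rho> (\<lambda>m' w. w \<le> W j \<and> Q j m')"
    and dis: "\<And>i j. i < n \<Longrightarrow> j < n \<Longrightarrow> i \<noteq> j \<Longrightarrow> A i \<inter> A j = {}"
    and loc: "\<And>j m m'. j < n \<Longrightarrow> Q j m \<Longrightarrow> (\<And>x. x \<notin> (\<Union>i\<in>{..<n} - {j}. A i) \<Longrightarrow> m' x = m x) \<Longrightarrow> Q j m'"
    and T: "Tb + 10 * (H + 1) + 8 \<le> T" and W: "(\<Sum>j<n. W j) + 20 * 2 ^ H \<le> W'"
    and R: "\<And>m'. (\<And>j. j < n \<Longrightarrow> Q j m') \<Longrightarrow> (\<And>x. (\<And>j. j < n \<Longrightarrow> x \<notin> A j) \<Longrightarrow> m' x = m x) \<Longrightarrow> R m'"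
  shows "dt P UNIV UNIV T m (s_for f) \<rho> (\<lambda>m' w. w \<le> W' \<and> R m')"
proof -
  let ?\<rho> = "\<rho>(10 := 1, 11 := 0, 12 := real n, 13 := 2, 14 := 2 ^ H, 15 := 0)"
  let ?I = "{0..<min (0 + 2 ^ H) n}"
  have I: "?I = {..<n}" "{0..<min (2 ^ H) n} = {..<n}" using m(3) by auto
  have D: "A i \<inter> A j = {} \<and> A i \<inter> (- (\<Union>i\<in>{..<n} - {j}. A i)) = {}" if "i < n" "j < n" "i \<noteq> j" for i j
    using dis[OF that] that by blast
  have F: "dt P (\<Union>j\<in>?I. A j) (\<Union>j\<in>?I. - (\<Union>i\<in>{..<n} - {j}. A i)) (Tb + 10 * (H + 1)) m [Call f] ?\<rho>
    (\<lambda>m' w. w + 10 \<le> (\<Sum>j\<in>?I. W j) + 20 * 2 ^ H \<and> (\<forall>j\<in>?I. Q j m'))"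
    by (rule parfor_dt[OF P body D loc]) (auto simp: for_regs_def)
  have G: "dt P UNIV UNIV (Tb + 10 * (H + 1)) m [Call f] ?\<rho> (\<lambda>m' w. 6 + w \<le> W' \<and> R m')"
  proof (rule tr_mono[OF F])
    fix m' and w :: nat
    assume fr: "\<And>x. x \<notin> (\<Union>j\<in>?I. A j) \<Longrightarrow> m' x = m x"
      and q: "w + 10 \<le> (\<Sum>j\<in>?I. W j) + 20 * 2 ^ H \<and> (\<forall>j\<in>?I. Q j m')"
    have "R m'" by (rule R) (use q fr in \<open>auto simp: I\<close>)
    moreover have "6 + w \<le> W'" using q W by (simp add: I)
    ultimately show "6 + w \<le> W' \<and> R m'" by blast
  qed auto
  show ?thesis unfolding s_for_def s_consts_def
    by (rule sx_tr) (simp add: m, intro conjI tr_mono[OF G], use T in auto)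
qed

definition col :: "nat set \<Rightarrow> nat \<Rightarrow> address set" where "col S j = {(a, i). a \<in> S \<and> i = j}"

lemma col_iff [simp]: "(a, i) \<in> col S j \<longleftrightarrow> a \<in> S \<and> i = j" by (simp add: col_def)

text \<open>
  This is \<open>\<lceil>log 2 (x / c)\<rceil> - 1\<close>, or 0 for \<open>x = c\<close>: rounding up and subtracting 1 keeps all keys
  below \<open>u\<close>, whereas rounding down yields the key \<open>u\<close> if \<open>U\<close> is a power of two.
\<close>

definition keyf :: "real \<Rightarrow> real \<Rightarrow> nat" where "keyf c x = nat (- \<lfloor>log 2 (c / x)\<rfloor> - 1)"

text \<open>Both ends are closed because of rounding up: \<open>x = c * 2 ^ j\<close> with positive
  j has key j - 1. The classes of \<open>near\<close> admit this.\<close>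

lemma keyf_bounds:
  assumes "0 < c" "c \<le> x"
  shows "c * 2 ^ keyf c x \<le> x" "x \<le> c * 2 ^ (keyf c x + 1)"
proof -
  let ?y = "log 2 (x / c)"
  have y0: "0 \<le> ?y" using assms by simp
  have e: "log 2 (c / x) = - ?y" using assms by (simp add: log_divide)
  have k: "keyf c x = nat (\<lceil>?y\<rceil> - 1)" by (simp add: keyf_def e ceiling_def)
  have "real (keyf c x) \<le> ?y"
  proof (cases "\<lceil>?y\<rceil> \<ge> 1")
    case True
    then show ?thesis unfolding k by (simp add: of_nat_nat; linarith)
  qed (use y0 k in auto)
  then have "2 powr real (keyf c x) \<le> 2 powr ?y" by simp
  also have "2 powr ?y = x / c" using assms by simp
  finally show "c * 2 ^ keyf c x \<le> x" using assms by (simp add: powr_realpow field_simps)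
  have "?y \<le> real (keyf c x + 1)" unfolding k using y0 by linarith
  then have "2 powr ?y \<le> 2 powr real (keyf c x + 1)" by simp
  then have "x / c \<le> 2 ^ (keyf c x + 1)" using assms by (simp add: powr_realpow powr_add)
  then show "x \<le> c * 2 ^ (keyf c x + 1)" using assms by (simp add: field_simps)
qed

lemma keyf_less:
  assumes "0 < c" "c \<le> x" "x \<le> M" "u = nat \<lceil>log 2 (M / c)\<rceil>" "u > 0"
  shows "keyf c x < u"
proof -
  have "log 2 (c / x) = - log 2 (x / c)" using assms by (simp add: log_divide)
  then have k: "keyf c x = nat (\<lceil>log 2 (x / c)\<rceil> - 1)" by (simp add: keyf_def ceiling_def)
  have "log 2 (x / c) \<le> log 2 (M / c)" using assms by (intro log_mono) (auto intro: divide_right_mono)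
  then have "\<lceil>log 2 (x / c)\<rceil> \<le> \<lceil>log 2 (M / c)\<rceil>" by (rule ceiling_mono)
  then show ?thesis unfolding k using assms(4,5) by linarith
qed

section \<open>Correctness of the preprocessing, stage by stage\<close>

locale prep =
  fixes n :: nat and w :: "nat \<Rightarrow> real" and X :: program
  assumes n: "n \<ge> 1" and w: "\<And>i. i < n \<Longrightarrow> 0 < w i"
begin

abbreviation "P \<equiv> prep_procs @ X"
abbreviation "H \<equiv> hh n"
definition "c = Min (w ` {..<n})"
definition "u = nat \<lceil>log 2 (Max (w ` {..<n}) / c)\<rceil>"

lemma c_pos: "0 < c" and c_le: "i < n \<Longrightarrow> c \<le> w i" and le_max: "i < n \<Longrightarrow> w i \<le> Max (w ` {..<n})"
proof -
  have "finite (w ` {..<n})" "w ` {..<n} \<noteq> {}" using n by (auto simp: lessThan_empty_iff)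
  then show "0 < c" "i < n \<Longrightarrow> c \<le> w i" "i < n \<Longrightarrow> w i \<le> Max (w ` {..<n})" using w by (auto simp: c_def)
qed

lemma n2: "n \<le> 2 ^ H" by (rule hh_le)

lemma sum_const: "(\<Sum>j<n. a) + 20 * 2 ^ H \<le> (a + 20) * 2 ^ H" for a :: nat
  using mult_left_mono[OF n2, of a] by (simp add: algebra_simps)

definition "J0 m \<longleftrightarrow> m (0, 0) = real n \<and> (\<forall>i<n. m (1, i) = w i)"
definition "J1 m \<longleftrightarrow> J0 m \<and> m (36, 0) = 2 ^ H"
text \<open>The sorter may rely on zeros outside its input, so its arrays stay untouched until
  \<open>s_scale\<close> and \<open>b_key\<close> fill in the input.\<close>

definition "Z m \<longleftrightarrow> (\<forall>a i. a \<ge> 40 \<longrightarrow> m (a, i) = 0)"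

definition "I1 m \<longleftrightarrow> J1 m \<and> Z m"
definition "I2 m \<longleftrightarrow> I1 m \<and> (\<forall>j<n. m (30, j) = real j \<and> good m w n (Some (Lf j)))"
definition "I3 m \<longleftrightarrow> I1 m \<and> (\<exists>t. m (30, 0) = real (root t) \<and> good m w n (Some t) \<and> lvs t = [0..<n])"
definition "I4 m \<longleftrightarrow> J1 m \<and> m (36, 1) = c \<and> m (36, 2) = real u \<and>
  (\<forall>a i. a \<ge> 40 \<longrightarrow> m (a, i) = (if a = 40 \<and> i = 0 then real n else if a = 40 \<and> i = 1 then real u else 0))"
definition "I5 m \<longleftrightarrow> J1 m \<and> m (36, 2) = real u \<and> (\<forall>j<n. m (35, j) = real (keyf c (w j))) \<and>
  view 40 m = sort_input n u (\<lambda>j. keyf c (w j))"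

lemma stage_size: "J0 m \<Longrightarrow> Z m \<Longrightarrow> dt P UNIV UNIV (1000 * (H + 1)) m s_size \<rho> (\<lambda>m' k. k \<le> 1000 * 2 ^ H \<and> I1 m')"
proof -
  assume m: "J0 m" "Z m"
  let ?\<rho> = "\<rho>(10 := 1, 11 := 0, 12 := real n, 13 := 2, 21 := 1, 20 := real n)"
  have H2: "H \<le> 2 ^ H" by (rule less_imp_le[OF less_exp])
  have F: "dt P UNIV UNIV 1 m [Store 36 11 21] (?\<rho>(21 := 2 ^ (0 + H))) (\<lambda>m' k. 3 * H + 2 + k \<le> 3 * H + 3 \<and> I1 m')"
    by (rule sx_tr) (use m in \<open>auto simp: I1_def J1_def J0_def Z_def intro!: tr_Nil\<close>)
  have G: "dt P UNIV UNIV (1 + 3 * H + 2) m (Call 1 # [Store 36 11 21]) ?\<rho> (\<lambda>m' k. k \<le> 3 * H + 3 \<and> I1 m')"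
    by (rule double_tr[where h = 0 and t = n]) (use F hh_le[of n] hh_gt[of _ n] in \<open>auto simp: prep_nth length_prep prep_procs_nth[unfolded One_nat_def]\<close>)
  have p: "1 \<le> (2::nat) ^ H" by simp
  have G: "dt P UNIV UNIV (1 + 3 * H + 2) m (Call 1 # [Store 36 11 21]) ?\<rho> (\<lambda>m' k. 20 + k \<le> 1000 * 2 ^ H \<and> I1 m')"
  proof (rule tr_mono[OF G])
    fix m' and k :: nat assume "k \<le> 3 * H + 3 \<and> I1 m'"
    moreover from this have "20 + k \<le> 1000 * 2 ^ H" using H2 p by linarith
    ultimately show "20 + k \<le> 1000 * 2 ^ H \<and> I1 m'" by blast
  qed auto
  show ?thesis unfolding s_size_def s_consts_def
    by (rule sx_tr) (use m in \<open>simp add: J0_def, intro tr_mono[OF G[unfolded One_nat_def]], auto\<close>)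
qed

lemma stage_init: "I1 m \<Longrightarrow> dt P UNIV UNIV (1000 * (H + 1)) m (s_for 4) \<rho> (\<lambda>m' k. k \<le> 1000 * 2 ^ H \<and> I2 m')"
proof -
  assume m: "I1 m"
  let ?A = "col {12, 13, 14, 15, 30, 31}"
  show ?thesis
  proof (rule stage_for[where A = ?A and Tb = 20 and W = "\<lambda>_. 20" and
        Q = "\<lambda>j m'. m' (30, j) = real j \<and> good m' w n (Some (Lf j))"])
    fix j \<rho> assume j: "j < n" and \<rho>: "for_regs n \<rho>" "\<rho> 15 = real j"
    show "dt P (?A j) (- (\<Union>i\<in>{..<n} - {j}. ?A i)) 20 m b_init \<rho> (\<lambda>m' k. k \<le> 20 \<and> m' (30, j) = real j \<and> good m' w n (Some (Lf j)))"
      unfolding b_init_def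
      by (rule sx_tr) (use m j \<rho> in \<open>auto simp: for_regs_def I1_def J1_def J0_def att_def intro!: tr_Nil\<close>)
  next
    fix j m m' assume "m (30, j) = real j \<and> good m w n (Some (Lf j))"
      and fr: "\<And>x. x \<notin> (\<Union>i\<in>{..<n} - {j}. ?A i) \<Longrightarrow> m' x = m x"
    then show "m' (30, j) = real j \<and> good m' w n (Some (Lf j))"
      using good_cong[of m w n "Some (Lf j)" m'] by auto
  next
    fix m' assume q: "\<And>j. j < n \<Longrightarrow> m' (30, j) = real j \<and> good m' w n (Some (Lf j))"
      and fr: "\<And>x. (\<And>j. j < n \<Longrightarrow> x \<notin> ?A j) \<Longrightarrow> m' x = m x"
    have "I1 m'" using m unfolding I1_def J1_def J0_def Z_def by (auto simp: fr)
    then show "I2 m'" using q by (auto simp: I2_def)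
  qed (use m n2 sum_const[of 20] in \<open>auto simp: I1_def J1_def J0_def prep_nth length_prep prep_procs_nth col_def\<close>)
qed

lemma bld_leafs_cut:
  "s < e \<Longrightarrow> e \<le> n \<Longrightarrow> bld Nd (\<lambda>i. if i < n then leafs i else None) b h e s = bld Nd leafs b h e s"
  by (induction h arbitrary: s) auto

lemma ptr_leafs: "ptr (leafs j) = real j" by (simp add: leafs_def)

lemma build_leafs:
  assumes "j < e" "e \<le> n" "\<rho> 11 = 0" "\<rho> 13 = 2" "\<rho> 14 = 2 ^ hh (e - j)" "\<rho> 15 = real j" "\<rho> 18 = real e" "\<rho> 19 = real n"
    "\<And>i. j \<le> i \<Longrightarrow> i < e \<Longrightarrow> m (30, i) = real i \<and> good m v n (Some (Lf i))"
  shows "dt P (AB n j e) (AB n j e \<union> RB n) (50 * (hh (e - j) + 1)) m [Call 2] \<rho>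
    (\<lambda>m' k. k + 50 \<le> 100 * 2 ^ hh (e - j) \<and> m' (30, j) = ptr (Some (gtree n j e)) \<and> good m' v n (Some (gtree n j e)))"
proof -
  let ?f = "\<lambda>i. if i < n then leafs i else None"
  have "dt P (AB n j (hi j (hh (e - j)) e)) (AB n j (hi j (hh (e - j)) e) \<union> RB n) (50 * (hh (e - j) + 1)) m [Call 2] \<rho>
    (\<lambda>m' w. w + 50 \<le> 100 * 2 ^ hh (e - j) \<and> m' (30, j) = ptr (bld Nd ?f n (hh (e - j)) e j) \<and> good m' v n (bld Nd ?f n (hh (e - j)) e j))"
    by (rule build_dt) (use assms in \<open>auto simp: prep_nth length_prep prep_procs_nth ptr_leafs leafs_def\<close>)
  then show ?thesis unfolding hi_hh[OF assms(1)] bld_leafs_cut[OF assms(1,2)] gtree_props(1)[OF assms(1,2)] .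
qed

lemma stage_build1: "I2 m \<Longrightarrow> dt P UNIV UNIV (1000 * (H + 1)) m (s_build 11) \<rho> (\<lambda>m' k. k \<le> 1000 * 2 ^ H \<and> I3 m')"
proof -
  assume m: "I2 m"
  let ?\<rho> = "\<rho>(10 := 1, 11 := 0, 12 := real n, 13 := 2, 14 := 2 ^ H, 15 := 0, 18 := real n, 19 := real n)"
  have n0: "0 < n" using n by simp
  have F: "dt P (AB n 0 n) (AB n 0 n \<union> RB n) (50 * (hh (n - 0) + 1)) m [Call 2] ?\<rho>
    (\<lambda>m' k. k + 50 \<le> 100 * 2 ^ hh (n - 0) \<and> m' (30, 0) = ptr (Some (gtree n 0 n)) \<and> good m' w n (Some (gtree n 0 n)))"
    by (rule build_leafs[OF n0 order_refl]) (use m in \<open>auto simp: I2_def\<close>)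
  have p: "1 \<le> (2::nat) ^ H" by simp
  have G: "dt P UNIV UNIV (50 * (H + 1)) m [Call 2] ?\<rho> (\<lambda>m' k. 20 + k \<le> 1000 * 2 ^ H \<and> I3 m')"
  proof (rule tr_mono[OF F])
    fix m' and k :: nat
    assume fr: "\<And>x. x \<notin> AB n 0 n \<Longrightarrow> m' x = m x"
      and q: "k + 50 \<le> 100 * 2 ^ hh (n - 0) \<and> m' (30, 0) = ptr (Some (gtree n 0 n)) \<and> good m' w n (Some (gtree n 0 n))"
    have "I1 m'" using m unfolding I2_def I1_def J1_def J0_def Z_def by (auto simp: fr attrs_def)
    then have "I3 m'" using q gtree_props(2)[OF n0 order_refl] by (auto simp: I3_def)
    moreover have "k + 50 \<le> 100 * 2 ^ H" using q by simp
    then have "20 + k \<le> 1000 * 2 ^ H" using p by linarith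
    ultimately show "20 + k \<le> 1000 * 2 ^ H \<and> I3 m'" by blast
  qed auto
  show ?thesis unfolding s_build_def s_consts_def
    by (rule sx_tr) (use m in \<open>simp add: I2_def I1_def J1_def J0_def, intro tr_mono[OF G], auto\<close>)
qed

lemma stage_scale: "I3 m \<Longrightarrow> dt P UNIV UNIV (1000 * (H + 1)) m s_scale \<rho> (\<lambda>m' k. k \<le> 1000 * 2 ^ H \<and> I4 m')"
proof -
  assume m: "I3 m"
  then obtain t where t: "m (30, 0) = real (root t)" "good m w n (Some t)" "lvs t = [0..<n]" by (auto simp: I3_def)
  have s: "set (lvs t) = {..<n}" using t(3) by auto
  have a: "m (13, root t) = Max (w ` {..<n})" "m (31, root t) = c"
    using t(2) att_root[of m w n t] mx_Max[of w t] mn_Min[of w t] unfolding s by (cases t; auto simp: att_def c_def)+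
  have n0: "0 < n" using n by simp
  have M: "0 < Max (w ` {..<n})" by (rule less_le_trans[OF w[OF n0] le_max[OF n0]])
  have cM: "c \<le> Max (w ` {..<n})" by (rule order_trans[OF c_le[OF n0] le_max[OF n0]])
  have "log 2 (c / Max (w ` {..<n})) = - log 2 (Max (w ` {..<n}) / c)" using M c_pos by (simp add: log_divide)
  moreover have "0 \<le> log 2 (Max (w ` {..<n}) / c)" using M c_pos cM by simp
  ultimately have u: "- real_of_int \<lfloor>log 2 (c / Max (w ` {..<n}))\<rfloor> = real u"
    by (simp add: u_def ceiling_def of_nat_nat; linarith)
  have "1 \<le> (2::nat) ^ H" by simp
  then have p: "14 \<le> 1000 * (2::nat) ^ H" by linarith
  show ?thesis unfolding s_scale_def s_consts_def
    by (rule sx_tr) (use m t(1) a M c_pos u p in \<open>auto simp: I3_def I1_def J1_def J0_def Z_def I4_def intro!: tr_Nil\<close>)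
qed

lemma real_keyf: "(if - real_of_int \<lfloor>log 2 (c / x)\<rfloor> - 1 < 0 then 0 else - real_of_int \<lfloor>log 2 (c / x)\<rfloor> - 1) = real (keyf c x)"
  by (auto simp: keyf_def of_nat_nat)

lemma stage_key: "I4 m \<Longrightarrow> dt P UNIV UNIV (1000 * (H + 1)) m (s_for 5) \<rho> (\<lambda>m' k. k \<le> 1000 * 2 ^ H \<and> I5 m')"
proof -
  assume m: "I4 m"
  let ?A = "col {35, 41}"
  show ?thesis
  proof (rule stage_for[where A = ?A and Tb = 20 and W = "\<lambda>_. 20" and
        Q = "\<lambda>j m'. m' (35, j) = real (keyf c (w j)) \<and> m' (41, j) = real (keyf c (w j))"])
    fix j \<rho> assume j: "j < n" and \<rho>: "for_regs n \<rho>" "\<rho> 15 = real j"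
    show "dt P (?A j) (- (\<Union>i\<in>{..<n} - {j}. ?A i)) 20 m b_key \<rho> (\<lambda>m' k. k \<le> 20 \<and> m' (35, j) = real (keyf c (w j)) \<and> m' (41, j) = real (keyf c (w j)))"
      unfolding b_key_def
      by (rule sx_tr) (use m j \<rho> w[OF j] c_pos real_keyf[of "w j"] in \<open>auto simp: for_regs_def I4_def J1_def J0_def intro!: tr_Nil split: if_splits\<close>)
  next
    fix m' assume q: "\<And>j. j < n \<Longrightarrow> m' (35, j) = real (keyf c (w j)) \<and> m' (41, j) = real (keyf c (w j))"
      and fr: "\<And>x. (\<And>j. j < n \<Longrightarrow> x \<notin> ?A j) \<Longrightarrow> m' x = m x"
    have v: "view 40 m' = sort_input n u (\<lambda>j. keyf c (w j))"
    proof (rule ext)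
      fix x :: address
      obtain a i where x: "x = (a, i)" by fastforce
      have "m' (a + 40, i) = m (a + 40, i)" if "\<not> (a = 1 \<and> i < n)" using that by (intro fr) auto
      then show "view 40 m' x = sort_input n u (\<lambda>j. keyf c (w j)) x"
        using m q by (auto simp: x view_def sort_input_def I4_def)
    qed
    have "J1 m'" "m' (36, 2) = real u" using m unfolding I4_def J1_def J0_def by (auto simp: fr)
    then show "I5 m'" using q v by (auto simp: I5_def)
  qed (use m n2 sum_const[of 20] in \<open>auto simp: I4_def J1_def J0_def prep_nth length_prep prep_procs_nth col_def\<close>)
qed

end

context prep
begin

definition "bs \<pi> \<longleftrightarrow> bij_betw \<pi> {..<n} {..<n} \<and> sorted_on n (\<lambda>j. keyf c (w (\<pi> j)))"
definition "ky \<pi> = (\<lambda>j. keyf c (w (\<pi> j)))"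
definition "wt \<pi> = (\<lambda>j. w (\<pi> j))"
abbreviation "ee \<pi> j \<equiv> en n (ky \<pi>) (ky \<pi> j)"
definition "J2 m \<longleftrightarrow> m (0, 0) = real n \<and> m (36, 0) = 2 ^ H"

definition "K6 \<pi> m \<longleftrightarrow> J1 m \<and> (\<forall>j<n. m (35, j) = real (keyf c (w j)) \<and> m (42, j) = real (\<pi> j))"
definition "K7 \<pi> m \<longleftrightarrow> J2 m \<and> (\<forall>j<n. m (16, j) = real (\<pi> j) \<and> m (30, j) = real j \<and>
  good m (wt \<pi>) n (Some (Lf j)) \<and> m (32, j) = real (ky \<pi> j))"
definition "K8 \<pi> m \<longleftrightarrow> K7 \<pi> m \<and> (\<forall>j<n. m (33, j) = (if start (ky \<pi>) j then 1 else 0) \<and> m (34, ky \<pi> j) = real (ee \<pi> j))"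
definition "K9 \<pi> m \<longleftrightarrow> J2 m \<and> (\<forall>j<n. m (16, j) = real (\<pi> j) \<and> m (33, j) = (if start (ky \<pi>) j then 1 else 0) \<and>
  (start (ky \<pi>) j \<longrightarrow> m (30, j) = real (root (gtree n j (ee \<pi> j))) \<and> good m (wt \<pi>) n (Some (gtree n j (ee \<pi> j)))))"
definition "K10 \<pi> m \<longleftrightarrow> J2 m \<and> (\<forall>j<n. m (16, j) = real (\<pi> j) \<and> m (30, j) = ptr (map_option flat (topf n (ky \<pi>) j)) \<and>
  good m (wt \<pi>) n (map_option flat (topf n (ky \<pi>) j)))"
definition "K11 \<pi> m \<longleftrightarrow> J2 m \<and> (\<forall>j<n. m (16, j) = real (\<pi> j)) \<and> m (30, 0) = real (root (flat (ttop n (ky \<pi>)))) \<and>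
  good m (wt \<pi>) n (Some (flat (ttop n (ky \<pi>))))"

lemma pi_less: "bs \<pi> \<Longrightarrow> j < n \<Longrightarrow> \<pi> j < n"
  unfolding bs_def bij_betw_def by auto

lemma ky_sorted: "bs \<pi> \<Longrightarrow> sorted_on n (ky \<pi>)"
  by (simp add: bs_def ky_def)

lemma stage_perm: "bs \<pi> \<Longrightarrow> K6 \<pi> m \<Longrightarrow> dt P UNIV UNIV (1000 * (H + 1)) m (s_for 7) \<rho> (\<lambda>m' k. k \<le> 1000 * 2 ^ H \<and> K7 \<pi> m')"
proof -
  assume \<pi>: "bs \<pi>" and m: "K6 \<pi> m"
  let ?A = "col {12, 13, 14, 15, 16, 30, 31, 32}"
  let ?Q = "\<lambda>j m'. m' (16, j) = real (\<pi> j) \<and> m' (30, j) = real j \<and> good m' (wt \<pi>) n (Some (Lf j)) \<and> m' (32, j) = real (ky \<pi> j)"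
  show ?thesis
  proof (rule stage_for[where A = ?A and Tb = 20 and W = "\<lambda>_. 20" and Q = ?Q])
    fix j \<rho> assume j: "j < n" and \<rho>: "for_regs n \<rho>" "\<rho> 15 = real j"
    show "dt P (?A j) (- (\<Union>i\<in>{..<n} - {j}. ?A i)) 20 m b_perm \<rho> (\<lambda>m' k. k \<le> 20 \<and> ?Q j m')"
      unfolding b_perm_def
      by (rule sx_tr) (use m j \<rho> pi_less[OF \<pi> j] in \<open>auto simp: for_regs_def K6_def J1_def J0_def att_def wt_def ky_def intro!: tr_Nil\<close>)
  next
    fix j m m' assume "?Q j m" and fr: "\<And>x. x \<notin> (\<Union>i\<in>{..<n} - {j}. ?A i) \<Longrightarrow> m' x = m x"
    then show "?Q j m'"
      using good_cong[of m "wt \<pi>" n "Some (Lf j)" m'] by (auto simp: attrs_def)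
  next
    fix m' assume q: "\<And>j. j < n \<Longrightarrow> ?Q j m'" and fr: "\<And>x. (\<And>j. j < n \<Longrightarrow> x \<notin> ?A j) \<Longrightarrow> m' x = m x"
    have "J2 m'" using m unfolding K6_def J1_def J0_def J2_def by (auto simp: fr)
    then show "K7 \<pi> m'" using q by (auto simp: K7_def)
  qed (use m n2 sum_const[of 20] in \<open>auto simp: K6_def J1_def J0_def prep_nth length_prep prep_procs_nth col_def\<close>)
qed

lemma stage_flag: "bs \<pi> \<Longrightarrow> K7 \<pi> m \<Longrightarrow> dt P UNIV UNIV (1000 * (H + 1)) m (s_for 8) \<rho> (\<lambda>m' k. k \<le> 1000 * 2 ^ H \<and> K8 \<pi> m')"
proof -
  assume \<pi>: "bs \<pi>" and m: "K7 \<pi> m"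
  note so = ky_sorted[OF \<pi>]
  let ?k = "ky \<pi>"
  \<comment> \<open>A cell of array 34 belongs to one position: \<open>ee\<close> depends on the key
    only, so two positions with equal keys that both end their segment coincide.\<close>
  let ?A = "\<lambda>j. {x :: address. x = (33, j) \<or> (ee \<pi> j = j + 1 \<and> x = (34, ?k j))}"
  let ?Q = "\<lambda>j m'. m' (33, j) = (if start ?k j then 1 else 0) \<and> (ee \<pi> j = j + 1 \<longrightarrow> m' (34, ?k j) = real (j + 1))"
  have dis: "?A i \<inter> ?A j = {}" if "i < n" "j < n" "i \<noteq> j" for i j
    using that by auto
  show ?thesis
  proof (rule stage_for[where A = ?A and Tb = 30 and W = "\<lambda>_. 30" and Q = ?Q, OF _ _ _ _ _ _ dis])
    fix j \<rho> assume j: "j < n" and \<rho>: "for_regs n \<rho>" "\<rho> 15 = real j"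
    have k: "m (32, i) = real (?k i)" if "i < n" for i using m that by (auto simp: K7_def)
    have e: "(ee \<pi> j = j + 1) \<longleftrightarrow> (j + 1 = n \<or> ?k j < ?k (j + 1))" using end_iff[OF so j] by blast
    show "dt P (?A j) (- (\<Union>i\<in>{..<n} - {j}. ?A i)) 30 m b_flag \<rho> (\<lambda>m' k. k \<le> 30 \<and> ?Q j m')"
    proof (cases "j = 0")
      case True
      show ?thesis
      proof (cases "j + 1 = n")
        case True
        then show ?thesis unfolding b_flag_def
          by (intro sx_tr) (use \<open>j = 0\<close> j \<rho> k e in \<open>auto simp: for_regs_def start_def intro!: tr_Nil\<close>)
      next
        case False
        then have "j + 1 < n" using j by simp
        then show ?thesis unfolding b_flag_def
          by (intro sx_tr) (use \<open>j = 0\<close> j \<rho> k e in \<open>auto simp: for_regs_def start_def intro!: tr_Nil\<close>)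
      qed
    next
      case False
      then obtain i where i: "j = Suc i" by (cases j) auto
      have st: "start ?k j \<longleftrightarrow> ?k i < ?k j" by (simp add: start_def i)
      have r: "real j - 1 = real i" by (simp add: i)
      show ?thesis
      proof (cases "j + 1 = n")
        case True
        then show ?thesis unfolding b_flag_def
          by (intro sx_tr) (use i j \<rho> k e st r in \<open>auto simp: for_regs_def intro!: tr_Nil\<close>)
      next
        case False
        then have "j + 1 < n" using j by simp
        then show ?thesis unfolding b_flag_def
          by (intro sx_tr) (use i j \<rho> k e st r in \<open>auto simp: for_regs_def intro!: tr_Nil\<close>)
      qed
    qed
  next
    fix j m m' assume "j < n" "?Q j m" and fr: "\<And>x. x \<notin> (\<Union>i\<in>{..<n} - {j}. ?A i) \<Longrightarrow> m' x = m x"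
    have "m' (33, j) = m (33, j)" by (rule fr) auto
    moreover have "m' (34, ?k j) = m (34, ?k j)" if "ee \<pi> j = j + 1"
      by (rule fr) (use that in auto)
    ultimately show "?Q j m'" using \<open>?Q j m\<close> by auto
  next
    fix m' assume q: "\<And>j. j < n \<Longrightarrow> ?Q j m'" and fr: "\<And>x. (\<And>j. j < n \<Longrightarrow> x \<notin> ?A j) \<Longrightarrow> m' x = m x"
    have "good m' (wt \<pi>) n (Some (Lf j))" if "j < n" for j
      by (rule good_cong[of m]) (use m that in \<open>auto simp: K7_def attrs_def intro!: fr\<close>)
    then have "K7 \<pi> m'" using m unfolding K7_def J2_def by (auto simp: fr)
    moreover have "m' (34, ?k j) = real (ee \<pi> j)" if j: "j < n" for j
    proof -
      \<comment> \<open>The end of the segment of j was recorded by its last position, which has the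
        same key.\<close>
      define i where "i = ee \<pi> j - 1"
      have "j < ee \<pi> j" by (rule seg_lt[OF so j])
      then have i: "j \<le> i" "i < ee \<pi> j" "ee \<pi> j = i + 1" by (auto simp: i_def)
      have "?k i = ?k j" "i < n" using seg_key[OF so i(1,2)] by auto
      then show ?thesis using q[of i] i(3) by auto
    qed
    ultimately show "K8 \<pi> m'" using q by (auto simp: K8_def)
  qed (use m n2 sum_const[of 30] in \<open>auto simp: K7_def J2_def prep_nth length_prep prep_procs_nth\<close>)
qed

lemma AB_disjoint:
  assumes \<pi>: "bs \<pi>" and "i < n" "j < n" "i \<noteq> j" "start (ky \<pi>) i" "start (ky \<pi>) j"
  shows "AB n i (ee \<pi> i) \<inter> AB n j (ee \<pi> j) = {}"
proof -
  have "ee \<pi> i \<le> j \<or> ee \<pi> j \<le> i"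
    using seg_disjoint[OF ky_sorted[OF \<pi>], of i j] seg_disjoint[OF ky_sorted[OF \<pi>], of j i] assms by linarith
  then show ?thesis by (auto simp: AB_def)
qed

lemma stage_group: "bs \<pi> \<Longrightarrow> K8 \<pi> m \<Longrightarrow> dt P UNIV UNIV (1000 * (H + 1)) m (s_for 9) \<rho> (\<lambda>m' k. k \<le> 1000 * 2 ^ H \<and> K9 \<pi> m')"
proof -
  assume \<pi>: "bs \<pi>" and m: "K8 \<pi> m"
  note so = ky_sorted[OF \<pi>]
  let ?k = "ky \<pi>"
  let ?g = "\<lambda>j. gtree n j (ee \<pi> j)"
  let ?A = "\<lambda>j. if start ?k j then AB n j (ee \<pi> j) else {}"
  let ?Q = "\<lambda>j m'. start ?k j \<longrightarrow> m' (30, j) = real (root (?g j)) \<and> good m' (wt \<pi>) n (Some (?g j))"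
  \<comment> \<open>For a segment of length d, finding the power of two and building cost at most
    \<open>100 * 2 ^ h + 3 * h\<close> with \<open>2 ^ h \<le> 2 * d\<close>, hence at most 206 per
    position; the rest covers the fixed instructions of an iteration.\<close>
  let ?W = "\<lambda>j. (if start ?k j then ee \<pi> j - j else 0) * 210 + 20"
  have dis: "?A i \<inter> ?A j = {}" if "i < n" "j < n" "i \<noteq> j" for i j
    using AB_disjoint[OF \<pi> that] by auto
  have gp: "j < ee \<pi> j" "ee \<pi> j \<le> n" if "j < n" for j using seg_lt[OF so that] en_le by auto
  show ?thesis
  proof (rule stage_for[where A = ?A and Tb = "60 * (H + 1)" and W = ?W and Q = ?Q, OF _ _ _ _ _ _ dis])
    fix j \<rho> assume j: "j < n" and \<rho>: "for_regs n \<rho>" "\<rho> 15 = real j"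
    let ?B = "- (\<Union>i\<in>{..<n} - {j}. ?A i)"
    have f: "m (33, j) = (if start ?k j then 1 else 0)" "m (32, j) = real (?k j)" "m (34, ?k j) = real (ee \<pi> j)"
      using m j by (auto simp: K8_def K7_def)
    show "dt P (?A j) ?B (60 * (H + 1)) m b_group \<rho> (\<lambda>m' k. k \<le> ?W j \<and> ?Q j m')"
    proof (cases "start ?k j")
      case False
      then show ?thesis unfolding b_group_def
        by (intro sx_tr) (use j \<rho> f in \<open>auto simp: for_regs_def intro!: tr_Nil\<close>)
    next
      case True
      let ?d = "ee \<pi> j - j" and ?e = "ee \<pi> j"
      let ?h = "hh ?d"
      have d: "1 \<le> ?d" "?d \<le> n" using gp[OF j] by auto
      have hH: "?h \<le> H" by (rule hh_mono[OF d(2)])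
      have h2: "2 ^ ?h \<le> 2 * ?d" by (rule hh_bound(1)[OF d(1)])
      have hp: "?h \<le> 2 ^ ?h" by (rule less_imp_le[OF less_exp])
      have B: "AB n j ?e \<union> RB n \<subseteq> ?B"
      proof -
        have "AB n j ?e \<inter> ?A i = {}" if "i < n" "i \<noteq> j" for i
          using AB_disjoint[OF \<pi> j that(1)] that(2) True by simp
        then have "AB n j ?e \<subseteq> ?B" by blast
        moreover have "RB n \<inter> AB n i e = {}" for i e by (auto simp: AB_def RB_def)
        then have "RB n \<inter> ?A i = {}" for i by simp
        then have "RB n \<subseteq> ?B" by blast
        ultimately show ?thesis by blast
      qed
      have F: "dt P (AB n j ?e) ?B (50 * (?h + 1)) m [Call 2] \<rho>'
        (\<lambda>m' k. k + 50 \<le> 100 * 2 ^ ?h \<and> ?Q j m')"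
        if "\<rho>' 11 = 0" "\<rho>' 13 = 2" "\<rho>' 14 = 2 ^ ?h" "\<rho>' 15 = real j" "\<rho>' 18 = real ?e" "\<rho>' 19 = real n" for \<rho>'
      proof (rule tr_mono[OF build_leafs[of j ?e \<rho>' m "wt \<pi>"]])
        show "m (30, i) = real i \<and> good m (wt \<pi>) n (Some (Lf i))" if "j \<le> i" "i < ?e" for i
        proof -
          have "i < n" using that gp(2)[OF j] by simp
          then show ?thesis using m by (simp add: K8_def K7_def)
        qed
      qed (use that gp[OF j] B in auto)
      let ?\<rho> = "\<rho>(16 := 1, 17 := real (?k j), 18 := real ?e, 20 := real ?e - real j, 21 := 1)"
      have G: "dt P (AB n j ?e) ?B ((50 * (?h + 1) + 2) + 3 * ?h + 2) m (Call 1 # [Arith Plus 14 21 11, Arith Plus 19 12 11, Call 2]) ?\<rho>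
        (\<lambda>m' k. k + 40 \<le> 100 * 2 ^ ?h + 3 * ?h \<and> ?Q j m')"
      proof (rule double_tr[where h = 0 and t = ?d])
        show "dt P (AB n j ?e) ?B (50 * (?h + 1) + 2) m [Arith Plus 14 21 11, Arith Plus 19 12 11, Call 2] (?\<rho>(21 := 2 ^ (0 + ?h)))
          (\<lambda>m' k. 3 * ?h + 2 + k + 40 \<le> 100 * 2 ^ ?h + 3 * ?h \<and> ?Q j m')"
          by (rule sx_tr) (use \<rho> in \<open>simp add: for_regs_def, intro tr_mono[OF F], auto\<close>)
        show "?d \<le> 2 ^ (0 + ?h)" using hh_le[of ?d] by simp
        show "2 ^ (0 + i) < ?d" if "i < ?h" for i using hh_gt[OF that] by simp
        show "?\<rho> 20 = real ?d" using gp(1)[OF j] by (simp add: of_nat_diff)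
      qed (simp_all add: prep_nth length_prep prep_procs_nth[unfolded One_nat_def])
      have G2: "dt P (AB n j ?e) ?B (60 * (H + 1) - 6) m (Call 1 # [Arith Plus 14 21 11, Arith Plus 19 12 11, Call 2]) ?\<rho>
        (\<lambda>m' k. 10 + k \<le> ?W j \<and> ?Q j m')"
      proof (rule tr_mono[OF G])
        show "(50 * (?h + 1) + 2) + 3 * ?h + 2 \<le> 60 * (H + 1) - 6" using hH by simp
        fix m' and k :: nat assume a: "k + 40 \<le> 100 * 2 ^ ?h + 3 * ?h \<and> ?Q j m'"
        then have "k + 40 \<le> 206 * ?d" using h2 hp by linarith
        then have "10 + k \<le> ?W j" using True by simp
        then show "10 + k \<le> ?W j \<and> ?Q j m'" using a by blast
      qed auto
      have "dt P (AB n j ?e) ?B (60 * (H + 1)) m b_group \<rho> (\<lambda>m' k. k \<le> ?W j \<and> ?Q j m')"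
        unfolding b_group_def
      proof (rule sx_tr)
        have mem: "(33, j) \<in> ?B" "(32, j) \<in> ?B" "(34, ?k j) \<in> ?B" by (auto simp: attrs_def)
        show "sx (AB n j ?e) ?B (\<lambda>na b \<rho> ma. na \<le> 60 * (H + 1) \<and> dt P (AB n j ?e) ?B (60 * (H + 1) - na) ma b \<rho>
            (\<lambda>m w. na + w \<le> ?W j \<and> ?Q j m)) 0
          [Load 16 33 15, IfLess 11 16 [Load 17 32 15, Load 18 34 17, Arith Minus 20 18 15, Const 21 1, Call 1, Arith Plus 14 21 11, Arith Plus 19 12 11, Call 2] []] \<rho> m"
          using \<rho> f True mem
          by (simp add: for_regs_def del: Compl_iff UN_iff, intro tr_mono[OF G2[unfolded One_nat_def]]) auto
      qed
      then show ?thesis using True by simp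
    qed
  next
    fix j m m' assume j: "j < n" and q: "?Q j m" and fr: "\<And>x. x \<notin> (\<Union>i\<in>{..<n} - {j}. ?A i) \<Longrightarrow> m' x = m x"
    show "?Q j m'"
    proof
      assume s: "start ?k j"
      have out: "x \<notin> (\<Union>i\<in>{..<n} - {j}. ?A i)" if "x \<in> AB n j (ee \<pi> j)" for x
        using AB_disjoint[OF \<pi> _ j _ _ s] that by (auto split: if_splits)
      have 1: "m' (30, j) = m (30, j)" using gp[OF j] by (intro fr out) auto
      have 2: "good m' (wt \<pi>) n (Some (?g j))"
      proof (rule good_cong[of m])
        show "good m (wt \<pi>) n (Some (?g j))" using q s by blast
        fix a i assume a: "a \<in> attrs" "i \<in> oids (Some (?g j))"
        then have "(j \<le> i \<and> i < ee \<pi> j) \<or> (n + j < i \<and> i < n + ee \<pi> j)" using gtree_props(4)[OF gp[OF j]] by auto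
        then show "m' (a, i) = m (a, i)"
        proof
          assume "n + j < i \<and> i < n + ee \<pi> j"
          then show ?thesis using a(1) by (intro fr out) auto
        next
          assume "j \<le> i \<and> i < ee \<pi> j"
          then have "i < n" using gp(2)[OF j] by simp
          then show ?thesis using a(1) by (intro fr) (auto split: if_splits)
        qed
      qed
      show "m' (30, j) = real (root (?g j)) \<and> good m' (wt \<pi>) n (Some (?g j))" using 1 2 q s by simp
    qed
  next
    fix m' assume q: "\<And>j. j < n \<Longrightarrow> ?Q j m'" and fr: "\<And>x. (\<And>j. j < n \<Longrightarrow> x \<notin> ?A j) \<Longrightarrow> m' x = m x"
    have "m' (0, 0) = m (0, 0)" "m' (36, 0) = m (36, 0)" "m' (16, j) = m (16, j)" "m' (33, j) = m (33, j)" for j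
      by (rule fr; simp add: attrs_def)+
    then show "K9 \<pi> m'" using m q unfolding K9_def K8_def K7_def J2_def by auto
  next
    have "(\<Sum>j<n. ?W j) = (\<Sum>j<n. if start ?k j then ee \<pi> j - j else 0) * 210 + 20 * n"
      by (simp add: sum.distrib sum_distrib_right)
    also have "\<dots> = 230 * n" unfolding segments_length[OF so n] by simp
    finally show "(\<Sum>j<n. ?W j) + 20 * 2 ^ H \<le> 1000 * 2 ^ H" using n2 by simp
  qed (use m n2 in \<open>auto simp: K8_def K7_def J2_def prep_nth length_prep prep_procs_nth\<close>)
qed

lemma stage_null: "bs \<pi> \<Longrightarrow> K9 \<pi> m \<Longrightarrow> dt P UNIV UNIV (1000 * (H + 1)) m (s_for 10) \<rho> (\<lambda>m' k. k \<le> 1000 * 2 ^ H \<and> K10 \<pi> m')"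
proof -
  assume \<pi>: "bs \<pi>" and m: "K9 \<pi> m"
  let ?k = "ky \<pi>"
  let ?A = "\<lambda>j. {x :: address. \<not> start ?k j \<and> x = (30, j)}"
  let ?Q = "\<lambda>j m'. \<not> start ?k j \<longrightarrow> m' (30, j) = (-1 :: real)"
  show ?thesis
  proof (rule stage_for[where A = ?A and Tb = 20 and W = "\<lambda>_. 20" and Q = ?Q])
    fix j \<rho> assume j: "j < n" and \<rho>: "for_regs n \<rho>" "\<rho> 15 = real j"
    show "dt P (?A j) (- (\<Union>i\<in>{..<n} - {j}. ?A i)) 20 m b_null \<rho> (\<lambda>m' k. k \<le> 20 \<and> ?Q j m')"
      unfolding b_null_def
      by (rule sx_tr) (use m j \<rho> in \<open>auto simp: for_regs_def K9_def intro!: tr_Nil\<close>)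
  next
    fix m' assume q: "\<And>j. j < n \<Longrightarrow> ?Q j m'" and fr: "\<And>x. (\<And>j. j < n \<Longrightarrow> x \<notin> ?A j) \<Longrightarrow> m' x = m x"
    have "good m' (wt \<pi>) n (Some (gtree n j (ee \<pi> j)))" if "j < n" "start ?k j" for j
      by (rule good_cong[of m]) (use m that in \<open>auto simp: K9_def attrs_def intro!: fr\<close>)
    moreover have "m' (30, j) = m (30, j)" if "start ?k j" for j
      by (rule fr) (use that in auto)
    moreover have "m' (0, 0) = m (0, 0)" "m' (36, 0) = m (36, 0)" "m' (16, j) = m (16, j)" for j
      by (rule fr; simp)+
    ultimately show "K10 \<pi> m'" using m q unfolding K9_def K10_def J2_def by (auto simp: topf_def simp del: good_simps(2))
  qed (use m n2 sum_const[of 20] in \<open>auto simp: K9_def J2_def prep_nth length_prep prep_procs_nth\<close>)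
qed

lemma wt_bounds:
  assumes "bs \<pi>" "j < n"
  shows "c * 2 ^ ky \<pi> j \<le> wt \<pi> j \<and> wt \<pi> j \<le> c * 2 ^ (ky \<pi> j + 1)"
  using keyf_bounds[OF c_pos c_le[OF pi_less[OF assms]]] by (simp add: ky_def wt_def)

lemma stage_build2: "bs \<pi> \<Longrightarrow> K10 \<pi> m \<Longrightarrow> dt P UNIV UNIV (1000 * (H + 1)) m (s_build 12) \<rho> (\<lambda>m' k. k \<le> 1000 * 2 ^ H \<and> K11 \<pi> m')"
proof -
  assume \<pi>: "bs \<pi>" and m: "K10 \<pi> m"
  let ?f = "\<lambda>j. map_option flat (topf n (ky \<pi>) j)"
  let ?\<rho> = "\<rho>(10 := 1, 11 := 0, 12 := real n, 13 := 2, 14 := 2 ^ H, 15 := 0, 18 := real n, 19 := 2 * real n)"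
  note tp = ttop_props[OF ky_sorted[OF \<pi>] n c_pos wt_bounds[OF \<pi>]]
  have n0: "0 < n" using n by simp
  have hn: "hi 0 H n = n" using n2 by simp
  have F: "dt P (AB (2 * n) 0 (hi 0 H n)) (AB (2 * n) 0 (hi 0 H n) \<union> RB (2 * n)) (50 * (H + 1)) m [Call 2] ?\<rho>
    (\<lambda>m' k. k + 50 \<le> 100 * 2 ^ H \<and> m' (30, 0) = ptr (bld Nd ?f (2 * n) H n 0) \<and> good m' (wt \<pi>) n (bld Nd ?f (2 * n) H n 0))"
    by (rule build_dt) (use m n0 tp(8) in \<open>auto simp: K10_def prep_nth length_prep prep_procs_nth\<close>)
  have p: "1 \<le> (2::nat) ^ H" by simp
  have G: "dt P UNIV UNIV (50 * (H + 1)) m [Call 2] ?\<rho> (\<lambda>m' k. 20 + k \<le> 1000 * 2 ^ H \<and> K11 \<pi> m')"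
  proof (rule tr_mono[OF F])
    fix m' and k :: nat
    assume fr: "\<And>x. x \<notin> AB (2 * n) 0 (hi 0 H n) \<Longrightarrow> m' x = m x"
      and q: "k + 50 \<le> 100 * 2 ^ H \<and> m' (30, 0) = ptr (bld Nd ?f (2 * n) H n 0) \<and> good m' (wt \<pi>) n (bld Nd ?f (2 * n) H n 0)"
    have "m' (0, 0) = m (0, 0)" "m' (36, 0) = m (36, 0)" "m' (16, j) = m (16, j)" for j
      by (rule fr; simp add: attrs_def)+
    moreover have e: "bld Nd ?f (2 * n) H n 0 = Some (flat (ttop n (ky \<pi>)))" by (rule tp(1))
    ultimately have "K11 \<pi> m'" using m q[unfolded e] unfolding K10_def K11_def J2_def by auto
    moreover have "20 + k \<le> 1000 * 2 ^ H" using q p by linarith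
    ultimately show "20 + k \<le> 1000 * 2 ^ H \<and> K11 \<pi> m'" by blast
  qed auto
  show ?thesis unfolding s_build_def s_consts_def
    by (rule sx_tr) (use m in \<open>simp add: K10_def J2_def, intro tr_mono[OF G], auto\<close>)
qed

lemma stage_root: "bs \<pi> \<Longrightarrow> K11 \<pi> m \<Longrightarrow> dt P UNIV UNIV (1000 * (H + 1)) m s_root \<rho> (\<lambda>m' k. k \<le> 1000 * 2 ^ H \<and> DS n w m')"
proof -
  assume \<pi>: "bs \<pi>" and m: "K11 \<pi> m"
  let ?T = "ttop n (ky \<pi>)"
  note tp = ttop_props[OF ky_sorted[OF \<pi>] n c_pos wt_bounds[OF \<pi>]]
  let ?m = "m((5, 0) := real (root (flat ?T)))"
  have "rep ?m (wt \<pi>) n (flat ?T)" by (rule rep_cong[of m]) (use m in \<open>auto simp: K11_def\<close>)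
  moreover have "?m (0, 0) = real n" "\<forall>j<n. ?m (16, j) = real (\<pi> j)" "?m (5, 0) = real (root (flat ?T))"
    using m by (auto simp: K11_def J2_def)
  moreover have "bij_betw \<pi> {..<n} {..<n}" using \<pi> by (simp add: bs_def)
  moreover have "real H \<le> log 2 n + 1" by (rule hh_bound(2)[OF n])
  ultimately have "DS n w ?m" unfolding DS_def
    using tp(2-7) n2 by (intro exI[of _ ?T] exI[of _ \<pi>] exI[of _ "\<lambda>g. c * 2 ^ (ky \<pi> (lo g) + 1)"] exI[of _ H])
      (auto simp: wt_def)
  moreover have "1 \<le> (2::nat) ^ H" by simp
  then have "6 \<le> 1000 * (2::nat) ^ H" by linarith
  ultimately show ?thesis unfolding s_root_def s_consts_def
    by (intro sx_tr) (use m in \<open>auto simp: K11_def J2_def intro!: tr_Nil\<close>)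
qed

end

context prep
begin

lemma chain:
  assumes "dt P UNIV UNIV T1 m b1 \<rho> (\<lambda>m' k. k \<le> W1 \<and> J m')"
    and "\<And>m'. J m' \<Longrightarrow> dt P UNIV UNIV T2 m' b \<rho> (\<lambda>m'' k. k \<le> W2 \<and> J' m'')"
  shows "dt P UNIV UNIV (T1 + T2 + 2) m (Par b1 [] # b) \<rho> (\<lambda>m' k. k \<le> W1 + W2 + 2 \<and> J' m')"
proof (rule dt_sub[OF assms(1)])
  fix m' k assume "k \<le> W1 \<and> J m'"
  then show "dt P UNIV UNIV T2 m' b \<rho> (\<lambda>m'' l. k + 2 + l \<le> W1 + W2 + 2 \<and> J' m'')"
    by (intro tr_mono[OF assms(2)]) auto
qed auto

lemma chain_last:
  assumes "dt P UNIV UNIV T1 m b1 \<rho> (\<lambda>m' k. k \<le> W1 \<and> J m')"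
  shows "dt P UNIV UNIV (T1 + 0 + 2) m [Par b1 []] \<rho> (\<lambda>m' k. k \<le> W1 + 0 + 2 \<and> J m')"
  by (rule chain[OF assms]) (auto intro: tr_Nil)

lemma stage_sort:
  assumes S: "integer_sorter S Ws Ts" "X = map (map (shift_instr 40 11)) S" and m: "I5 m"
  shows "dt P UNIV UNIV (Ts n u + 1000 * (H + 1)) m s_sort (\<lambda>_. 0)
    (\<lambda>m' k. k \<le> Ws n u + 1000 * 2 ^ H \<and> (\<exists>\<pi>. bs \<pi> \<and> K6 \<pi> m'))"
proof (cases "u > 0")
  case True
  let ?key = "\<lambda>j. keyf c (w j)" and ?A = "{(a, i :: nat). 40 \<le> a} :: address set"
  have "?key i < u" if "i < n" for i
    by (rule keyf_less[OF c_pos c_le[OF that] le_max[OF that] u_def True])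
  then have "achieves S (sort_input n u ?key) (Ts n u) (Ws n u) (sort_output n ?key)"
    using S(1)[unfolded integer_sorter_def, rule_format, of n ?key u] n by simp
  then have a: "\<forall>x\<in>set_pmf (run S (Ts n u) (Config (view 40 m) (Run [Call 0] (\<lambda>_. 0)) 0)).
      \<exists>\<sigma>. x = Some \<sigma> \<and> halted \<sigma> \<and> (work \<sigma> \<le> Ws n u \<and> sort_output n ?key (shared \<sigma>))"
    using m by (simp add: achieves_def execute_def I5_def)
  have F: "dt P ?A ?A (Ts n u) m [Call 11] (\<lambda>_. 0) (\<lambda>m' k. k \<le> Ws n u \<and> sort_output n ?key (view 40 m'))"
    using tr_shift[of prep_procs 11 S "Ts n u" 40 m _ 0 "\<lambda>k m. k \<le> Ws n u \<and> sort_output n ?key m", OF length_prep a]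
    by (simp add: S(2))
  have p: "1 \<le> (2::nat) ^ H" by simp
  have G: "dt P UNIV UNIV (Ts n u) m [Call 11] (\<lambda>_. 0)
    (\<lambda>m' k. 10 + k \<le> Ws n u + 1000 * 2 ^ H \<and> (\<exists>\<pi>. bs \<pi> \<and> K6 \<pi> m'))"
  proof (rule tr_mono[OF F])
    fix m' and k :: nat
    assume fr: "\<And>x. x \<notin> ?A \<Longrightarrow> m' x = m x" and q: "k \<le> Ws n u \<and> sort_output n ?key (view 40 m')"
    obtain \<pi> where \<pi>: "bij_betw \<pi> {..<n} {..<n}" "\<forall>j<n. m' (42, j) = real (\<pi> j)"
      "\<forall>i j. i \<le> j \<and> j < n \<longrightarrow> ?key (\<pi> i) \<le> ?key (\<pi> j)"
      using q unfolding sort_output_def view_def by auto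
    have "m' (a, i) = m (a, i)" if "a < 40" for a i using that by (intro fr) auto
    then have "K6 \<pi> m'" using m \<pi>(2) by (simp add: K6_def I5_def J1_def J0_def)
    moreover have "bs \<pi>" using \<pi>(1,3) by (auto simp: bs_def sorted_on_def)
    moreover have "10 + k \<le> Ws n u + 1000 * 2 ^ H" using q p by linarith
    ultimately show "10 + k \<le> Ws n u + 1000 * 2 ^ H \<and> (\<exists>\<pi>. bs \<pi> \<and> K6 \<pi> m')" by blast
  qed auto
  \<comment> \<open>The sorter has to start with all registers 0. The stage itself begins so, and
    \<open>s_sort\<close> resets the only register it has used.\<close>
  have z: "(\<lambda>_ :: nat. 0 :: real)(10 := 0) = (\<lambda>_. 0)" by auto
  show ?thesis unfolding s_sort_def
    by (rule sx_tr) (use m True in \<open>simp add: I5_def z, intro tr_mono[OF G], auto\<close>)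
next
  case False
  \<comment> \<open>Array 42 is the output array 2 of the relocated sorter. With equal weights the
    identity is a sorting permutation, and writing it there replaces the call.\<close>
  let ?A = "col {42}"
  have "w j = c" if "j < n" for j
  proof -
    let ?M = "Max (w ` {..<n})"
    have M: "c \<le> ?M" using c_le[OF that] le_max[OF that] by simp
    have "log 2 (?M / c) \<le> 0" using False by (simp add: u_def)
    then have "?M / c \<le> 1" using c_pos M by (simp add: log_le_zero_cancel_iff)
    then show ?thesis using c_pos c_le[OF that] le_max[OF that] by (simp add: field_simps)
  qed
  then have b: "bs id" by (auto simp: bs_def sorted_on_def)
  have F: "dt P UNIV UNIV (900 * (H + 1)) m (s_for 6) \<rho> (\<lambda>m' k. k \<le> 900 * 2 ^ H \<and> K6 id m')" for \<rho>
  proof (rule stage_for[where A = ?A and Tb = 20 and W = "\<lambda>_. 20" and Q = "\<lambda>j m'. m' (42, j) = real j"])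
    fix j \<rho> assume j: "j < n" and \<rho>: "for_regs n \<rho>" "\<rho> 15 = real j"
    show "dt P (?A j) (- (\<Union>i\<in>{..<n} - {j}. ?A i)) 20 m b_ident \<rho> (\<lambda>m' k. k \<le> 20 \<and> m' (42, j) = real j)"
      unfolding b_ident_def by (rule sx_tr) (use \<rho> in \<open>auto intro!: tr_Nil\<close>)
  next
    fix m' assume q: "\<And>j. j < n \<Longrightarrow> m' (42, j) = real j" and fr: "\<And>x. (\<And>j. j < n \<Longrightarrow> x \<notin> ?A j) \<Longrightarrow> m' x = m x"
    show "K6 id m'" using m q unfolding K6_def I5_def J1_def J0_def by (auto simp: fr)
  qed (use m n2 sum_const[of 20] in \<open>auto simp: I5_def J1_def J0_def prep_nth length_prep prep_procs_nth col_def\<close>)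
  have "1 \<le> (2::nat) ^ H" by simp
  then have p: "Suc (Suc (Suc k)) \<le> Ws n u + 1000 * 2 ^ H" if "k \<le> Suc (Suc (900 * 2 ^ H))" for k :: nat using that by linarith
  have "m (36, 2) = 0" using m False by (simp add: I5_def)
  then show ?thesis unfolding s_sort_def
    by (intro sx_tr) (simp, intro tr_mono[OF chain_last[OF F]], use p b in auto)
qed

lemma main_dt:
  assumes S: "integer_sorter S Ws Ts" "X = map (map (shift_instr 40 11)) S" and m: "J0 m" "Z m"
  shows "dt P UNIV UNIV (Ts n u + 12000 * (H + 1) + 24) m p_main (\<lambda>_. 0)
    (\<lambda>m' k. k \<le> Ws n u + 12000 * 2 ^ H + 24 \<and> DS n w m')"
proof -
  let ?t = "1000 * (H + 1)" and ?v = "1000 * 2 ^ H"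
  have A: "dt P UNIV UNIV (6 * ?t + 12) m [Par (s_for 7) [], Par (s_for 8) [], Par (s_for 9) [], Par (s_for 10) [],
      Par (s_build 12) [], Par s_root []] (\<lambda>_. 0) (\<lambda>m' k. k \<le> 6 * ?v + 12 \<and> DS n w m')"
    if ex: "\<exists>\<pi>. bs \<pi> \<and> K6 \<pi> m" for m
  proof -
    obtain \<pi> where \<pi>: "bs \<pi>" "K6 \<pi> m" using ex by blast
    show ?thesis
      apply (rule tr_mono)
          apply (rule chain[OF stage_perm[OF \<pi>]])
          apply (rule chain[OF stage_flag[OF \<pi>(1)]], assumption)
          apply (rule chain[OF stage_group[OF \<pi>(1)]], assumption)
          apply (rule chain[OF stage_null[OF \<pi>(1)]], assumption)
          apply (rule chain[OF stage_build2[OF \<pi>(1)]], assumption)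
          apply (rule chain_last[OF stage_root[OF \<pi>(1)]], assumption)
      by auto
  qed
  show ?thesis unfolding p_main_def
    apply (rule tr_mono)
        apply (rule chain[OF stage_size[OF m]])
        apply (rule chain[OF stage_init], assumption)
        apply (rule chain[OF stage_build1], assumption)
        apply (rule chain[OF stage_scale], assumption)
        apply (rule chain[OF stage_key], assumption)
        apply (rule chain[OF stage_sort[OF S]], assumption)
        apply (rule A, assumption)
    by auto
qed

lemma preprocess_achieves:
  assumes S: "integer_sorter S Ws Ts" "X = map (map (shift_instr 40 11)) S"
  shows "achieves P (weights_input n w) (real (Ts n u) + 30000 * (1 + log 2 n)) (real (Ws n u) + 30000 * real n) (DS n w)"
proof -
  let ?m = "weights_input n w" and ?T = "real (Ts n u) + 30000 * (1 + log 2 n)"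
  have m: "J0 ?m" "Z ?m" by (auto simp: weights_input_def J0_def Z_def)
  have F: "dt P UNIV UNIV (Ts n u + 12000 * (H + 1) + 25) ?m [Call 0] (\<lambda>_. 0)
    (\<lambda>m' k. k \<le> Ws n u + 12000 * 2 ^ H + 25 \<and> DS n w m')"
    by (rule tr_call[OF main_dt[OF S m, folded prep_procs_nth(1)[folded prep_nth(2)[of 0 X, simplified]]]])
      (auto simp: length_prep)
  have l: "0 \<le> log 2 n" using n by simp
  \<comment> \<open>Rounding n up to a power of two at most doubles it, so 12 stages of 1000 each
    give 24000 n for the work. The constant 30000 absorbs the additive terms, and likewise for the
    span.\<close>
  have h: "2 ^ H \<le> 2 * n" "real H \<le> log 2 n + 1" by (rule hh_bound[OF n])+
  have "real (Ts n u + 12000 * (H + 1) + 25) \<le> ?T" using h(2) l by (simp add: distrib_left)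
  then have T: "Ts n u + 12000 * (H + 1) + 25 \<le> nat \<lfloor>?T\<rfloor>" by linarith
  have W: "real k \<le> real (Ws n u) + 30000 * real n" if "k \<le> Ws n u + 12000 * 2 ^ H + 25" for k
  proof -
    have "k \<le> Ws n u + 30000 * n" using that h(1) n by linarith
    then show ?thesis by (metis of_nat_add of_nat_le_iff of_nat_mult of_nat_numeral)
  qed
  show ?thesis
    using tr_adequate[OF F T, of 0] W unfolding achieves_def execute_def rel_pmf_return_pmf2
    by fastforce
qed

end

theorem theorem6:
  shows "\<exists>(C :: real) (query :: program) (D :: nat \<Rightarrow> (nat \<Rightarrow> real) \<Rightarrow> memory \<Rightarrow> bool).
    (\<forall>sorter Wsort Tsort. integer_sorter sorter Wsort Tsort \<longrightarrow>
       (\<exists>preprocess :: program. \<forall>n w u.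
          n \<ge> 1 \<and> (\<forall>i<n. 0 < w i) \<and>
          u = nat \<lceil>log 2 (Max (w ` {..<n}) / Min (w ` {..<n}))\<rceil> \<longrightarrow>
          achieves preprocess (weights_input n w)
            (Tsort n u + C * (1 + log 2 n))
            (Wsort n u + C * n)
            (D n w))) \<and>
    (\<forall>n w k.
       n \<ge> 1 \<and> (\<forall>i<n. 0 < w i) \<longrightarrow>
       samples_from query (D n w) k (sample_pmf k n w)
         (C * (1 + log 2 n))
         (C * (measure_pmf.expectation (sample_pmf k n w) (\<lambda>S. real (card (set_mset S)))
               + log 2 n + 1)))"
proof (rule exI[of _ 30000], rule exI[of _ query], rule exI[of _ DS], intro conjI allI impI)
  fix sorter Wsort Tsort assume S: "integer_sorter sorter Wsort Tsort"
  show "\<exists>preprocess :: program. \<forall>n w u. n \<ge> 1 \<and> (\<forall>i<n. 0 < w i) \<and>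
          u = nat \<lceil>log 2 (Max (w ` {..<n}) / Min (w ` {..<n}))\<rceil> \<longrightarrow>
          achieves preprocess (weights_input n w) (Tsort n u + 30000 * (1 + log 2 n)) (real (Wsort n u) + 30000 * real n) (DS n w)"
  \<comment> \<open>The program depends on the sorter alone; u is computed from the weights at run
    time.\<close>
  proof (intro exI[of _ "prep_procs @ map (map (shift_instr 40 11)) sorter"] allI impI)
    fix n :: nat and w :: "nat \<Rightarrow> real" and u
    assume a: "n \<ge> 1 \<and> (\<forall>i<n. 0 < w i) \<and> u = nat \<lceil>log 2 (Max (w ` {..<n}) / Min (w ` {..<n}))\<rceil>"
    interpret prep n w "map (map (shift_instr 40 11)) sorter" by unfold_locales (use a in auto)
    have "u = prep.u n w" using a by (simp add: u_def c_def)
    then show "achieves (prep_procs @ map (map (shift_instr 40 11)) sorter) (weights_input n w)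
        (Tsort n u + 30000 * (1 + log 2 n)) (real (Wsort n u) + 30000 * real n) (DS n w)"
      using preprocess_achieves[OF S refl] by simp
  qed
next
  fix n :: nat and w :: "nat \<Rightarrow> real" and k assume "n \<ge> 1 \<and> (\<forall>i<n. 0 < w i)"
  then show "samples_from query (DS n w) k (sample_pmf k n w) (30000 * (1 + log 2 n))
      (30000 * (measure_pmf.expectation (sample_pmf k n w) (\<lambda>S. real (card (set_mset S))) + log 2 n + 1))"
    by (intro query_samples) auto
qed

end
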